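(* Let $k\ge 1$ and let $n_1,\ldots,n_k\ge 1$ be integers with $n_{k+1}:=n_1=\min\{n_1,n_2,\ldots,n_k\}$. Let $A_1,A_2,\ldots,A_k$ be independent random matrices, $A_i$ of dimension $n_i\times n_{i+1}$ for $i=1,\ldots,k$, with i.i.d. standard complex Gaussian entries. Then the eigenvalues $z_1,z_2,\ldots,z_{n_1}$ of $A=A_1A_2\cdots A_k$ form a determinantal point process on the complex plane. Equivalently, the vector of eigenvalues of $A$ has density, with respect to Lebesgue measure on $\mathbb{C}^{n_1}$, proportional to $$\prod_{\ell=1}^{n_1}\omega(z_\ell)\prod_{1\le i<j\le n_1}|z_i-z_j|^2,$$ where the weight function $\omega:\mathbb{C}\to[0,\infty)$ is given by $$|dz|^2\,\omega(z)=\int_{x_1\cdots x_k=z}e^{-\sum_{j=1}^{k}|x_j|^2}\prod_{j=1}^{k}|x_j|^{2(n_j-n_1)}\prod_{j=1}^{k}|dx_j|^2 .$$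
   Context: A standard complex Gaussian variable has density $\pi^{-1}e^{-|z|^2}$ with respect to Lebesgue measure on $\mathbb{C}$. $|dz|^2$ denotes Lebesgue measure on $\mathbb{C}$ (up to an irrelevant constant). Notation for the weight: for functions $h$ and $g$ of $(x_1,\ldots,x_k)\in\mathbb{C}^k$, with $h$ complex-valued and $g\ge 0$, one writes $|dz|^2\omega(z)=\int_{h(x_1,\ldots,x_k)=z}g(x_1,\ldots,x_k)|dx_1|^2\cdots|dx_k|^2$ if $$\int_{\mathbb{C}} f(z)\,\omega(z)\,|dz|^2=\int_{\mathbb{C}^k} f(h(x_1,\ldots,x_k))\,g(x_1,\ldots,x_k)\,|dx_1|^2\cdots|dx_k|^2$$ for every integrable $f:\mathbb{C}\to\mathbb{C}$; that is, $\omega(z)|dz|^2$ is the push-forward under $h$ of the measure $g\,|dx_1|^2\cdots|dx_k|^2$. "The vector of eigenvalues has density $p$" for a symmetric $p$ means: the eigenvalues, counted with multiplicity and listed in uniformly random order, have joint density $p$ on $\mathbb{C}^{n_1}$; equivalently, $\mathbf{E}[f(z_1,\ldots,z_{n_1})]=\int f p$ for every bounded continuous symmetric $f$ on $\mathbb{C}^{n_1}$. A point process on $\mathbb{C}$ is determinantal if there is a kernel $K(x,y)$ such that, for each $r$, its $r$-point correlation function with respect to Lebesgue measure is $\det(K(x_i,x_j))_{i,j=1}^r$. *)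

theory Defs
  imports "HOL-Probability.Probability" "Jordan_Normal_Form.Char_Poly"
begin

definition std_complex_gaussian_density :: "complex \<Rightarrow> real" where
  "std_complex_gaussian_density z = exp (- (cmod z)\<^sup>2) / pi"

(* The factor 1_m d is the empty product; its size d is the number of columns of the last factor. *)
definition matrix_product :: "nat \<Rightarrow> complex mat list \<Rightarrow> complex mat" where
  "matrix_product d As = foldr (*) As (1\<^sub>m d)"

(* Integration over \<complex>^k is integration over PiM {1..k} (\<lambda>_. lborel); the points of
   this product are the functions on {1..k} extended by undefined. *)
definition pushforward_weight ::
  "nat \<Rightarrow> ((nat \<Rightarrow> complex) \<Rightarrow> complex) \<Rightarrow> ((nat \<Rightarrow> complex) \<Rightarrow> real) \<Rightarrow> (complex \<Rightarrow> real) \<Rightarrow> bool"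
where
  "pushforward_weight k h g \<omega> \<longleftrightarrow>
     \<omega> \<in> borel_measurable borel \<and> (\<forall>z. 0 \<le> \<omega> z) \<and>
     density lborel (\<lambda>z. ennreal (\<omega> z)) =
       distr (density (PiM {1..k} (\<lambda>_. lborel)) (\<lambda>x. ennreal (g x))) borel h"

(* Defined only up to Lebesgue-null sets, hence a predicate.  The exponents n j - n 1 are
   natural number differences, so this is meaningful when n 1 \<le> n j for all j. *)
definition product_weight :: "nat \<Rightarrow> (nat \<Rightarrow> nat) \<Rightarrow> (complex \<Rightarrow> real) \<Rightarrow> bool" where
  "product_weight k n \<omega> \<longleftrightarrow>
     pushforward_weight k (\<lambda>x. \<Prod>j\<in>{1..k}. x j)
       (\<lambda>x. exp (- (\<Sum>j\<in>{1..k}. (cmod (x j))\<^sup>2)) *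
             (\<Prod>j\<in>{1..k}. cmod (x j) ^ (2 * (n j - n 1)))) \<omega>"

definition symmetric_fun :: "nat \<Rightarrow> ((nat \<Rightarrow> complex) \<Rightarrow> 'b) \<Rightarrow> bool" where
  "symmetric_fun N f \<longleftrightarrow>
     (\<forall>\<sigma>. \<sigma> permutes {1..N} \<longrightarrow> (\<forall>z \<in> {1..N} \<rightarrow>\<^sub>E UNIV. f (z \<circ> \<sigma>) = f z))"

(* z s 1, ..., z s N is any enumeration of N random points; only symmetric test functions
   are used, so its order plays no role and no z _ l has to be measurable by itself. *)
definition has_symmetric_density ::
  "'a measure \<Rightarrow> nat \<Rightarrow> ('a \<Rightarrow> nat \<Rightarrow> complex) \<Rightarrow> ((nat \<Rightarrow> complex) \<Rightarrow> real) \<Rightarrow> bool"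
where
  "has_symmetric_density M N z p \<longleftrightarrow>
     integrable (PiM {1..N} (\<lambda>_. lborel)) p \<and> (\<forall>x. 0 \<le> p x) \<and> symmetric_fun N p \<and>
     (\<forall>f :: (nat \<Rightarrow> complex) \<Rightarrow> complex.
        continuous_on ({1..N} \<rightarrow>\<^sub>E UNIV) f \<and> bounded (f ` ({1..N} \<rightarrow>\<^sub>E UNIV)) \<and> symmetric_fun N f \<longrightarrow>
        has_bochner_integral M (\<lambda>s. f (restrict (z s) {1..N}))
          (\<integral>x. f x * complex_of_real (p x) \<partial>PiM {1..N} (\<lambda>_. lborel)))"

(* The sum runs over the r-tuples of points with distinct indices, so a point of
   multiplicity m is counted as m points. *)
definition correlation_function ::
  "'a measure \<Rightarrow> nat \<Rightarrow> ('a \<Rightarrow> nat \<Rightarrow> complex) \<Rightarrow> nat \<Rightarrow> ((nat \<Rightarrow> complex) \<Rightarrow> real) \<Rightarrow> bool"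
where
  "correlation_function M N z r \<rho> \<longleftrightarrow>
     \<rho> \<in> borel_measurable (PiM {..<r} (\<lambda>_. lborel)) \<and> (\<forall>x. 0 \<le> \<rho> x) \<and>
     (\<forall>f :: (nat \<Rightarrow> complex) \<Rightarrow> ennreal. f \<in> borel_measurable (PiM {..<r} (\<lambda>_. lborel)) \<longrightarrow>
        (let S = (\<lambda>s. \<Sum>\<phi> | \<phi> \<in> {..<r} \<rightarrow>\<^sub>E {1..N} \<and> inj_on \<phi> {..<r}. f (\<lambda>i\<in>{..<r}. z s (\<phi> i)))
         in S \<in> borel_measurable M \<and>
            (\<integral>\<^sup>+ s. S s \<partial>M) = (\<integral>\<^sup>+ x. f x * ennreal (\<rho> x) \<partial>PiM {..<r} (\<lambda>_. lborel))))"

definition determinantal_process ::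
  "'a measure \<Rightarrow> nat \<Rightarrow> ('a \<Rightarrow> nat \<Rightarrow> complex) \<Rightarrow> bool"
where
  "determinantal_process M N z \<longleftrightarrow>
     (\<exists>K :: complex \<Rightarrow> complex \<Rightarrow> complex.
        case_prod K \<in> borel_measurable (borel \<Otimes>\<^sub>M borel) \<and>
        (\<forall>r. \<exists>\<rho>. correlation_function M N z r \<rho> \<and>
           (AE x in PiM {..<r} (\<lambda>_. lborel).
              complex_of_real (\<rho> x) = Determinant.det (Matrix.mat r r (\<lambda>(i, j). K (x i) (x j))))))"

end

theory Submission
 imports Defs
begin

text \<open>
A matrix with a marked eigenvalue \<open>z\<close> is unitarily similar to a block matrix with diagonal blocks
\<open>C\<close>, \<open>z\<close> and one row \<open>b\<close> off the diagonal, with Jacobian \<open>|det (z - C)|\<^sup>2\<close>; this produces the Vandermonde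
factor. For a product, QL decompositions bring all factors to block form at once: \<open>z\<close> becomes the product
of the corner entries, the rows \<open>b\<close> integrate out, and induction on the size gives the law of the
characteristic polynomial. Beforehand, unitary invariance replaces each rectangular factor by a square one
with weight \<open>|det|^(2 (n\<^sub>j - n\<^sub>1))\<close>. A measurable enumeration of the roots transfers the law to symmetric
functions of the eigenvalues. The weight is rotation invariant, so the monomials are orthogonal, and
integrating one point out of \<open>det (K (x\<^sub>i, x\<^sub>j))\<close> (Gaudin) yields the correlation functions.
\<close>

text \<open>For a matrix with blocks \<open>D\<close>, \<open>c\<close>, \<open>b\<close> and corner
  entry \<open>a\<close>, the eigenvalue equation is \<open>q(z) = a r(z)\<close>, where
  \<open>r\<close> is the characteristic polynomial of \<open>D\<close> and \<open>q\<close> that of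
  the whole matrix for \<open>a = 0\<close>. An eigenvalue is therefore marked by taking
  \<open>z\<close> instead of \<open>a\<close> as integration variable; \<open>q / r\<close> is
  generically (n + 1)-to-one, whence the factor \<open>Suc n\<close>. The eigenvector is recorded in
  the affine chart \<open>(v, 1)\<close>, so that no measure on the unitary group occurs and the
  chart contributes only the volume \<open>kap n\<close> of projective space. Constants are not
  evaluated on the way: Gaussian test functions show them finite and positive, and total mass one
  settles the last of them. The obstacle in the product is its leftmost factor: spectral functions
  are invariant under conjugation only, whereas QL decompositions demand left invariance. All matrix
  integrals are taken in \<open>ennreal\<close>, so that every interchange asks for measurability
  and nothing else.\<close>

abbreviation "\<B> M \<equiv> borel_measurable M"

abbreviation "\<L> \<equiv> lborel :: complex measure"

abbreviation "\<P> I \<equiv> PiM I (%_. lborel)"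

lemmas measurable_times_ennreal = borel_measurable_times_ennreal

notation carrier_mat ("\<M>")
notation pair_measure (infixr "\<Otimes>" 80)
notation smult_mat (infixl "\<cdot>" 70)

syntax
 "_integral_lborel" :: "pttrn => ennreal => ennreal" ("(2\<integral>_./ _)" [0, 10] 10)
 "_integral_lebm" :: "pttrn => nat => nat => ennreal => ennreal" ("(2\<integral>_|_,_./ _)" [0, 0, 0, 10] 10)
translations
 "\<integral>x. f" \<rightharpoonup> "CONST nn_integral (CONST lborel) (%x. f)"

lemma product_sigma_finite_const: "sigma_finite_measure N ==> product_sigma_finite (%_. N)"
 by (simp add: product_sigma_finite_def)

lemmas product_lborel = product_sigma_finite_const[OF sigma_finite_lborel]
lemmas measurable_nn_integral_lborel = sigma_finite_measure.borel_measurable_nn_integral[OF sigma_finite_lborel]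

section \<open>Lebesgue measure on matrices\<close>

text \<open>Points of a finite product are extensional functions, so relabelling the coordinates
  along \<open>g\<close> means composing with \<open>inv_into K g\<close> and restricting.
  Rectangles go to rectangles with the same product of measures.\<close>

lemma PiM_reindex:
 assumes N: "sigma_finite_measure N" and fin: "finite K" and inj: "inj_on g K"
 shows "distr (PiM K (%_. N)) (PiM (g ` K) (%_. N)) (%x. \<lambda>i\<in>g ` K. x (inv_into K g i)) = PiM (g ` K) (%_. N)"
proof (rule product_sigma_finite.PiM_eqI[OF product_sigma_finite_const[OF N]])
 show "finite (g ` K)" using fin by simp
 have m: "(%x. \<lambda>i\<in>g ` K. x (inv_into K g i)) : measurable (PiM K (%_. N)) (PiM (g ` K) (%_. N))"
  by (intro measurable_restrict measurable_component_singleton) (simp add: inv_into_into)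
 fix A assume A: "!!i. i : g ` K ==> A i : sets N"
 have "(%x. \<lambda>i\<in>g ` K. x (inv_into K g i)) -` Pi\<^sub>E (g ` K) A \<inter> space (PiM K (%_. N)) = Pi\<^sub>E K (%k. A (g k))"
  using sets.sets_into_space[OF A] by (auto simp: space_PiM PiE_iff inv_into_f_f[OF inj] extensional_def)
 hence "emeasure (distr (PiM K (%_. N)) (PiM (g ` K) (%_. N)) (%x. \<lambda>i\<in>g ` K. x (inv_into K g i))) (Pi\<^sub>E (g ` K) A)
  = emeasure (PiM K (%_. N)) (Pi\<^sub>E K (%k. A (g k)))"
  by (subst emeasure_distr[OF m]) (use A fin in \<open>auto intro!: sets_PiM_I_finite\<close>)
 also have "... = (\<Prod>k\<in>K. emeasure N (A (g k)))"
  by (rule product_sigma_finite.emeasure_PiM[OF product_sigma_finite_const[OF N]]) (use A fin in auto)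
 also have "... = (\<Prod>i\<in>g ` K. emeasure N (A i))" by (simp add: prod.reindex[OF inj])
 finally show "emeasure (distr (PiM K (%_. N)) (PiM (g ` K) (%_. N)) (%x. \<lambda>i\<in>g ` K. x (inv_into K g i))) (Pi\<^sub>E (g ` K) A) = (\<Prod>i\<in>g ` K. emeasure N (A i))" .
qed simp

lemma nn_integral_PiM_reindex:
 assumes N: "sigma_finite_measure N" and fin: "finite K" and inj: "inj_on g K"
  and f: "f : \<B> (PiM (g ` K) (%_. N))"
 shows "(\<integral>\<^sup>+x. f x \<partial>PiM (g ` K) (%_. N)) =
  (\<integral>\<^sup>+x. f (\<lambda>i\<in>g ` K. x (inv_into K g i)) \<partial>PiM K (%_. N))"
proof -
 have m: "(%x. \<lambda>i\<in>g ` K. x (inv_into K g i)) : measurable (PiM K (%_. N)) (PiM (g ` K) (%_. N))"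
  by (intro measurable_restrict measurable_component_singleton) (simp add: inv_into_into)
 show ?thesis
  by (subst PiM_reindex[OF N fin inj, symmetric], subst nn_integral_distr[OF m]) (use f in auto)
qed

lemma nn_integral_PiM_translate:
 fixes a :: "'i => 'b::euclidean_space"
 assumes fin: "finite K" and f: "f : \<B> (\<P> K)"
 shows "(\<integral>\<^sup>+x. f x \<partial>PiM K (%_. lborel :: 'b measure)) =
  (\<integral>\<^sup>+x. f (\<lambda>i\<in>K. a i + x i) \<partial>\<P> K)"
proof -
 let ?P = "PiM K (%_. lborel :: 'b measure)"
 let ?t = "%x. \<lambda>i\<in>K. a i + x i"
 note psf = product_lborel
 have m: "?t : measurable ?P ?P"
  by (intro measurable_restrict) auto
 have "distr ?P ?P ?t = ?P"
 proof (rule product_sigma_finite.PiM_eqI[OF psf fin])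
  fix A :: "'i => 'b set" assume A: "!!i. i : K ==> A i : sets lborel"
  have pre: "?t -` Pi\<^sub>E K A \<inter> space ?P = Pi\<^sub>E K (%i. (+) (a i) -` A i)"
   by (auto simp: space_PiM PiE_iff extensional_def)
  have s: "(+) (a i) -` A i : sets lborel" if "i : K" for i
   using measurable_sets_borel[of "(+) (a i)" borel "A i"] A[OF that] by simp
  have "emeasure (distr ?P ?P ?t) (Pi\<^sub>E K A) = emeasure ?P (Pi\<^sub>E K (%i. (+) (a i) -` A i))"
   by (subst emeasure_distr[OF m]) (use A fin pre in \<open>auto intro!: sets_PiM_I_finite\<close>)
  also have "... = (\<Prod>i\<in>K. emeasure lborel ((+) (a i) -` A i))"
   by (rule product_sigma_finite.emeasure_PiM[OF psf fin s])
  also have "... = (\<Prod>i\<in>K. emeasure lborel (A i))"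
  proof (rule prod.cong)
   fix i assume i: "i : K"
   have "emeasure (distr lborel borel ((+) (a i))) (A i) = emeasure lborel ((+) (a i) -` A i)"
    using A[OF i] by (subst emeasure_distr) auto
   thus "emeasure lborel ((+) (a i) -` A i) = emeasure lborel (A i)"
    by (simp add: lborel_distr_plus)
  qed simp
  finally show "emeasure (distr ?P ?P ?t) (Pi\<^sub>E K A) = (\<Prod>i\<in>K. emeasure lborel (A i))" .
 qed simp
 hence "(\<integral>\<^sup>+x. f x \<partial>?P) = (\<integral>\<^sup>+x. f x \<partial>distr ?P ?P ?t)" by simp
 also have "... = (\<integral>\<^sup>+x. f (?t x) \<partial>?P)" by (rule nn_integral_distr[OF m]) (use f in simp)
 finally show ?thesis .
qed

definition entries :: "nat => nat => complex mat => nat \<times> nat => complex" where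
 "entries r c A = (\<lambda>ij\<in>{..<r} \<times> {..<c}. A $$ ij)"

text \<open>The sigma-algebra is pulled back from the entries on \<open>\<M> r c\<close>. The
  dimension thus belongs to the space, and measurability of a matrix-valued map reduces to its
  dimension and its entries.\<close>

definition lebm :: "nat => nat => complex mat measure" where
 "lebm r c = distr (\<P> ({..<r} \<times> {..<c}))
   (vimage_algebra (\<M> r c) (entries r c) (PiM ({..<r} \<times> {..<c}) (%_. borel))) (mat r c)"

translations
 "\<integral>A|r,c. f" \<rightharpoonup> "CONST nn_integral (CONST lebm r c) (%A. f)"

lemma space_lebm [simp]: "space (lebm r c) = \<M> r c"
 by (simp add: lebm_def)

lemma entries_space: "entries r c A : space (PiM ({..<r} \<times> {..<c}) (%_. borel))"
 by (simp add: entries_def space_PiM)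

lemma measurable_lebmI:
 assumes "!!x. x : space N ==> A x : \<M> r c"
  and "!!i j. i < r ==> j < c ==> (%x. A x $$ (i, j)) : \<B> N"
 shows "A : measurable N (lebm r c)"
proof -
 have "(%x. entries r c (A x)) : measurable N (PiM ({..<r} \<times> {..<c}) (%_. borel))"
  unfolding entries_def by (rule measurable_restrict) (use assms(2) in auto)
 hence "A : measurable N (vimage_algebra (\<M> r c) (entries r c) (PiM ({..<r} \<times> {..<c}) (%_. borel)))"
  by (intro measurable_vimage_algebra2) (use assms(1) in auto)
 thus ?thesis by (simp add: lebm_def)
qed

lemma measurable_entries: "entries r c : measurable (lebm r c) (PiM ({..<r} \<times> {..<c}) (%_. borel))"
proof -
 have "entries r c : measurable (vimage_algebra (\<M> r c) (entries r c) (PiM ({..<r} \<times> {..<c}) (%_. borel))) (PiM ({..<r} \<times> {..<c}) (%_. borel))"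
  by (rule measurable_vimage_algebra1) (auto simp: entries_space)
 thus ?thesis by (simp add: lebm_def)
qed

lemma measurable_index_mat:
 assumes "i < r" "j < c" shows "(%A. A $$ (i, j)) : \<B> (lebm r c)"
proof -
 have "(%A. entries r c A (i, j)) : \<B> (lebm r c)"
  by (rule measurable_compose[OF measurable_entries measurable_component_singleton]) (use assms in auto)
 thus ?thesis using assms by (simp add: entries_def)
qed

lemma measurable_index_mat':
 assumes "A : measurable N (lebm r c)" "i < r" "j < c"
 shows "(%x. A x $$ (i, j)) : \<B> N"
 by (rule measurable_compose[OF assms(1) measurable_index_mat]) (use assms in auto)

lemma measurable_carrier_mat:
 assumes "A : measurable N (lebm r c)" "x : space N"
 shows "A x : \<M> r c"
 using measurable_space[OF assms] by simp

lemma measurable_mat_PiM: "mat r c : measurable (\<P> ({..<r} \<times> {..<c})) (lebm r c)"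
 by (rule measurable_lebmI) auto

lemma nn_integral_lebm:
 assumes "f : \<B> (lebm r c)"
 shows "(\<integral>A|r,c. f A) = (\<integral>\<^sup>+x. f (mat r c x) \<partial>\<P> ({..<r} \<times> {..<c}))"
proof -
 let ?V = "vimage_algebra (\<M> r c) (entries r c) (PiM ({..<r} \<times> {..<c}) (%_. borel))"
 have s: "sets ?V = sets (lebm r c)" by (simp add: lebm_def)
 have m: "mat r c : measurable (\<P> ({..<r} \<times> {..<c})) ?V"
  using measurable_mat_PiM measurable_cong_sets[OF refl s] by blast
 have f: "f : \<B> ?V" using assms measurable_cong_sets[OF s refl] by blast
 show ?thesis unfolding lebm_def by (subst nn_integral_distr[OF m]) (use f in simp_all)
qed

lemma emeasure_lebm:
 assumes "X : sets (lebm r c)"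
 shows "emeasure (lebm r c) X = emeasure (\<P> ({..<r} \<times> {..<c})) (mat r c -` X \<inter> space (\<P> ({..<r} \<times> {..<c})))"
proof -
 let ?V = "vimage_algebra (\<M> r c) (entries r c) (PiM ({..<r} \<times> {..<c}) (%_. borel))"
 have s: "sets ?V = sets (lebm r c)" by (simp add: lebm_def)
 have m: "mat r c : measurable (\<P> ({..<r} \<times> {..<c})) ?V"
  using measurable_mat_PiM measurable_cong_sets[OF refl s] by blast
 show ?thesis unfolding lebm_def by (rule emeasure_distr[OF m]) (use assms s in auto)
qed

lemma entries_mat:
 assumes "x : space (\<P> ({..<r} \<times> {..<c}))"
 shows "entries r c (mat r c x) = x"
 using assms by (auto simp: entries_def space_PiM PiE_def extensional_def fun_eq_iff)

lemma sigma_finite_lebm: "sigma_finite_measure (lebm r c)"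
proof -
 let ?P = "PiM ({..<r} \<times> {..<c}) (%_. \<L>)"
 interpret P: sigma_finite_measure ?P
  by (rule product_sigma_finite.sigma_finite[OF product_lborel]) auto
 obtain A where A: "countable A" "A \<subseteq> sets ?P" "\<Union>A = space ?P" "!!a. a : A ==> emeasure ?P a ~= \<infinity>"
  using P.sigma_finite_countable by blast
 have spP: "sets ?P = sets (PiM ({..<r} \<times> {..<c}) (%_. borel :: complex measure))"
  by (rule sets_PiM_cong) auto
 have E: "entries r c : measurable (lebm r c) ?P"
  using measurable_entries measurable_cong_sets[OF refl spP] by blast
 let ?A = "(%a. entries r c -` a \<inter> space (lebm r c)) ` A"
 show ?thesis
 proof (rule sigma_finite_measure.intro, intro exI[of _ ?A] conjI ballI)
  show "countable ?A" using A by simp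
  show "?A \<subseteq> sets (lebm r c)" using A(2) by (auto simp del: space_lebm intro!: measurable_sets[OF E])
  show "\<Union>?A = space (lebm r c)"
   using A(3) measurable_space[OF E] by (auto simp del: space_lebm) (metis UnionE)
  fix X assume "X : ?A"
  then obtain a where a: "a : A" "X = entries r c -` a \<inter> space (lebm r c)" by blast
  have Xs: "X : sets (lebm r c)" using a A(2) by (auto simp del: space_lebm intro!: measurable_sets[OF E])
  have "mat r c -` X \<inter> space ?P = a"
  proof -
   have "a \<subseteq> space ?P" using a A by (auto dest: sets.sets_into_space)
   thus ?thesis unfolding a(2) using entries_mat by (auto simp: subset_iff)
  qed
  thus "emeasure (lebm r c) X ~= \<infinity>" using A(4)[OF a(1)] by (simp add: emeasure_lebm[OF Xs])
 qed
qed

text \<open>\<open>ga\<close> and \<open>gb\<close> cut the index rectangle into relabelled copies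
  of two smaller ones, and Fubini on the disjoint union separates the blocks. Stacked rows, adjacent
  columns and transposition are all instances.\<close>

lemma nn_integral_lebm_combine:
 fixes f :: "complex mat => ennreal"
 assumes f: "f : \<B> (lebm r c)"
  and inj1: "inj_on ga ({..<r1} \<times> {..<c1})" and inj2: "inj_on gb ({..<r2} \<times> {..<c2})"
  and dis: "ga ` ({..<r1} \<times> {..<c1}) \<inter> gb ` ({..<r2} \<times> {..<c2}) = {}"
  and un: "ga ` ({..<r1} \<times> {..<c1}) \<union> gb ` ({..<r2} \<times> {..<c2}) = {..<r} \<times> {..<c}"
  and cm: "!!A B. A : \<M> r1 c1 ==> B : \<M> r2 c2 ==> cmb A B : \<M> r c"
  and cm1: "!!A B ij. A : \<M> r1 c1 ==> B : \<M> r2 c2 ==> ij : {..<r1} \<times> {..<c1} ==> cmb A B $$ ga ij = A $$ ij"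
  and cm2: "!!A B ij. A : \<M> r1 c1 ==> B : \<M> r2 c2 ==> ij : {..<r2} \<times> {..<c2} ==> cmb A B $$ gb ij = B $$ ij"
 shows "(%(A, B). cmb A B) : measurable (lebm r1 c1 \<Otimes> lebm r2 c2) (lebm r c)"
  and "(\<integral>A|r,c. f A) = (\<integral>A|r1,c1. \<integral>B|r2,c2. f (cmb A B))"
proof -
 define I1 I2 where "I1 = {..<r1} \<times> {..<c1}" and "I2 = {..<r2} \<times> {..<c2}"
 note psf = product_lborel
 let ?L = "%_. \<L>"
 show cmbm: "(%(A, B). cmb A B) : measurable (lebm r1 c1 \<Otimes> lebm r2 c2) (lebm r c)"
 proof (rule measurable_lebmI)
  fix i j assume "i < r" "j < c"
  hence "(i, j) : ga ` I1 \<union> gb ` I2" using un by (auto simp: I1_def I2_def)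
  then consider k where "k : I1" "(i, j) = ga k" | k where "k : I2" "(i, j) = gb k" by blast
  thus "(%x. (case x of (A, B) => cmb A B) $$ (i, j)) : \<B> (lebm r1 c1 \<Otimes> lebm r2 c2)"
  proof cases
   case 1
   have "(%x. fst x $$ k) : \<B> (lebm r1 c1 \<Otimes> lebm r2 c2)"
    using measurable_index_mat'[OF measurable_fst, of "fst k" r1 "snd k" c1] 1 by (auto simp: I1_def)
   thus ?thesis
    by (rule measurable_cong[THEN iffD1, rotated])
      (use 1 in \<open>auto simp: space_pair_measure cm1 I1_def\<close>)
  next
   case 2
   have "(%x. snd x $$ k) : \<B> (lebm r1 c1 \<Otimes> lebm r2 c2)"
    using measurable_index_mat'[OF measurable_snd, of "fst k" r2 "snd k" c2] 2 by (auto simp: I2_def)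
   thus ?thesis
    by (rule measurable_cong[THEN iffD1, rotated])
      (use 2 in \<open>auto simp: space_pair_measure cm2 I2_def\<close>)
  qed
 qed (use cm in \<open>auto simp: space_pair_measure\<close>)
 have fm: "(%x. f (mat r c x)) : \<B> (PiM (ga ` I1 \<union> gb ` I2) ?L)"
  using measurable_compose[OF measurable_mat_PiM f] un by (simp add: I1_def I2_def)
 let ?h1 = "%x. \<lambda>i\<in>ga ` I1. x (inv_into I1 ga i)"
 let ?h2 = "%x. \<lambda>i\<in>gb ` I2. x (inv_into I2 gb i)"
 have fin: "finite I1" "finite I2" by (auto simp: I1_def I2_def)
 have inj: "inj_on ga I1" "inj_on gb I2" using inj1 inj2 by (auto simp: I1_def I2_def)
 have eq: "mat r c (merge (ga ` I1) (gb ` I2) (?h1 x, ?h2 y)) = cmb (mat r1 c1 x) (mat r2 c2 y)" for x y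
 proof (rule eq_matI)
  have M: "mat r1 c1 x : \<M> r1 c1" "mat r2 c2 y : \<M> r2 c2" by auto
  note C = cm[OF M]
  fix i j assume "i < dim_row (cmb (mat r1 c1 x) (mat r2 c2 y))" "j < dim_col (cmb (mat r1 c1 x) (mat r2 c2 y))"
  hence ij: "i < r" "j < c" using C by auto
  hence "(i, j) : ga ` I1 \<union> gb ` I2" using un by (auto simp: I1_def I2_def)
  then consider k where "k : I1" "(i, j) = ga k" | k where "k : I2" "(i, j) = gb k" by blast
  thus "mat r c (merge (ga ` I1) (gb ` I2) (?h1 x, ?h2 y)) $$ (i, j) = cmb (mat r1 c1 x) (mat r2 c2 y) $$ (i, j)"
  proof cases
   case 1
   hence "merge (ga ` I1) (gb ` I2) (?h1 x, ?h2 y) (ga k) = x k"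
    using inj by (simp add: merge_def)
   moreover have "cmb (mat r1 c1 x) (mat r2 c2 y) $$ ga k = x k"
    using cm1[OF M, of k] 1 by (auto simp: I1_def)
   ultimately show ?thesis unfolding index_mat(1)[OF ij] using 1 by simp
  next
   case 2
   hence "gb k \<notin> ga ` I1" using dis by (auto simp: I1_def I2_def)
   hence "merge (ga ` I1) (gb ` I2) (?h1 x, ?h2 y) (gb k) = y k"
    using inj 2 by (simp add: merge_def)
   moreover have "cmb (mat r1 c1 x) (mat r2 c2 y) $$ gb k = y k"
    using cm2[OF M, of k] 2 by (auto simp: I2_def)
   ultimately show ?thesis unfolding index_mat(1)[OF ij] using 2 by simp
  qed
 qed (use cm[of "mat r1 c1 x" "mat r2 c2 y"] in auto)
 have m2: "(%y. f (mat r c (merge (ga ` I1) (gb ` I2) (x, y)))) : \<B> (PiM (gb ` I2) ?L)"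
  if "x : space (PiM (ga ` I1) ?L)" for x
  by (rule measurable_compose[OF _ fm]) (use that in \<open>auto intro!: measurable_compose[OF _ measurable_merge]\<close>)
 have m1: "(%x. \<integral>\<^sup>+y. f (mat r c (merge (ga ` I1) (gb ` I2) (x, y))) \<partial>PiM (gb ` I2) ?L) : \<B> (PiM (ga ` I1) ?L)"
 proof (rule sigma_finite_measure.borel_measurable_nn_integral)
  show "sigma_finite_measure (PiM (gb ` I2) ?L)"
   by (rule product_sigma_finite.sigma_finite[OF psf]) (use fin in auto)
  show "(%(x, y). f (mat r c (merge (ga ` I1) (gb ` I2) (x, y)))) : \<B> (PiM (ga ` I1) ?L \<Otimes> PiM (gb ` I2) ?L)"
   using measurable_compose[OF measurable_merge fm] by (simp add: case_prod_beta')
 qed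
 have fc: "(%(A, B). f (cmb A B)) : \<B> (lebm r1 c1 \<Otimes> lebm r2 c2)"
  using measurable_compose[OF cmbm f] by (simp add: case_prod_beta')
 have "(\<integral>A|r,c. f A) = (\<integral>\<^sup>+x. f (mat r c x) \<partial>PiM (ga ` I1 \<union> gb ` I2) ?L)"
  unfolding nn_integral_lebm[OF f] using un by (simp add: I1_def I2_def)
 also have "... = (\<integral>\<^sup>+x. \<integral>\<^sup>+y. f (mat r c (merge (ga ` I1) (gb ` I2) (x, y))) \<partial>PiM (gb ` I2) ?L \<partial>PiM (ga ` I1) ?L)"
  by (rule product_sigma_finite.product_nn_integral_fold[OF psf]) (use dis fin fm in \<open>auto simp: I1_def I2_def\<close>)
 also have "... = (\<integral>\<^sup>+x. \<integral>\<^sup>+y. f (mat r c (merge (ga ` I1) (gb ` I2) (x, ?h2 y))) \<partial>PiM I2 ?L \<partial>PiM (ga ` I1) ?L)"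
  by (intro nn_integral_cong nn_integral_PiM_reindex[OF sigma_finite_lborel fin(2) inj(2)] m2)
 also have "... = (\<integral>\<^sup>+x. \<integral>\<^sup>+y. f (mat r c (merge (ga ` I1) (gb ` I2) (?h1 x, ?h2 y))) \<partial>PiM I2 ?L \<partial>PiM I1 ?L)"
 proof (rule nn_integral_PiM_reindex[OF sigma_finite_lborel fin(1) inj(1)])
  show "(%x. \<integral>\<^sup>+y. f (mat r c (merge (ga ` I1) (gb ` I2) (x, ?h2 y))) \<partial>PiM I2 ?L) : \<B> (PiM (ga ` I1) ?L)"
   by (rule measurable_cong[THEN iffD1, OF _ m1])
     (intro nn_integral_PiM_reindex[OF sigma_finite_lborel fin(2) inj(2)] m2)
 qed
 also have "... = (\<integral>\<^sup>+x. \<integral>\<^sup>+y. f (cmb (mat r1 c1 x) (mat r2 c2 y)) \<partial>PiM I2 ?L \<partial>PiM I1 ?L)"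
  unfolding eq ..
 also have "... = (\<integral>\<^sup>+x. (\<integral>B|r2,c2. f (cmb (mat r1 c1 x) B)) \<partial>PiM I1 ?L)"
 proof (rule nn_integral_cong)
  fix x
  have "(%B. f (cmb (mat r1 c1 x) B)) : \<B> (lebm r2 c2)"
   using measurable_compose[OF measurable_Pair1'[of "mat r1 c1 x" "lebm r1 c1" "lebm r2 c2"] fc] by simp
  thus "(\<integral>\<^sup>+y. f (cmb (mat r1 c1 x) (mat r2 c2 y)) \<partial>PiM I2 ?L) = (\<integral>B|r2,c2. f (cmb (mat r1 c1 x) B))"
   unfolding I2_def by (rule nn_integral_lebm[symmetric])
 qed
 also have "... = (\<integral>A|r1,c1. \<integral>B|r2,c2. f (cmb A B))"
  unfolding I1_def
  by (rule nn_integral_lebm[symmetric]) (rule sigma_finite_measure.borel_measurable_nn_integral[OF sigma_finite_lebm fc])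
 finally show "(\<integral>A|r,c. f A) = (\<integral>A|r1,c1. \<integral>B|r2,c2. f (cmb A B))" .
qed

section \<open>Pushing area forward under a rational function\<close>

no_notation Matrix.vec_index (infixl "$" 100)
no_notation Matrix.scalar_prod (infix "\<bullet>" 70)

text \<open>\<open>has_measure_differentiable_image\<close> speaks of images of finite measure. A
  finite Jacobian integral would make the image \<open>lmeasurable\<close>, so outside that case
  both sides are infinite together.\<close>

lemma emeasure_differentiable_image:
 fixes f :: "real^'n::{finite,wellorder} => real^'n::_"
 assumes S: "S : sets borel"
  and der: "!!x. x : S ==> (f has_derivative f' x) (at x within S)"
  and inj: "inj_on f S"
  and meas: "(%x. indicator S x * \<bar>Determinants.det (matrix (f' x))\<bar>) : \<B> borel"
 shows "f ` S : sets lebesgue"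
  and "emeasure lebesgue (f ` S) =
   (\<integral>x. ennreal (indicator S x * \<bar>Determinants.det (matrix (f' x))\<bar>))"
proof -
 let ?d = "%x. \<bar>Determinants.det (matrix (f' x))\<bar>"
 have SL: "S : sets lebesgue" using S by auto
 have "f differentiable_on S"
  using der unfolding differentiable_on_def differentiable_def by blast
 thus im: "f ` S : sets lebesgue"
  by (intro differentiable_image_in_sets_lebesgue[OF SL]) auto
 note iff = has_measure_differentiable_image[OF SL der inj]
 have hi: "(?d has_integral m) S \<longleftrightarrow> ((%x. indicator S x * ?d x) has_integral m) UNIV" for m
  by (subst has_integral_restrict_UNIV[symmetric])
    (intro arg_cong[of _ _ "%g. (g has_integral m) UNIV"] ext, auto simp: indicator_def)
 show "emeasure lebesgue (f ` S) = (\<integral>x. ennreal (indicator S x * ?d x))"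
 proof (cases "f ` S : lmeasurable")
  case True
  hence "(?d has_integral Sigma_Algebra.measure lebesgue (f ` S)) S"
   using iff by blast
  hence "(\<integral>x. ennreal (indicator S x * ?d x)) = ennreal (Sigma_Algebra.measure lebesgue (f ` S))"
   unfolding hi by (intro nn_integral_has_integral_lborel) (use meas in auto)
  thus ?thesis using True by (simp add: emeasure_eq_measure2)
 next
  case False
  have "(\<integral>x. ennreal (indicator S x * ?d x)) = \<infinity>"
  proof (rule ccontr)
   assume "\<not> ?thesis"
   then obtain r where r: "0 <= r" "(\<integral>x. ennreal (indicator S x * ?d x)) = ennreal r"
    by (cases "\<integral>\<^sup>+x. ennreal (indicator S x * ?d x) \<partial>lborel") auto
   have "((%x. indicator S x * ?d x) has_integral r) UNIV"
    by (rule nn_integral_has_integral) (use meas r in auto)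
   hence "f ` S : lmeasurable" using iff hi by blast
   with False show False by simp
  qed
  moreover have "emeasure lebesgue (f ` S) = \<infinity>"
   using False im less_top[of "emeasure lebesgue (f ` S)"] unfolding fmeasurable_def
   by (simp del: emeasure_completion)
  ultimately show ?thesis by simp
 qed
qed

text \<open>The change of variables theorem lives on \<open>real^'n\<close>; the plane is carried to
  \<open>real^2\<close> and back by these mutually inverse linear maps, which preserve area.\<close>

definition vec_of_complex :: "complex => real^2" where
 "vec_of_complex z = (\<chi> i. if i = 1 then Re z else Im z)"

definition complex_of_vec :: "real^2 => complex" where
 "complex_of_vec x = Complex (x $ 1) (x $ 2)"

lemma complex_of_vec_inverse [simp]: "vec_of_complex (complex_of_vec x) = x"
 by (simp add: vec_of_complex_def complex_of_vec_def Finite_Cartesian_Product.vec_eq_iff forall_2)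

lemma vec_of_complex_inverse [simp]: "complex_of_vec (vec_of_complex z) = z"
 by (simp add: vec_of_complex_def complex_of_vec_def)

lemma bounded_linear_vec_of_complex: "bounded_linear vec_of_complex"
proof -
 have "linear vec_of_complex"
  by (rule linearI) (auto simp: vec_of_complex_def Finite_Cartesian_Product.vec_eq_iff)
 thus ?thesis by (simp add: linear_conv_bounded_linear)
qed

lemma bounded_linear_complex_of_vec: "bounded_linear complex_of_vec"
proof -
 have "linear complex_of_vec"
  by (rule linearI) (auto simp: complex_of_vec_def complex_eq_iff)
 thus ?thesis by (simp add: linear_conv_bounded_linear)
qed

lemma measurable_complex_of_vec [measurable]: "complex_of_vec : \<B> borel"
 by (intro borel_measurable_continuous_onI linear_continuous_on bounded_linear_complex_of_vec)

lemma lborel_complex_eq_distr: "\<L> = distr lborel borel complex_of_vec"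
proof (rule lborel_eqI)
 fix l u :: complex
 assume le: "!!b. b : Basis ==> l \<bullet> b <= u \<bullet> b"
 have "complex_of_vec -` box l u = box (vec_of_complex l) (vec_of_complex u)"
  by (auto simp: complex_of_vec_def vec_of_complex_def mem_box Basis_complex_def
    axis_eq_axis Basis_vec_def inner_axis forall_2)
 moreover have "emeasure lborel (box (vec_of_complex l) (vec_of_complex u)) =
   ennreal (\<Prod>b\<in>Basis. (vec_of_complex u - vec_of_complex l) \<bullet> b)"
  by (rule emeasure_lborel_box)
    (use le[of 1] le[of \<i>] in \<open>auto simp: vec_of_complex_def Basis_complex_def Basis_vec_def inner_axis\<close>)
 moreover have "(\<Prod>b\<in>Basis. (vec_of_complex u - vec_of_complex l) \<bullet> b) = (\<Prod>b\<in>Basis. (u - l) \<bullet> b)"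
 proof -
  have B: "(Basis :: (real^2) set) = {axis 1 1, axis 2 1}"
   by (auto simp: Basis_vec_def) (metis exhaust_2)
  have "axis 1 (1::real) ~= axis (2::2) 1" by (simp add: axis_eq_axis)
  thus ?thesis unfolding B Basis_complex_def
   by (simp add: inner_axis vec_of_complex_def)
 qed
 ultimately show "emeasure (distr lborel borel complex_of_vec) (box l u) = ennreal (prod ((\<bullet>) (u - l)) Basis)"
  by (simp add: emeasure_distr)
qed simp

lemma nn_integral_lborel_complex:
 assumes "f : \<B> borel"
 shows "(\<integral>z. f z) = (\<integral>x. f (complex_of_vec x))"
 using assms by (subst lborel_complex_eq_distr) (simp add: nn_integral_distr)

text \<open>By the Cauchy-Riemann equations the real Jacobian of a holomorphic map is the squared
  modulus of its derivative. The image is kept in \<open>real^2\<close>, where it is Lebesgue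
  measurable.\<close>

lemma emeasure_holomorphic_image:
 fixes f :: "complex => complex"
 assumes S: "S : sets borel"
  and der: "!!z. z : S ==> (f has_field_derivative f' z) (at z)"
  and inj: "inj_on f S"
  and meas: "f' : \<B> borel"
 shows "vec_of_complex ` f ` S : sets lebesgue"
  and "emeasure lebesgue (vec_of_complex ` f ` S) =
   (\<integral>z. indicator S z * ennreal ((cmod (f' z))\<^sup>2))"
proof -
 define g where "g x = vec_of_complex (f (complex_of_vec x))" for x
 define g' where "g' x = (%h. vec_of_complex (f' (complex_of_vec x) * complex_of_vec h))" for x
 define R where "R = complex_of_vec -` S"
 have R: "R : sets borel" unfolding R_def using measurable_sets_borel[OF measurable_complex_of_vec S] by simp
 have RI: "g ` R = vec_of_complex ` f ` S"
 proof -
  have "complex_of_vec ` R = S" unfolding R_def by (force intro: image_eqI[of _ _ "vec_of_complex _"])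
  thus ?thesis unfolding g_def by (metis image_image)
 qed
 have inj': "inj_on g R"
  by (rule inj_onI) (metis (no_types, lifting) R_def g_def complex_of_vec_inverse vec_of_complex_inverse inj inj_onD vimageD)
 have der': "(g has_derivative g' x) (at x within R)" if "x : R" for x
 proof -
  have "(f has_derivative (*) (f' (complex_of_vec x))) (at (complex_of_vec x))"
   using der[of "complex_of_vec x"] that by (simp add: R_def has_field_derivative_def)
  moreover have "(complex_of_vec has_derivative complex_of_vec) (at x)"
   by (rule bounded_linear_imp_has_derivative[OF bounded_linear_complex_of_vec])
  ultimately have "((%x. f (complex_of_vec x)) has_derivative (%h. f' (complex_of_vec x) * complex_of_vec h)) (at x)"
   by (rule has_derivative_compose[rotated])
  hence "(g has_derivative g' x) (at x)"
   unfolding g_def g'_def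
   by (rule bounded_linear.has_derivative[OF bounded_linear_vec_of_complex])
  thus ?thesis by (rule has_derivative_at_withinI)
 qed
 have det: "Determinants.det (matrix (g' x)) = (cmod (f' (complex_of_vec x)))\<^sup>2" for x
  unfolding det_2 matrix_def g'_def cmod_def
  by (simp add: vec_of_complex_def complex_of_vec_def axis_def power2_eq_square)
 have ind: "indicator R x = (indicator S (complex_of_vec x) :: real)" for x by (simp add: R_def indicator_def)
 have m: "(%x. indicator R x * \<bar>Determinants.det (matrix (g' x))\<bar>) : \<B> borel"
  unfolding det using R meas by measurable
 show "vec_of_complex ` f ` S : sets lebesgue"
  using emeasure_differentiable_image(1)[OF R der' inj' m] by (simp add: RI)
 have "emeasure lebesgue (vec_of_complex ` f ` S) = (\<integral>x. ennreal (indicator R x * (cmod (f' (complex_of_vec x)))\<^sup>2))"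
  using emeasure_differentiable_image(2)[OF R der' inj' m] unfolding det RI by simp
 also have "... = (\<integral>x. (%z. indicator S z * ennreal ((cmod (f' z))\<^sup>2)) (complex_of_vec x))"
  unfolding ind by (intro nn_integral_cong) (auto simp: indicator_def)
 also have "... = (\<integral>z. indicator S z * ennreal ((cmod (f' z))\<^sup>2))"
  by (rule nn_integral_lborel_complex[symmetric]) (use S meas in measurable)
 finally show "emeasure lebesgue (vec_of_complex ` f ` S) = (\<integral>z. indicator S z * ennreal ((cmod (f' z))\<^sup>2))" .
qed

text \<open>The area formula, applied to the part of \<open>S\<close> that \<open>f\<close> maps
  into a Borel set, says that two measures coincide; \<open>h\<close> is then integrated against
  both.\<close>

lemma nn_integral_holomorphic_image:
 fixes f :: "complex => complex"
 assumes S: "S : sets borel"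
  and der: "!!z. z : S ==> (f has_field_derivative f' z) (at z)"
  and inj: "inj_on f S"
  and f[measurable]: "f : \<B> borel"
  and f'[measurable]: "f' : \<B> borel"
  and h[measurable]: "h : \<B> borel"
 shows "(\<integral>z. indicator S z * ennreal ((cmod (f' z))\<^sup>2) * h (f z)) =
  (\<integral>\<^sup>+x. indicator (vec_of_complex ` f ` S) x * h (complex_of_vec x) \<partial>lebesgue)"
proof -
 have [measurable]: "S : sets borel" by fact
 have vS: "vec_of_complex ` f ` S : sets lebesgue"
  by (rule emeasure_holomorphic_image(1)[OF S der inj f'])
 note [measurable] = vS
 have cv [measurable]: "complex_of_vec : measurable lebesgue borel"
  using measurable_complex_of_vec by (simp add: measurable_completion)
 define mu where "mu = distr (density lborel (%z. indicator S z * ennreal ((cmod (f' z))\<^sup>2))) borel f"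
 define \<nu> where "\<nu> = distr (density lebesgue (indicator (vec_of_complex ` f ` S))) borel complex_of_vec"
 have "mu = \<nu>"
 proof (rule measure_eqI)
  show "sets mu = sets \<nu>" by (simp add: mu_def \<nu>_def)
  fix A assume "A : sets mu"
  hence A[measurable]: "A : sets borel" by (simp add: mu_def)
  define T where "T = S \<inter> f -` A"
  have T: "T : sets borel" unfolding T_def using measurable_sets_borel[OF f A] S by auto
  have "emeasure mu A = (\<integral>z. indicator S z * ennreal ((cmod (f' z))\<^sup>2) * indicator (f -` A) z)"
   unfolding mu_def using measurable_sets_borel[OF f A] by (simp add: emeasure_distr emeasure_density)
  also have "... = (\<integral>z. indicator T z * ennreal ((cmod (f' z))\<^sup>2))"
   by (intro nn_integral_cong) (auto simp: T_def indicator_def)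
  also have "... = emeasure lebesgue (vec_of_complex ` f ` T)"
   by (rule emeasure_holomorphic_image(2)[OF T _ _ f', symmetric])
     (use der inj in \<open>auto simp: T_def intro: inj_on_subset\<close>)
  also have "vec_of_complex ` f ` T = vec_of_complex ` f ` S \<inter> complex_of_vec -` A"
   unfolding T_def by auto
  also have "emeasure lebesgue ... = emeasure \<nu> A"
  proof -
   have "complex_of_vec -` A : sets lebesgue"
    using measurable_sets[OF cv A] by simp
   thus ?thesis
    unfolding \<nu>_def using vS
    by (simp add: emeasure_distr emeasure_density indicator_inter_arith[symmetric])
  qed
  finally show "emeasure mu A = emeasure \<nu> A" .
 qed
 moreover have "(\<integral>\<^sup>+w. h w \<partial>mu) = (\<integral>z. indicator S z * ennreal ((cmod (f' z))\<^sup>2) * h (f z))"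
  unfolding mu_def by (simp add: nn_integral_distr nn_integral_density)
 moreover have "(\<integral>\<^sup>+w. h w \<partial>\<nu>) = (\<integral>\<^sup>+x. indicator (vec_of_complex ` f ` S) x * h (complex_of_vec x) \<partial>lebesgue)"
  unfolding \<nu>_def by (simp add: nn_integral_distr nn_integral_density)
 ultimately show ?thesis by simp
qed

text \<open>The derivative at \<open>z\<close> is multiplication by \<open>f' z\<close>, so
  continuity of \<open>f'\<close> makes the derivative continuous in operator norm, as the inverse
  function theorem requires.\<close>

lemma field_derivative_locally_injective:
 fixes f :: "complex => complex"
 assumes S: "open S" "a : S"
  and der: "!!z. z : S ==> (f has_field_derivative f' z) (at z)"
  and cont: "continuous_on S f'" and nz: "f' a ~= 0"
 obtains r where "0 < r" "ball a r \<subseteq> S" "inj_on f (ball a r)"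
proof -
 have c: "isCont f' a" using cont S continuous_on_eq_continuous_at by blast
 show ?thesis
 proof (rule has_derivative_locally_injective[OF S(2,1), where f = f and f' = "%z h. f' z * h" and g' = "%h. h / f' a"])
  show "bounded_linear (%h. h / f' a)" by (rule bounded_linear_divide)
  show "(%h. h / f' a) \<circ> (*) (f' a) = id" using nz by auto
  show "(f has_derivative (*) (f' z)) (at z)" if "z : S" for z
   using der[OF that] by (simp add: has_field_derivative_def)
  fix e :: real assume e: "0 < e"
  then obtain d where d: "d > 0" "!!x. dist x a < d ==> dist (f' x) (f' a) < e / 2"
   using c unfolding continuous_at_eps_delta by (metis half_gt_zero)
  have "onorm (%v. f' x * v - f' a * v) < e" if "dist a x < d" for x
  proof -
   have "onorm (%v. f' x * v - f' a * v) <= cmod (f' x - f' a)"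
    by (rule onorm_le) (simp add: norm_mult left_diff_distrib[symmetric])
   also have "... < e" using d(2)[of x] that e by (simp add: dist_commute dist_norm norm_minus_commute)
   finally show ?thesis .
  qed
  thus "\<exists>d>0. \<forall>x. dist a x < d --> onorm (%v. f' x * v - f' a * v) < e" using d(1) by blast
 qed (use that in blast)
qed


text \<open>Compare orders at a root \<open>a\<close> of \<open>q\<close>: \<open>r\<close> does not
  vanish there, so \<open>pderiv q * r\<close> has order one less than \<open>q\<close>, whereas
  \<open>q * pderiv r\<close> has at least the order of \<open>q\<close>.\<close>

lemma wronskian_neq_0:
 fixes q r :: "complex poly"
 assumes dq: "degree q = Suc n" and r0: "r ~= 0" and cop: "!!z. poly q z = 0 ==> poly r z ~= 0"
 shows "pderiv q * r - q * pderiv r ~= 0"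
proof
 assume "pderiv q * r - q * pderiv r = 0"
 hence eq: "pderiv q * r = q * pderiv r" by simp
 have q0: "q ~= 0" using dq by auto
 have "\<not> constant (poly q)" using dq by (simp add: constant_degree)
 then obtain a where a: "poly q a = 0" using fundamental_theorem_of_algebra by blast
 have pq: "pderiv q ~= 0" using dq by (simp add: pderiv_eq_0_iff)
 have oq: "order a q = Suc (order a (pderiv q))"
  by (rule order_pderiv) (use pq a q0 in \<open>auto simp: order_root\<close>)
 have "order a r = 0" using cop[OF a] by (simp add: order_0I)
 moreover have "order a (pderiv q * r) = order a (pderiv q) + order a r"
  by (rule order_mult) (use pq r0 in auto)
 moreover have "order a (q * pderiv r) = order a q + order a (pderiv r)"
  by (rule order_mult) (use eq pq r0 in auto)
 ultimately show False using eq oq by simp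
qed

text \<open>At a multiple root \<open>z\<close> of a member of the pencil both
  \<open>q = w r\<close> and \<open>q' = w r'\<close> hold. So \<open>z\<close> is one of the
  finitely many zeros of the Wronskian, and \<open>w = q(z) / r(z)\<close> is determined by
  \<open>z\<close>.\<close>

lemma finite_not_rsquarefree_pencil:
 fixes q r :: "complex poly"
 assumes dq: "degree q = Suc n" and r0: "r ~= 0" and cop: "!!z. poly q z = 0 ==> poly r z ~= 0"
 shows "finite {w. \<not> rsquarefree (q - Polynomial.smult w r)}"
proof -
 let ?D = "pderiv q * r - q * pderiv r"
 have "{w. \<not> rsquarefree (q - Polynomial.smult w r)} \<subseteq> (%z. poly q z / poly r z) ` {z. poly ?D z = 0}"
 proof
  fix w assume "w : {w. \<not> rsquarefree (q - Polynomial.smult w r)}"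
  then obtain z where z: "poly (q - Polynomial.smult w r) z = 0" "poly (pderiv (q - Polynomial.smult w r)) z = 0"
   unfolding rsquarefree_roots by blast
  hence e: "poly q z = w * poly r z" "poly (pderiv q) z = w * poly (pderiv r) z"
   by (simp_all add: pderiv_diff pderiv_smult)
  hence "poly r z ~= 0" using cop[of z] by fastforce
  hence "w = poly q z / poly r z" "poly ?D z = 0" using e by simp_all
  thus "w : (%z. poly q z / poly r z) ` {z. poly ?D z = 0}" by blast
 qed
 thus ?thesis
  using poly_roots_finite[OF wronskian_neq_0[OF assms]] by (auto intro: finite_subset)
qed

text \<open>Outside a finite set of values \<open>w\<close> the polynomial \<open>q - w r\<close>
  has degree \<open>Suc n\<close> and simple roots, so \<open>q / r\<close> takes the value
  \<open>w\<close> exactly \<open>Suc n\<close> times; the squared modulus of its derivative is the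
  Jacobian. The factor \<open>Suc n\<close> of the deflation originates here.\<close>

lemma nn_integral_rational_function:
 fixes q r :: "complex poly" and h :: "complex => ennreal"
 assumes dq: "degree q = Suc n" and dr: "degree r <= n" and r0: "r ~= 0"
  and cop: "!!z. poly q z = 0 ==> poly r z ~= 0"
  and h[measurable]: "h : \<B> borel"
 shows "(\<integral>z. ennreal ((cmod ((poly (pderiv q) z * poly r z - poly q z * poly (pderiv r) z) / (poly r z)\<^sup>2))\<^sup>2)
      * h (poly q z / poly r z)) = of_nat (Suc n) * (\<integral>w. h w)"
proof -
 define D where "D = pderiv q * r - q * pderiv r"
 define ph where "ph z = poly q z / poly r z" for z
 define ph' where "ph' z = poly D z / (poly r z)\<^sup>2" for z
 define \<Omega> where "\<Omega> = {z. poly r z ~= 0 & poly D z ~= 0}"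
 have D0: "D ~= 0" unfolding D_def by (rule wronskian_neq_0[OF dq r0 cop])
 have fin: "finite {z. poly r z = 0 \<or> poly D z = 0}"
  using poly_roots_finite[OF r0] poly_roots_finite[OF D0] by (simp add: Collect_disj_eq)
 have compl: "- \<Omega> = {z. poly r z = 0 \<or> poly D z = 0}" by (auto simp: \<Omega>_def)
 have open\<Omega>: "open \<Omega>"
  using finite_imp_closed[OF fin] unfolding compl[symmetric] by (simp add: closed_def)
 have der: "(ph has_field_derivative ph' z) (at z)" if "z : \<Omega>" for z
 proof -
  have "(ph has_field_derivative (poly (pderiv q) z * poly r z - poly q z * poly (pderiv r) z) / (poly r z * poly r z)) (at z)"
   unfolding ph_def by (intro DERIV_divide poly_DERIV) (use that in \<open>auto simp: \<Omega>_def\<close>)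
  thus ?thesis by (simp add: ph'_def D_def power2_eq_square)
 qed
 have cont: "continuous_on \<Omega> ph'"
  unfolding ph'_def by (intro continuous_intros) (auto simp: \<Omega>_def)
 have nz: "ph' z ~= 0" if "z : \<Omega>" for z using that by (auto simp: ph'_def \<Omega>_def)
 have polym: "(%z. poly p z) : \<B> borel" for p :: "complex poly"
  by (intro borel_measurable_continuous_onI continuous_intros)
 have phm[measurable]: "ph : \<B> borel" and ph'm[measurable]: "ph' : \<B> borel"
  unfolding ph_def ph'_def by (intro borel_measurable_divide borel_measurable_power polym)+
 \<comment> \<open>Lindelof extracts countably many open sets on which \<open>ph\<close> is
   injective; \<open>disjointed\<close> refines them to a partition \<open>E\<close> of
   \<open>\<Omega>\<close>, so that the area formula applies piece by piece.\<close>
 define F where "F = {B. open B & B \<subseteq> \<Omega> & inj_on ph B}"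
 have UF: "\<Union>F = \<Omega>"
 proof
  show "\<Union>F \<subseteq> \<Omega>" by (auto simp: F_def)
  show "\<Omega> \<subseteq> \<Union>F"
  proof
   fix a assume a: "a : \<Omega>"
   obtain e where "0 < e" "ball a e \<subseteq> \<Omega>" "inj_on ph (ball a e)"
    by (rule field_derivative_locally_injective[OF open\<Omega> a der cont nz[OF a]]) auto
   thus "a : \<Union>F" unfolding F_def by (intro UnionI[of "ball a e"]) auto
  qed
 qed
 obtain F' where F': "F' \<subseteq> F" "countable F'" "\<Union>F' = \<Union>F"
  by (rule Lindelof[of F]) (auto simp: F_def)
 have ne: "F' ~= {}"
 proof
  assume "F' = {}"
  hence "\<Omega> = {}" using F' UF by simp
  hence "finite (UNIV :: complex set)" using fin compl by (metis Compl_empty_eq)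
  thus False using infinite_UNIV_char_0 by blast
 qed
 define B where "B = from_nat_into F'"
 define E where "E = disjointed B"
 have BF: "B j : F" for j using from_nat_into[OF ne] F' by (auto simp: B_def)
 have UB: "(\<Union>j. B j) = \<Omega>"
  unfolding B_def using range_from_nat_into[OF ne F'(2)] F' UF by simp
 have UE: "(\<Union>j. E j) = \<Omega>" unfolding E_def by (simp add: UN_disjointed_eq UB)
 have dE: "disjoint_family E" unfolding E_def by (rule disjoint_family_disjointed)
 have EB: "E j \<subseteq> B j" for j unfolding E_def by (rule disjointed_subset)
 have Ein: "inj_on ph (E j)" for j using BF[of j] EB[of j] by (auto simp: F_def intro: inj_on_subset)
 have E\<Omega>: "E j \<subseteq> \<Omega>" for j using UE by blast
 have Em[measurable]: "E j : sets borel" for j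
 proof -
  have "range B \<subseteq> sets borel" using BF by (auto simp: F_def)
  hence "range E \<subseteq> sets borel" unfolding E_def by (rule sets.range_disjointed_sets)
  thus ?thesis by blast
 qed
 let ?I = "%j x. indicator (vec_of_complex ` ph ` E j) x :: ennreal"
 have step: "(\<integral>z. indicator (E j) z * ennreal ((cmod (ph' z))\<^sup>2) * h (ph z)) =
   (\<integral>\<^sup>+x. ?I j x * h (complex_of_vec x) \<partial>lebesgue)" for j
  by (rule nn_integral_holomorphic_image) (use E\<Omega> der Ein in auto)
 have cv [measurable]: "complex_of_vec : measurable lebesgue borel"
  using measurable_complex_of_vec by (simp add: measurable_completion)
 have im [measurable]: "vec_of_complex ` ph ` E j : sets lebesgue" for j
  by (rule emeasure_holomorphic_image(1)[where f' = ph']) (use E\<Omega> der Ein in auto)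
 \<comment> \<open>The critical values, together with the value 0 that division by zero assigns to
   the poles.\<close>
 define Bad where "Bad = ph ` {z. poly r z = 0 \<or> poly D z = 0}"
 have finBad: "finite Bad" unfolding Bad_def using fin by simp
 have count: "(\<Sum>j. ?I j x) = of_nat (Suc n)" if x: "complex_of_vec x \<notin> Bad" for x
 proof -
  define w where "w = complex_of_vec x"
  define s where "s = q - Polynomial.smult w r"
  define Z where "Z = {z : \<Omega>. ph z = w}"
  have ds: "degree s = Suc n"
  proof -
   have "degree (- Polynomial.smult w r) < degree q"
    using dq dr degree_smult_le[of w r] by simp
   hence "degree (q + - Polynomial.smult w r) = degree q" by (rule degree_add_eq_left)
   thus ?thesis using dq by (simp add: s_def)
  qed
  have s0: "s ~= 0" using ds by auto
  have root: "poly s z = 0 \<longleftrightarrow> z : Z" for z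
  proof
   assume "poly s z = 0"
   hence e: "poly q z = w * poly r z" by (simp add: s_def)
   have rz: "poly r z ~= 0" using e cop[of z] by fastforce
   hence phz: "ph z = w" using e by (simp add: ph_def)
   have "poly D z ~= 0" using x phz by (auto simp: Bad_def w_def[symmetric])
   thus "z : Z" using rz phz by (simp add: Z_def \<Omega>_def)
  next
   assume "z : Z"
   thus "poly s z = 0" by (auto simp: Z_def \<Omega>_def ph_def s_def)
  qed
  have "rsquarefree s"
   unfolding rsquarefree_roots
  proof (intro allI notI)
   fix z assume z: "poly s z = 0 & poly (pderiv s) z = 0"
   hence "z : Z" using root by blast
   hence r: "poly r z ~= 0" "poly D z ~= 0" "poly q z = w * poly r z"
    by (auto simp: Z_def \<Omega>_def ph_def)
   have "poly (pderiv q) z = w * poly (pderiv r) z"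
    using z by (simp add: s_def pderiv_diff pderiv_smult)
   hence "poly D z = 0" using r by (simp add: D_def)
   with r show False by simp
  qed
  hence "card {z. poly s z = 0} = Suc n" using rsquarefree_card_degree[OF s0] ds by simp
  hence cZ: "card Z = Suc n" using root by simp
  hence fZ: "finite Z" by (intro card_ge_0_finite) simp
  \<comment> \<open>A piece meets the fibre \<open>Z\<close> in at most one point, because
    \<open>ph\<close> is injective on it. Summed over all pieces, the indicators count the
    fibre.\<close>
  have ind: "?I j x = (\<Sum>z\<in>Z. indicator (E j) z)" for j
  proof (cases "\<exists>z\<in>Z. z : E j")
   case True
   then obtain z where z: "z : Z" "z : E j" by blast
   have "x = vec_of_complex (ph z)" using z by (simp add: Z_def w_def)
   hence "x : vec_of_complex ` ph ` E j" using z by blast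
   moreover have "indicator (E j) y = (if y = z then 1 else 0 :: ennreal)" if "y : Z" for y
    using z that Ein[of j] by (auto simp: Z_def indicator_def inj_on_def)
   ultimately show ?thesis using fZ z by simp
  next
   case False
   have "x \<notin> vec_of_complex ` ph ` E j"
    using False E\<Omega>[of j] by (auto simp: Z_def w_def)
   moreover have "indicator (E j) y = (0 :: ennreal)" if "y : Z" for y using False that by auto
   ultimately show ?thesis by simp
  qed
  have "(\<Sum>j. ?I j x) = (\<Sum>z\<in>Z. \<Sum>j. indicator (E j) z)"
   unfolding ind by (rule suminf_sum) auto
  also have "... = (\<Sum>z\<in>Z. 1)"
  proof (rule sum.cong)
   fix z assume "z : Z"
   hence "z : (\<Union>j. E j)" using UE by (simp add: Z_def)
   thus "(\<Sum>j. indicator (E j) z) = (1::ennreal)"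
    using suminf_indicator[OF dE, of z] by (simp add: indicator_def)
  qed simp
  finally show ?thesis using cZ by simp
 qed
 have "(\<integral>z. ennreal ((cmod (ph' z))\<^sup>2) * h (ph z)) =
   (\<integral>z. (\<Sum>j. indicator (E j) z * ennreal ((cmod (ph' z))\<^sup>2) * h (ph z)))"
 proof (rule nn_integral_cong_AE)
  have "AE z in lborel. z \<notin> - \<Omega>"
   unfolding compl by (rule AE_not_in) (use fin in \<open>simp add: finite_imp_null_set_lborel\<close>)
  thus "AE z in lborel. ennreal ((cmod (ph' z))\<^sup>2) * h (ph z) =
    (\<Sum>j. indicator (E j) z * ennreal ((cmod (ph' z))\<^sup>2) * h (ph z))"
  proof (rule AE_mp[OF _ AE_I2], intro impI)
   fix z assume "z \<notin> - \<Omega>"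
   hence "z : (\<Union>j. E j)" using UE by simp
   hence "(\<Sum>j. indicator (E j) z) = (1::ennreal)"
    using suminf_indicator[OF dE, of z] by (simp add: indicator_def)
   thus "ennreal ((cmod (ph' z))\<^sup>2) * h (ph z) =
    (\<Sum>j. indicator (E j) z * ennreal ((cmod (ph' z))\<^sup>2) * h (ph z))"
    by (simp add: mult.assoc ennreal_suminf_multc)
  qed
 qed
 also have "... = (\<Sum>j. \<integral>z. indicator (E j) z * ennreal ((cmod (ph' z))\<^sup>2) * h (ph z))"
  by (rule nn_integral_suminf) simp
 also have "... = (\<integral>\<^sup>+x. (\<Sum>j. ?I j x * h (complex_of_vec x)) \<partial>lebesgue)"
  unfolding step by (rule nn_integral_suminf[symmetric]) simp
 also have "... = (\<integral>\<^sup>+x. of_nat (Suc n) * h (complex_of_vec x) \<partial>lebesgue)"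
 proof (rule nn_integral_cong_AE)
  have "finite (vec_of_complex ` Bad)" using finBad by simp
  hence "AE x in lborel. x \<notin> vec_of_complex ` Bad"
   by (intro AE_not_in) (simp add: finite_imp_null_set_lborel)
  hence "AE x in lebesgue. x \<notin> vec_of_complex ` Bad" by (rule AE_completion)
  thus "AE x in lebesgue. (\<Sum>j. ?I j x * h (complex_of_vec x)) = of_nat (Suc n) * h (complex_of_vec x)"
  proof (rule AE_mp[OF _ AE_I2], intro impI)
   fix x assume x: "x \<notin> vec_of_complex ` Bad"
   have "complex_of_vec x \<notin> Bad"
   proof
    assume "complex_of_vec x : Bad"
    hence "vec_of_complex (complex_of_vec x) : vec_of_complex ` Bad" by (rule imageI)
    with x show False by simp
   qed
   from count[OF this] show "(\<Sum>j. ?I j x * h (complex_of_vec x)) = of_nat (Suc n) * h (complex_of_vec x)"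
    by (simp only: ennreal_suminf_multc)
  qed
 qed
 also have "... = (\<integral>x. of_nat (Suc n) * h (complex_of_vec x))"
  by (rule nn_integral_completion)
 also have "... = of_nat (Suc n) * (\<integral>x. h (complex_of_vec x))"
  by (rule nn_integral_cmult) measurable
 also have "(\<integral>x. h (complex_of_vec x)) = (\<integral>w. h w)"
  by (rule nn_integral_lborel_complex[symmetric]) measurable
 finally show ?thesis by (simp add: ph_def ph'_def D_def)
qed

text \<open>The linear polynomial \<open>t z\<close> over the constant 1 is a rational function of
  degree one.\<close>

lemma nn_integral_lborel_complex_scale:
 fixes t :: complex and h :: "complex => ennreal"
 assumes "t ~= 0" and h: "h : \<B> borel"
 shows "(\<integral>z. h z) = ennreal ((cmod t)\<^sup>2) * (\<integral>z. h (t * z))"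
proof -
 have "(\<integral>z. ennreal ((cmod t)\<^sup>2) * h (z * t)) = of_nat (Suc 0) * (\<integral>w. h w)"
  using nn_integral_rational_function[of "[:0, t:]" 0 1 h] assms by (simp add: pderiv_pCons)
 moreover have "(\<integral>z. ennreal ((cmod t)\<^sup>2) * h (z * t)) = ennreal ((cmod t)\<^sup>2) * (\<integral>z. h (z * t))"
  by (rule nn_integral_cmult) (use h in measurable)
 ultimately show ?thesis by (simp add: mult.commute)
qed

section \<open>Matrices bordered by a last row and column\<close>

declare One_nat_def [simp del]
declare Suc_eq_plus1 [symmetric, simp]

lemma atLeast0_lessThan_1 [simp]: "{0..<1} = {0::nat}"
 by auto

text \<open>The distinguished entry is the lower right corner, so that stripping the border lowers
  the index bound from \<open>Suc n\<close> to \<open>n\<close>. The square shape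
  \<open>lblk\<close> means that the last basis vector is an eigenvector with eigenvalue
  \<open>z\<close>.\<close>

definition blk :: "'a::zero mat => 'a mat => 'a mat => 'a => 'a mat" where
 "blk C v b z = four_block_mat C v b (mat 1 1 (%_. z))"

abbreviation "lblk n C == blk C (0\<^sub>m n 1)"

lemma blk_carrier [simp]: "C : \<M> r c ==> blk C v b z : \<M> (Suc r) (Suc c)"
 using four_block_carrier_mat[of C r c "mat 1 1 (%_. z)" 1 1 v b] by (simp add: blk_def)

lemma dim_blk [simp]: "dim_row (blk C v b z) = Suc (dim_row C)" "dim_col (blk C v b z) = Suc (dim_col C)"
 by (simp_all add: blk_def)

lemma index_blk:
 assumes "C : \<M> r c"
 shows "i < r ==> j < c ==> blk C v b z $$ (i, j) = C $$ (i, j)"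
  "i < r ==> blk C v b z $$ (i, c) = v $$ (i, 0)"
  "j < c ==> blk C v b z $$ (r, j) = b $$ (0, j)"
  "blk C v b z $$ (r, c) = z"
 using assms by (simp_all add: blk_def)

lemma blk_exhaust:
 assumes "A : \<M> (Suc r) (Suc c)"
 obtains C v b z where "A = blk C v b z" "C : \<M> r c" "v : \<M> r 1" "b : \<M> 1 c"
proof
 let ?C = "mat r c (%ij. A $$ ij)" and ?v = "mat r 1 (%(i, j). A $$ (i, c))" and ?b = "mat 1 c (%(i, j). A $$ (r, j))"
 show "A = blk ?C ?v ?b (A $$ (r, c))"
  by (rule eq_matI) (use assms in \<open>auto simp: blk_def less_Suc_eq\<close>)
qed auto

lemma mult_blk:
 fixes z1 z2 :: "'a::comm_ring_1"
 assumes "C1 : \<M> r m" "v1 : \<M> r 1" "b1 : \<M> 1 m"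
  "C2 : \<M> m c" "v2 : \<M> m 1" "b2 : \<M> 1 c"
 shows "blk C1 v1 b1 z1 * blk C2 v2 b2 z2 =
  blk (C1 * C2 + v1 * b2) (C1 * v2 + z2 \<cdot> v1) (b1 * C2 + z1 \<cdot> b2) ((b1 * v2) $$ (0, 0) + z1 * z2)"
proof -
 have e1: "v1 * mat 1 1 (%_. z2) = z2 \<cdot> v1"
  by (rule eq_matI) (use assms in \<open>auto simp: scalar_prod_def\<close>)
 have e2: "mat 1 1 (%_. z1) * b2 = z1 \<cdot> b2"
  by (rule eq_matI) (use assms in \<open>auto simp: scalar_prod_def\<close>)
 have e3: "b1 * v2 + mat 1 1 (%_. z1) * mat 1 1 (%_. z2) = mat 1 1 (%_. (b1 * v2) $$ (0, 0) + z1 * z2)"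
  by (rule eq_matI) (use assms in \<open>auto simp: scalar_prod_def\<close>)
 show ?thesis unfolding blk_def
  by (subst mult_four_block_mat[OF assms(1,2,3) _ assms(4,5,6)]) (auto simp: e1 e2 e3)
qed

lemma mult_blk_append_rows:
 fixes t :: "'a::comm_ring_1"
 assumes "D : \<M> r r" "u : \<M> r 1" "w : \<M> 1 r"
  "A : \<M> r c" "a : \<M> 1 c"
 shows "blk D u w t * (A @\<^sub>r a) = (D * A + u * a) @\<^sub>r (w * A + t \<cdot> a)"
proof -
 have e2: "mat 1 1 (%_. t) * a = t \<cdot> a"
  by (rule eq_matI) (use assms in \<open>auto simp: scalar_prod_def\<close>)
 have z: "u * 0\<^sub>m 1 0 = 0\<^sub>m r 0" "D * 0\<^sub>m r 0 = 0\<^sub>m r 0" using assms by auto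
 have "blk D u w t * (A @\<^sub>r a) = four_block_mat D u w (mat 1 1 (%_. t)) * four_block_mat A (0\<^sub>m r 0) a (0\<^sub>m 1 0)"
  using assms by (simp add: blk_def append_rows_def)
 also have "... = four_block_mat (D * A + u * a) (D * 0\<^sub>m r 0 + u * 0\<^sub>m 1 0) (w * A + mat 1 1 (%_. t) * a) (w * 0\<^sub>m r 0 + mat 1 1 (%_. t) * 0\<^sub>m 1 0)"
  by (rule mult_four_block_mat[OF assms(1,2,3) _ assms(4) _ assms(5)]) auto
 also have "... = (D * A + u * a) @\<^sub>r (w * A + t \<cdot> a)"
  unfolding append_rows_def by (rule cong_four_block_mat) (use assms in \<open>auto simp: e2\<close>)
 finally show ?thesis .
qed

lemma det_mat_1_1 [simp]: "det (mat 1 1 (%_. z)) = z"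
 by (simp add: det_single)

lemma det_blk_lower:
 fixes z :: "'a::idom"
 assumes "C : \<M> r r" "b : \<M> 1 r"
 shows "det (lblk r C b z) = det C * z"
 unfolding blk_def by (subst det_four_block_mat_upper_right_zero[OF assms(1) refl assms(2)]) auto

lemma det_blk_upper:
 fixes z :: "'a::idom"
 assumes "C : \<M> r r" "v : \<M> r 1"
 shows "det (blk C v (0\<^sub>m 1 r) z) = det C * z"
 unfolding blk_def by (subst det_four_block_mat_lower_left_zero[OF assms refl]) auto

section \<open>Measurability of matrix operations\<close>

named_theorems lebm_meas

lemma [lebm_meas]: "m : \<M> r c ==> (%x. m) : measurable N (lebm r c)"
 by (rule measurable_const) simp

lemma measurable_mat_mult [lebm_meas]:
 assumes A: "A : measurable N (lebm r m)" and B: "B : measurable N (lebm m c)"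
 shows "(%x. A x * B x) : measurable N (lebm r c)"
proof (rule measurable_lebmI)
 note CA = measurable_carrier_mat[OF A] and CB = measurable_carrier_mat[OF B]
 show "A x * B x : \<M> r c" if "x : space N" for x using CA[OF that] CB[OF that] by auto
 fix i j assume ij: "i < r" "j < c"
 have "(%x. \<Sum>k<m. A x $$ (i, k) * B x $$ (k, j)) : \<B> N"
  by (intro borel_measurable_sum borel_measurable_times measurable_index_mat'[OF A] measurable_index_mat'[OF B]) (use ij in auto)
 thus "(%x. (A x * B x) $$ (i, j)) : \<B> N"
 proof (rule measurable_cong[THEN iffD1, rotated])
  fix x assume "x : space N"
  thus "(\<Sum>k<m. A x $$ (i, k) * B x $$ (k, j)) = (A x * B x) $$ (i, j)"
   using CA[of x] CB[of x] ij by (auto simp: scalar_prod_def atLeast0LessThan)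
 qed
qed

lemma measurable_mat_add [lebm_meas]:
 assumes A: "A : measurable N (lebm r c)" and B: "B : measurable N (lebm r c)"
 shows "(%x. A x + B x) : measurable N (lebm r c)"
proof (rule measurable_lebmI)
 note CA = measurable_carrier_mat[OF A] and CB = measurable_carrier_mat[OF B]
 show "A x + B x : \<M> r c" if "x : space N" for x using CA[OF that] CB[OF that] by auto
 fix i j assume ij: "i < r" "j < c"
 have "(%x. A x $$ (i, j) + B x $$ (i, j)) : \<B> N"
  by (intro borel_measurable_add measurable_index_mat'[OF A] measurable_index_mat'[OF B]) (use ij in auto)
 thus "(%x. (A x + B x) $$ (i, j)) : \<B> N"
 proof (rule measurable_cong[THEN iffD1, rotated])
  fix x assume "x : space N"
  thus "A x $$ (i, j) + B x $$ (i, j) = (A x + B x) $$ (i, j)" using CA[of x] CB[of x] ij by (auto)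
 qed
qed

lemma measurable_mat_minus [lebm_meas]:
 assumes A: "A : measurable N (lebm r c)" and B: "B : measurable N (lebm r c)"
 shows "(%x. A x - B x) : measurable N (lebm r c)"
proof (rule measurable_lebmI)
 note CA = measurable_carrier_mat[OF A] and CB = measurable_carrier_mat[OF B]
 show "A x - B x : \<M> r c" if "x : space N" for x using CA[OF that] CB[OF that] by auto
 fix i j assume ij: "i < r" "j < c"
 have "(%x. A x $$ (i, j) - B x $$ (i, j)) : \<B> N"
  by (intro borel_measurable_diff measurable_index_mat'[OF A] measurable_index_mat'[OF B]) (use ij in auto)
 thus "(%x. (A x - B x) $$ (i, j)) : \<B> N"
 proof (rule measurable_cong[THEN iffD1, rotated])
  fix x assume "x : space N"
  thus "A x $$ (i, j) - B x $$ (i, j) = (A x - B x) $$ (i, j)" using CA[of x] CB[of x] ij by (auto)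
 qed
qed

lemma measurable_mat_smult [lebm_meas]:
 assumes t: "t : \<B> N" and A: "A : measurable N (lebm r c)"
 shows "(%x. t x \<cdot> A x) : measurable N (lebm r c)"
proof (rule measurable_lebmI)
 note CA = measurable_carrier_mat[OF A]
 show "t x \<cdot> A x : \<M> r c" if "x : space N" for x using CA[OF that] by auto
 fix i j assume ij: "i < r" "j < c"
 have "(%x. t x * A x $$ (i, j)) : \<B> N"
  by (intro borel_measurable_times t measurable_index_mat'[OF A]) (use ij in auto)
 thus "(%x. (t x \<cdot> A x) $$ (i, j)) : \<B> N"
 proof (rule measurable_cong[THEN iffD1, rotated])
  fix x assume "x : space N"
  thus "t x * A x $$ (i, j) = (t x \<cdot> A x) $$ (i, j)" using CA[of x] ij by (auto)
 qed
qed

lemma measurable_mat_transpose [lebm_meas]: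
 assumes A: "A : measurable N (lebm r c)"
 shows "(%x. transpose_mat (A x)) : measurable N (lebm c r)"
proof (rule measurable_lebmI)
 note CA = measurable_carrier_mat[OF A]
 show "transpose_mat (A x) : \<M> c r" if "x : space N" for x using CA[OF that] by auto
 fix i j assume ij: "i < c" "j < r"
 have "(%x. A x $$ (j, i)) : \<B> N"
  by (intro measurable_index_mat'[OF A]) (use ij in auto)
 thus "(%x. transpose_mat (A x) $$ (i, j)) : \<B> N"
 proof (rule measurable_cong[THEN iffD1, rotated])
  fix x assume "x : space N"
  thus "A x $$ (j, i) = transpose_mat (A x) $$ (i, j)" using CA[of x] ij by (auto)
 qed
qed

lemma measurable_four_block_mat [lebm_meas]:
 assumes A: "A : measurable N (lebm r1 c1)" and B: "B : measurable N (lebm r1 c2)"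
  and C: "C : measurable N (lebm r2 c1)" and D: "D : measurable N (lebm r2 c2)"
 shows "(%x. four_block_mat (A x) (B x) (C x) (D x)) : measurable N (lebm (r1 + r2) (c1 + c2))"
proof (rule measurable_lebmI)
 note CA = measurable_carrier_mat[OF A] and CD = measurable_carrier_mat[OF D]
 show "four_block_mat (A x) (B x) (C x) (D x) : \<M> (r1 + r2) (c1 + c2)" if "x : space N" for x
  using CA[OF that] CD[OF that] by auto
 fix i j assume ij: "i < r1 + r2" "j < c1 + c2"
 have "(%x. if i < r1 then if j < c1 then A x $$ (i, j) else B x $$ (i, j - c1)
   else if j < c1 then C x $$ (i - r1, j) else D x $$ (i - r1, j - c1)) : \<B> N"
  using ij measurable_index_mat'[OF A, of i j] measurable_index_mat'[OF B, of i "j - c1"]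
   measurable_index_mat'[OF C, of "i - r1" j] measurable_index_mat'[OF D, of "i - r1" "j - c1"]
  by (cases "i < r1"; cases "j < c1") simp_all
 thus "(%x. four_block_mat (A x) (B x) (C x) (D x) $$ (i, j)) : \<B> N"
 proof (rule measurable_cong[THEN iffD1, rotated])
  fix x assume x: "x : space N"
  note d = carrier_matD[OF CA[OF x]] carrier_matD[OF CD[OF x]]
  show "(if i < r1 then if j < c1 then A x $$ (i, j) else B x $$ (i, j - c1)
   else if j < c1 then C x $$ (i - r1, j) else D x $$ (i - r1, j - c1)) = four_block_mat (A x) (B x) (C x) (D x) $$ (i, j)"
   by (subst index_mat_four_block(1)) (use ij in \<open>simp_all add: d\<close>)
 qed
qed

lemma measurable_mat_1_1 [lebm_meas]:
 "z : \<B> N ==> (%x. mat 1 1 (%_. z x)) : measurable N (lebm 1 1)"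
 by (rule measurable_lebmI) auto

lemma measurable_blk [lebm_meas]:
 assumes "A : measurable N (lebm r c)" "B : measurable N (lebm r 1)"
  "C : measurable N (lebm 1 c)" "z : \<B> N"
 shows "(%x. blk (A x) (B x) (C x) (z x)) : measurable N (lebm (Suc r) (Suc c))"
 using measurable_four_block_mat[OF assms(1-3) measurable_mat_1_1[OF assms(4)]] by (simp add: blk_def)

lemma measurable_append_rows [lebm_meas]:
 assumes A: "A : measurable N (lebm r1 c)" and B: "B : measurable N (lebm r2 c)"
 shows "(%x. A x @\<^sub>r B x) : measurable N (lebm (r1 + r2) c)"
proof -
 have "(%x. four_block_mat (A x) (0\<^sub>m r1 0) (B x) (0\<^sub>m r2 0)) : measurable N (lebm (r1 + r2) (c + 0))"
  by (intro lebm_meas A B) auto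
 hence "(%x. four_block_mat (A x) (0\<^sub>m r1 0) (B x) (0\<^sub>m r2 0)) : measurable N (lebm (r1 + r2) c)" by simp
 thus ?thesis
 proof (rule measurable_cong[THEN iffD1, rotated])
  fix x assume "x : space N"
  thus "four_block_mat (A x) (0\<^sub>m r1 0) (B x) (0\<^sub>m r2 0) = A x @\<^sub>r B x"
   using measurable_carrier_mat[OF A, of x] measurable_carrier_mat[OF B, of x] by (auto simp: append_rows_def)
 qed
qed

lemma measurable_append_row [lebm_meas]:
 assumes A: "A : measurable N (lebm r c)" and B: "B : measurable N (lebm 1 c)"
 shows "(%x. A x @\<^sub>r B x) : measurable N (lebm (Suc r) c)"
 using measurable_append_rows[OF assms] by simp

lemma measurable_det:
 assumes A: "A : measurable N (lebm n n)"
 shows "(%x. det (A x)) : \<B> N"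
proof -
 have "(%x. \<Sum>p\<in>{p. p permutes {0..<n}}. signof p * (\<Prod>i = 0..<n. A x $$ (i, p i))) : \<B> N"
 proof (intro borel_measurable_sum borel_measurable_times borel_measurable_prod borel_measurable_const measurable_index_mat'[OF A])
  fix p i assume "p : {p. p permutes {0..<n}}" "i : {0..<n}"
  thus "i < n" "p i < n" using permutes_in_image[of p "{0..<n}" i] by auto
 qed
 thus ?thesis
  by (rule measurable_cong[THEN iffD1, rotated]) (simp add: det_def'[OF measurable_carrier_mat[OF A]])
qed

lemma measurable_mat_delete:
 assumes A: "A : measurable N (lebm (Suc r) (Suc c))" "i < Suc r" "j < Suc c"
 shows "(%x. mat_delete (A x) i j) : measurable N (lebm r c)"
proof (rule measurable_lebmI)
 note CA = measurable_carrier_mat[OF A(1)]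
 show "mat_delete (A x) i j : \<M> r c" if "x : space N" for x
  using CA[OF that] by (auto simp: mat_delete_def)
 fix k l assume kl: "k < r" "l < c"
 have "(%x. A x $$ (if k < i then k else Suc k, if l < j then l else Suc l)) : \<B> N"
  by (intro measurable_index_mat'[OF A(1)]) (use kl in auto)
 thus "(%x. mat_delete (A x) i j $$ (k, l)) : \<B> N"
 proof (rule measurable_cong[THEN iffD1, rotated])
  fix x assume "x : space N"
  thus "A x $$ (if k < i then k else Suc k, if l < j then l else Suc l) = mat_delete (A x) i j $$ (k, l)" using CA[of x] kl by (auto simp: mat_delete_def)
 qed
qed

lemma measurable_adj_mat [lebm_meas]:
 assumes A: "A : measurable N (lebm n n)"
 shows "(%x. adj_mat (A x)) : measurable N (lebm n n)"
proof (cases n)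
 case 0
 thus ?thesis using adj_mat(1)[OF measurable_carrier_mat[OF A]] by (intro measurable_lebmI) auto
next
 case (Suc m)
 show ?thesis
 proof (rule measurable_lebmI)
  show "adj_mat (A x) : \<M> n n" if "x : space N" for x using measurable_carrier_mat[OF A that] by (rule adj_mat)
  fix i j assume ij: "i < n" "j < n"
  have "(%x. (-1) ^ (j + i) * det (mat_delete (A x) j i)) : \<B> N"
   by (intro borel_measurable_times borel_measurable_const measurable_det measurable_mat_delete)
     (use A Suc ij in auto)
  thus "(%x. adj_mat (A x) $$ (i, j)) : \<B> N"
  proof (rule measurable_cong[THEN iffD1, rotated])
   fix x assume "x : space N"
   thus "(-1) ^ (j + i) * det (mat_delete (A x) j i) = adj_mat (A x) $$ (i, j)"
    using measurable_carrier_mat[OF A, of x] ij by (auto simp: adj_mat_def Determinant.cofactor_def)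
  qed
 qed
qed

section \<open>Splitting the matrix measure, and linear changes of variables\<close>

lemma nn_integral_lebm_append_rows:
 assumes f: "f : \<B> (lebm (r1 + r2) c)"
 shows "(\<integral>A|r1 + r2,c. f A) = (\<integral>A|r1,c. \<integral>B|r2,c. f (A @\<^sub>r B))"
proof (rule nn_integral_lebm_combine(2)[OF f, where ga = "%ij. ij" and gb = "%(i, j). (r1 + i, j)"])
 show "(%ij. ij) ` ({..<r1} \<times> {..<c}) \<union> (%(i, j). (r1 + i, j)) ` ({..<r2} \<times> {..<c}) = {..<r1 + r2} \<times> {..<c}"
  by (auto simp: image_iff) (metis add_diff_inverse_nat lessThan_iff nat_add_left_cancel_less)
qed (auto simp: append_rows_def inj_on_def)

definition hcat :: "complex mat => complex mat => complex mat" where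
 "hcat A B = transpose_mat (transpose_mat A @\<^sub>r transpose_mat B)"

lemma hcat_carrier: "A : \<M> r c1 ==> B : \<M> r c2 ==> hcat A B : \<M> r (c1 + c2)"
 by (auto simp: hcat_def append_rows_def)

lemma index_hcat: "A : \<M> r c1 ==> B : \<M> r c2 ==> i < r ==> j < c1 + c2 ==>
  hcat A B $$ (i, j) = (if j < c1 then A $$ (i, j) else B $$ (i, j - c1))"
 by (auto simp: hcat_def append_rows_def)

lemma nn_integral_lebm_hcat:
 assumes f: "f : \<B> (lebm r (c1 + c2))"
 shows "(\<integral>A|r,c1 + c2. f A) = (\<integral>A|r,c1. \<integral>B|r,c2. f (hcat A B))"
proof (rule nn_integral_lebm_combine(2)[OF f, where ga = "%ij. ij" and gb = "%(i, j). (i, c1 + j)"])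
 show "(%ij. ij) ` ({..<r} \<times> {..<c1}) \<union> (%(i, j). (i, c1 + j)) ` ({..<r} \<times> {..<c2}) = {..<r} \<times> {..<c1 + c2}"
  by (auto simp: image_iff) (metis add_diff_inverse_nat lessThan_iff nat_add_left_cancel_less)
qed (auto simp: hcat_carrier index_hcat inj_on_def)

lemma measurable_hcat [lebm_meas]:
 assumes A: "A : measurable N (lebm r c1)" and B: "B : measurable N (lebm r c2)"
 shows "(%x. hcat (A x) (B x)) : measurable N (lebm r (c1 + c2))"
 unfolding hcat_def by (intro lebm_meas A B)

lemma nn_integral_lebm_singleton:
 fixes f :: "complex mat => ennreal"
 assumes f: "f : \<B> (lebm 1 1)"
 shows "(\<integral>A|1,1. f A) = (\<integral>z. f (mat 1 1 (%_. z)))"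
proof -
 have e: "{..<1::nat} \<times> {..<1::nat} = {(0, 0)}" by auto
 have eq: "(%x :: nat \<times> nat => complex. f (mat 1 1 x)) = (%x. f (mat 1 1 (%_. x (0, 0))))"
  by (intro ext arg_cong[of _ _ f] eq_matI) auto
 have "(\<integral>A|1,1. f A) = (\<integral>\<^sup>+x. f (mat 1 1 (%_. x (0, 0))) \<partial>\<P> {(0::nat, 0::nat)})"
  unfolding nn_integral_lebm[OF f] e eq ..
 also have "... = (\<integral>z. f (mat 1 1 (%_. z)))"
  by (rule product_sigma_finite.product_nn_integral_singleton[OF product_lborel, where i = "(0::nat, 0::nat)"])
    (rule measurable_compose[OF _ f], rule measurable_lebmI, auto)
 finally show ?thesis .
qed

lemma nn_integral_lebm_empty:
 assumes f: "f : \<B> (lebm r c)" and rc: "r = 0 \<or> c = 0"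
 shows "(\<integral>A|r,c. f A) = f (0\<^sub>m r c)"
proof -
 have e: "{..<r} \<times> {..<c} = {}" using rc by auto
 have "mat r c x = 0\<^sub>m r c" for x :: "nat \<times> nat => complex" by (rule eq_matI) (use rc in auto)
 thus ?thesis unfolding nn_integral_lebm[OF f] e
  by (subst product_sigma_finite.nn_integral_empty[OF product_lborel]) auto
qed

lemma nn_integral_swap:
 assumes "sigma_finite_measure M1" "sigma_finite_measure M2"
  "(%(x, y). f x y) : \<B> (M1 \<Otimes> M2)"
 shows "(\<integral>\<^sup>+x. \<integral>\<^sup>+y. f x y \<partial>M2 \<partial>M1) = (\<integral>\<^sup>+y. \<integral>\<^sup>+x. f x y \<partial>M1 \<partial>M2)"
 using pair_sigma_finite.Fubini'[of M1 M2 f] assms by (simp add: pair_sigma_finite_def)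

lemma nn_integral_lebm_transpose:
 fixes f :: "complex mat => ennreal"
 assumes f: "f : \<B> (lebm r c)"
 shows "(\<integral>A|r,c. f A) = (\<integral>A|c,r. f (transpose_mat A))"
proof -
 \<comment> \<open>With an empty second block the splitting lemma is a pure relabelling, here the
   exchange of row and column indices.\<close>
 have "(\<integral>A|r,c. f A) = (\<integral>A|c,r. \<integral>B|0,0. f (transpose_mat A))"
  by (rule nn_integral_lebm_combine(2)[OF f, where ga = prod.swap and gb = "%ij. ij"]) auto
 thus ?thesis by (subst (asm) nn_integral_lebm_empty) auto
qed

lemma nn_integral_lebm_translate:
 assumes f: "f : \<B> (lebm r c)" and B: "B : \<M> r c"
 shows "(\<integral>A|r,c. f A) = (\<integral>A|r,c. f (A + B))"
proof -
 have g: "(%A. f (A + B)) : \<B> (lebm r c)"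
  by (rule measurable_compose[OF _ f]) (intro lebm_meas B measurable_ident_sets refl)
 have e: "mat r c (\<lambda>ij\<in>{..<r} \<times> {..<c}. B $$ ij + x ij) = mat r c x + B" for x
  by (rule eq_matI) (use B in auto)
 show ?thesis unfolding nn_integral_lebm[OF f] nn_integral_lebm[OF g]
  by (subst nn_integral_PiM_translate[where a = "%ij. B $$ ij"])
    (use measurable_compose[OF measurable_mat_PiM f] in \<open>auto simp: e\<close>)
qed


lemma nn_integral_PiM_scale:
 fixes t :: complex
 assumes fin: "finite K" and f: "f : \<B> (\<P> K)" and t: "t ~= 0"
 shows "(\<integral>\<^sup>+x. f x \<partial>\<P> K) =
  ennreal ((cmod t)\<^sup>2) ^ card K * (\<integral>\<^sup>+x. f (\<lambda>i\<in>K. t * x i) \<partial>\<P> K)"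
proof -
 let ?P = "PiM K (%_. \<L>)"
 let ?t = "%x. \<lambda>i\<in>K. t * x i"
 let ?s = "ennreal ((cmod t)\<^sup>2) ^ card K"
 note psf = product_lborel
 have m: "?t : measurable ?P ?P"
  by (intro measurable_restrict) auto
 have "scale_measure ?s (distr ?P ?P ?t) = ?P"
 proof (rule product_sigma_finite.PiM_eqI[OF psf fin])
  fix A :: "'a => complex set" assume A: "!!i. i : K ==> A i : sets lborel"
  have pre: "?t -` Pi\<^sub>E K A \<inter> space ?P = Pi\<^sub>E K (%i. (*) t -` A i)"
   by (auto simp: space_PiM PiE_iff extensional_def)
  have s: "(*) t -` A i : sets lborel" if "i : K" for i
   using measurable_sets_borel[of "(*) t" borel "A i"] A[OF that] by simp
  have "emeasure (distr ?P ?P ?t) (Pi\<^sub>E K A) = emeasure ?P (Pi\<^sub>E K (%i. (*) t -` A i))"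
   by (subst emeasure_distr[OF m]) (use A fin pre in \<open>auto intro!: sets_PiM_I_finite\<close>)
  also have "... = (\<Prod>i\<in>K. emeasure lborel ((*) t -` A i))"
   by (rule product_sigma_finite.emeasure_PiM[OF psf fin s])
  finally have "?s * emeasure (distr ?P ?P ?t) (Pi\<^sub>E K A) = (\<Prod>i\<in>K. ennreal ((cmod t)\<^sup>2) * emeasure lborel ((*) t -` A i))"
   by (simp add: prod.distrib)
  also have "... = (\<Prod>i\<in>K. emeasure lborel (A i))"
  proof (rule prod.cong)
   fix i assume i: "i : K"
   have "(\<integral>z. indicator (A i) z) = ennreal ((cmod t)\<^sup>2) * (\<integral>z. indicator (A i) (t * z))"
    by (rule nn_integral_lborel_complex_scale[OF t]) (use A[OF i] in auto)
   also have "(\<integral>z. indicator (A i) (t * z)) = (\<integral>z. indicator ((*) t -` A i) z)"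
    by (intro nn_integral_cong) (auto simp: indicator_def)
   finally show "ennreal ((cmod t)\<^sup>2) * emeasure lborel ((*) t -` A i) = emeasure lborel (A i)"
    using A[OF i] s[OF i] by simp
  qed simp
  finally show "emeasure (scale_measure ?s (distr ?P ?P ?t)) (Pi\<^sub>E K A) = (\<Prod>i\<in>K. emeasure lborel (A i))"
   by simp
 qed simp
 hence "(\<integral>\<^sup>+x. f x \<partial>?P) = (\<integral>\<^sup>+x. f x \<partial>scale_measure ?s (distr ?P ?P ?t))" by simp
 also have "... = ?s * (\<integral>\<^sup>+x. f x \<partial>distr ?P ?P ?t)"
  by (rule nn_integral_scale_measure) (use f in simp)
 also have "(\<integral>\<^sup>+x. f x \<partial>distr ?P ?P ?t) = (\<integral>\<^sup>+x. f (?t x) \<partial>?P)"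
  by (rule nn_integral_distr[OF m]) (use f in simp)
 finally show ?thesis .
qed

lemma nn_integral_lebm_scale:
 assumes f: "f : \<B> (lebm r c)" and t: "t ~= 0"
 shows "(\<integral>A|r,c. f A) = ennreal ((cmod t)\<^sup>2) ^ (r * c) * (\<integral>A|r,c. f (t \<cdot> A))"
proof -
 have g: "(%A. f (t \<cdot> A)) : \<B> (lebm r c)"
  by (rule measurable_compose[OF _ f]) (intro lebm_meas measurable_const measurable_ident_sets refl, simp)
 have e: "mat r c (\<lambda>ij\<in>{..<r} \<times> {..<c}. t * x ij) = t \<cdot> mat r c x" for x
  by (rule eq_matI) auto
 show ?thesis unfolding nn_integral_lebm[OF f] nn_integral_lebm[OF g]
  by (subst nn_integral_PiM_scale[OF _ _ t])
    (use measurable_compose[OF measurable_mat_PiM f] in \<open>auto simp: e card_cartesian_product\<close>)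
qed

lemma lebm_ident: "(%x. x) : measurable (lebm r c) (lebm r c)"
 by simp

lemma measurable_mult_const_left:
 assumes "B : \<M> r m" "f : \<B> (lebm r c)"
 shows "(%A. f (B * A)) : \<B> (lebm m c)"
 by (rule measurable_compose[OF measurable_mat_mult[OF measurable_const lebm_ident] assms(2)]) (use assms in simp)

lemma measurable_mult_const_right:
 assumes "B : \<M> m c" "f : \<B> (lebm r c)"
 shows "(%A. f (A * B)) : \<B> (lebm r m)"
 by (rule measurable_compose[OF measurable_mat_mult[OF lebm_ident measurable_const] assms(2)]) (use assms in simp)

text \<open>For a fixed last row \<open>a\<close> the shear translates the upper rows by
  \<open>u * a\<close>, so there is no Jacobian.\<close>

lemma nn_integral_lebm_upper_shear:
 assumes f: "f : \<B> (lebm (Suc r) c)" and u: "u : \<M> r 1"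
 shows "(\<integral>A|Suc r,c. f A) = (\<integral>A|Suc r,c. f (blk (1\<^sub>m r) u (0\<^sub>m 1 r) 1 * A))"
proof -
 have f': "f : \<B> (lebm (r + 1) c)" using f by simp
 let ?S = "blk (1\<^sub>m r) u (0\<^sub>m 1 r) 1"
 have S: "?S : \<M> (Suc r) (Suc r)" by simp
 have g: "(%A. f (?S * A)) : \<B> (lebm (r + 1) c)"
  using measurable_mult_const_left[OF S f] by simp
 have sw: "(\<integral>A|r,c. \<integral>a|1,c. f (A @\<^sub>r a)) = (\<integral>a|1,c. \<integral>A|r,c. f (A @\<^sub>r a))"
  by (intro nn_integral_swap sigma_finite_lebm)
    (unfold case_prod_beta', rule measurable_compose[OF _ f'], intro lebm_meas measurable_fst measurable_snd)
 have sw': "(\<integral>A|r,c. \<integral>a|1,c. f (?S * (A @\<^sub>r a))) = (\<integral>a|1,c. \<integral>A|r,c. f (?S * (A @\<^sub>r a)))"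
  by (intro nn_integral_swap sigma_finite_lebm)
    (unfold case_prod_beta', rule measurable_compose[OF _ measurable_mult_const_left[OF S f]], intro lebm_meas measurable_fst measurable_snd)
 have "(\<integral>A|r,c. f (A @\<^sub>r a)) = (\<integral>A|r,c. f (?S * (A @\<^sub>r a)))" if a: "a : \<M> 1 c" for a
 proof -
  have "(\<integral>A|r,c. f (A @\<^sub>r a)) = (\<integral>A|r,c. f ((A + u * a) @\<^sub>r a))"
  proof (rule nn_integral_lebm_translate)
   show "(%A. f (A @\<^sub>r a)) : \<B> (lebm r c)"
    by (rule measurable_compose[OF _ f']) (intro lebm_meas a, simp)
  qed (use u a in auto)
  also have "... = (\<integral>A|r,c. f (?S * (A @\<^sub>r a)))"
   by (intro nn_integral_cong arg_cong[of _ _ f], subst mult_blk_append_rows[OF _ u])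
     (use a u in \<open>auto intro!: arg_cong2[of _ _ _ _ append_rows] eq_matI\<close>)
  finally show ?thesis .
 qed
 hence "(\<integral>a|1,c. \<integral>A|r,c. f (A @\<^sub>r a)) = (\<integral>a|1,c. \<integral>A|r,c. f (?S * (A @\<^sub>r a)))"
  by (rule nn_integral_cong) simp
 thus ?thesis
  using nn_integral_lebm_append_rows[OF f'] nn_integral_lebm_append_rows[OF g] sw sw' by simp
qed

text \<open>For fixed upper rows \<open>A\<close> the last row is dilated by \<open>t\<close> in
  \<open>c\<close> complex coordinates and translated by \<open>w * A\<close>. The action of
  \<open>D\<close> on the upper rows enters as a hypothesis with an arbitrary constant
  \<open>K\<close>, ready for an induction on the size.\<close>

lemma nn_integral_lebm_lower:
 assumes f: "f : \<B> (lebm (Suc r) c)"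
  and D: "D : \<M> r r" and w: "w : \<M> 1 r" and t: "t ~= 0"
  and IH: "!!g. g : \<B> (lebm r c) ==>
   (\<integral>A|r,c. g A) = K * (\<integral>A|r,c. g (D * A))"
 shows "(\<integral>A|Suc r,c. f A) =
  K * ennreal ((cmod t)\<^sup>2) ^ c * (\<integral>A|Suc r,c. f (lblk r D w t * A))"
proof -
 have f': "f : \<B> (lebm (r + 1) c)" using f by simp
 let ?T = "lblk r D w t" and ?s = "ennreal ((cmod t)\<^sup>2) ^ c"
 have T: "?T : \<M> (Suc r) (Suc r)" using D by simp
 have g: "(%A. f (?T * A)) : \<B> (lebm (r + 1) c)"
  using measurable_mult_const_left[OF T f] by simp
 have m1: "(%A. \<integral>a|1,c. f (A @\<^sub>r a)) : \<B> (lebm r c)"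
  by (rule sigma_finite_measure.borel_measurable_nn_integral[OF sigma_finite_lebm])
    (unfold case_prod_beta', rule measurable_compose[OF _ f'], intro lebm_meas measurable_fst measurable_snd)
 have inner: "(\<integral>a|1,c. f ((D * A) @\<^sub>r a)) = ?s * (\<integral>a|1,c. f (?T * (A @\<^sub>r a)))"
  if A: "A : \<M> r c" for A
 proof -
  have DA: "D * A : \<M> r c" using D A by auto
  have m: "(%a. f ((D * A) @\<^sub>r a)) : \<B> (lebm 1 c)"
   by (rule measurable_compose[OF _ f']) (intro lebm_meas DA, simp)
  have wA: "(1 / t) \<cdot> (w * A) : \<M> 1 c" using w A by auto
  have "(\<integral>a|1,c. f ((D * A) @\<^sub>r a)) = ?s * (\<integral>a|1,c. f ((D * A) @\<^sub>r (t \<cdot> a)))"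
   using nn_integral_lebm_scale[OF m t] by simp
  also have "(\<integral>a|1,c. f ((D * A) @\<^sub>r (t \<cdot> a))) =
    (\<integral>a|1,c. f ((D * A) @\<^sub>r (t \<cdot> (a + (1 / t) \<cdot> (w * A)))))"
   by (rule nn_integral_lebm_translate[OF _ wA])
     (rule measurable_compose[OF _ f'], intro lebm_meas DA measurable_const, simp_all)
  also have "... = (\<integral>a|1,c. f (?T * (A @\<^sub>r a)))"
  proof (intro nn_integral_cong arg_cong[of _ _ f])
   fix a assume "a : space (lebm 1 c)"
   hence a: "a : \<M> 1 c" by simp
   have "t \<cdot> (a + (1 / t) \<cdot> (w * A)) = w * A + t \<cdot> a"
    by (rule eq_matI) (use a w A t in \<open>auto simp: field_simps\<close>)
   moreover have "D * A + 0\<^sub>m r 1 * a = D * A" using D A a by auto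
   ultimately show "(D * A) @\<^sub>r (t \<cdot> (a + (1 / t) \<cdot> (w * A))) = ?T * (A @\<^sub>r a)"
    by (subst mult_blk_append_rows[OF D _ w A a]) auto
  qed
  finally show ?thesis .
 qed
 have mT: "(%A. \<integral>a|1,c. f (?T * (A @\<^sub>r a))) : \<B> (lebm r c)"
  by (rule sigma_finite_measure.borel_measurable_nn_integral[OF sigma_finite_lebm])
    (unfold case_prod_beta', rule measurable_compose[OF _ measurable_mult_const_left[OF T f]], intro lebm_meas measurable_fst measurable_snd)
 have "(\<integral>A|Suc r,c. f A) = (\<integral>A|r,c. \<integral>a|1,c. f (A @\<^sub>r a))"
  using nn_integral_lebm_append_rows[OF f'] by simp
 also have "... = K * (\<integral>A|r,c. \<integral>a|1,c. f ((D * A) @\<^sub>r a))"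
  by (rule IH[OF m1])
 also have "... = K * (\<integral>A|r,c. ?s * (\<integral>a|1,c. f (?T * (A @\<^sub>r a))))"
  by (intro arg_cong[of _ _ "%x. K * x"] nn_integral_cong inner) simp
 also have "... = K * ?s * (\<integral>A|r,c. \<integral>a|1,c. f (?T * (A @\<^sub>r a)))"
  by (simp add: nn_integral_cmult[OF mT] mult.assoc)
 also have "(\<integral>A|r,c. \<integral>a|1,c. f (?T * (A @\<^sub>r a))) = (\<integral>A|Suc r,c. f (?T * A))"
  using nn_integral_lebm_append_rows[OF g] by simp
 finally show ?thesis .
qed

text \<open>Gaussian elimination by induction: if the corner \<open>t\<close> is nonzero,
  \<open>B\<close> is an upper shear times a lower block matrix whose upper block is the Schur
  complement of \<open>t\<close>. Each of the \<open>c\<close> columns contributes the real Jacobian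
  \<open>|det B|^2\<close>.\<close>

lemma nn_integral_lebm_mult_left:
 assumes "f : \<B> (lebm r c)" "B : \<M> r r" "det B ~= 0"
 shows "(\<integral>A|r,c. f A) = ennreal ((cmod (det B))\<^sup>2) ^ c * (\<integral>A|r,c. f (B * A))"
 using assms
proof (induction r arbitrary: f B)
 case 0
 have "B * 0\<^sub>m 0 c = 0\<^sub>m 0 c" by (rule eq_matI) (use 0 in auto)
 moreover have "(%A. f (B * A)) : \<B> (lebm 0 c)"
  by (rule measurable_mult_const_left[OF 0(2,1)])
 ultimately show ?case using 0 by (simp add: nn_integral_lebm_empty)
next
 case (Suc r)
 have pivot: "(\<integral>A|Suc r,c. f A) =
   ennreal ((cmod (det B))\<^sup>2) ^ c * (\<integral>A|Suc r,c. f (B * A))"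
  if f: "f : \<B> (lebm (Suc r) c)" and dB: "det B ~= 0" and B: "B = blk D u w t"
   and D: "D : \<M> r r" and u: "u : \<M> r 1" and w: "w : \<M> 1 r" and t: "t ~= 0"
  for f B D u w t
 proof -
  let ?u = "(1 / t) \<cdot> u"
  define D' where "D' = D - ?u * w"
  define S where "S = blk (1\<^sub>m r) ?u (0\<^sub>m 1 r) 1"
  define T where "T = blk D' (0\<^sub>m r 1) w t"
  have D': "D' : \<M> r r" using D u w by (auto simp: D'_def)
  have u': "?u : \<M> r 1" using u by simp
  have S: "S : \<M> (Suc r) (Suc r)" and T: "T : \<M> (Suc r) (Suc r)"
   using D' by (simp_all add: S_def T_def)
  have ST: "B = S * T"
  proof -
   have "S * T = blk (1\<^sub>m r * D' + ?u * w) (1\<^sub>m r * 0\<^sub>m r 1 + t \<cdot> ?u) (0\<^sub>m 1 r * D' + 1 \<cdot> w) ((0\<^sub>m 1 r * 0\<^sub>m r 1) $$ (0, 0) + 1 * t)"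
    unfolding S_def T_def by (rule mult_blk) (use D' u' w in auto)
   also have "1\<^sub>m r * D' + ?u * w = D"
    unfolding D'_def by (rule eq_matI) (use D u w in auto)
   also have "1\<^sub>m r * 0\<^sub>m r 1 + t \<cdot> ?u = u" by (rule eq_matI) (use u t in auto)
   also have "0\<^sub>m 1 r * D' + 1 \<cdot> w = w" by (rule eq_matI) (use D' w in auto)
   finally show ?thesis by (simp add: B)
  qed
  have "det B = det S * det T" unfolding ST by (rule det_mult[OF S T])
  moreover have "det S = 1" unfolding S_def using det_blk_upper[OF _ u', of "1\<^sub>m r" 1] by simp
  moreover have "det T = det D' * t" unfolding T_def by (rule det_blk_lower[OF D' w])
  ultimately have dB': "det B = det D' * t" by simp
  hence dD': "det D' ~= 0" using dB by auto
  have g: "(%A. f (S * A)) : \<B> (lebm (Suc r) c)"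
   by (rule measurable_mult_const_left[OF S f])
  have "(\<integral>A|Suc r,c. f A) = (\<integral>A|Suc r,c. f (S * A))"
   unfolding S_def by (rule nn_integral_lebm_upper_shear[OF f u'])
  also have "... = ennreal ((cmod (det D'))\<^sup>2) ^ c * ennreal ((cmod t)\<^sup>2) ^ c * (\<integral>A|Suc r,c. f (S * (T * A)))"
   unfolding T_def by (rule nn_integral_lebm_lower[OF g D' w t Suc.IH[OF _ D' dD']])
  also have "ennreal ((cmod (det D'))\<^sup>2) ^ c * ennreal ((cmod t)\<^sup>2) ^ c = ennreal ((cmod (det B))\<^sup>2) ^ c"
   by (simp add: dB' norm_mult power_mult_distrib ennreal_mult)
  also have "(\<integral>A|Suc r,c. f (S * (T * A))) = (\<integral>A|Suc r,c. f (B * A))"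
   by (intro nn_integral_cong) (use assoc_mult_mat[OF S T] in \<open>simp add: ST\<close>)
  finally show ?thesis .
 qed
 obtain D u w t where B: "B = blk D u w t" and D: "D : \<M> r r" and u: "u : \<M> r 1"
   and w: "w : \<M> 1 r"
  using blk_exhaust[OF Suc.prems(2)] by metis
 show ?case
 proof (cases "t = 0")
  case False
  thus ?thesis using pivot[OF Suc.prems(1,3) B D u w] by simp
 next
  case True
  \<comment> \<open>Adding column \<open>j\<close> to the last column by the shear \<open>E\<close>
    turns the corner into \<open>w $$ (0, j)\<close>, so that the pivot case applies to
    \<open>B * E\<close>.\<close>
  have "\<exists>j<r. w $$ (0, j) ~= 0"
  proof (rule ccontr)
   assume "\<not> ?thesis"
   hence "w = 0\<^sub>m 1 r" using w by (intro eq_matI) auto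
   hence "det B = 0" using det_blk_upper[OF D u, of t] True by (simp add: B)
   thus False using Suc.prems by simp
  qed
  then obtain j where j: "j < r" "w $$ (0, j) ~= 0" by blast
  define e :: "complex mat" where "e = mat r 1 (%(i, _). if i = j then 1 else 0)"
  define E where "E = blk (1\<^sub>m r) e (0\<^sub>m 1 r) 1"
  have e: "e : \<M> r 1" by (simp add: e_def)
  have E: "E : \<M> (Suc r) (Suc r)" by (simp add: E_def)
  have we: "(w * e) $$ (0, 0) = w $$ (0, j)"
   using w j by (simp add: e_def scalar_prod_def if_distrib[of "%x. _ * x"] cong: if_cong)
  have BE: "B * E = blk (D * 1\<^sub>m r + u * 0\<^sub>m 1 r) (D * e + 1 \<cdot> u) (w * 1\<^sub>m r + t \<cdot> 0\<^sub>m 1 r) ((w * e) $$ (0, 0) + t * 1)"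
   unfolding B E_def by (rule mult_blk) (use D u w e in auto)
  have dE: "det E = 1" unfolding E_def using det_blk_upper[OF _ e, of "1\<^sub>m r" 1] by simp
  have dBE: "det (B * E) = det B" using det_mult[OF Suc.prems(2) E] dE by simp
  have "(\<integral>A|Suc r,c. f A) =
    ennreal ((cmod (det (B * E)))\<^sup>2) ^ c * (\<integral>A|Suc r,c. f (B * E * A))"
   by (rule pivot[OF Suc.prems(1) _ BE]) (use dBE Suc.prems D u w e we j True in auto)
  also have "(\<integral>A|Suc r,c. f (B * E * A)) = (\<integral>A|Suc r,c. f (B * (E * A)))"
   by (intro nn_integral_cong) (use assoc_mult_mat[OF Suc.prems(2) E] in simp)
  also have "... = (\<integral>A|Suc r,c. f (B * A))"
   unfolding E_def
   by (rule nn_integral_lebm_upper_shear[OF _ e, symmetric])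
     (rule measurable_mult_const_left[OF Suc.prems(2,1)])
  finally show ?thesis by (simp add: dBE)
 qed
qed

lemma nn_integral_lebm_mult_right:
 assumes f: "f : \<B> (lebm r c)" and B: "B : \<M> c c" and dB: "det B ~= 0"
 shows "(\<integral>A|r,c. f A) = ennreal ((cmod (det B))\<^sup>2) ^ r * (\<integral>A|r,c. f (A * B))"
proof -
 have BT: "transpose_mat B : \<M> c c" using B by simp
 have g: "(%A. f (A * B)) : \<B> (lebm r c)"
  by (rule measurable_mult_const_right[OF B f])
 have h: "(%A. f (transpose_mat A)) : \<B> (lebm c r)"
  by (rule measurable_compose[OF _ f]) (intro lebm_meas, simp)
 have "(\<integral>A|r,c. f A) = (\<integral>A|c,r. f (transpose_mat A))"
  by (rule nn_integral_lebm_transpose[OF f])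
 also have "... = ennreal ((cmod (det B))\<^sup>2) ^ r * (\<integral>A|c,r. f (transpose_mat (transpose_mat B * A)))"
  using nn_integral_lebm_mult_left[OF h BT] dB by (simp add: det_transpose[OF B])
 also have "(\<integral>A|c,r. f (transpose_mat (transpose_mat B * A))) = (\<integral>A|c,r. f (transpose_mat A * B))"
  by (intro nn_integral_cong) (use B in \<open>simp add: transpose_mult[OF BT]\<close>)
 also have "... = (\<integral>A|r,c. f (A * B))"
  by (rule nn_integral_lebm_transpose[OF g, symmetric])
 finally show ?thesis .
qed


lemma measurable_nn_integral_lebm:
 "(%(x, A). f x A) : \<B> (N \<Otimes> lebm r c) ==>
  (%x. \<integral>A|r,c. f x A) : \<B> N"
 by (rule sigma_finite_measure.borel_measurable_nn_integral[OF sigma_finite_lebm])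

lemma nn_integral_lebm_blk:
 assumes f: "f : \<B> (lebm (Suc r) (Suc c))"
 shows "(\<integral>A|Suc r,Suc c. f A) =
  (\<integral>C|r,c. \<integral>v|r,1. \<integral>b|1,c. \<integral>z. f (blk C v b z))"
proof -
 have f': "f : \<B> (lebm (r + 1) (c + 1))" using f by simp
 have eq: "hcat C v @\<^sub>r hcat b (mat 1 1 (%_. z)) = blk C v b z"
  if "C : \<M> r c" "v : \<M> r 1" "b : \<M> 1 c" for C v b z
  by (rule eq_matI) (use that in \<open>auto simp: blk_def append_rows_def hcat_def\<close>)
 have m1: "(%(A, B). f (A @\<^sub>r B)) : \<B> (lebm r (c + 1) \<Otimes> lebm 1 (c + 1))"
  unfolding case_prod_beta'
  by (rule measurable_compose[OF _ f']) (intro lebm_meas measurable_fst measurable_snd)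
 have mB: "(%B. f (A @\<^sub>r B)) : \<B> (lebm 1 (c + 1))" if "A : \<M> r (c + 1)" for A
  using measurable_compose[OF measurable_Pair1'[of A "lebm r (c + 1)"] m1] that by simp
 have "(\<integral>A|Suc r,Suc c. f A) = (\<integral>A|r,c + 1. \<integral>B|1,c + 1. f (A @\<^sub>r B))"
  using nn_integral_lebm_append_rows[OF f'] by simp
 also have "... = (\<integral>C|r,c. \<integral>v|r,1. \<integral>B|1,c + 1. f (hcat C v @\<^sub>r B))"
  by (intro nn_integral_lebm_hcat measurable_nn_integral_lebm m1)
 also have "... = (\<integral>C|r,c. \<integral>v|r,1. \<integral>b|1,c. \<integral>z. f (blk C v b z))"
 proof (intro nn_integral_cong)
  fix C v assume "C : space (lebm r c)" "v : space (lebm r 1)"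
  hence C: "C : \<M> r c" and v: "v : \<M> r 1" by auto
  have Cv: "hcat C v : \<M> r (c + 1)" using hcat_carrier[OF C v] .
  have "(\<integral>B|1,c + 1. f (hcat C v @\<^sub>r B)) = (\<integral>b|1,c. \<integral>Z|1,1. f (hcat C v @\<^sub>r hcat b Z))"
   by (rule nn_integral_lebm_hcat[OF mB[OF Cv]])
  also have "... = (\<integral>b|1,c. \<integral>z. f (blk C v b z))"
  proof (rule nn_integral_cong)
   fix b assume "b : space (lebm 1 c)"
   hence b: "b : \<M> 1 c" by simp
   have "(%Z. f (hcat C v @\<^sub>r hcat b Z)) : \<B> (lebm 1 1)"
    by (rule measurable_compose[OF _ mB[OF Cv]], rule measurable_hcat) (intro measurable_const, simp_all add: b)
   thus "(\<integral>Z|1,1. f (hcat C v @\<^sub>r hcat b Z)) = (\<integral>z. f (blk C v b z))"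
    by (simp add: nn_integral_lebm_singleton eq[OF C v b])
  qed
  finally show "(\<integral>B|1,c + 1. f (hcat C v @\<^sub>r B)) = (\<integral>b|1,c. \<integral>z. f (blk C v b z))" .
 qed
 finally show ?thesis .
qed

section \<open>Characteristic polynomials of bordered matrices\<close>

definition zsub :: "nat => 'a::comm_ring_1 => 'a mat => 'a mat" where
 "zsub n z A = z \<cdot> 1\<^sub>m n - A"

lemma zsub_carrier [simp]: "A : \<M> n n ==> zsub n z A : \<M> n n"
 unfolding zsub_def by (rule minus_carrier_mat)

lemma poly_char_poly:
 fixes A :: "complex mat"
 assumes A: "A : \<M> n n"
 shows "poly (char_poly A) z = det (zsub n z A)"
proof -
 have "- char_matrix A z = zsub n z A"
  by (rule eq_matI) (use A in \<open>auto simp: char_matrix_def zsub_def\<close>)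
 thus ?thesis using char_poly_matrix[OF A, of z] by simp
qed

lemma zsub_blk:
 fixes a :: "'a::comm_ring_1"
 assumes "D : \<M> n n" "c : \<M> n 1" "b : \<M> 1 n"
 shows "zsub (Suc n) z (blk D c b a) = blk (zsub n z D) (- c) (- b) (z - a)"
 by (rule eq_matI) (use assms in \<open>auto simp: zsub_def blk_def less_Suc_eq\<close>)

text \<open>The right factor \<open>?Q\<close> clears the last column. Taking determinants produces
  \<open>det D ^ n\<close> on both sides, which cancels in a domain; integral domains are allowed so
  that the entries may be polynomials.\<close>

lemma det_blk_nonsingular:
 fixes a :: "'a::idom"
 assumes D: "D : \<M> n n" and c: "c : \<M> n 1" and b: "b : \<M> 1 n"
  and dD: "det D ~= 0"
 shows "det (blk D c b a) = a * det D - (b * adj_mat D * c) $$ (0, 0)"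
proof -
 note aD = adj_mat[OF D]
 let ?t = "a * det D - (b * adj_mat D * c) $$ (0, 0)"
 let ?Q = "blk (adj_mat D) (- (adj_mat D * c)) (0\<^sub>m 1 n) (det D)"
 have ac: "- (adj_mat D * c) : \<M> n 1" using aD(1) c by auto
 have P: "blk D c b a : \<M> (Suc n) (Suc n)" using D by simp
 have Q: "?Q : \<M> (Suc n) (Suc n)" using aD(1) by simp
 have "D * - (adj_mat D * c) = - (det D \<cdot> c)"
 proof -
  have "D * - (adj_mat D * c) = - (D * (adj_mat D * c))"
   by (rule uminus_mult_right_mat) (use D c aD in auto)
  also have "D * (adj_mat D * c) = (det D \<cdot> 1\<^sub>m n) * c"
   using assoc_mult_mat[OF D aD(1) c] aD(2) by simp
  also have "... = det D \<cdot> c" using mult_smult_assoc_mat[OF one_carrier_mat c] c by simp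
  finally show ?thesis .
 qed
 hence e2: "D * - (adj_mat D * c) + det D \<cdot> c = 0\<^sub>m n 1" using c by auto
 have "b * - (adj_mat D * c) = - (b * (adj_mat D * c))"
  by (rule uminus_mult_right_mat) (use b c aD in auto)
 also have "b * (adj_mat D * c) = b * adj_mat D * c" using assoc_mult_mat[OF b aD(1) c] by simp
 finally have "(b * - (adj_mat D * c)) $$ (0, 0) = - ((b * adj_mat D * c) $$ (0, 0))"
  using b c aD(1) by simp
 hence e4: "(b * - (adj_mat D * c)) $$ (0, 0) + a * det D = ?t" by simp
 have "blk D c b a * ?Q = lblk n (det D \<cdot> 1\<^sub>m n) (b * adj_mat D) ?t"
 proof -
  have "blk D c b a * ?Q = blk (D * adj_mat D + c * 0\<^sub>m 1 n) (D * - (adj_mat D * c) + det D \<cdot> c)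
    (b * adj_mat D + a \<cdot> 0\<^sub>m 1 n) ((b * - (adj_mat D * c)) $$ (0, 0) + a * det D)"
   by (rule mult_blk[OF D c b aD(1) ac]) simp
  moreover have "D * adj_mat D + c * 0\<^sub>m 1 n = det D \<cdot> 1\<^sub>m n" using aD c by auto
  moreover have "b * adj_mat D + a \<cdot> 0\<^sub>m 1 n = b * adj_mat D" using aD(1) b by auto
  ultimately show ?thesis using e2 e4 by simp
 qed
 hence "det (blk D c b a) * det ?Q = det (lblk n (det D \<cdot> 1\<^sub>m n) (b * adj_mat D) ?t)"
  using det_mult[OF P Q] by simp
 also have "... = det D ^ n * ?t"
  by (subst det_blk_lower) (use b aD(1) in auto)
 also have "det ?Q = det (adj_mat D) * det D"
  by (rule det_blk_upper[OF aD(1) ac])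
 also have "det (adj_mat D) * det D = det D ^ n"
  using det_mult[OF aD(1) D] aD(3) by simp
 finally have "det D ^ n * (det (blk D c b a)) = det D ^ n * ?t" by (simp add: mult.commute)
 thus ?thesis using dD by simp
qed

lemma bilinear_form_index:
 assumes "K : \<M> n n" "c : \<M> n 1" "b : \<M> 1 n"
 shows "(b * K * c) $$ (0, 0) = (\<Sum>i<n. b $$ (0, i) * (\<Sum>j<n. K $$ (i, j) * c $$ (j, 0)))"
 unfolding assoc_mult_mat[OF assms(3,1,2)]
 using assms by (simp add: scalar_prod_def atLeast0LessThan)

lemma sum_one_column:
 fixes f :: "nat \<times> nat => complex"
 shows "(\<Sum>kl\<in>{..<n} \<times> {..<1}. f kl) = (\<Sum>k<n. f (k, 0))"
 by (rule sum.reindex_bij_witness[of _ "%k. (k, 0)" fst]) auto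

lemma sum_one_row:
 fixes f :: "nat \<times> nat => complex"
 shows "(\<Sum>kl\<in>{..<1} \<times> {..<n}. f kl) = (\<Sum>k<n. f (0, k))"
 by (rule sum.reindex_bij_witness[of _ "%k. (0, k)" snd]) auto

text \<open>The singular case follows by perturbing \<open>D\<close> to \<open>D + X\<close> over the polynomial ring.\<close>

lemma det_blk:
 fixes a :: complex
 assumes D: "D : \<M> n n" and c: "c : \<M> n 1" and b: "b : \<M> 1 n"
 shows "det (blk D c b a) = a * det D - (b * adj_mat D * c) $$ (0, 0)"
proof -
 define E where "E = char_poly_matrix (- D)"
 let ?c = "map_mat (%x. [:x:]) c" and ?b = "map_mat (%x. [:x:]) b"
 have E: "E : \<M> n n" using D by (simp add: E_def)
 have b': "?b : \<M> 1 n" and c': "?c : \<M> n 1" using b c by auto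
 have "det E = char_poly (- D)" by (simp add: char_poly_def E_def)
 hence dE: "det E ~= 0" using degree_monic_char_poly[of "- D" n] D by auto
 have ind: "poly (E $$ (i, j)) 0 = D $$ (i, j)" if "i < n" "j < n" for i j
  using that D by (auto simp: char_poly_matrix_def E_def)
 have dD: "poly (det E) 0 = det D"
  by (rule poly_det_cong[OF D E]) (simp add: ind)
 have adj: "poly (adj_mat E $$ (i, j)) 0 = adj_mat D $$ (i, j)" if ij: "i < n" "j < n" for i j
 proof -
  obtain m where m: "n = Suc m" using ij by (cases n) auto
  have "poly (det (mat_delete E j i)) 0 = det (mat_delete D j i)"
  proof (rule poly_det_cong)
   show "mat_delete D j i : \<M> m m" "mat_delete E j i : \<M> m m"
    using mat_delete_carrier[OF D, of j i] mat_delete_carrier[OF E, of j i] m by simp_all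
   fix k l assume "k < m" "l < m"
   thus "poly (mat_delete E j i $$ (k, l)) 0 = mat_delete D j i $$ (k, l)"
    using D E m ij ind by (auto simp: mat_delete_def)
  qed
  thus ?thesis using ij D E by (simp add: adj_mat_def Determinant.cofactor_def poly_power)
 qed
 have bE: "blk E ?c ?b [:a:] : \<M> (Suc n) (Suc n)" using E by simp
 have bD: "blk D c b a : \<M> (Suc n) (Suc n)" using D by simp
 have "poly (det (blk E ?c ?b [:a:])) 0 = det (blk D c b a)"
 proof (rule poly_det_cong[OF bD bE])
  fix i j assume "i < Suc n" "j < Suc n"
  thus "poly (blk E ?c ?b [:a:] $$ (i, j)) 0 = blk D c b a $$ (i, j)"
   using D E b c ind by (auto simp: blk_def)
 qed
 moreover have "poly (det (blk E ?c ?b [:a:])) 0 = a * det D - poly ((?b * adj_mat E * ?c) $$ (0, 0)) 0"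
  unfolding det_blk_nonsingular[OF E c' b' dE] by (simp add: dD)
 moreover have "poly ((?b * adj_mat E * ?c) $$ (0, 0)) 0 = (b * adj_mat D * c) $$ (0, 0)"
  unfolding bilinear_form_index[OF adj_mat(1)[OF E] c' b'] bilinear_form_index[OF adj_mat(1)[OF D] c b] poly_sum
  by (intro sum.cong refl) (use b c in \<open>simp add: poly_sum adj mult.commute\<close>)
 ultimately show ?thesis by simp
qed

text \<open>The corner enters the characteristic polynomial affinely: with \<open>q\<close> the
  polynomial for corner 0 and \<open>r\<close> that of \<open>D\<close>, the eigenvalue equation
  \<open>q(z) = a r(z)\<close> can be solved for \<open>a\<close>.\<close>

lemma char_poly_blk:
 fixes D :: "complex mat"
 assumes D: "D : \<M> n n" and c: "c : \<M> n 1" and b: "b : \<M> 1 n"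
 shows "char_poly (blk D c b a) = char_poly (blk D c b 0) - Polynomial.smult a (char_poly D)"
  and "poly (char_poly (blk D c b a)) z = (z - a) * poly (char_poly D) z - (b * adj_mat (zsub n z D) * c) $$ (0, 0)"
proof -
 have ev: "poly (char_poly (blk D c b a)) z = (z - a) * poly (char_poly D) z - (b * adj_mat (zsub n z D) * c) $$ (0, 0)" for a z
 proof -
  note aD = adj_mat(1)[OF zsub_carrier[OF D, of z]]
  have "poly (char_poly (blk D c b a)) z = det (blk (zsub n z D) (- c) (- b) (z - a))"
   using poly_char_poly[of "blk D c b a" "Suc n" z] D zsub_blk[OF D c b] by simp
  also have "... = (z - a) * det (zsub n z D) - ((- b) * adj_mat (zsub n z D) * (- c)) $$ (0, 0)"
   by (rule det_blk) (use D b c in auto)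
  also have "(- b) * adj_mat (zsub n z D) * (- c) = b * adj_mat (zsub n z D) * c"
   using b c aD by (simp add: uminus_mult_left_mat uminus_mult_right_mat)
  finally show ?thesis using poly_char_poly[OF D] by simp
 qed
 show "poly (char_poly (blk D c b a)) z = (z - a) * poly (char_poly D) z - (b * adj_mat (zsub n z D) * c) $$ (0, 0)"
  by (rule ev)
 have "poly (char_poly (blk D c b a)) = poly (char_poly (blk D c b 0) - Polynomial.smult a (char_poly D))"
  by (rule ext) (simp add: ev[of a] ev[of 0] algebra_simps)
 thus "char_poly (blk D c b a) = char_poly (blk D c b 0) - Polynomial.smult a (char_poly D)"
  by (simp add: poly_eq_poly_eq_iff)
qed

lemma char_poly_blk_lower:
 fixes C :: "complex mat"
 assumes C: "C : \<M> n n" and b: "b : \<M> 1 n"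
 shows "char_poly (lblk n C b z) = [:- z, 1:] * char_poly C"
proof -
 have "poly (char_poly (lblk n C b z)) = poly ([:- z, 1:] * char_poly C)"
 proof
  fix x
  note aC = adj_mat(1)[OF zsub_carrier[OF C, of x]]
  have "(b * adj_mat (zsub n x C) * 0\<^sub>m n 1) $$ (0, 0) = 0"
   using b aC by simp
  thus "poly (char_poly (lblk n C b z)) x = poly ([:- z, 1:] * char_poly C) x"
   using char_poly_blk(2)[OF C _ b, of "0\<^sub>m n 1" z x] by (simp add: algebra_simps)
 qed
 thus ?thesis by (simp add: poly_eq_poly_eq_iff)
qed

text \<open>The derivative of the characteristic polynomial is the sum of the characteristic
  polynomials of the principal minors. Their values at \<open>z\<close> are the diagonal entries of
  the adjugate of \<open>z - D\<close>, which cannot all vanish at a simple root.\<close>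

lemma adj_mat_zsub_neq_0:
 fixes D :: "complex mat"
 assumes D: "D : \<M> n n" and sf: "rsquarefree (char_poly D)" and z: "poly (char_poly D) z = 0"
 obtains i where "i < n" "adj_mat (zsub n z D) $$ (i, i) ~= 0"
proof -
 have "poly (pderiv (char_poly D)) z ~= 0" using sf z unfolding rsquarefree_roots by blast
 hence "(\<Sum>i<n. poly (char_poly (mat_delete D i i)) z) ~= 0"
  by (simp add: pderiv_char_poly[OF D] poly_sum)
 then obtain i where i: "i < n" "poly (char_poly (mat_delete D i i)) z ~= 0"
  by (meson lessThan_iff sum.not_neutral_contains_not_neutral)
 obtain m where m: "n = Suc m" using i by (cases n) auto
 have dm: "mat_delete D i i : \<M> m m" using D m by (auto simp: mat_delete_def)
 have "zsub m z (mat_delete D i i) = mat_delete (zsub n z D) i i"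
  by (rule eq_matI) (use D m i in \<open>auto simp: mat_delete_def zsub_def\<close>)
 hence "adj_mat (zsub n z D) $$ (i, i) = poly (char_poly (mat_delete D i i)) z"
  using i D poly_char_poly[OF dm, of z] by (simp add: adj_mat_def Determinant.cofactor_def zsub_def)
 thus ?thesis using that[OF i(1)] i(2) by simp
qed

text \<open>Fubini in the coordinate \<open>k\<close>: once the other entries are fixed, a single
  value of this one makes the form vanish.\<close>

lemma AE_linear_form_neq_0:
 fixes w :: "nat \<times> nat => complex"
 assumes k: "k : {..<r} \<times> {..<c}" "w k ~= 0"
 shows "AE A in lebm r c. (\<Sum>ij\<in>{..<r} \<times> {..<c}. w ij * A $$ ij) ~= 0"
proof -
 let ?I = "{..<r} \<times> {..<c}"
 let ?L = "%_::nat \<times> nat. \<L>"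
 have P: "{A : space (lebm r c). (\<Sum>ij\<in>?I. w ij * A $$ ij) = 0} : sets (lebm r c)"
 proof -
  have "(%A. \<Sum>ij\<in>?I. w ij * A $$ ij) : \<B> (lebm r c)"
   by (intro borel_measurable_sum borel_measurable_times borel_measurable_const) (auto intro: measurable_index_mat)
  thus ?thesis by measurable
 qed
 let ?h = "%x :: nat \<times> nat => complex. indicator {0} (\<Sum>ij\<in>?I. w ij * x ij) :: ennreal"
 have ins: "?I = insert k (?I - {k})" using k by auto
 have hm: "?h : \<B> (PiM ?I ?L)" by measurable
 have f: "indicator {A : space (lebm r c). (\<Sum>ij\<in>?I. w ij * A $$ ij) = 0} : \<B> (lebm r c)"
  using P by simp
 have "emeasure (lebm r c) {A : space (lebm r c). (\<Sum>ij\<in>?I. w ij * A $$ ij) = 0} =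
   (\<integral>A|r,c. indicator {A : space (lebm r c). (\<Sum>ij\<in>?I. w ij * A $$ ij) = 0} A)"
  using P by (simp del: space_lebm)
 also have "... = (\<integral>\<^sup>+x. indicator {A : space (lebm r c). (\<Sum>ij\<in>?I. w ij * A $$ ij) = 0} (mat r c x) \<partial>PiM ?I ?L)"
  by (rule nn_integral_lebm[OF f])
 also have "... = (\<integral>\<^sup>+x. ?h x \<partial>PiM ?I ?L)"
 proof (rule nn_integral_cong)
  fix x :: "nat \<times> nat => complex"
  have "(\<Sum>ij\<in>?I. w ij * mat r c x $$ ij) = (\<Sum>ij\<in>?I. w ij * x ij)" by (intro sum.cong) auto
  thus "indicator {A : space (lebm r c). (\<Sum>ij\<in>?I. w ij * A $$ ij) = 0} (mat r c x) = ?h x"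
   by (simp add: indicator_def)
 qed
 also have "... = (\<integral>\<^sup>+x. (\<integral>y. ?h (x(k := y))) \<partial>PiM (?I - {k}) ?L)"
  by (subst (1) ins, rule product_sigma_finite.product_nn_integral_insert[OF product_lborel])
    (use hm ins in auto)
 also have "... = (\<integral>\<^sup>+x. 0 \<partial>PiM (?I - {k}) ?L)"
 proof (rule nn_integral_cong)
  fix x :: "nat \<times> nat => complex"
  let ?s = "\<Sum>ij\<in>?I - {k}. w ij * x ij"
  have "(\<Sum>ij\<in>?I. w ij * (x(k := y)) ij) = w k * y + ?s" for y
   using sum.remove[of ?I k "%ij. w ij * (x(k := y)) ij"] k by auto
  hence "?h (x(k := y)) = indicator {- ?s / w k} y" for y
   using k by (auto simp: indicator_def field_simps eq_neg_iff_add_eq_0)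
  thus "(\<integral>y. ?h (x(k := y))) = 0" by simp
 qed
 finally have "emeasure (lebm r c) {A : space (lebm r c). (\<Sum>ij\<in>?I. w ij * A $$ ij) = 0} = 0" by simp
 hence "{A : space (lebm r c). (\<Sum>ij\<in>?I. w ij * A $$ ij) = 0} : null_sets (lebm r c)"
  using P by (rule null_setsI)
 thus ?thesis by (rule AE_I') blast
qed

text \<open>For almost every \<open>c\<close> the entry \<open>i\<close> of \<open>K * c\<close> is
  nonzero, and then a nonzero linear form in \<open>b\<close> remains.\<close>

lemma AE_bilinear_neq_0:
 fixes K :: "complex mat"
 assumes K: "K : \<M> n n" and nz: "i < n" "j < n" "K $$ (i, j) ~= 0"
 shows "AE c in lebm n 1. AE b in lebm 1 n. (b * K * c) $$ (0, 0) ~= 0"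
proof -
 have A1: "AE c in lebm n 1. (\<Sum>kl\<in>{..<n} \<times> {..<1}. K $$ (i, fst kl) * c $$ kl) ~= 0"
  by (rule AE_linear_form_neq_0[of "(j, 0)"]) (use nz in auto)
 have A2: "AE b in lebm 1 n. (b * K * c) $$ (0, 0) ~= 0"
  if c: "c : \<M> n 1" and s: "(\<Sum>kl\<in>{..<n} \<times> {..<1}. K $$ (i, fst kl) * c $$ kl) ~= 0" for c
 proof -
  have Kc: "K * c : \<M> n 1" using K c by auto
  have "(\<Sum>kl\<in>{..<n} \<times> {..<1}. K $$ (i, fst kl) * c $$ kl) = (K * c) $$ (i, 0)"
   unfolding sum_one_column using K c nz by (simp add: scalar_prod_def atLeast0LessThan)
  hence "(K * c) $$ (i, 0) ~= 0" using s by simp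
  hence "AE b in lebm 1 n. (\<Sum>kl\<in>{..<1} \<times> {..<n}. (K * c) $$ (snd kl, 0) * b $$ kl) ~= 0"
   by (intro AE_linear_form_neq_0[of "(0, i)"]) (use nz in auto)
  thus ?thesis
  proof (rule AE_mp[OF _ AE_I2], intro impI)
   fix b assume "b : space (lebm 1 n)" and s: "(\<Sum>kl\<in>{..<1} \<times> {..<n}. (K * c) $$ (snd kl, 0) * b $$ kl) ~= 0"
   hence b: "b : \<M> 1 n" by simp
   have "(b * K * c) $$ (0, 0) = (\<Sum>l<n. b $$ (0, l) * (K * c) $$ (l, 0))"
    unfolding bilinear_form_index[OF K c b]
    by (intro sum.cong refl) (use K c in \<open>simp add: scalar_prod_def atLeast0LessThan\<close>)
   also have "... = (\<Sum>kl\<in>{..<1} \<times> {..<n}. (K * c) $$ (snd kl, 0) * b $$ kl)"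
    unfolding sum_one_row by (simp add: mult.commute)
   finally show "(b * K * c) $$ (0, 0) ~= 0" using s by simp
  qed
 qed
 show ?thesis
  by (rule AE_mp[OF A1 AE_I2]) (use A2 in simp)
qed

text \<open>At a root \<open>z\<close> of the characteristic polynomial of \<open>D\<close> the
  bordered polynomial has the value \<open>- b adj(z - D) c\<close>, a nonzero bilinear form in
  \<open>b\<close> and \<open>c\<close>. As there are finitely many roots, the quantifiers may be
  exchanged.\<close>

lemma coprime_generic:
 fixes D :: "complex mat"
 assumes D: "D : \<M> n n" and sf: "rsquarefree (char_poly D)"
 shows "AE c in lebm n 1. AE b in lebm 1 n. \<forall>z. poly (char_poly (blk D c b 0)) z = 0 --> poly (char_poly D) z ~= 0"
proof -
 let ?Z = "{z. poly (char_poly D) z = 0}"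
 have fin: "finite ?Z"
  by (rule poly_roots_finite) (use degree_monic_char_poly[OF D] in auto)
 have cnt: "countable ?Z" using fin by (rule countable_finite)
 let ?P = "%z c b. (b * adj_mat (zsub n z D) * c) $$ (0, 0) ~= 0"
 have "\<forall>z\<in>?Z. AE c in lebm n 1. AE b in lebm 1 n. ?P z c b"
 proof
  fix z assume "z : ?Z"
  hence "poly (char_poly D) z = 0" by simp
  from adj_mat_zsub_neq_0[OF D sf this] obtain i where "i < n" "adj_mat (zsub n z D) $$ (i, i) ~= 0" by blast
  thus "AE c in lebm n 1. AE b in lebm 1 n. ?P z c b"
   by (intro AE_bilinear_neq_0[OF adj_mat(1)[OF zsub_carrier[OF D]]])
 qed
 hence "AE c in lebm n 1. \<forall>z\<in>?Z. AE b in lebm 1 n. ?P z c b"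
  by (simp only: AE_ball_countable[OF cnt])
 thus ?thesis
 proof (rule AE_mp[OF _ AE_I2], intro impI)
  fix c assume c: "c : space (lebm n 1)" and "\<forall>z\<in>?Z. AE b in lebm 1 n. ?P z c b"
  hence ae: "AE b in lebm 1 n. \<forall>z\<in>?Z. ?P z c b"
   by (simp only: AE_ball_countable[OF cnt])
  show "AE b in lebm 1 n. \<forall>z. poly (char_poly (blk D c b 0)) z = 0 --> poly (char_poly D) z ~= 0"
   using ae
  proof (rule AE_mp[OF _ AE_I2], intro impI allI notI)
   fix b z assume "b : space (lebm 1 n)" "\<forall>z\<in>?Z. (b * adj_mat (zsub n z D) * c) $$ (0, 0) ~= 0"
    "poly (char_poly (blk D c b 0)) z = 0" "poly (char_poly D) z = 0"
   thus False using char_poly_blk(2)[OF D, of c b 0 z] c by auto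
  qed
 qed
qed

text \<open>A nonconstant polynomial is large near infinity, so approximate common roots stay
  bounded and have a limit point in \<open>K\<close>. Existence of a common root in an uncountable
  closed set is thereby tested on a dense subset \<open>T\<close>, which may be countable.\<close>

lemma common_root_iff:
 fixes p s :: "complex poly"
 assumes K: "closed K" and T: "T \<subseteq> K" "K \<subseteq> closure T" and p: "p ~= 0"
 shows "(\<exists>z\<in>K. poly p z = 0 & poly s z = 0) \<longleftrightarrow>
  (\<forall>m::nat. \<exists>z\<in>T. cmod (poly p z) + cmod (poly s z) < 1 / Suc m)"
proof
 let ?g = "%z. cmod (poly p z) + cmod (poly s z)"
 have cont: "continuous_on UNIV ?g" by (intro continuous_intros)
 {
  assume "\<exists>z\<in>K. poly p z = 0 & poly s z = 0"
  then obtain z where z: "z : K" "?g z = 0" by auto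
  show "\<forall>m::nat. \<exists>z\<in>T. ?g z < 1 / Suc m"
  proof
   fix m :: nat
   have "z : closure T" using z T by blast
   then obtain w where w: "!!i. w i : T" "w \<longlonglongrightarrow> z" unfolding closure_sequential by blast
   have "(%i. ?g (w i)) \<longlonglongrightarrow> ?g z"
    using w(2) by (rule continuous_on_tendsto_compose[OF cont]) auto
   hence "eventually (%i. ?g (w i) < 1 / Suc m) sequentially"
    by (rule order_tendstoD) (use z in simp)
   then obtain i where "?g (w i) < 1 / Suc m" unfolding eventually_sequentially by blast
   thus "\<exists>z\<in>T. ?g z < 1 / Suc m" using w(1) by blast
  qed
 }
 assume "\<forall>m::nat. \<exists>z\<in>T. ?g z < 1 / Suc m"
 hence "\<forall>m::nat. \<exists>w. w : T & ?g w < 1 / Suc m" by blast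
 from choice[OF this] obtain w where w: "!!m::nat. w m : T" "!!m. ?g (w m) < 1 / Suc m" by blast
 have g0: "(%m. ?g (w m)) \<longlonglongrightarrow> 0"
 proof (rule tendsto_sandwich[OF _ _ tendsto_const])
  show "(%m. 1 / real (Suc m)) \<longlonglongrightarrow> 0" using LIMSEQ_Suc[OF lim_1_over_n] by (simp add: inverse_eq_divide)
 qed (use less_imp_le[OF w(2)] in auto)
 \<comment> \<open>A nonzero constant has no approximate roots. Excluding it gives the form
   \<open>pCons k q\<close> with \<open>q ~= 0\<close>, which growth at infinity requires.\<close>
 have "degree p ~= 0"
 proof
  assume "degree p = 0"
  then obtain k where k: "p = [:k:]" "k ~= 0" using p by (metis degree_eq_zeroE pCons_0_0)
  have "(%m. cmod k) \<longlonglongrightarrow> 0"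
   by (rule tendsto_sandwich[OF _ _ tendsto_const g0]) (use k in auto)
  thus False using k by (simp add: LIMSEQ_const_iff)
 qed
 then obtain k q where pq: "p = pCons k q" "q ~= 0" by (cases p) (auto split: if_splits)
 obtain r where r: "!!z. r <= cmod z ==> 1 <= cmod (poly (pCons k q) z)" using poly_infinity[OF pq(2), of 1 k] by blast
 have "w m : cball 0 (max r 0)" for m
 proof (rule ccontr)
  assume "\<not> ?thesis"
  hence "r <= cmod (w m)" by auto
  from r[OF this] w(2)[of m] show False unfolding pq(1)
   by (smt (verit) norm_ge_zero divide_le_eq_1 of_nat_0_le_iff of_nat_Suc)
 qed
 hence "w m : K \<inter> cball 0 (max r 0)" for m using w(1) T by blast
 moreover have "compact (K \<inter> cball 0 (max r 0))" using K by (intro closed_Int_compact) auto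
 ultimately obtain z f where zf: "z : K \<inter> cball 0 (max r 0)" "strict_mono f" "(w \<circ> f) \<longlonglongrightarrow> z"
  using seq_compactE[OF compact_imp_seq_compact] by blast
 have "(%m. ?g ((w \<circ> f) m)) \<longlonglongrightarrow> ?g z"
  using zf(3) by (rule continuous_on_tendsto_compose[OF cont]) auto
 moreover have "(%m. ?g ((w \<circ> f) m)) \<longlonglongrightarrow> 0"
  using LIMSEQ_subseq_LIMSEQ[OF g0 zf(2)] by (simp add: o_def)
 ultimately have "?g z = 0" by (rule LIMSEQ_unique)
 hence "poly p z = 0" "poly s z = 0"
  by (smt (verit) norm_ge_zero norm_eq_zero)+
 thus "\<exists>z\<in>K. poly p z = 0 & poly s z = 0" using zf by blast
qed

text \<open>Uses a countable dense subset of \<open>K\<close> in \<open>common_root_iff\<close>.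
  With \<open>s = p\<close> the lemma detects roots in \<open>K\<close>, with the derivative of
  \<open>p\<close> for \<open>s\<close> it detects multiple roots.\<close>

lemma measurable_common_root:
 fixes p s :: "'a => complex poly"
 assumes K: "closed K" and p: "!!x. x : space N ==> p x ~= 0"
  and m: "!!z. (%x. poly (p x) z) : \<B> N" "!!z. (%x. poly (s x) z) : \<B> N"
 shows "{x : space N. \<exists>z\<in>K. poly (p x) z = 0 & poly (s x) z = 0} : sets N"
proof -
 obtain T where T: "countable T" "T \<subseteq> K" "K \<subseteq> closure T" using separable[of K] by metis
 note [measurable] = m
 have "{x : space N. \<exists>z\<in>K. poly (p x) z = 0 & poly (s x) z = 0} =
   (\<Inter>m::nat. \<Union>z\<in>T. {x : space N. cmod (poly (p x) z) + cmod (poly (s x) z) < 1 / Suc m})"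
 proof (rule Set.set_eqI)
  fix x
  show "x : {x : space N. \<exists>z\<in>K. poly (p x) z = 0 & poly (s x) z = 0} \<longleftrightarrow>
   x : (\<Inter>m::nat. \<Union>z\<in>T. {x : space N. cmod (poly (p x) z) + cmod (poly (s x) z) < 1 / Suc m})"
  proof (cases "x : space N")
   case True
   thus ?thesis using common_root_iff[OF K T(2,3) p[OF True], of "s x"] by simp
  qed simp
 qed
 also have "... : sets N"
 proof (intro sets.countable_INT' sets.countable_UN'' T(1) image_subsetI)
  fix m :: nat and z :: complex
  show "{x : space N. cmod (poly (p x) z) + cmod (poly (s x) z) < 1 / Suc m} : sets N" by measurable
 qed auto
 finally show ?thesis .
qed

lemma measurable_zsub [lebm_meas]:
 assumes "z : \<B> N" "A : measurable N (lebm n n)"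
 shows "(%x. zsub n (z x) (A x)) : measurable N (lebm n n)"
 unfolding zsub_def by (intro lebm_meas assms one_carrier_mat)

lemma measurable_poly_char_poly:
 assumes z: "z : \<B> N" and A: "A : measurable N (lebm n n)"
 shows "(%x. poly (char_poly (A x)) (z x)) : \<B> N"
 using measurable_det[OF measurable_zsub[OF assms]]
 by (rule measurable_cong[THEN iffD1, rotated]) (simp add: poly_char_poly[OF measurable_carrier_mat[OF A]])

lemma sets_not_rsquarefree:
 "{A : space (lebm n n). \<not> rsquarefree (char_poly A)} : sets (lebm n n)"
proof -
 have "(%A. poly (pderiv (char_poly A)) z) : \<B> (lebm n n)" for z
 proof -
  have "(%A. \<Sum>i<n. poly (char_poly (mat_delete A i i)) z) : \<B> (lebm n n)"
  proof (cases n)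
   case (Suc m)
   thus ?thesis
    by (intro borel_measurable_sum measurable_poly_char_poly[where n = m] measurable_const measurable_mat_delete) auto
  qed simp
  thus ?thesis
   by (rule measurable_cong[THEN iffD1, rotated]) (simp add: pderiv_char_poly poly_sum)
 qed
 moreover have "char_poly A ~= 0" if "A : space (lebm n n)" for A
  using degree_monic_char_poly[of A n] that by auto
 ultimately have "{A : space (lebm n n). \<exists>z\<in>UNIV. poly (char_poly A) z = 0 & poly (pderiv (char_poly A)) z = 0} : sets (lebm n n)"
  by (intro measurable_common_root measurable_poly_char_poly[where n = n] measurable_const lebm_ident) auto
 thus ?thesis by (simp add: rsquarefree_roots)
qed

text \<open>Induction on the size: for a squarefree block \<open>D\<close> and generic
  \<open>b\<close>, \<open>c\<close>, only finitely many corner entries produce a multiple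
  eigenvalue.\<close>

lemma AE_rsquarefree_char_poly: "AE A in lebm n n. rsquarefree (char_poly A)"
proof (induction n)
 case 0
 have "rsquarefree (char_poly A)" if "A : \<M> 0 0" for A :: "complex mat"
 proof -
  have "char_poly A = 1" using degree_monic_char_poly[OF that] monic_degree_0[of "char_poly A"] by simp
  thus ?thesis by (simp add: rsquarefree_roots)
 qed
 thus ?case by (intro AE_I2) simp
next
 case (Suc n)
 let ?B = "{A : space (lebm (Suc n) (Suc n)). \<not> rsquarefree (char_poly A)}"
 have mB: "indicator ?B : \<B> (lebm (Suc n) (Suc n))"
  using sets_not_rsquarefree by (rule borel_measurable_indicator)
 have "emeasure (lebm (Suc n) (Suc n)) ?B = (\<integral>A|Suc n,Suc n. indicator ?B A)"
  by (rule nn_integral_indicator[OF sets_not_rsquarefree, symmetric])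
 also have "... = (\<integral>D|n,n. \<integral>c|n,1. \<integral>b|1,n. \<integral>z. indicator ?B (blk D c b z))"
  by (rule nn_integral_lebm_blk[OF mB])
 also have "... = (\<integral>D|n,n. 0)"
 proof (rule nn_integral_cong_AE, rule AE_mp[OF Suc.IH AE_I2], intro impI)
  fix D assume "D : space (lebm n n)" and sf: "rsquarefree (char_poly D)"
  hence D: "D : \<M> n n" by simp
  have "(\<integral>c|n,1. \<integral>b|1,n. \<integral>z. indicator ?B (blk D c b z)) = (\<integral>c|n,1. 0)"
  proof (rule nn_integral_cong_AE, rule AE_mp[OF coprime_generic[OF D sf] AE_I2], intro impI)
   fix c assume "c : space (lebm n 1)"
    and ae: "AE b in lebm 1 n. \<forall>z. poly (char_poly (blk D c b 0)) z = 0 --> poly (char_poly D) z ~= 0"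
   hence c: "c : \<M> n 1" by simp
   have "(\<integral>b|1,n. \<integral>z. indicator ?B (blk D c b z)) = (\<integral>b|1,n. 0)"
   proof (rule nn_integral_cong_AE, rule AE_mp[OF ae AE_I2], intro impI)
    fix b assume "b : space (lebm 1 n)"
     and cop: "\<forall>z. poly (char_poly (blk D c b 0)) z = 0 --> poly (char_poly D) z ~= 0"
    hence b: "b : \<M> 1 n" by simp
    let ?F = "{a. \<not> rsquarefree (char_poly (blk D c b 0) - Polynomial.smult a (char_poly D))}"
    have "finite ?F"
    proof (rule finite_not_rsquarefree_pencil)
     show "degree (char_poly (blk D c b 0)) = Suc n"
      using degree_monic_char_poly[OF blk_carrier[OF D, of c b 0]] by blast
     show "char_poly D ~= 0" using degree_monic_char_poly[OF D] by auto
    qed (use cop in blast)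
    hence "AE z in lborel. z \<notin> ?F" by (intro AE_not_in) (simp add: finite_imp_null_set_lborel)
    hence "(\<integral>z. indicator ?B (blk D c b z)) = (\<integral>\<^sup>+z. 0 \<partial>\<L>)"
     by (intro nn_integral_cong_AE) (erule AE_mp, auto intro!: AE_I2 simp: char_poly_blk(1)[OF D c b, symmetric])
    thus "(\<integral>z. indicator ?B (blk D c b z)) = 0" by simp
   qed
   thus "(\<integral>b|1,n. \<integral>z. indicator ?B (blk D c b z)) = 0" by simp
  qed
  thus "(\<integral>c|n,1. \<integral>b|1,n. \<integral>z. indicator ?B (blk D c b z)) = 0" by simp
 qed
 finally have "emeasure (lebm (Suc n) (Suc n)) ?B = 0" by simp
 thus ?case by (intro AE_I[of _ _ ?B] sets_not_rsquarefree) (simp_all add: subset_iff)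
qed

section \<open>Schur and QL decompositions\<close>

definition ctr :: "complex mat => complex mat" where
 "ctr A = map_mat cnj (transpose_mat A)"

lemma ctr_carrier [simp]: "A : \<M> r c ==> ctr A : \<M> c r"
 by (simp add: ctr_def)

lemma index_ctr: "A : \<M> r c ==> i < c ==> j < r ==> ctr A $$ (i, j) = cnj (A $$ (j, i))"
 by (auto simp: ctr_def)

lemma ctr_ctr [simp]: "ctr (ctr A) = A"
 by (rule eq_matI) (auto simp: ctr_def)

lemma ctr_mult: "A : \<M> r m ==> B : \<M> m c ==> ctr (A * B) = ctr B * ctr A"
 by (rule eq_matI) (auto simp: ctr_def scalar_prod_def mult.commute)

lemma ctr_blk:
 "A : \<M> r c ==> v : \<M> r 1 ==> b : \<M> 1 c ==>
  ctr (blk A v b z) = blk (ctr A) (ctr b) (ctr v) (cnj z)"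
 by (rule eq_matI) (auto simp: ctr_def blk_def)

lemma det_ctr: "A : \<M> n n ==> det (ctr A) = cnj (det A)"
proof -
 assume A: "A : \<M> n n"
 interpret h: comm_ring_hom cnj by unfold_locales auto
 show ?thesis unfolding ctr_def using A by (simp add: det_transpose[OF A])
qed

definition uni :: "nat => complex mat => bool" where
 "uni n U \<longleftrightarrow> U : \<M> n n & ctr U * U = 1\<^sub>m n"

lemma uniD: "uni n U ==> U : \<M> n n" "uni n U ==> ctr U * U = 1\<^sub>m n"
 by (auto simp: uni_def)

lemma uni_right: "uni n U ==> U * ctr U = 1\<^sub>m n"
 using mat_mult_left_right_inverse[of "ctr U" n U] by (auto simp: uni_def)

lemma uni_ctr: "uni n U ==> uni n (ctr U)"
 using uni_right[of n U] by (simp add: uni_def)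

lemma uni_det: "uni n U ==> cmod (det U) = 1"
proof -
 assume U: "uni n U"
 have "det (ctr U * U) = cnj (det U) * det U"
  using det_mult[of "ctr U" n U] uniD[OF U] det_ctr[of U n] by simp
 hence "cnj (det U) * det U = 1" using uniD[OF U] by simp
 hence "cmod (cnj (det U) * det U) = 1" by simp
 hence "(cmod (det U))\<^sup>2 = 1" by (simp add: norm_mult power2_eq_square)
 thus ?thesis by (simp add: power2_eq_1_iff) (use norm_ge_zero[of "det U"] in linarith)
qed

lemma uni_det_neq_0: "uni n U ==> det U ~= 0"
 using uni_det by fastforce

lemma uni_blk: "uni n U ==> uni (Suc n) (lblk n U (0\<^sub>m 1 n) 1)"
proof -
 assume U: "uni n U"
 note C = uniD(1)[OF U]
 have z: "ctr (0\<^sub>m 1 n) = 0\<^sub>m n 1" "ctr (0\<^sub>m n 1) = 0\<^sub>m 1 n" by (auto simp: ctr_def intro!: eq_matI)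
 have "ctr (lblk n U (0\<^sub>m 1 n) 1) * lblk n U (0\<^sub>m 1 n) 1 = lblk n (1\<^sub>m n) (0\<^sub>m 1 n) 1"
  using C uniD(2)[OF U] right_mult_zero_mat[OF ctr_carrier[OF C], of 1] by (subst ctr_blk) (auto simp: z mult_blk[of _ n n _ _ _ n])
 also have "... = 1\<^sub>m (Suc n)" by (rule eq_matI) (auto simp: blk_def)
 finally show ?thesis using C by (simp add: uni_def)
qed

text \<open>The squared Frobenius norm, so that \<open>gau\<close> is the unnormalised density of a
  matrix with independent standard complex Gaussian entries.\<close>

definition fro :: "complex mat => real" where
 "fro A = (\<Sum>i<dim_row A. \<Sum>j<dim_col A. (cmod (A $$ (i, j)))\<^sup>2)"

abbreviation "gau A \<equiv> ennreal (exp (- fro A))"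

lemma fro_nonneg: "0 <= fro A"
 unfolding fro_def by (intro sum_nonneg) auto

lemma fro_carrier: "A : \<M> r c ==> fro A = (\<Sum>i<r. \<Sum>j<c. (cmod (A $$ (i, j)))\<^sup>2)"
 by (auto simp: fro_def)

text \<open>The trace of \<open>ctr A * A\<close>, in which a unitary left factor of
  \<open>A\<close> cancels.\<close>

lemma fro_eq_gram: "A : \<M> r c ==> of_real (fro A) = (\<Sum>j<c. (ctr A * A) $$ (j, j))"
proof -
 assume A: "A : \<M> r c"
 have "(ctr A * A) $$ (j, j) = (\<Sum>i<r. of_real ((cmod (A $$ (i, j)))\<^sup>2))" if "j < c" for j
  using A that by (simp add: ctr_def scalar_prod_def atLeast0LessThan complex_norm_square[symmetric] mult.commute[of "cnj _"])
 hence "(\<Sum>j<c. (ctr A * A) $$ (j, j)) = (\<Sum>j<c. \<Sum>i<r. of_real ((cmod (A $$ (i, j)))\<^sup>2))" by simp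
 also have "... = (\<Sum>i<r. \<Sum>j<c. of_real ((cmod (A $$ (i, j)))\<^sup>2))" by (rule sum.swap)
 finally show ?thesis by (simp add: fro_carrier[OF A])
qed

lemma fro_ctr: "A : \<M> r c ==> fro (ctr A) = fro A"
 by (subst fro_carrier[of _ c r], simp, subst fro_carrier[of A r c], simp, subst sum.swap)
   (auto simp: ctr_def)

lemma fro_unitary_left: "uni r U ==> A : \<M> r c ==> fro (U * A) = fro A"
proof -
 assume U: "uni r U" and A: "A : \<M> r c"
 note C = uniD(1)[OF U]
 have "ctr (U * A) * (U * A) = ctr A * (ctr U * (U * A))"
  using assoc_mult_mat[of "ctr A" c r "ctr U" r "U * A" c] A C by (simp add: ctr_mult[OF C A])
 also have "ctr U * (U * A) = A"
  using assoc_mult_mat[of "ctr U" r r U r A c] A C uniD(2)[OF U] by simp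
 finally have "complex_of_real (fro (U * A)) = of_real (fro A)"
  using fro_eq_gram[of "U * A" r c] fro_eq_gram[OF A] A C by simp
 thus ?thesis by (simp only: of_real_eq_iff)
qed

lemma fro_unitary_right: "uni c U ==> A : \<M> r c ==> fro (A * U) = fro A"
 using fro_unitary_left[OF uni_ctr, of c U "ctr A" r] fro_ctr[of "A * U" r c] fro_ctr[of A r c]
 by (auto simp: ctr_mult dest!: uniD(1))

lemma fro_blk:
 assumes "C : \<M> r c" "v : \<M> r 1" "b : \<M> 1 c"
 shows "fro (blk C v b z) = fro C + fro v + fro b + (cmod z)\<^sup>2"
proof -
 have C: "blk C v b z : \<M> (Suc r) (Suc c)" using assms by simp
 have "fro (blk C v b z) = (\<Sum>i<r. (\<Sum>j<c. (cmod (C $$ (i, j)))\<^sup>2) + (cmod (v $$ (i, 0)))\<^sup>2) +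
   ((\<Sum>j<c. (cmod (b $$ (0, j)))\<^sup>2) + (cmod z)\<^sup>2)"
  unfolding fro_carrier[OF C] by (simp add: index_blk[OF assms(1)])
 moreover have "fro v = (\<Sum>i<r. (cmod (v $$ (i, 0)))\<^sup>2)"
  unfolding fro_carrier[OF assms(2)] by (simp add: One_nat_def)
 moreover have "fro b = (\<Sum>j<c. (cmod (b $$ (0, j)))\<^sup>2)"
  unfolding fro_carrier[OF assms(3)] by (simp add: One_nat_def)
 ultimately show ?thesis by (simp add: fro_carrier[OF assms(1)] sum.distrib)
qed

lemma measurable_fro:
 assumes A: "A : measurable N (lebm r c)"
 shows "(%x. fro (A x)) : \<B> N"
proof -
 have "(%x. \<Sum>i<r. \<Sum>j<c. (cmod (A x $$ (i, j)))\<^sup>2) : \<B> N"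
  by (intro borel_measurable_sum borel_measurable_power measurable_compose[OF measurable_index_mat'[OF A] borel_measurable_norm]) auto
 thus ?thesis
  by (rule measurable_cong[THEN iffD1, rotated]) (simp add: fro_carrier[OF measurable_carrier_mat[OF A]])
qed

text \<open>It maps the last basis vector to \<open>(v, 1)\<close>. Hence \<open>(v, 1)\<close> is
  an eigenvector of the conjugate of \<open>lblk n C b z\<close> by \<open>shr n v\<close>, and
  \<open>v\<close> is the affine coordinate of the eigenline.\<close>

definition shr :: "nat => complex mat => complex mat" where
 "shr n v = blk (1\<^sub>m n) v (0\<^sub>m 1 n) 1"

lemma shr_carrier [simp]: "shr n v : \<M> (Suc n) (Suc n)"
 by (simp add: shr_def)

lemma blk_one: "lblk n (1\<^sub>m n) (0\<^sub>m 1 n) 1 = 1\<^sub>m (Suc n)"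
 by (rule eq_matI) (auto simp: blk_def)

lemma shr_inverse: "v : \<M> n 1 ==> shr n v * shr n (- v) = 1\<^sub>m (Suc n)"
 "v : \<M> n 1 ==> shr n (- v) * shr n v = 1\<^sub>m (Suc n)"
 unfolding shr_def by (subst mult_blk[of _ n n _ _ _ n]; auto simp: blk_def intro!: eq_matI)+

lemma det_shr: "v : \<M> n 1 ==> det (shr n v) = 1"
 unfolding shr_def by (subst det_blk_upper) auto

text \<open>\<open>U\<close> rotates \<open>(v, 1) / rh\<close> to the last basis vector inside the plane that they span.\<close>

lemma shr_QL:
 assumes v: "v : \<M> n 1"
 obtains U Ga sg rh where "uni (Suc n) U" "Ga : \<M> n n" "sg : \<M> 1 n" "0 < rh"
  "rh\<^sup>2 = 1 + fro v" "shr n v = U * lblk n Ga sg (complex_of_real rh)"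
  "cmod (det Ga) * rh = 1"
proof -
 define s where "s = fro v"
 define rh where "rh = sqrt (1 + s)"
 have s0: "0 <= s" unfolding s_def by (rule fro_nonneg)
 have rh2: "rh\<^sup>2 = 1 + s" unfolding rh_def using s0 by simp
 have rh0: "0 < rh" unfolding rh_def using s0 by simp
 \<comment> \<open>Chosen such that \<open>X = 1 - \<kappa> v v*\<close> multiplies \<open>v\<close>
   by \<open>1 / rh\<close> and fixes the orthogonal complement of \<open>v\<close>.\<close>
 define \<kappa> where "\<kappa> = 1 / (rh * (rh + 1))"
 have s_eq: "s = rh * rh - 1" using rh2 by (simp add: power2_eq_square)
 have k1: "1 - \<kappa> * s = 1 / rh"
 proof -
  have "s = (rh - 1) * (rh + 1)" unfolding s_eq by (simp add: algebra_simps)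
  hence "\<kappa> * s = (rh - 1) / rh" unfolding \<kappa>_def using rh0 by simp
  thus ?thesis using rh0 by (simp add: field_simps)
 qed
 have k2: "- 2 * \<kappa> + \<kappa> * \<kappa> * s + 1 / (rh * rh) = 0"
 proof -
  have "\<kappa> * s = (rh - 1) / rh" using k1 rh0 by (simp add: field_simps)
  hence e1: "\<kappa> * \<kappa> * s = \<kappa> * ((rh - 1) / rh)" by (simp add: mult.assoc)
  have e2: "1 / (rh * rh) = \<kappa> * (rh + 1) / rh" unfolding \<kappa>_def using rh0 by simp
  show ?thesis unfolding e1 e2 using rh0 by (simp add: field_simps)
 qed
 let ?c = "complex_of_real"
 define w where "w = ctr v"
 have w: "w : \<M> 1 n" using v by (simp add: w_def)
 define W where "W = v * w"
 have W: "W : \<M> n n" using v w by (simp add: W_def)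
 have wv: "(w * v) $$ (0, 0) = ?c s"
  using fro_eq_gram[OF v] by (simp add: s_def w_def One_nat_def)
 have wv': "w * v = ?c s \<cdot> 1\<^sub>m 1"
  by (rule eq_matI) (use wv w v in \<open>auto simp: less_one\<close>)
 have Wv: "W * v = ?c s \<cdot> v"
  unfolding W_def assoc_mult_mat[OF v w v] wv' by (simp only: mult_smult_distrib[OF v one_carrier_mat] right_mult_one_mat[OF v])
 have wW: "w * W = ?c s \<cdot> w"
  unfolding W_def assoc_mult_mat[OF w v w, symmetric] wv' by (simp only: mult_smult_assoc_mat[OF one_carrier_mat w] left_mult_one_mat[OF w])
 have WW: "W * W = ?c s \<cdot> W"
  unfolding W_def using assoc_mult_mat[OF v w W[unfolded W_def]] wW[unfolded W_def] by (simp add: mult_smult_distrib[OF v w])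
 define X where "X = 1\<^sub>m n - ?c \<kappa> \<cdot> W"
 have X: "X : \<M> n n" using W by (simp add: X_def minus_carrier_mat)
 have kW: "?c \<kappa> \<cdot> W : \<M> n n" using W by simp
 have Xv: "X * v = ?c (1 / rh) \<cdot> v"
 proof -
  have "X * v = v - ?c \<kappa> \<cdot> (?c s \<cdot> v)"
   unfolding X_def minus_mult_distrib_mat[OF one_carrier_mat kW v] mult_smult_assoc_mat[OF W v] Wv using v by simp
  also have "... = ?c (1 - \<kappa> * s) \<cdot> v"
   by (rule eq_matI) (use v in \<open>auto simp: algebra_simps\<close>)
  finally show ?thesis by (simp add: k1)
 qed
 have wX: "w * X = ?c (1 / rh) \<cdot> w"
 proof -
  have "w * X = w - ?c \<kappa> \<cdot> (?c s \<cdot> w)"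
   unfolding X_def mult_minus_distrib_mat[OF w one_carrier_mat kW] mult_smult_distrib[OF w W] wW using w by simp
  also have "... = ?c (1 - \<kappa> * s) \<cdot> w"
   by (rule eq_matI) (use w in \<open>auto simp: algebra_simps\<close>)
  finally show ?thesis by (simp add: k1)
 qed
 have XX: "X * X + ?c (1 / (rh * rh)) \<cdot> W = 1\<^sub>m n"
 proof -
  have "X * X = X - ?c \<kappa> \<cdot> (X * W)"
   by (subst (2) X_def) (simp add: mult_minus_distrib_mat[OF X one_carrier_mat kW] mult_smult_distrib[OF X W] right_mult_one_mat[OF X])
  also have "X * W = ?c (1 / rh) \<cdot> W"
   unfolding W_def assoc_mult_mat[OF X v w, symmetric] Xv by (rule mult_smult_assoc_mat[OF v w])
  finally have XXe: "X * X = X - ?c \<kappa> \<cdot> (?c (1 / rh) \<cdot> W)" .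
  have co: "- \<kappa> - \<kappa> * (1 / rh) + 1 / (rh * rh) = 0"
   unfolding k1[symmetric] using k2 by (simp add: algebra_simps)
  have co': "- ?c \<kappa> - ?c \<kappa> * ?c (1 / rh) + ?c (1 / (rh * rh)) = 0"
   using arg_cong[OF co, of ?c] by (simp only: of_real_add of_real_diff of_real_minus of_real_mult of_real_0)
  show ?thesis
  proof (rule eq_matI)
   fix i j assume "i < dim_row (1\<^sub>m n :: complex mat)" "j < dim_col (1\<^sub>m n :: complex mat)"
   hence ij: "i < n" "j < n" by auto
   have "(X * X + ?c (1 / (rh * rh)) \<cdot> W) $$ (i, j) =
     1\<^sub>m n $$ (i, j) + (- ?c \<kappa> - ?c \<kappa> * ?c (1 / rh) + ?c (1 / (rh * rh))) * W $$ (i, j)"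
    unfolding XXe unfolding X_def using ij W by (simp add: algebra_simps)
   thus "(X * X + ?c (1 / (rh * rh)) \<cdot> W) $$ (i, j) = 1\<^sub>m n $$ (i, j)" by (simp only: co') simp
  qed (use X W in auto)
 qed
 define V where "V = ?c (1 / rh) \<cdot> v"
 define V' where "V' = ?c (1 / rh) \<cdot> w"
 have V: "V : \<M> n 1" and V': "V' : \<M> 1 n" using v w by (auto simp: V_def V'_def)
 have VV': "V * V' = ?c (1 / (rh * rh)) \<cdot> W"
  unfolding V_def V'_def W_def mult_smult_assoc_mat[OF v smult_carrier_mat[OF w]] mult_smult_distrib[OF v w]
  by (rule eq_matI) (use v w in auto)
 have V'V: "(V' * V) $$ (0, 0) = ?c (s / (rh * rh))"
  unfolding V_def V'_def mult_smult_assoc_mat[OF w smult_carrier_mat[OF v]] mult_smult_distrib[OF w v]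
  using w v wv by simp
 have mV: "- V : \<M> n 1" "- V' : \<M> 1 n" using V V' by auto
 have XV: "X * V = ?c (1 / rh) \<cdot> V"
  unfolding V_def mult_smult_distrib[OF X v] Xv ..
 have V'X: "V' * X = ?c (1 / rh) \<cdot> V'"
  unfolding V'_def mult_smult_assoc_mat[OF w X] wX ..
 define U where "U = blk X V (- V') (?c (1 / rh))"
 define R where "R = lblk n X V' (?c rh)"
 have U: "U : \<M> (Suc n) (Suc n)" and R: "R : \<M> (Suc n) (Suc n)"
  using X by (auto simp: U_def R_def)
 have ctrW: "ctr W = W"
  unfolding W_def ctr_mult[OF v w] by (simp add: w_def)
 have ctrX: "ctr X = X"
 proof (rule eq_matI)
  fix i j assume "i < dim_row X" "j < dim_col X"
  hence ij: "i < n" "j < n" using X by auto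
  have "cnj (W $$ (j, i)) = W $$ (i, j)" using index_ctr[OF W ij] by (simp add: ctrW)
  thus "ctr X $$ (i, j) = X $$ (i, j)"
   unfolding index_ctr[OF X ij] unfolding X_def using ij W by auto
 qed (use X in \<open>auto simp: ctr_def\<close>)
 have ctrV: "ctr V = V'" "ctr V' = V"
  unfolding V_def V'_def w_def by (rule eq_matI; use v in \<open>auto simp: ctr_def\<close>)+
 have ctrU: "ctr U = blk X (- V) V' (?c (1 / rh))"
 proof -
  have "ctr (- V') = - V" using ctrV(2) V V' by (intro eq_matI) (auto simp: ctr_def)
  thus ?thesis unfolding U_def by (subst ctr_blk[OF X V mV(2)]) (simp add: ctrX ctrV)
 qed
 have "ctr U * U = blk (X * X + (- V) * (- V')) (X * V + ?c (1 / rh) \<cdot> (- V))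
   (V' * X + ?c (1 / rh) \<cdot> (- V')) ((V' * V) $$ (0, 0) + ?c (1 / rh) * ?c (1 / rh))"
  unfolding ctrU unfolding U_def by (rule mult_blk[OF X mV(1) V' X V mV(2)])
 also have "(- V) * (- V') = ?c (1 / (rh * rh)) \<cdot> W"
  using V V' mV by (simp add: uminus_mult_left_mat uminus_mult_right_mat VV')
 also have "X * V + ?c (1 / rh) \<cdot> (- V) = 0\<^sub>m n 1"
  unfolding XV by (rule eq_matI) (use V in auto)
 also have "V' * X + ?c (1 / rh) \<cdot> (- V') = 0\<^sub>m 1 n"
  unfolding V'X by (rule eq_matI) (use V' in auto)
 also have "(V' * V) $$ (0, 0) + ?c (1 / rh) * ?c (1 / rh) = ?c ((s + 1) / (rh * rh))"
  unfolding V'V by (simp add: add_divide_distrib)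
 also have "(s + 1) / (rh * rh) = 1" using rh2 s0 by (simp add: power2_eq_square)
 also have "X * X + ?c (1 / (rh * rh)) \<cdot> W = 1\<^sub>m n" by (rule XX)
 finally have uU: "uni (Suc n) U" using U by (simp add: uni_def blk_one)
 have "U * R = blk (X * X + V * V') (X * 0\<^sub>m n 1 + ?c rh \<cdot> V)
   ((- V') * X + ?c (1 / rh) \<cdot> V') (((- V') * 0\<^sub>m n 1) $$ (0, 0) + ?c (1 / rh) * ?c rh)"
  unfolding U_def R_def by (rule mult_blk[OF X V mV(2) X _ V']) simp
 also have "X * 0\<^sub>m n 1 + ?c rh \<cdot> V = v"
  using X v rh0 by (intro eq_matI) (auto simp: V_def)
 also have "(- V') * X + ?c (1 / rh) \<cdot> V' = 0\<^sub>m 1 n"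
  unfolding uminus_mult_left_mat[of V' X] using V' X V'X
  by (intro eq_matI) (auto simp: uminus_mult_left_mat)
 also have "((- V') * 0\<^sub>m n 1) $$ (0, 0) + ?c (1 / rh) * ?c rh = 1"
  using V' rh0 by simp
 also have "X * X + V * V' = 1\<^sub>m n" unfolding VV' by (rule XX)
 finally have S: "shr n v = U * R" by (simp add: shr_def)
 have "det (shr n v) = det U * det R" unfolding S by (rule det_mult[OF U R])
 hence "cmod (det U * det R) = 1" using det_shr[OF v] by simp
 hence "cmod (det R) = 1" using uni_det[OF uU] by (simp add: norm_mult)
 hence "cmod (det X) * rh = 1"
  using det_blk_lower[OF X V', of "?c rh"] rh0 by (simp add: R_def norm_mult)
 thus ?thesis using that[OF uU X V' rh0 _ S[unfolded R_def]] rh2 by (simp add: s_def)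
qed

text \<open>Deflation and the QL formula reorder fourfold integrals. Exchanges of adjacent integrals
  are isolated here and in the next two lemmas, so that each use has to supply joint measurability
  only.\<close>

lemma nn_integral_swap12:
 assumes sf: "sigma_finite_measure M1" "sigma_finite_measure M2" "sigma_finite_measure M3" "sigma_finite_measure M4"
  and m: "(%p. f (fst p) (fst (snd p)) (fst (snd (snd p))) (snd (snd (snd p)))) : \<B> (M1 \<Otimes> M2 \<Otimes> M3 \<Otimes> M4)"
 shows "(\<integral>\<^sup>+x. \<integral>\<^sup>+y. \<integral>\<^sup>+z. \<integral>\<^sup>+w. f x y z w \<partial>M4 \<partial>M3 \<partial>M2 \<partial>M1) = (\<integral>\<^sup>+y. \<integral>\<^sup>+x. \<integral>\<^sup>+z. \<integral>\<^sup>+w. f x y z w \<partial>M4 \<partial>M3 \<partial>M1 \<partial>M2)"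
proof (rule nn_integral_swap[OF sf(1,2)])
 have "(%p. (fst (fst (fst p)), snd (fst (fst p)), snd (fst p), snd p)) : ((M1 \<Otimes> M2) \<Otimes> M3) \<Otimes> M4 \<rightarrow>\<^sub>M (M1 \<Otimes> M2 \<Otimes> M3 \<Otimes> M4)"
  by measurable
 from measurable_compose[OF this m]
 have "(%(q, w). f (fst (fst q)) (snd (fst q)) (snd q) w) : \<B> (((M1 \<Otimes> M2) \<Otimes> M3) \<Otimes> M4)"
  by (simp add: case_prod_beta')
 from sigma_finite_measure.borel_measurable_nn_integral[OF sf(4) this]
 have "(%(q, z). \<integral>\<^sup>+w. f (fst q) (snd q) z w \<partial>M4) : \<B> ((M1 \<Otimes> M2) \<Otimes> M3)"
  by (simp add: case_prod_beta')
 from sigma_finite_measure.borel_measurable_nn_integral[OF sf(3) this]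
 show "(%(x, y). \<integral>\<^sup>+z. \<integral>\<^sup>+w. f x y z w \<partial>M4 \<partial>M3) : \<B> (M1 \<Otimes> M2)"
  by (simp add: case_prod_beta')
qed

lemma nn_integral_swap23:
 assumes sf: "sigma_finite_measure M2" "sigma_finite_measure M3" "sigma_finite_measure M4"
  and m: "(%p. f (fst p) (fst (snd p)) (fst (snd (snd p))) (snd (snd (snd p)))) : \<B> (M1 \<Otimes> M2 \<Otimes> M3 \<Otimes> M4)"
 shows "(\<integral>\<^sup>+x. \<integral>\<^sup>+y. \<integral>\<^sup>+z. \<integral>\<^sup>+w. f x y z w \<partial>M4 \<partial>M3 \<partial>M2 \<partial>M1) = (\<integral>\<^sup>+x. \<integral>\<^sup>+z. \<integral>\<^sup>+y. \<integral>\<^sup>+w. f x y z w \<partial>M4 \<partial>M2 \<partial>M3 \<partial>M1)"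
proof (intro nn_integral_cong nn_integral_swap[OF sf(1,2)])
 fix x assume x: "x : space M1"
 have "(%p. (x, fst (fst p), snd (fst p), snd p)) : ((M2 \<Otimes> M3) \<Otimes> M4) \<rightarrow>\<^sub>M (M1 \<Otimes> M2 \<Otimes> M3 \<Otimes> M4)"
  using x by measurable
 from measurable_compose[OF this m]
 have "(%(q, w). f x (fst q) (snd q) w) : \<B> ((M2 \<Otimes> M3) \<Otimes> M4)"
  by (simp add: case_prod_beta')
 from sigma_finite_measure.borel_measurable_nn_integral[OF sf(3) this]
 show "(%(y, z). \<integral>\<^sup>+w. f x y z w \<partial>M4) : \<B> (M2 \<Otimes> M3)"
  by (simp add: case_prod_beta')
qed

lemma nn_integral_swap34:
 assumes sf: "sigma_finite_measure M3" "sigma_finite_measure M4"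
  and m: "(%p. f (fst p) (fst (snd p)) (fst (snd (snd p))) (snd (snd (snd p)))) : \<B> (M1 \<Otimes> M2 \<Otimes> M3 \<Otimes> M4)"
 shows "(\<integral>\<^sup>+x. \<integral>\<^sup>+y. \<integral>\<^sup>+z. \<integral>\<^sup>+w. f x y z w \<partial>M4 \<partial>M3 \<partial>M2 \<partial>M1) = (\<integral>\<^sup>+x. \<integral>\<^sup>+y. \<integral>\<^sup>+w. \<integral>\<^sup>+z. f x y z w \<partial>M3 \<partial>M4 \<partial>M2 \<partial>M1)"
proof (intro nn_integral_cong nn_integral_swap[OF sf(1,2)])
 fix x y assume xy: "x : space M1" "y : space M2"
 have "(%p. (x, y, fst p, snd p)) : (M3 \<Otimes> M4) \<rightarrow>\<^sub>M (M1 \<Otimes> M2 \<Otimes> M3 \<Otimes> M4)"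
  using xy by measurable
 from measurable_compose[OF this m]
 show "(%(z, w). f x y z w) : \<B> (M3 \<Otimes> M4)"
  by (simp add: case_prod_beta')
qed


text \<open>Defined for singular matrices too: \<open>1 / 0 = 0\<close> gives the zero matrix there,
  so that \<open>minv\<close> is measurable without a case distinction.\<close>

definition minv :: "complex mat => complex mat" where
 "minv A = (1 / det A) \<cdot> adj_mat A"

lemma minv:
 assumes A: "A : \<M> n n" and d: "det A ~= 0"
 shows "minv A : \<M> n n" "A * minv A = 1\<^sub>m n" "minv A * A = 1\<^sub>m n" "det (minv A) = 1 / det A"
proof -
 note a = adj_mat[OF A]
 show C: "minv A : \<M> n n" using a(1) by (simp add: minv_def)
 show l: "A * minv A = 1\<^sub>m n"
  unfolding minv_def mult_smult_distrib[OF A a(1)] a(2) by (rule eq_matI) (use d in auto)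
 show "minv A * A = 1\<^sub>m n"
  unfolding minv_def mult_smult_assoc_mat[OF a(1) A] a(3) by (rule eq_matI) (use d in auto)
 have "det A * det (minv A) = 1" using det_mult[OF A C] l by simp
 thus "det (minv A) = 1 / det A" using d by (simp add: field_simps)
qed

lemma minv_carrier: "A : \<M> n n ==> minv A : \<M> n n"
 using adj_mat(1)[of A n] by (simp add: minv_def)

lemma measurable_minv [lebm_meas]:
 assumes A: "A : measurable N (lebm n n)"
 shows "(%x. minv (A x)) : measurable N (lebm n n)"
 unfolding minv_def by (intro lebm_meas A borel_measurable_divide borel_measurable_const measurable_det[OF A])

section \<open>Deflation: an eigenvalue as integration variable\<close>

lemma char_poly_conj:
 assumes "M : \<M> n n" "P : \<M> n n" "Q : \<M> n n" "P * Q = 1\<^sub>m n"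
 shows "char_poly (P * M * Q) = char_poly (M :: complex mat)"
proof -
 have "Q * P = 1\<^sub>m n" using mat_mult_left_right_inverse[OF assms(2,3,4)] .
 hence "similar_mat_wit (P * M * Q) M P Q"
  using assms by (intro similar_mat_witI[of _ _ n]) auto
 thus ?thesis by (intro char_poly_similar) (auto simp: similar_mat_def)
qed

lemma uni_conj_char_poly:
 assumes "uni n U" "M : \<M> n n"
 shows "char_poly (U * M * ctr U) = char_poly M"
 using assms uni_right[OF assms(1)] uniD(1)[OF assms(1)] by (intro char_poly_conj) auto

lemma ennreal_solve: "0 < c ==> X = ennreal c * Y ==> Y = ennreal (1 / c) * X"
 by (simp add: mult.assoc[symmetric] ennreal_mult[symmetric] del: ennreal_1) simp

lemma measurable_poly_pderiv_char_poly:
 assumes z: "z : \<B> N" and A: "A : measurable N (lebm n n)"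
 shows "(%x. poly (pderiv (char_poly (A x))) (z x)) : \<B> N"
proof -
 have "(%x. \<Sum>i<n. poly (char_poly (mat_delete (A x) i i)) (z x)) : \<B> N"
 proof (cases n)
  case (Suc m)
  thus ?thesis
   by (intro borel_measurable_sum measurable_poly_char_poly[where n = m] z measurable_mat_delete) (use A in auto)
 qed simp
 thus ?thesis
  by (rule measurable_cong[THEN iffD1, rotated]) (simp add: pderiv_char_poly[OF measurable_carrier_mat[OF A]] poly_sum)
qed

text \<open>The corner entry for which \<open>z\<close> becomes an eigenvalue of the matrix with
  blocks \<open>D\<close>, \<open>c\<close>, \<open>b\<close>.\<close>

definition eigq :: "complex mat => complex mat => complex mat => complex => complex" where
 "eigq D c b z = poly (char_poly (blk D c b 0)) z / poly (char_poly D) z"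

text \<open>The derivative of \<open>eigq\<close> in \<open>z\<close>, in the shape that
  \<open>nn_integral_rational_function\<close> produces.\<close>

definition jacq :: "complex mat => complex mat => complex mat => complex => complex" where
 "jacq D c b z = (poly (pderiv (char_poly (blk D c b 0))) z * poly (char_poly D) z
   - poly (char_poly (blk D c b 0)) z * poly (pderiv (char_poly D)) z) / (poly (char_poly D) z)\<^sup>2"

text \<open>The right-hand side of the second formula is the substitution behind the deflation:
  upper block \<open>D = C + v * b\<close>, column \<open>(z - D) v\<close>, corner
  \<open>z - b v\<close>, while the row \<open>b\<close> is kept.\<close>

lemma shr_conj:
 assumes C: "C : \<M> n n" and v: "v : \<M> n 1" and b: "b : \<M> 1 n"
 shows "shr n v * lblk n C b z = blk (C + v * b) (z \<cdot> v) b z"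
  and "shr n v * lblk n C b z * shr n (- v) =
   blk (C + v * b) (zsub n z (C + v * b) * v) b (z - (b * v) $$ (0, 0))"
proof -
 have "shr n v * lblk n C b z = blk (1\<^sub>m n * C + v * b) (1\<^sub>m n * 0\<^sub>m n 1 + z \<cdot> v)
   (0\<^sub>m 1 n * C + 1 \<cdot> b) ((0\<^sub>m 1 n * 0\<^sub>m n 1) $$ (0, 0) + 1 * z)"
  unfolding shr_def by (rule mult_blk) (use C v b in auto)
 also have "1\<^sub>m n * C + v * b = C + v * b" using C by simp
 also have "1\<^sub>m n * 0\<^sub>m n 1 + z \<cdot> v = z \<cdot> v" by (rule eq_matI) (use v in auto)
 also have "0\<^sub>m 1 n * C + 1 \<cdot> b = b" by (rule eq_matI) (use b C in auto)
 finally show 1: "shr n v * lblk n C b z = blk (C + v * b) (z \<cdot> v) b z" by simp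
 let ?D = "C + v * b"
 have D: "?D : \<M> n n" using C v b by auto
 have zv: "z \<cdot> v : \<M> n 1" "- v : \<M> n 1" using v by auto
 have "blk ?D (z \<cdot> v) b z * shr n (- v) = blk (?D * 1\<^sub>m n + (z \<cdot> v) * 0\<^sub>m 1 n) (?D * (- v) + 1 \<cdot> (z \<cdot> v))
   (b * 1\<^sub>m n + z \<cdot> 0\<^sub>m 1 n) ((b * (- v)) $$ (0, 0) + z * 1)"
  unfolding shr_def by (rule mult_blk[OF D zv(1) b one_carrier_mat zv(2)]) simp
 also have "?D * 1\<^sub>m n + (z \<cdot> v) * 0\<^sub>m 1 n = ?D"
  using right_mult_one_mat[OF D] right_mult_zero_mat[OF zv(1), of n] D by simp
 also have "?D * (- v) + 1 \<cdot> (z \<cdot> v) = zsub n z ?D * v"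
 proof -
  have "zsub n z ?D * v = (z \<cdot> 1\<^sub>m n) * v - ?D * v"
   unfolding zsub_def by (rule minus_mult_distrib_mat[OF _ D v]) simp
  also have "(z \<cdot> 1\<^sub>m n) * v = z \<cdot> v" using mult_smult_assoc_mat[OF one_carrier_mat v] v by simp
  finally have e: "zsub n z ?D * v = z \<cdot> v - ?D * v" .
  have e2: "?D * (- v) = - (?D * v)" by (rule uminus_mult_right_mat) (use D v in auto)
  have Dv: "?D * v : \<M> n 1" using D v by (rule mult_carrier_mat)
  show ?thesis unfolding e e2 by (rule eq_matI) (use Dv v in \<open>auto simp del: index_mult_mat(1)\<close>)
 qed
 also have "b * 1\<^sub>m n + z \<cdot> 0\<^sub>m 1 n = b" by (rule eq_matI) (use b in auto)
 also have "(b * (- v)) $$ (0, 0) + z * 1 = z - (b * v) $$ (0, 0)"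
 proof -
  have "b * (- v) = - (b * v)" by (rule uminus_mult_right_mat) (use b v in auto)
  thus ?thesis using b v by simp
 qed
 finally show "shr n v * lblk n C b z * shr n (- v) =
   blk ?D (zsub n z ?D * v) b (z - (b * v) $$ (0, 0))" unfolding 1 .
qed

lemma add_minus_cancel_mat: "A : \<M> r c ==> B : \<M> r c ==> A - B + B = (A :: complex mat)"
 by (rule eq_matI) auto

lemma add_diff_cancel_mat: "A : \<M> r c ==> B : \<M> r c ==> A + B - B = (A :: complex mat)"
 by (rule eq_matI) auto

text \<open>Differentiating \<open>q - a r = (X - z) \<chi>\<^sub>C\<close> at \<open>z\<close>, where \<open>a = q(z) / r(z)\<close>, gives \<open>(q / r)' = \<chi>\<^sub>C / r\<close> at \<open>z\<close>.\<close>

lemma eigq_jacq: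
 assumes D: "D : \<M> n n" and v: "v : \<M> n 1" and b: "b : \<M> 1 n"
  and nz: "det (zsub n z D) ~= 0"
 shows "eigq D (zsub n z D * v) b z = z - (b * v) $$ (0, 0)"
  and "jacq D (zsub n z D * v) b z = det (zsub n z (D - v * b)) / det (zsub n z D)"
proof -
 define c where "c = zsub n z D * v"
 define a where "a = z - (b * v) $$ (0, 0)"
 define C where "C = D - v * b"
 have vb: "v * b : \<M> n n" using v b by auto
 have c: "c : \<M> n 1" unfolding c_def by (rule mult_carrier_mat[OF zsub_carrier[OF D] v])
 have C: "C : \<M> n n" unfolding C_def using vb by (rule minus_carrier_mat)
 have CD: "C + v * b = D" unfolding C_def by (rule add_minus_cancel_mat[OF D vb])
 define q where "q = char_poly (blk D c b 0)"
 define r where "r = char_poly D"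
 define x where "x = char_poly C"
 have M: "lblk n C b z : \<M> (Suc n) (Suc n)" using C by simp
 have "char_poly (blk D c b a) = char_poly (shr n v * lblk n C b z * shr n (- v))"
  unfolding shr_conj(2)[OF C v b] CD c_def a_def ..
 also have "... = char_poly (lblk n C b z)"
  by (rule char_poly_conj[OF M shr_carrier shr_carrier shr_inverse(1)[OF v]])
 also have "... = [:- z, 1:] * x" unfolding x_def by (rule char_poly_blk_lower[OF C b])
 finally have e: "q - Polynomial.smult a r = [:- z, 1:] * x"
  using char_poly_blk(1)[OF D c b, of a] by (simp add: q_def r_def)
 have rz: "poly r z = det (zsub n z D)" unfolding r_def by (rule poly_char_poly[OF D])
 have xz: "poly x z = det (zsub n z C)" unfolding x_def by (rule poly_char_poly[OF C])
 have "poly (q - Polynomial.smult a r) z = 0" unfolding e by simp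
 hence qz: "poly q z = a * poly r z" by simp
 have "poly (pderiv (q - Polynomial.smult a r)) z = poly x z"
  unfolding e by (simp only: pderiv_mult poly_add poly_mult) (simp add: pderiv_pCons)
 hence q'z: "poly (pderiv q) z = a * poly (pderiv r) z + poly x z"
  by (simp add: pderiv_diff pderiv_smult algebra_simps)
 show "eigq D (zsub n z D * v) b z = z - (b * v) $$ (0, 0)"
  using nz qz unfolding eigq_def c_def[symmetric] q_def[symmetric] r_def[symmetric] rz[symmetric] a_def[symmetric] by simp
 have "jacq D c b z = (poly x z * poly r z) / (poly r z)\<^sup>2"
  unfolding jacq_def q_def[symmetric] r_def[symmetric] qz q'z by (simp add: algebra_simps)
 also have "... = poly x z / poly r z" using nz rz by (simp add: power2_eq_square)
 finally show "jacq D (zsub n z D * v) b z = det (zsub n z (D - v * b)) / det (zsub n z D)"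
  by (simp add: c_def xz rz C_def)
qed

lemma measurable_eigq:
 assumes "D : measurable N (lebm n n)" "c : measurable N (lebm n 1)" "b : measurable N (lebm 1 n)" "z : \<B> N"
 shows "(%x. eigq (D x) (c x) (b x) (z x)) : \<B> N"
 unfolding eigq_def
 by (intro borel_measurable_divide measurable_poly_char_poly[where n = n] measurable_poly_char_poly[where n = "Suc n"]
   measurable_blk borel_measurable_const assms)

lemma measurable_jacq:
 assumes "D : measurable N (lebm n n)" "c : measurable N (lebm n 1)" "b : measurable N (lebm 1 n)" "z : \<B> N"
 shows "(%x. jacq (D x) (c x) (b x) (z x)) : \<B> N"
proof -
 have B: "(%x. blk (D x) (c x) (b x) 0) : measurable N (lebm (Suc n) (Suc n))"
  by (intro measurable_blk assms borel_measurable_const)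
 note [measurable] = measurable_poly_char_poly[OF assms(4) B] measurable_poly_pderiv_char_poly[OF assms(4) B]
  measurable_poly_char_poly[OF assms(4) assms(1)] measurable_poly_pderiv_char_poly[OF assms(4) assms(1)]
 show ?thesis unfolding jacq_def by measurable
qed

lemma measurable_norm_ennreal: "f : \<B> N ==> (%x. ennreal ((cmod (f x)) ^ k)) : \<B> N"
 by measurable

text \<open>This lemma and the next two serve the integrands of \<open>deflation\<close> in the
  coordinates \<open>D, c, b, z\<close>, then \<open>D, v, b, z\<close>, and finally
  \<open>C, v, b, z\<close>.\<close>

lemma measurable_deflation_before:
 assumes h: "h : \<B> (lebm (Suc n) (Suc n))"
  and m: "D : measurable N (lebm n n)" "c : measurable N (lebm n 1)" "b : measurable N (lebm 1 n)" "z : \<B> N"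
 shows "(%x. ennreal ((cmod (jacq (D x) (c x) (b x) (z x)))\<^sup>2) * h (blk (D x) (c x) (b x) (eigq (D x) (c x) (b x) (z x)))) : \<B> N"
 by (intro measurable_times_ennreal measurable_norm_ennreal measurable_jacq[OF m] measurable_compose[OF _ h]
   measurable_blk measurable_eigq[OF m] m)

lemma measurable_deflation_between:
 assumes h: "h : \<B> (lebm (Suc n) (Suc n))"
  and m: "D : measurable N (lebm n n)" "v : measurable N (lebm n 1)" "b : measurable N (lebm 1 n)" "z : \<B> N"
 shows "(%x. ennreal ((cmod (det (zsub n (z x) (D x - v x * b x))))\<^sup>2) *
   h (blk (D x) (zsub n (z x) (D x) * v x) (b x) (z x - (b x * v x) $$ (0, 0)))) : \<B> N"
proof -
 have bv: "(%x. (b x * v x) $$ (0, 0)) : \<B> N"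
  by (rule measurable_index_mat'[OF measurable_mat_mult[OF m(3,2)]]) auto
 show ?thesis
  by (intro measurable_times_ennreal measurable_norm_ennreal measurable_det[where n = n] measurable_compose[OF _ h]
   measurable_blk measurable_mat_mult[OF measurable_zsub[OF m(4,1)] m(2)] borel_measurable_diff bv
   measurable_zsub measurable_mat_minus measurable_mat_mult[OF m(2,3)] m)
qed

lemma measurable_deflation_after:
 assumes h: "h : \<B> (lebm (Suc n) (Suc n))"
  and m: "C : measurable N (lebm n n)" "v : measurable N (lebm n 1)" "b : measurable N (lebm 1 n)" "z : \<B> N"
 shows "(%x. ennreal ((cmod (det (zsub n (z x) (C x))))\<^sup>2) *
   h (shr n (v x) * lblk n (C x) (b x) (z x) * shr n (- v x))) : \<B> N"
proof -
 have mv: "(%x. - v x) : measurable N (lebm n 1)"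
 proof (rule measurable_cong[THEN iffD1])
  show "(%x. (-1) \<cdot> v x) : measurable N (lebm n 1)" by (intro lebm_meas m borel_measurable_const)
  show "(-1) \<cdot> v x = - v x" if "x : space N" for x
   by (rule eq_matI) (use measurable_carrier_mat[OF m(2) that] in auto)
 qed
 have s: "(%x. shr n (w x)) : measurable N (lebm (Suc n) (Suc n))" if "w : measurable N (lebm n 1)" for w
  unfolding shr_def by (intro measurable_blk that measurable_const borel_measurable_const) auto
 have B: "(%x. lblk n (C x) (b x) (z x)) : measurable N (lebm (Suc n) (Suc n))"
  by (intro measurable_blk m measurable_const) auto
 show ?thesis
  by (intro measurable_times_ennreal measurable_norm_ennreal measurable_det[where n = n] measurable_compose[OF _ h]
   measurable_mat_mult[OF measurable_mat_mult[OF s[OF m(2)] B] s[OF mv]] measurable_zsub m)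
qed

text \<open>Three substitutions turn the blocks \<open>D, c, b, a\<close> into an eigenvalue
  \<open>z\<close>, the affine coordinate \<open>v\<close> of its eigenvector, the row
  \<open>b\<close> and the complementary block \<open>C\<close>. The Jacobian of the second cancels
  the denominator of the first, which leaves \<open>|det (z - C)|^2\<close>.\<close>

lemma deflation:
 assumes h: "h : \<B> (lebm (Suc n) (Suc n))"
 shows "of_nat (Suc n) * (\<integral>P|Suc n,Suc n. h P) =
  (\<integral>v|n,1. \<integral>C|n,n. \<integral>b|1,n. \<integral>z. ennreal ((cmod (det (zsub n z C)))\<^sup>2) *
   h (shr n v * lblk n C b z * shr n (- v)))"
proof -
 let ?N = "of_nat (Suc n) :: ennreal"
 let ?I = "%D c b z. ennreal ((cmod (jacq D c b z))\<^sup>2) * h (blk D c b (eigq D c b z))"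
 let ?G = "%D v b z. ennreal ((cmod (det (zsub n z (D - v * b))))\<^sup>2) *
   h (blk D (zsub n z D * v) b (z - (b * v) $$ (0, 0)))"
 let ?H = "%C v b z. ennreal ((cmod (det (zsub n z C)))\<^sup>2) *
   h (shr n v * lblk n C b z * shr n (- v))"
 note mI = measurable_deflation_before[OF h] and mG = measurable_deflation_between[OF h]
  and mH = measurable_deflation_after[OF h]
 note sf = sigma_finite_lebm sigma_finite_lborel
 have Nh: "(%P. ?N * h P) : \<B> (lebm (Suc n) (Suc n))" using h by measurable
 have "?N * (\<integral>P|Suc n,Suc n. h P) = (\<integral>P|Suc n,Suc n. ?N * h P)"
  by (rule nn_integral_cmult[OF h, symmetric])
 also have "... = (\<integral>D|n,n. \<integral>c|n,1. \<integral>b|1,n. \<integral>a. ?N * h (blk D c b a))"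
  by (rule nn_integral_lebm_blk[OF Nh])
 \<comment> \<open>Replaces the corner \<open>a\<close> by \<open>z\<close> through the
   \<open>Suc n\<close>-to-one map \<open>q / r\<close>; the genericity it requires holds for almost
   every \<open>D\<close>, \<open>c\<close>, \<open>b\<close>.\<close>
 also have "... = (\<integral>D|n,n. \<integral>c|n,1. \<integral>b|1,n. \<integral>z. ?I D c b z)"
 proof (rule nn_integral_cong_AE, rule AE_mp[OF AE_rsquarefree_char_poly AE_I2], intro impI)
  fix D assume "D : space (lebm n n)" and sqf: "rsquarefree (char_poly D)"
  hence D: "D : \<M> n n" by simp
  show "(\<integral>c|n,1. \<integral>b|1,n. \<integral>a. ?N * h (blk D c b a)) =
    (\<integral>c|n,1. \<integral>b|1,n. \<integral>z. ?I D c b z)"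
  proof (rule nn_integral_cong_AE, rule AE_mp[OF coprime_generic[OF D sqf] AE_I2], intro impI)
   fix c assume "c : space (lebm n 1)"
    and ae: "AE b in lebm 1 n. \<forall>z. poly (char_poly (blk D c b 0)) z = 0 --> poly (char_poly D) z ~= 0"
   hence c: "c : \<M> n 1" by simp
   show "(\<integral>b|1,n. \<integral>a. ?N * h (blk D c b a)) = (\<integral>b|1,n. \<integral>z. ?I D c b z)"
   proof (rule nn_integral_cong_AE, rule AE_mp[OF ae AE_I2], intro impI)
    fix b assume "b : space (lebm 1 n)"
     and cop: "\<forall>z. poly (char_poly (blk D c b 0)) z = 0 --> poly (char_poly D) z ~= 0"
    hence b: "b : \<M> 1 n" by simp
    have hm: "(%a. h (blk D c b a)) : \<B> borel"
     by (rule measurable_compose[OF _ h]) (intro measurable_blk measurable_const measurable_ident, use D c b in auto)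
    have "(\<integral>z. ennreal ((cmod ((poly (pderiv (char_poly (blk D c b 0))) z * poly (char_poly D) z -
       poly (char_poly (blk D c b 0)) z * poly (pderiv (char_poly D)) z) / (poly (char_poly D) z)\<^sup>2))\<^sup>2) *
      h (blk D c b (poly (char_poly (blk D c b 0)) z / poly (char_poly D) z))) = ?N * (\<integral>a. h (blk D c b a))"
    proof (rule nn_integral_rational_function[OF _ _ _ _ hm])
     show "degree (char_poly (blk D c b 0)) = Suc n"
      using degree_monic_char_poly[OF blk_carrier[OF D, of c b 0]] by blast
     show "degree (char_poly D) <= n" "char_poly D ~= 0" using degree_monic_char_poly[OF D] by auto
    qed (use cop in blast)
    also have "?N * (\<integral>a. h (blk D c b a)) = (\<integral>a. ?N * h (blk D c b a))"
     by (rule nn_integral_cmult[symmetric]) (use hm in simp)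
    finally show "(\<integral>a. ?N * h (blk D c b a)) = (\<integral>z. ?I D c b z)"
     by (simp only: jacq_def eigq_def)
   qed
  qed
 qed
 also have "... = (\<integral>D|n,n. \<integral>b|1,n. \<integral>c|n,1. \<integral>z. ?I D c b z)"
  by (intro nn_integral_swap23 sf) (rule mI; measurable)
 also have "... = (\<integral>D|n,n. \<integral>b|1,n. \<integral>z. \<integral>c|n,1. ?I D c b z)"
  by (intro nn_integral_swap34 sf) (rule mI; measurable)
 \<comment> \<open>Replaces \<open>c\<close> by \<open>(z - D) v\<close> for \<open>z\<close>
   outside the spectrum of \<open>D\<close>. The integral over \<open>c\<close> was moved inside
   because the substitution depends on \<open>z\<close>.\<close>
 also have "... = (\<integral>D|n,n. \<integral>b|1,n. \<integral>z. \<integral>v|n,1. ?G D v b z)"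
 proof (rule nn_integral_cong, rule nn_integral_cong)
  fix D b assume "D : space (lebm n n)" "b : space (lebm 1 n)"
  hence D: "D : \<M> n n" and b: "b : \<M> 1 n" by auto
  have "finite {z. poly (char_poly D) z = 0}"
   by (rule poly_roots_finite) (use degree_monic_char_poly[OF D] in auto)
  hence "AE z in lborel. z \<notin> {z. poly (char_poly D) z = 0}"
   by (intro AE_not_in) (simp add: finite_imp_null_set_lborel)
  thus "(\<integral>z. \<integral>c|n,1. ?I D c b z) = (\<integral>z. \<integral>v|n,1. ?G D v b z)"
  proof (intro nn_integral_cong_AE, elim AE_mp, intro AE_I2 impI)
   fix z assume "z \<notin> {z. poly (char_poly D) z = 0}"
   hence nz: "det (zsub n z D) ~= 0" using poly_char_poly[OF D, of z] by simp
   let ?Z = "zsub n z D"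
   have Z: "?Z : \<M> n n" using D by simp
   have m: "(%c. ?I D c b z) : \<B> (lebm n 1)"
    by (rule mI) (use D b in \<open>auto intro: measurable_const\<close>)
   have "(\<integral>c|n,1. ?I D c b z) = ennreal ((cmod (det ?Z))\<^sup>2) ^ 1 * (\<integral>v|n,1. ?I D (?Z * v) b z)"
    by (rule nn_integral_lebm_mult_left[OF m Z nz])
   also have "... = (\<integral>v|n,1. ennreal ((cmod (det ?Z))\<^sup>2) * ?I D (?Z * v) b z)"
    using nn_integral_cmult[OF measurable_mult_const_left[OF Z m], of "ennreal ((cmod (det ?Z))\<^sup>2)"] by simp
   also have "... = (\<integral>v|n,1. ?G D v b z)"
   proof (rule nn_integral_cong)
    fix v assume "v : space (lebm n 1)"
    hence v: "v : \<M> n 1" by simp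
    have "ennreal ((cmod (det ?Z))\<^sup>2) * ennreal ((cmod (det (zsub n z (D - v * b)) / det ?Z))\<^sup>2) =
      ennreal ((cmod (det (zsub n z (D - v * b))))\<^sup>2)"
     using nz by (simp add: ennreal_mult[symmetric] norm_divide power_divide)
    thus "ennreal ((cmod (det ?Z))\<^sup>2) * ?I D (?Z * v) b z = ?G D v b z"
     unfolding eigq_jacq[OF D v b nz] by (simp add: mult.assoc[symmetric])
   qed
   finally show "(\<integral>c|n,1. ?I D c b z) = (\<integral>v|n,1. ?G D v b z)" .
  qed
 qed
 also have "... = (\<integral>D|n,n. \<integral>b|1,n. \<integral>v|n,1. \<integral>z. ?G D v b z)"
  by (intro nn_integral_swap34 sf) (rule mG; measurable)
 also have "... = (\<integral>D|n,n. \<integral>v|n,1. \<integral>b|1,n. \<integral>z. ?G D v b z)"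
  by (intro nn_integral_swap23 sf) (rule mG; measurable)
 also have "... = (\<integral>v|n,1. \<integral>D|n,n. \<integral>b|1,n. \<integral>z. ?G D v b z)"
  by (intro nn_integral_swap12 sf) (rule mG; measurable)
 also have "... = (\<integral>v|n,1. \<integral>b|1,n. \<integral>D|n,n. \<integral>z. ?G D v b z)"
  by (intro nn_integral_swap23 sf) (rule mG; measurable)
 also have "... = (\<integral>v|n,1. \<integral>b|1,n. \<integral>z. \<integral>D|n,n. ?G D v b z)"
  by (intro nn_integral_swap34 sf) (rule mG; measurable)
 \<comment> \<open>A translation of \<open>D\<close> by \<open>v * b\<close>, without
   Jacobian.\<close>
 also have "... = (\<integral>v|n,1. \<integral>b|1,n. \<integral>z. \<integral>C|n,n. ?H C v b z)"
 proof (rule nn_integral_cong, rule nn_integral_cong, rule nn_integral_cong)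
  fix v b z assume "v : space (lebm n 1)" "b : space (lebm 1 n)"
  hence v: "v : \<M> n 1" and b: "b : \<M> 1 n" by auto
  hence vb: "v * b : \<M> n n" by auto
  have m: "(%D. ?G D v b z) : \<B> (lebm n n)"
   by (rule mG) (use v b in \<open>auto intro: measurable_const\<close>)
  have "(\<integral>D|n,n. ?G D v b z) = (\<integral>C|n,n. ?G (C + v * b) v b z)"
   by (rule nn_integral_lebm_translate[OF m vb])
  also have "... = (\<integral>C|n,n. ?H C v b z)"
  proof (rule nn_integral_cong)
   fix C assume "C : space (lebm n n)"
   hence C: "C : \<M> n n" by simp
   show "?G (C + v * b) v b z = ?H C v b z"
    unfolding shr_conj(2)[OF C v b] add_diff_cancel_mat[OF C vb] ..
  qed
  finally show "(\<integral>D|n,n. ?G D v b z) = (\<integral>C|n,n. ?H C v b z)" .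
 qed
 also have "... = (\<integral>v|n,1. \<integral>b|1,n. \<integral>C|n,n. \<integral>z. ?H C v b z)"
  by (intro nn_integral_swap34 sf) (rule mH; measurable)
 also have "... = (\<integral>v|n,1. \<integral>C|n,n. \<integral>b|1,n. \<integral>z. ?H C v b z)"
  by (intro nn_integral_swap23 sf) (rule mH; measurable)
 finally show ?thesis .
qed

text \<open>The integrand is the Fubini-Study volume density in an affine chart, so this is the
  volume of complex projective space of dimension \<open>n\<close>.\<close>

definition kap :: "nat => ennreal" where
 "kap n = (\<integral>v|n,1. ennreal (1 / (1 + fro v) ^ Suc n))"

lemma measurable_const_mat: "A : \<M> r c ==> (%x. A) : measurable N (lebm r c)"
 by simp

lemma nn_integral_row_affine:
 assumes f: "f : \<B> (lebm 1 n)" and G: "G : \<M> n n" "det G ~= 0" and t: "t ~= 0"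
  and k: "k : \<M> 1 n"
 shows "(\<integral>b|1,n. f b) = ennreal ((cmod (det G))\<^sup>2 * ((cmod t)\<^sup>2) ^ n) * (\<integral>b|1,n. f (t \<cdot> (b * G) + k))"
proof -
 have g: "(%b. f (b + k)) : \<B> (lebm 1 n)"
  by (rule measurable_compose[OF measurable_mat_add[OF lebm_ident measurable_const_mat[OF k]] f])
 have g2: "(%b. f (t \<cdot> b + k)) : \<B> (lebm 1 n)"
  by (rule measurable_compose[OF measurable_mat_smult[OF borel_measurable_const lebm_ident] g])
 have "(\<integral>b|1,n. f b) = (\<integral>b|1,n. f (b + k))"
  by (rule nn_integral_lebm_translate[OF f k])
 also have "... = ennreal ((cmod t)\<^sup>2) ^ n * (\<integral>b|1,n. f (t \<cdot> b + k))"
  using nn_integral_lebm_scale[OF g t] by simp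
 also have "(\<integral>b|1,n. f (t \<cdot> b + k)) = ennreal ((cmod (det G))\<^sup>2) * (\<integral>b|1,n. f (t \<cdot> (b * G) + k))"
  using nn_integral_lebm_mult_right[OF g2 G] by simp
 finally show ?thesis by (simp add: ennreal_mult ennreal_power[symmetric] mult_ac)
qed

text \<open>Passing the triangular matrix through \<open>lblk n C b z\<close> keeps the corner
  \<open>z\<close>, conjugates \<open>C\<close> by \<open>Ga\<close> and maps \<open>b\<close>
  affinely. The translation part of that map depends on \<open>z\<close>.\<close>

lemma shr_QL_conj:
 assumes G: "Ga : \<M> n n" "Ga' : \<M> n n" "Ga' * Ga = 1\<^sub>m n" and s: "sg : \<M> 1 n"
  and C: "C : \<M> n n" and b: "b : \<M> 1 n"
 shows "lblk n (Ga * C * Ga') (rh \<cdot> (b * Ga') + (sg * C * Ga' - z \<cdot> (sg * Ga'))) z * lblk n Ga sg rh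
  = lblk n Ga sg rh * lblk n C b (z :: complex)"
proof -
 let ?\<beta> = "rh \<cdot> (b * Ga') + (sg * C * Ga' - z \<cdot> (sg * Ga'))"
 have c1: "Ga * C : \<M> n n" "Ga * C * Ga' : \<M> n n" using G C by auto
 have c2: "b * Ga' : \<M> 1 n" "sg * C : \<M> 1 n" "sg * C * Ga' : \<M> 1 n" "sg * Ga' : \<M> 1 n"
  using G C b s by auto
 have c3: "rh \<cdot> (b * Ga') : \<M> 1 n" "z \<cdot> (sg * Ga') : \<M> 1 n"
  "sg * C * Ga' - z \<cdot> (sg * Ga') : \<M> 1 n" "?\<beta> : \<M> 1 n"
  using c2 by (auto simp: minus_carrier_mat)
 have e1: "Ga * C * Ga' * Ga = Ga * C"
  using assoc_mult_mat[OF c1(1) G(2) G(1)] G(3) right_mult_one_mat[OF c1(1)] by simp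
 have e2: "b * Ga' * Ga = b" using assoc_mult_mat[OF b G(2) G(1)] G(3) right_mult_one_mat[OF b] by simp
 have e3: "sg * C * Ga' * Ga = sg * C" using assoc_mult_mat[OF c2(2) G(2) G(1)] G(3) right_mult_one_mat[OF c2(2)] by simp
 have e4: "sg * Ga' * Ga = sg" using assoc_mult_mat[OF s G(2) G(1)] G(3) right_mult_one_mat[OF s] by simp
 have "?\<beta> * Ga = rh \<cdot> b + (sg * C - z \<cdot> sg)"
  unfolding add_mult_distrib_mat[OF c3(1,3) G(1)] minus_mult_distrib_mat[OF c2(3) c3(2) G(1)]
   mult_smult_assoc_mat[OF c2(1) G(1)] mult_smult_assoc_mat[OF c2(4) G(1)] e2 e3 e4 ..
 hence e5: "?\<beta> * Ga + z \<cdot> sg = sg * C + rh \<cdot> b"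
  using b s c2(2) by (intro eq_matI) (auto simp del: index_mult_mat(1))
 have "lblk n (Ga * C * Ga') ?\<beta> z * lblk n Ga sg rh =
   blk (Ga * C * Ga' * Ga + 0\<^sub>m n 1 * sg) (Ga * C * Ga' * 0\<^sub>m n 1 + rh \<cdot> 0\<^sub>m n 1) (?\<beta> * Ga + z \<cdot> sg) ((?\<beta> * 0\<^sub>m n 1) $$ (0, 0) + z * rh)"
  by (rule mult_blk[OF c1(2) _ c3(4) G(1) _ s]) auto
 also have "... = lblk n (Ga * C) (sg * C + rh \<cdot> b) (rh * z)"
  unfolding e1 e5 using c1 c3 s right_mult_zero_mat[OF c1(2), of 1] right_mult_zero_mat[OF c3(4), of 1]
  by (simp add: left_mult_zero_mat[OF s] mult.commute)
 also have "... = blk (Ga * C + 0\<^sub>m n 1 * b) (Ga * 0\<^sub>m n 1 + z \<cdot> 0\<^sub>m n 1) (sg * C + rh \<cdot> b) ((sg * 0\<^sub>m n 1) $$ (0, 0) + rh * z)"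
  using c1 b s G(1) right_mult_zero_mat[OF s, of 1] right_mult_zero_mat[OF G(1), of 1] by (simp add: left_mult_zero_mat[OF b])
 also have "... = lblk n Ga sg rh * lblk n C b z"
  by (rule mult_blk[symmetric, OF G(1) _ s C _ b]) auto
 finally show ?thesis .
qed

text \<open>Diagonal blocks of lower block triangular matrices multiply separately; this is why the
  corner entries of all factors multiply to the marked eigenvalue of the product.\<close>

lemma QL_mult:
 assumes G: "Ga : \<M> m m" and s: "sg : \<M> 1 m"
  and C: "C : \<M> m n" and b: "b : \<M> 1 n"
 shows "lblk m Ga sg rh * lblk m C b (z :: complex) = lblk m (Ga * C) (sg * C + rh \<cdot> b) (rh * z)"
proof -
 have "lblk m Ga sg rh * lblk m C b z =
   blk (Ga * C + 0\<^sub>m m 1 * b) (Ga * 0\<^sub>m m 1 + z \<cdot> 0\<^sub>m m 1) (sg * C + rh \<cdot> b) ((sg * 0\<^sub>m m 1) $$ (0, 0) + rh * z)"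
  by (rule mult_blk[OF G _ s C _ b]) auto
 also have "Ga * C + 0\<^sub>m m 1 * b = Ga * C"
  using G C by (simp add: left_mult_zero_mat[OF b])
 also have "Ga * 0\<^sub>m m 1 + z \<cdot> 0\<^sub>m m 1 = 0\<^sub>m m 1"
  using right_mult_zero_mat[OF G, of 1] by simp
 also have "(sg * 0\<^sub>m m 1) $$ (0, 0) = 0" using right_mult_zero_mat[OF s, of 1] by simp
 finally show ?thesis by simp
qed

text \<open>The Jacobians of left multiplication by \<open>G\<close> and of right multiplication by
  its inverse are reciprocal.\<close>

lemma nn_integral_lebm_conj:
 assumes f: "f : \<B> (lebm n n)" and G: "G : \<M> n n" "det G ~= 0"
 shows "(\<integral>C|n,n. f (G * C * minv G)) = (\<integral>C|n,n. f C)"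
proof -
 note i = minv[OF G]
 have i0: "det (minv G) ~= 0" using i(4) G by simp
 have g: "(%C. f (C * minv G)) : \<B> (lebm n n)"
  by (rule measurable_mult_const_right[OF i(1) f])
 have "(\<integral>C|n,n. f C) = ennreal ((cmod (det (minv G)))\<^sup>2) ^ n * (ennreal ((cmod (det G))\<^sup>2) ^ n * (\<integral>C|n,n. f (G * C * minv G)))"
  using nn_integral_lebm_mult_right[OF f i(1) i0] nn_integral_lebm_mult_left[OF g G] by simp
 also have "... = (ennreal ((cmod (det (minv G)))\<^sup>2) * ennreal ((cmod (det G))\<^sup>2)) ^ n * (\<integral>C|n,n. f (G * C * minv G))"
  by (simp only: power_mult_distrib mult.assoc)
 also have "ennreal ((cmod (det (minv G)))\<^sup>2) * ennreal ((cmod (det G))\<^sup>2) = 1"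
  using G(2) by (simp add: i(4) ennreal_mult[symmetric] norm_divide power_divide)
 finally show ?thesis by simp
qed

lemma measurable_schur:
 assumes h: "Ps : \<B> (lebm (Suc n) (Suc n))"
  and m: "C : measurable N (lebm n n)" "b : measurable N (lebm 1 n)" "z : \<B> N"
 shows "(%x. ennreal ((cmod (det (zsub n (z x) (C x))))\<^sup>2) * Ps (lblk n (C x) (b x) (z x))) : \<B> N"
 by (intro measurable_times_ennreal measurable_norm_ennreal measurable_det[where n = n] measurable_compose[OF _ h]
   measurable_blk measurable_const_mat zero_carrier_mat measurable_zsub m)

text \<open>Write \<open>shr n v = U * R\<close> with \<open>R\<close> lower triangular.
  \<open>U\<close> drops out by invariance, and conjugation by \<open>R\<close> is absorbed by an
  affine substitution in \<open>C\<close> and \<open>b\<close>. Only its Jacobian depends on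
  \<open>v\<close>, so the integral over \<open>v\<close> splits off as
  \<open>kap n\<close>.\<close>

lemma schur_deflation:
 assumes h: "Ps : \<B> (lebm (Suc n) (Suc n))"
  and inv: "!!U M. uni (Suc n) U ==> M : \<M> (Suc n) (Suc n) ==> Ps (U * M * ctr U) = Ps M"
 shows "of_nat (Suc n) * (\<integral>P|Suc n,Suc n. Ps P) =
  kap n * (\<integral>C|n,n. \<integral>b|1,n. \<integral>z. ennreal ((cmod (det (zsub n z C)))\<^sup>2) * Ps (lblk n C b z))"
proof -
 define K where "K C b z = ennreal ((cmod (det (zsub n z C)))\<^sup>2) * Ps (lblk n C b z)" for C b z
 define J where "J = (\<integral>C|n,n. \<integral>b|1,n. \<integral>z. K C b z)"
 note mK = measurable_schur[OF h, folded K_def]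
 have mL: "(%C. \<integral>z. \<integral>b|1,n. K C b z) : \<B> (lebm n n)"
 proof (rule measurable_nn_integral_lborel)
  have "(%(q, b). K (fst q) b (snd q)) : \<B> ((lebm n n \<Otimes> lborel) \<Otimes> lebm 1 n)"
   unfolding case_prod_beta' by (rule mK; measurable)
  from measurable_nn_integral_lebm[OF this]
  show "(%(C, z). \<integral>b|1,n. K C b z) : \<B> (lebm n n \<Otimes> lborel)"
   by (simp add: case_prod_beta')
 qed
 have swap: "(\<integral>b|1,n. \<integral>z. K C b z) = (\<integral>z. \<integral>b|1,n. K C b z)"
  if "C : \<M> n n" for C
  by (intro nn_integral_swap sigma_finite_lebm sigma_finite_lborel, unfold case_prod_beta', rule mK)
    (auto simp: that)
 have J: "J = (\<integral>C|n,n. \<integral>z. \<integral>b|1,n. K C b z)"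
  unfolding J_def by (intro nn_integral_cong swap) simp
 have fixed: "(\<integral>C|n,n. \<integral>b|1,n. \<integral>z. ennreal ((cmod (det (zsub n z C)))\<^sup>2) *
   Ps (shr n v * lblk n C b z * shr n (- v))) = ennreal (1 / (1 + fro v) ^ Suc n) * J"
  if v: "v : \<M> n 1" for v
 proof -
  obtain U Ga sg rh where U: "uni (Suc n) U" and G: "Ga : \<M> n n" and s: "sg : \<M> 1 n"
   and rh: "0 < rh" "rh\<^sup>2 = 1 + fro v" and S: "shr n v = U * lblk n Ga sg (complex_of_real rh)"
   and dG: "cmod (det Ga) * rh = 1"
   by (rule shr_QL[OF v])
  let ?R = "lblk n Ga sg (complex_of_real rh)"
  let ?k = "Suc n"
  have dG0: "det Ga ~= 0" using dG by auto
  note G' = minv[OF G dG0]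
  define k where "k C z = sg * C * minv Ga - z \<cdot> (sg * minv Ga)" for C z
  have kc: "k C z : \<M> 1 n" if "C : \<M> n n" for C z
   unfolding k_def using that s G' by (auto simp: minus_carrier_mat)
  have Uc: "U : \<M> ?k ?k" and Rc: "?R : \<M> ?k ?k" using uniD(1)[OF U] G by auto
  have R: "ctr U * shr n v = ?R"
   unfolding S assoc_mult_mat[OF ctr_carrier[OF Uc] Uc Rc, symmetric] uniD(2)[OF U] by (rule left_mult_one_mat[OF Rc])
  \<comment> \<open>Since \<open>?R * ?M = ?N * ?R\<close>, conjugation by \<open>shr n v\<close>
    becomes conjugation of the triangular matrix \<open>?N\<close> by \<open>U\<close>, which the
    invariance of \<open>Ps\<close> removes.\<close>
  have pt: "ennreal ((cmod (det (zsub n z C)))\<^sup>2) * Ps (shr n v * lblk n C b z * shr n (- v)) =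
    K (Ga * C * minv Ga) (complex_of_real rh \<cdot> (b * minv Ga) + k C z) z"
   if C: "C : \<M> n n" and b: "b : \<M> 1 n" for C b z
  proof -
   let ?N = "lblk n (Ga * C * minv Ga) (complex_of_real rh \<cdot> (b * minv Ga) + k C z) z"
   let ?M = "lblk n C b z"
   have gc: "Ga * C * minv Ga : \<M> n n" using G C G' by auto
   have N: "?N : \<M> ?k ?k" and M: "?M : \<M> ?k ?k" using gc C by auto
   note as = assoc_mult_mat[of _ ?k ?k _ ?k _ ?k]
   note cs = Uc Rc N M shr_carrier ctr_carrier[OF Uc]
   have "shr n v * ?M * shr n (- v) = U * (?R * ?M) * shr n (- v)"
    unfolding S by (simp add: as cs)
   also have "?R * ?M = ?N * ?R" unfolding k_def by (rule shr_QL_conj[OF G G'(1,3) s C b, symmetric])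
   also have "?N * ?R = ?N * (ctr U * shr n v)" unfolding R ..
   also have "U * (?N * (ctr U * shr n v)) * shr n (- v) = U * ?N * ctr U * (shr n v * shr n (- v))"
    by (simp add: as cs mult_carrier_mat[of _ ?k ?k _ ?k])
   also have "... = U * ?N * ctr U" unfolding shr_inverse(1)[OF v]
    by (rule right_mult_one_mat[OF mult_carrier_mat[OF mult_carrier_mat[OF Uc N] ctr_carrier[OF Uc]]])
   finally have "Ps (shr n v * ?M * shr n (- v)) = Ps ?N" using inv[OF U N] by simp
   moreover have "det (zsub n z (Ga * C * minv Ga)) = det (zsub n z C)"
    using poly_char_poly[OF gc, of z] poly_char_poly[OF C, of z] char_poly_conj[OF C G G'(1,2)] by simp
   ultimately show ?thesis by (simp add: K_def)
  qed
  let ?B = "%C b z. complex_of_real rh \<cdot> (b * minv Ga) + k C z"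
  let ?w = "ennreal (1 / (1 + fro v) ^ Suc n)"
  have "(\<integral>C|n,n. \<integral>b|1,n. \<integral>z. ennreal ((cmod (det (zsub n z C)))\<^sup>2) *
    Ps (shr n v * lblk n C b z * shr n (- v)))
   = (\<integral>C|n,n. \<integral>b|1,n. \<integral>z. K (Ga * C * minv Ga) (?B C b z) z)"
   by (rule nn_integral_cong, rule nn_integral_cong, rule nn_integral_cong) (simp add: pt)
  also have "... = (\<integral>C|n,n. ?w * (\<integral>z. \<integral>b|1,n. K (Ga * C * minv Ga) b z))"
  proof (rule nn_integral_cong)
   fix C assume "C : space (lebm n n)"
   hence C: "C : \<M> n n" by simp
   hence gc: "Ga * C * minv Ga : \<M> n n" using G G' by auto
   \<comment> \<open>The translation \<open>k C z\<close> depends on \<open>z\<close>, so the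
     integral over \<open>b\<close> has to be the inner one.\<close>
   have "(\<integral>b|1,n. \<integral>z. K (Ga * C * minv Ga) (?B C b z) z) =
     (\<integral>z. \<integral>b|1,n. K (Ga * C * minv Ga) (?B C b z) z)"
   proof (intro nn_integral_swap sigma_finite_lebm sigma_finite_lborel, unfold case_prod_beta', rule mK)
    have f: "fst : measurable (lebm 1 n \<Otimes> \<L>) (lebm 1 n)"
     and sn: "snd : \<B> (lebm 1 n \<Otimes> \<L>)" by auto
    show "(%x. ?B C (fst x) (snd x)) : measurable (lebm 1 n \<Otimes> lborel) (lebm 1 n)"
     unfolding k_def
     by (intro measurable_mat_add measurable_mat_minus measurable_mat_smult borel_measurable_const sn
       measurable_mat_mult[OF f measurable_const_mat[OF G'(1)]] measurable_const_mat) (use s C G' in auto)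
   qed (use gc in auto)
   also have "... = (\<integral>z. ?w * (\<integral>b|1,n. K (Ga * C * minv Ga) b z))"
   proof (rule nn_integral_cong)
    fix z
    have m: "(%b. K (Ga * C * minv Ga) b z) : \<B> (lebm 1 n)"
     by (rule mK) (use gc in auto)
    have "(\<integral>b|1,n. K (Ga * C * minv Ga) b z) =
      ennreal ((cmod (det (minv Ga)))\<^sup>2 * ((cmod (complex_of_real rh))\<^sup>2) ^ n) * (\<integral>b|1,n. K (Ga * C * minv Ga) (?B C b z) z)"
     by (rule nn_integral_row_affine[OF m G'(1) _ _ kc[OF C]]) (use G'(4) dG0 rh in auto)
    \<comment> \<open>\<open>Ga\<close> has determinant of modulus \<open>1 / rh\<close>, and
      \<open>rh\<^sup>2 = 1 + fro v\<close>. The \<open>n\<close> coordinates scaled by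
      \<open>rh\<close> and one more factor \<open>rh\<^sup>2\<close> give the exponent
      \<open>Suc n\<close> in \<open>kap\<close>.\<close>
    also have "(cmod (det (minv Ga)))\<^sup>2 * ((cmod (complex_of_real rh))\<^sup>2) ^ n = (1 + fro v) ^ Suc n"
    proof -
     have "cmod (det (minv Ga)) = rh" using dG dG0 by (simp add: G'(4) norm_divide field_simps)
     thus ?thesis using rh by simp
    qed
    finally show "(\<integral>b|1,n. K (Ga * C * minv Ga) (?B C b z) z) = ?w * (\<integral>b|1,n. K (Ga * C * minv Ga) b z)"
     by (intro ennreal_solve) (use fro_nonneg[of v] in auto)
   qed
   also have "... = ?w * (\<integral>z. \<integral>b|1,n. K (Ga * C * minv Ga) b z)"
   proof (rule nn_integral_cmult, rule measurable_nn_integral_lebm, unfold case_prod_beta')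
    show "(%x. K (Ga * C * minv Ga) (snd x) (fst x)) : \<B> (lborel \<Otimes> lebm 1 n)"
     unfolding K_def by (rule measurable_schur[OF h]) (use gc in auto)
   qed
   finally show "(\<integral>b|1,n. \<integral>z. K (Ga * C * minv Ga) (?B C b z) z) =
     ?w * (\<integral>z. \<integral>b|1,n. K (Ga * C * minv Ga) b z)" .
  qed
  also have "... = ?w * (\<integral>C|n,n. \<integral>z. \<integral>b|1,n. K (Ga * C * minv Ga) b z)"
  proof (rule nn_integral_cmult)
   show "(%C. \<integral>z. \<integral>b|1,n. K (Ga * C * minv Ga) b z) : \<B> (lebm n n)"
    by (rule measurable_compose[OF _ mL], rule measurable_mat_mult[OF measurable_mat_mult[OF measurable_const_mat[OF G] lebm_ident] measurable_const_mat[OF G'(1)]])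
  qed
  also have "(\<integral>C|n,n. \<integral>z. \<integral>b|1,n. K (Ga * C * minv Ga) b z) = J"
   unfolding J by (rule nn_integral_lebm_conj[OF mL G dG0])
  finally show ?thesis .
 qed
 have "of_nat (Suc n) * (\<integral>P|Suc n,Suc n. Ps P) = (\<integral>v|n,1. ennreal (1 / (1 + fro v) ^ Suc n) * J)"
  unfolding deflation[OF h] by (rule nn_integral_cong) (simp add: fixed)
 also have "... = kap n * J"
  unfolding kap_def by (rule nn_integral_multc) (use measurable_fro[OF lebm_ident] in measurable)
 finally show ?thesis unfolding J_def K_def .
qed

section \<open>QL integration for rectangular matrices\<close>

lemma measurable_QL:
 assumes h: "Ps : \<B> (lebm (Suc m) (Suc n))"
  and m: "C : measurable N (lebm m n)" "v : measurable N (lebm m 1)" "b : measurable N (lebm 1 n)" "z : \<B> N" "w : \<B> N"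
 shows "(%x. ennreal ((cmod (w x)) ^ k) * Ps (blk (C x) (v x) (b x) (z x))) : \<B> N"
 by (intro measurable_times_ennreal measurable_norm_ennreal measurable_compose[OF _ h]
   measurable_blk m)

lemma measurable_QL_shr:
 assumes h: "Ps : \<B> (lebm (Suc m) (Suc n))"
  and m: "C : measurable N (lebm m n)" "v : measurable N (lebm m 1)" "b : measurable N (lebm 1 n)" "z : \<B> N"
 shows "(%x. ennreal ((cmod (z x)) ^ k) * Ps (shr m (v x) * lblk m (C x) (b x) (z x))) : \<B> N"
proof -
 have s: "(%x. shr m (v x)) : measurable N (lebm (Suc m) (Suc m))"
  unfolding shr_def by (intro measurable_blk m measurable_const_mat borel_measurable_const) auto
 show ?thesis
  by (intro measurable_times_ennreal measurable_norm_ennreal measurable_compose[OF _ h]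
   measurable_mat_mult[OF s] measurable_blk m measurable_const_mat zero_carrier_mat)
qed

lemma shr_mult_blk:
 assumes C: "C : \<M> m n" and v: "v : \<M> m 1" and b: "b : \<M> 1 n"
 shows "shr m v * lblk m C b z = blk (C + v * b) (z \<cdot> v) b z"
proof -
 have "shr m v * lblk m C b z = blk (1\<^sub>m m * C + v * b) (1\<^sub>m m * 0\<^sub>m m 1 + z \<cdot> v)
   (0\<^sub>m 1 m * C + 1 \<cdot> b) ((0\<^sub>m 1 m * 0\<^sub>m m 1) $$ (0, 0) + 1 * z)"
  unfolding shr_def by (rule mult_blk) (use C v b in auto)
 also have "1\<^sub>m m * C + v * b = C + v * b" using C by simp
 also have "1\<^sub>m m * 0\<^sub>m m 1 + z \<cdot> v = z \<cdot> v" by (rule eq_matI) (use v in auto)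
 also have "0\<^sub>m 1 m * C + 1 \<cdot> b = b" by (rule eq_matI) (use b C in auto)
 finally show ?thesis by simp
qed

text \<open>A matrix with nonzero corner \<open>z\<close> is \<open>shr m v\<close> times a lower
  block triangular matrix, its last column being \<open>z v\<close>; this substitution gives
  \<open>|z|^(2 m)\<close>. As in \<open>schur_deflation\<close> the triangular part of
  \<open>shr m v\<close> is absorbed linearly, but by left multiplication instead of
  conjugation.\<close>

lemma QL_integral:
 assumes h: "Ps : \<B> (lebm (Suc m) (Suc n))"
  and inv: "!!U M. uni (Suc m) U ==> M : \<M> (Suc m) (Suc n) ==> Ps (U * M) = Ps M"
 shows "(\<integral>P|Suc m,Suc n. Ps P) =
  kap m * (\<integral>C|m,n. \<integral>b|1,n. \<integral>z. ennreal (cmod z ^ (2 * m)) * Ps (lblk m C b z))"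
proof -
 let ?I = "%D c b a. Ps (blk D c b a)"
 let ?G = "%D v b a. ennreal (cmod a ^ (2 * m)) * Ps (blk D (a \<cdot> v) b a)"
 let ?H = "%C v b a. ennreal (cmod a ^ (2 * m)) * Ps (shr m v * lblk m C b a)"
 let ?F = "%C b a. ennreal (cmod a ^ (2 * m)) * Ps (lblk m C b a)"
 define J where "J = (\<integral>C|m,n. \<integral>b|1,n. \<integral>a. ?F C b a)"
 note sf = sigma_finite_lebm sigma_finite_lborel
 note mH = measurable_QL_shr[OF h, where k = "2 * m"]
 have fixed: "(\<integral>C|m,n. \<integral>a. \<integral>b|1,n. ?H C v b a) = ennreal (1 / (1 + fro v) ^ Suc m) * J"
  if v: "v : \<M> m 1" for v
 proof -
  obtain U Ga sg rh where U: "uni (Suc m) U" and G: "Ga : \<M> m m" and s: "sg : \<M> 1 m"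
   and rh: "0 < rh" "rh\<^sup>2 = 1 + fro v" and S: "shr m v = U * lblk m Ga sg (complex_of_real rh)"
   and dG: "cmod (det Ga) * rh = 1"
   by (rule shr_QL[OF v])
  let ?r = "complex_of_real rh"
  have r0: "?r ~= 0" using rh by simp
  have dG0: "det Ga ~= 0" using dG by auto
  \<comment> \<open>Powers of \<open>rh\<close> from the modulus of the corner, the \<open>n\<close>
    entries of \<open>b\<close>, the area element of the corner and the \<open>n\<close> columns of
    \<open>C\<close>, in this order. The second and the fourth cancel, and
    \<open>rh ^ (2 * m + 2)\<close> remains in the denominator.\<close>
  let ?w1 = "ennreal (1 / rh ^ (2 * m))" and ?w2 = "ennreal (1 / rh ^ (2 * n))"
   and ?w3 = "ennreal (1 / rh\<^sup>2)" and ?w4 = "ennreal (rh ^ (2 * n))"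
  have pt: "?H C v b a = ?w1 * ?F (Ga * C) (?r \<cdot> (b * 1\<^sub>m n) + sg * C) (?r * a)"
   if C: "C : \<M> m n" and b: "b : \<M> 1 n" for C b a
  proof -
   have GC: "Ga * C : \<M> m n" using G C by simp
   have R: "lblk m Ga sg ?r : \<M> (Suc m) (Suc m)" and M: "lblk m C b a : \<M> (Suc m) (Suc n)"
    using G C by auto
   have "shr m v * lblk m C b a = U * (lblk m Ga sg ?r * lblk m C b a)"
    unfolding S by (rule assoc_mult_mat[OF uniD(1)[OF U] R M])
   hence "Ps (shr m v * lblk m C b a) = Ps (lblk m Ga sg ?r * lblk m C b a)"
    using inv[OF U mult_carrier_mat[OF R M]] by simp
   also have "lblk m Ga sg ?r * lblk m C b a = lblk m (Ga * C) (sg * C + ?r \<cdot> b) (?r * a)"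
    by (rule QL_mult[OF G s C b])
   also have "sg * C + ?r \<cdot> b = ?r \<cdot> (b * 1\<^sub>m n) + sg * C"
   proof -
    have "sg * C : \<M> 1 n" using s C by simp
    thus ?thesis using b by (simp add: comm_add_mat[of "sg * C" 1 n])
   qed
   finally have e: "Ps (shr m v * lblk m C b a) = Ps (lblk m (Ga * C) (?r \<cdot> (b * 1\<^sub>m n) + sg * C) (?r * a))" .
   have "ennreal (cmod a ^ (2 * m)) = ?w1 * ennreal (cmod (?r * a) ^ (2 * m))"
    using rh by (simp add: ennreal_mult[symmetric] norm_mult power_mult_distrib)
   thus ?thesis unfolding e by (simp add: mult.assoc)
  qed
  have mF: "(%b. ?F C b a) : \<B> (lebm 1 n)" if "C : \<M> m n" for C a
   by (rule measurable_QL[OF h]) (use that in auto)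
  have mF2: "(%(a, b). ?F C b a) : \<B> (lborel \<Otimes> lebm 1 n)" if "C : \<M> m n" for C
   unfolding case_prod_beta' by (rule measurable_QL[OF h]) (use that in auto)
  have mFa: "(%a. \<integral>b|1,n. ?F C b a) : \<B> borel" if "C : \<M> m n" for C
   using measurable_nn_integral_lebm[OF mF2[OF that]] by simp
  have mF3: "(%C. \<integral>a. \<integral>b|1,n. ?F C b a) : \<B> (lebm m n)"
  proof (rule measurable_nn_integral_lborel)
   have "(%(q, b). ?F (fst q) b (snd q)) : \<B> ((lebm m n \<Otimes> lborel) \<Otimes> lebm 1 n)"
    unfolding case_prod_beta' by (rule measurable_QL[OF h]; measurable)
   from measurable_nn_integral_lebm[OF this]
   show "(%(C, a). \<integral>b|1,n. ?F C b a) : \<B> (lebm m n \<Otimes> lborel)"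
    by (simp add: case_prod_beta')
  qed
  have mF3': "(%C. \<integral>a. \<integral>b|1,n. ?F (Ga * C) b a) : \<B> (lebm m n)"
   by (rule measurable_mult_const_left[OF G mF3])
  have "(\<integral>C|m,n. \<integral>a. \<integral>b|1,n. ?H C v b a) =
    (\<integral>C|m,n. ?w1 * (?w2 * (?w3 * (\<integral>a. \<integral>b|1,n. ?F (Ga * C) b a))))"
  proof (rule nn_integral_cong)
   fix C assume "C : space (lebm m n)"
   hence C: "C : \<M> m n" by simp
   have GC: "Ga * C : \<M> m n" and sC: "sg * C : \<M> 1 n" using G C s by auto
   let ?L = "%a. \<integral>b|1,n. ?F (Ga * C) b a"
   have "(\<integral>a. \<integral>b|1,n. ?H C v b a) = (\<integral>a. ?w1 * (?w2 * ?L (?r * a)))"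
   proof (rule nn_integral_cong)
    fix a
    have mB: "(%b. ?F (Ga * C) (?r \<cdot> (b * 1\<^sub>m n) + sg * C) (?r * a)) : \<B> (lebm 1 n)"
     by (rule measurable_compose[OF _ mF[OF GC]], intro measurable_mat_add measurable_mat_smult borel_measurable_const
       measurable_mat_mult[OF lebm_ident measurable_const_mat[OF one_carrier_mat]] measurable_const_mat sC)
    have "(\<integral>b|1,n. ?H C v b a) = (\<integral>b|1,n. ?w1 * ?F (Ga * C) (?r \<cdot> (b * 1\<^sub>m n) + sg * C) (?r * a))"
     by (rule nn_integral_cong) (simp add: pt[OF C])
    also have "... = ?w1 * (\<integral>b|1,n. ?F (Ga * C) (?r \<cdot> (b * 1\<^sub>m n) + sg * C) (?r * a))"
     by (rule nn_integral_cmult[OF mB])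
    also have "(\<integral>b|1,n. ?F (Ga * C) (?r \<cdot> (b * 1\<^sub>m n) + sg * C) (?r * a)) = ?w2 * ?L (?r * a)"
    proof (rule ennreal_solve)
     have "?L (?r * a) = ennreal ((cmod (det (1\<^sub>m n)))\<^sup>2 * ((cmod ?r)\<^sup>2) ^ n) * (\<integral>b|1,n. ?F (Ga * C) (?r \<cdot> (b * 1\<^sub>m n) + sg * C) (?r * a))"
      by (rule nn_integral_row_affine[OF mF[OF GC] one_carrier_mat _ r0 sC]) simp
     thus "?L (?r * a) = ennreal (rh ^ (2 * n)) * (\<integral>b|1,n. ?F (Ga * C) (?r \<cdot> (b * 1\<^sub>m n) + sg * C) (?r * a))"
      using rh by (simp add: power_mult)
    qed (use rh in simp)
    finally show "(\<integral>b|1,n. ?H C v b a) = ?w1 * (?w2 * ?L (?r * a))" .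
   qed
   also have "... = ?w1 * (?w2 * (\<integral>a. ?L (?r * a)))"
   proof -
    have [measurable]: "(%a. ?L (?r * a)) : \<B> borel"
     by (rule measurable_compose[OF _ mFa[OF GC]]) measurable
    show ?thesis by (simp add: nn_integral_cmult)
   qed
   also have "(\<integral>a. ?L (?r * a)) = ?w3 * (\<integral>a. ?L a)"
   proof (rule ennreal_solve)
    show "(\<integral>a. ?L a) = ennreal (rh\<^sup>2) * (\<integral>a. ?L (?r * a))"
     using nn_integral_lborel_complex_scale[OF r0 mFa[OF GC]] rh by simp
   qed (use rh(1) in simp)
   finally show "(\<integral>a. \<integral>b|1,n. ?H C v b a) = ?w1 * (?w2 * (?w3 * (\<integral>a. ?L a)))" .
  qed
  also have "... = ?w1 * (?w2 * (?w3 * (\<integral>C|m,n. \<integral>a. \<integral>b|1,n. ?F (Ga * C) b a)))"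
   using mF3' by (simp add: nn_integral_cmult)
  also have "(\<integral>C|m,n. \<integral>a. \<integral>b|1,n. ?F (Ga * C) b a) =
    ?w4 * (\<integral>C|m,n. \<integral>a. \<integral>b|1,n. ?F C b a)"
  proof -
   have "(\<integral>C|m,n. \<integral>a. \<integral>b|1,n. ?F C b a) =
     ennreal ((cmod (det Ga) ^ (2 * n))) * (\<integral>C|m,n. \<integral>a. \<integral>b|1,n. ?F (Ga * C) b a)"
    using nn_integral_lebm_mult_left[OF mF3 G dG0] by (simp add: ennreal_power power_mult)
   hence "(\<integral>C|m,n. \<integral>a. \<integral>b|1,n. ?F (Ga * C) b a) =
    ennreal (1 / (cmod (det Ga) ^ (2 * n))) * (\<integral>C|m,n. \<integral>a. \<integral>b|1,n. ?F C b a)"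
    by (intro ennreal_solve) (use dG0 in auto)
   moreover have "1 / (cmod (det Ga) ^ (2 * n)) = rh ^ (2 * n)"
   proof -
    have "(cmod (det Ga) * rh) ^ (2 * n) = 1" using dG by simp
    thus ?thesis using dG0 by (simp add: power_mult_distrib field_simps)
   qed
   ultimately show ?thesis by simp
  qed
  also have "(\<integral>C|m,n. \<integral>a. \<integral>b|1,n. ?F C b a) = J"
   unfolding J_def
  proof (rule nn_integral_cong)
   fix C assume "C : space (lebm m n)"
   hence C: "C : \<M> m n" by simp
   show "(\<integral>a. \<integral>b|1,n. ?F C b a) = (\<integral>b|1,n. \<integral>a. ?F C b a)"
    by (intro nn_integral_swap sf mF2[OF C])
  qed
  also have "?w1 * (?w2 * (?w3 * (?w4 * J))) = ennreal (1 / (1 + fro v) ^ Suc m) * J"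
  proof -
   have "?w1 * (?w2 * (?w3 * (?w4 * J))) = (?w1 * ?w2 * ?w3 * ?w4) * J" by (simp add: mult.assoc)
   also have "?w1 * ?w2 * ?w3 * ?w4 = ennreal (1 / rh ^ (2 * m) * (1 / rh ^ (2 * n)) * (1 / rh\<^sup>2) * rh ^ (2 * n))"
    using rh(1) by (simp only: ennreal_mult[symmetric] zero_le_divide_iff zero_le_power less_imp_le zero_le_one simp_thms mult_nonneg_nonneg)
   also have "1 / rh ^ (2 * m) * (1 / rh ^ (2 * n)) * (1 / rh\<^sup>2) * rh ^ (2 * n) = 1 / (rh\<^sup>2) ^ Suc m"
    using rh(1) by (simp add: power_mult)
   finally show ?thesis using rh(2) by simp
  qed
  finally show ?thesis .
 qed
 have "(\<integral>P|Suc m,Suc n. Ps P) = (\<integral>D|m,n. \<integral>c|m,1. \<integral>b|1,n. \<integral>a. ?I D c b a)"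
  by (rule nn_integral_lebm_blk[OF h])
 also have "... = (\<integral>D|m,n. \<integral>b|1,n. \<integral>c|m,1. \<integral>a. ?I D c b a)"
  by (intro nn_integral_swap23 sf) (rule measurable_compose[OF _ h], rule measurable_blk; measurable)
 also have "... = (\<integral>D|m,n. \<integral>b|1,n. \<integral>a. \<integral>c|m,1. ?I D c b a)"
  by (intro nn_integral_swap34 sf) (rule measurable_compose[OF _ h], rule measurable_blk; measurable)
 \<comment> \<open>The last column is written as a multiple of the corner \<open>a\<close>, which
   vanishes only on a null set.\<close>
 also have "... = (\<integral>D|m,n. \<integral>b|1,n. \<integral>a. \<integral>v|m,1. ?G D v b a)"
 proof (rule nn_integral_cong, rule nn_integral_cong)
  fix D b assume "D : space (lebm m n)" "b : space (lebm 1 n)"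
  hence D: "D : \<M> m n" and b: "b : \<M> 1 n" by auto
  have "AE a in lborel. a \<notin> {0 :: complex}"
   by (intro AE_not_in) (simp add: finite_imp_null_set_lborel)
  thus "(\<integral>a. \<integral>c|m,1. ?I D c b a) = (\<integral>a. \<integral>v|m,1. ?G D v b a)"
  proof (intro nn_integral_cong_AE, elim AE_mp, intro AE_I2 impI)
   fix a :: complex assume "a \<notin> {0}"
   hence a: "a ~= 0" by simp
   have mi: "(%c. ?I D c b a) : \<B> (lebm m 1)"
    by (rule measurable_compose[OF _ h], rule measurable_blk) (use D b in auto)
   have mi': "(%v. ?I D (a \<cdot> v) b a) : \<B> (lebm m 1)"
    by (rule measurable_compose[OF measurable_mat_smult[OF borel_measurable_const lebm_ident] mi])
   have "(\<integral>c|m,1. ?I D c b a) = ennreal ((cmod a)\<^sup>2) ^ m * (\<integral>v|m,1. ?I D (a \<cdot> v) b a)"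
    using nn_integral_lebm_scale[OF mi a] by simp
   also have "ennreal ((cmod a)\<^sup>2) ^ m = ennreal (cmod a ^ (2 * m))" by (simp add: ennreal_power power_mult)
   also have "ennreal (cmod a ^ (2 * m)) * (\<integral>v|m,1. ?I D (a \<cdot> v) b a) = (\<integral>v|m,1. ?G D v b a)"
    by (rule nn_integral_cmult[OF mi', symmetric])
   finally show "(\<integral>c|m,1. ?I D c b a) = (\<integral>v|m,1. ?G D v b a)" .
  qed
 qed
 also have "... = (\<integral>D|m,n. \<integral>b|1,n. \<integral>v|m,1. \<integral>a. ?G D v b a)"
  by (intro nn_integral_swap34 sf) (rule measurable_QL[OF h]; (rule measurable_mat_smult)?; measurable)
 also have "... = (\<integral>D|m,n. \<integral>v|m,1. \<integral>b|1,n. \<integral>a. ?G D v b a)"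
  by (intro nn_integral_swap23 sf) (rule measurable_QL[OF h]; (rule measurable_mat_smult)?; measurable)
 also have "... = (\<integral>v|m,1. \<integral>D|m,n. \<integral>b|1,n. \<integral>a. ?G D v b a)"
  by (intro nn_integral_swap12 sf) (rule measurable_QL[OF h]; (rule measurable_mat_smult)?; measurable)
 also have "... = (\<integral>v|m,1. \<integral>b|1,n. \<integral>D|m,n. \<integral>a. ?G D v b a)"
  by (intro nn_integral_swap23 sf) (rule measurable_QL[OF h]; (rule measurable_mat_smult)?; measurable)
 also have "... = (\<integral>v|m,1. \<integral>b|1,n. \<integral>a. \<integral>D|m,n. ?G D v b a)"
  by (intro nn_integral_swap34 sf) (rule measurable_QL[OF h]; (rule measurable_mat_smult)?; measurable)
 also have "... = (\<integral>v|m,1. \<integral>b|1,n. \<integral>a. \<integral>C|m,n. ?H C v b a)"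
 proof (rule nn_integral_cong, rule nn_integral_cong, rule nn_integral_cong)
  fix v b a assume "v : space (lebm m 1)" "b : space (lebm 1 n)"
  hence v: "v : \<M> m 1" and b: "b : \<M> 1 n" by auto
  hence vb: "v * b : \<M> m n" by auto
  have mg: "(%D. ?G D v b a) : \<B> (lebm m n)"
   by (rule measurable_QL[OF h]) (use v b in auto)
  have "(\<integral>D|m,n. ?G D v b a) = (\<integral>C|m,n. ?G (C + v * b) v b a)"
   by (rule nn_integral_lebm_translate[OF mg vb])
  also have "... = (\<integral>C|m,n. ?H C v b a)"
   by (rule nn_integral_cong) (use shr_mult_blk[OF _ v b] in simp)
  finally show "(\<integral>D|m,n. ?G D v b a) = (\<integral>C|m,n. ?H C v b a)" .
 qed
 also have "... = (\<integral>v|m,1. \<integral>b|1,n. \<integral>C|m,n. \<integral>a. ?H C v b a)"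
  by (intro nn_integral_swap34 sf) (rule mH; measurable)
 also have "... = (\<integral>v|m,1. \<integral>C|m,n. \<integral>b|1,n. \<integral>a. ?H C v b a)"
  by (intro nn_integral_swap23 sf) (rule mH; measurable)
 also have "... = (\<integral>v|m,1. \<integral>C|m,n. \<integral>a. \<integral>b|1,n. ?H C v b a)"
  by (intro nn_integral_swap34 sf) (rule mH; measurable)
 also have "... = (\<integral>v|m,1. ennreal (1 / (1 + fro v) ^ Suc m) * J)"
  by (rule nn_integral_cong) (simp add: fixed)
 also have "... = kap m * J"
  unfolding kap_def by (rule nn_integral_multc) (use measurable_fro[OF lebm_ident] in measurable)
 finally show ?thesis unfolding J_def .
qed

section \<open>Gaussian integrals and positivity of the constants\<close>

lemma lborel_complex_eq_pair: "\<L> = distr (lborel \<Otimes> lborel) borel (%(x, y). Complex x y)"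
proof (rule lborel_eqI)
 fix l u :: complex
 assume le: "!!b. b : Basis ==> inner l b <= inner u b"
 have le': "Re l <= Re u" "Im l <= Im u" using le[of 1] le[of \<i>] by (auto simp: Basis_complex_def)
 have m: "(%(x, y). Complex x y) : \<B> (lborel \<Otimes> lborel)"
 proof -
  have "(%(x, y). complex_of_real x + \<i> * complex_of_real y) : \<B> (lborel \<Otimes> lborel)" by measurable
  thus ?thesis by (simp add: Complex_eq)
 qed
 have pre: "(%(x, y). Complex x y) -` box l u \<inter> space (lborel \<Otimes> lborel) = {Re l<..<Re u} \<times> {Im l<..<Im u}"
  by (auto simp: box_def Basis_complex_def space_pair_measure)
 have "emeasure (distr (lborel \<Otimes> lborel) borel (%(x, y). Complex x y)) (box l u) =
   emeasure (lborel \<Otimes> lborel) ({Re l<..<Re u} \<times> {Im l<..<Im u})"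
  by (subst emeasure_distr[OF m]) (auto simp: pre)
 also have "... = ennreal (Re u - Re l) * ennreal (Im u - Im l)"
  using le' by (simp add: lborel.emeasure_pair_measure_Times)
 also have "... = ennreal (prod (inner (u - l)) Basis)"
  using le' by (simp add: Basis_complex_def ennreal_mult)
 finally show "emeasure (distr (lborel \<Otimes> lborel) borel (%(x, y). Complex x y)) (box l u) = ennreal (prod (inner (u - l)) Basis)" .
qed simp

text \<open>Half of the Gaussian exponent is held in reserve to dominate polynomial factors.\<close>

lemma nn_integral_gaussian_half_finite: "(\<integral>z. ennreal (exp (- (cmod z)\<^sup>2 / 2))) < \<infinity>"
proof -
 let ?g = "%x. ennreal (exp (- x\<^sup>2 / 2))"
 have m: "(%(x, y). Complex x y) : \<B> (lborel \<Otimes> lborel)"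
 proof -
  have "(%(x, y). complex_of_real x + \<i> * complex_of_real y) : \<B> (lborel \<Otimes> lborel)" by measurable
  thus ?thesis by (simp add: Complex_eq)
 qed
 have g: "(\<integral>x. ?g x) < \<infinity>"
 proof -
  have e: "?g x = ennreal (sqrt (2 * pi)) * ennreal (normal_density 0 1 x)" for x :: real
   by (simp add: normal_density_def ennreal_mult[symmetric])
  have "(\<integral>x. ?g x) = ennreal (sqrt (2 * pi)) * (\<integral>x. ennreal (normal_density 0 1 x))"
   unfolding e by (rule nn_integral_cmult) measurable
  also have "(\<integral>x. ennreal (normal_density 0 1 x)) < \<infinity>"
   using integrable_normal_density[of 1 0] by (simp add: integrable_iff_bounded)
  hence "ennreal (sqrt (2 * pi)) * (\<integral>x. ennreal (normal_density 0 1 x)) < \<infinity>"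
   by (simp add: ennreal_mult_less_top)
  finally show ?thesis .
 qed
 have "(\<integral>z. ennreal (exp (- (cmod z)\<^sup>2 / 2))) = (\<integral>\<^sup>+p. ennreal (exp (- (cmod (case p of (x, y) => Complex x y))\<^sup>2 / 2)) \<partial>(lborel \<Otimes> lborel))"
  by (subst lborel_complex_eq_pair, rule nn_integral_distr[OF m]) measurable
 also have "... = (\<integral>\<^sup>+p. ?g (fst p) * ?g (snd p) \<partial>(lborel \<Otimes> lborel))"
  by (intro nn_integral_cong) (auto simp: cmod_def ennreal_mult[symmetric] exp_add[symmetric] add_divide_distrib)
 also have "... = (\<integral>x. \<integral>y. ?g x * ?g y)"
  by (subst lborel.nn_integral_fst[symmetric]) auto
 also have "... = (\<integral>x. ?g x * (\<integral>y. ?g y))"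
  by (intro nn_integral_cong nn_integral_cmult) measurable
 also have "... = (\<integral>x. ?g x) * (\<integral>y. ?g y)"
  by (rule nn_integral_multc) measurable
 also have "... < \<infinity>" using g by (simp add: ennreal_mult_less_top)
 finally show ?thesis .
qed

text \<open>The weight of a single scalar variable; for factor number \<open>j\<close> of the
  product, \<open>m\<close> is the surplus \<open>n j - n 1\<close>.\<close>

definition gx :: "nat => complex => ennreal" where
 "gx m x = ennreal (cmod x ^ (2 * m) * exp (- (cmod x)\<^sup>2))"

lemma measurable_gx [measurable]: "gx m : \<B> borel"
 unfolding gx_def by measurable

lemma power_le_exp: "0 <= x ==> x ^ p <= fact p * exp (x :: real)"
proof -
 assume x: "0 <= x"
 have s: "summable (%n. x ^ n /\<^sub>R fact n)" by (rule summable_exp_generic)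
 have "(\<Sum>n\<in>{p}. x ^ n /\<^sub>R fact n) <= (\<Sum>n. x ^ n /\<^sub>R fact n)"
  by (rule sum_le_suminf[OF s]) (use x in auto)
 hence "x ^ p / fact p <= exp x" by (simp add: exp_def divide_inverse mult.commute)
 thus ?thesis by (simp add: field_simps)
qed

lemma AE_lborel_complex_neq_0: "AE z in lborel. z ~= (0::complex)"
 using AE_not_in[of "{0::complex}" lborel] by (simp add: finite_imp_null_set_lborel)

text \<open>With \<open>t = |z|^2 / 2\<close> the bound \<open>t^m <= m! exp t\<close> shows that
  the integrand is at most \<open>2^m m!\<close> times a Gaussian with half the exponent.\<close>

lemma nn_integral_gx: "(\<integral>z. gx m z) < \<infinity>" "(\<integral>z. gx m z) ~= 0"
proof -
 let ?C = "2 ^ m * fact m :: real"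
 have le: "gx m z <= ennreal ?C * ennreal (exp (- (cmod z)\<^sup>2 / 2))" for z
 proof -
  let ?t = "(cmod z)\<^sup>2 / 2"
  have "?t ^ m <= fact m * exp ?t" by (rule power_le_exp) simp
  hence "2 ^ m * ?t ^ m <= 2 ^ m * (fact m * exp ?t)" by (rule mult_left_mono) simp
  hence "cmod z ^ (2 * m) <= ?C * exp ?t" by (simp add: power_mult power_divide mult.assoc)
  hence "cmod z ^ (2 * m) * exp (- (cmod z)\<^sup>2) <= ?C * exp ?t * exp (- (cmod z)\<^sup>2)"
   by (rule mult_right_mono) simp
  also have "... = ?C * exp (- (cmod z)\<^sup>2 / 2)"
   by (simp only: mult.assoc exp_add[symmetric]) simp
  finally show ?thesis unfolding gx_def by (subst ennreal_mult[symmetric]) (auto intro: ennreal_leI)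
 qed
 have "(\<integral>z. gx m z) <= (\<integral>z. ennreal ?C * ennreal (exp (- (cmod z)\<^sup>2 / 2)))"
  by (intro nn_integral_mono le)
 also have "... = ennreal ?C * (\<integral>z. ennreal (exp (- (cmod z)\<^sup>2 / 2)))"
  by (rule nn_integral_cmult) measurable
 also have "... < \<infinity>" using nn_integral_gaussian_half_finite by (simp add: ennreal_mult_less_top)
 finally show "(\<integral>z. gx m z) < \<infinity>" .
 show "(\<integral>z. gx m z) ~= 0"
 proof
  assume "(\<integral>z. gx m z) = 0"
  hence "AE z in lborel. gx m z = 0" by (subst (asm) nn_integral_0_iff_AE) auto
  with AE_lborel_complex_neq_0 have "AE z in \<L>. False"
   by eventually_elim (auto simp: gx_def)
  thus False
   using AE_iff_measurable[of UNIV "lborel :: complex measure" "%_. False"] by (simp add: emeasure_lborel_UNIV)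
 qed
qed

lemma nn_integral_lebm_gaussian:
 "(\<integral>A|r,c. gau A) = (\<integral>z. gx 0 z) ^ (r * c)"
proof -
 let ?I = "{..<r} \<times> {..<c}"
 have m: "(%A. gau A) : \<B> (lebm r c)"
  using measurable_fro[OF lebm_ident] by measurable
 have "(\<integral>A|r,c. gau A) = (\<integral>\<^sup>+x. (\<Prod>ij\<in>?I. gx 0 (x ij)) \<partial>\<P> ?I)"
 proof (unfold nn_integral_lebm[OF m], rule nn_integral_cong)
  fix x :: "nat \<times> nat => complex"
  have "fro (mat r c x) = (\<Sum>ij\<in>?I. (cmod (x ij))\<^sup>2)"
   unfolding fro_carrier[OF mat_carrier] by (simp add: sum.cartesian_product)
  hence "gau (mat r c x) = ennreal (\<Prod>ij\<in>?I. exp (- (cmod (x ij))\<^sup>2))"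
   by (simp add: sum_negf[symmetric] exp_sum)
  also have "... = (\<Prod>ij\<in>?I. ennreal (exp (- (cmod (x ij))\<^sup>2)))"
   by (rule prod_ennreal[symmetric]) simp
  finally show "gau (mat r c x) = (\<Prod>ij\<in>?I. gx 0 (x ij))" by (simp add: gx_def)
 qed
 also have "... = (\<Prod>ij\<in>?I. \<integral>z. gx 0 z)"
  by (rule product_sigma_finite.product_nn_integral_prod[OF product_lborel]) auto
 finally show ?thesis by (simp add: card_cartesian_product)
qed

lemma ennreal_power_finite_pos: "(a :: ennreal) < \<infinity> ==> a ~= 0 ==> a ^ k < \<infinity> & a ^ k ~= 0"
 by (induction k) (auto simp: ennreal_mult_less_top)

lemma nn_integral_lebm_gaussian_finite_pos:
 "(\<integral>A|r,c. gau A) < \<infinity>" "(\<integral>A|r,c. gau A) ~= 0"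
 unfolding nn_integral_lebm_gaussian using ennreal_power_finite_pos[OF nn_integral_gx[of 0]] by auto

lemma fro_empty: "A : \<M> r c ==> r = 0 \<or> c = 0 ==> fro A = 0"
 by (auto simp: fro_carrier)

text \<open>The QL formula is tested on Gaussian columns: for \<open>n = 0\<close> the block and the
  row are empty and one scalar integral is left. Both known integrals are finite and nonzero, hence
  so is the factor between them.\<close>

lemma kap_finite_pos: "kap m < \<infinity>" "kap m ~= 0"
proof -
 let ?Ps = "%A. gau A"
 have m: "?Ps : \<B> (lebm (Suc m) (Suc 0))"
  using measurable_fro[OF lebm_ident] by measurable
 have "(\<integral>A|Suc m,Suc 0. ?Ps A) =
   kap m * (\<integral>C|m,0. \<integral>b|1,0. \<integral>z. ennreal (cmod z ^ (2 * m)) * ?Ps (lblk m C b z))"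
  by (rule QL_integral[OF m]) (simp add: fro_unitary_left)
 also have "(\<integral>C|m,0. \<integral>b|1,0. \<integral>z. ennreal (cmod z ^ (2 * m)) * ?Ps (lblk m C b z))
   = (\<integral>C|m,0. \<integral>b|1,0. \<integral>z. gx m z)"
 proof (rule nn_integral_cong, rule nn_integral_cong, rule nn_integral_cong)
  fix C b z assume "C : space (lebm m 0)" "b : space (lebm 1 0)"
  hence C: "C : \<M> m 0" and b: "b : \<M> 1 0" by auto
  have "fro (0\<^sub>m m 1) = 0" by (simp add: fro_def)
  hence "fro (lblk m C b z) = (cmod z)\<^sup>2"
   using fro_blk[OF C _ b, of "0\<^sub>m m 1" z] fro_empty[OF C] fro_empty[OF b] by simp
  thus "ennreal (cmod z ^ (2 * m)) * ?Ps (lblk m C b z) = gx m z"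
   by (simp add: gx_def ennreal_mult)
 qed
 also have "... = (\<integral>z. gx m z)"
  by (subst nn_integral_lebm_empty[where r = m and c = 0], simp, simp,
    subst nn_integral_lebm_empty[where r = 1 and c = 0], simp, simp, rule refl)
 finally have e: "(\<integral>A|Suc m,Suc 0. ?Ps A) = kap m * (\<integral>z. gx m z)" .
 note f = nn_integral_lebm_gaussian_finite_pos[of "Suc m" "Suc 0"]
 show "kap m ~= 0" using e f by auto
 show "kap m < \<infinity>"
 proof (rule ccontr)
  assume "\<not> kap m < \<infinity>"
  hence "kap m = \<infinity>" using less_top[of "kap m"] by simp
  thus False using e f nn_integral_gx(2)[of m] by (simp add: ennreal_top_mult)
 qed
qed

text \<open>For fixed other blocks the determinant is affine in the corner with slope
  \<open>det D\<close>, which is almost surely nonzero by induction.\<close>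

lemma AE_det_neq_0: "AE A in lebm n n. det A ~= 0"
proof (induction n)
 case 0
 thus ?case by (intro AE_I2) simp
next
 case (Suc n)
 let ?B = "{A : space (lebm (Suc n) (Suc n)). det A = 0}"
 have B: "?B : sets (lebm (Suc n) (Suc n))" using measurable_det[OF lebm_ident] by measurable
 have mB: "indicator ?B : \<B> (lebm (Suc n) (Suc n))"
  using B by (rule borel_measurable_indicator)
 have "emeasure (lebm (Suc n) (Suc n)) ?B = (\<integral>A|Suc n,Suc n. indicator ?B A)"
  by (rule nn_integral_indicator[OF B, symmetric])
 also have "... = (\<integral>D|n,n. \<integral>c|n,1. \<integral>b|1,n. \<integral>z. indicator ?B (blk D c b z))"
  by (rule nn_integral_lebm_blk[OF mB])
 also have "... = (\<integral>D|n,n. 0)"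
 proof (rule nn_integral_cong_AE, rule AE_mp[OF Suc.IH AE_I2], intro impI)
  fix D assume "D : space (lebm n n)" and dD: "det D ~= 0"
  hence D: "D : \<M> n n" by simp
  have "(\<integral>c|n,1. \<integral>b|1,n. \<integral>z. indicator ?B (blk D c b z)) = (\<integral>c|n,1. \<integral>b|1,n. 0)"
  proof (rule nn_integral_cong, rule nn_integral_cong)
   fix c b assume "c : space (lebm n 1)" "b : space (lebm 1 n)"
   hence c: "c : \<M> n 1" and b: "b : \<M> 1 n" by auto
   have "indicator ?B (blk D c b z) = (indicator {(b * adj_mat D * c) $$ (0, 0) / det D} z :: ennreal)" for z
    using dD D by (simp add: indicator_def det_blk[OF D c b] field_simps)
   thus "(\<integral>z. indicator ?B (blk D c b z)) = 0" by simp
  qed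
  thus "(\<integral>c|n,1. \<integral>b|1,n. \<integral>z. indicator ?B (blk D c b z)) = 0" by simp
 qed
 finally have "emeasure (lebm (Suc n) (Suc n)) ?B = 0" by simp
 thus ?case by (intro AE_I[of _ _ ?B] B) (simp_all add: subset_iff)
qed

section \<open>From tall matrices to square ones\<close>

lemma uni_lower_right: "uni n U ==> uni (d + n) (four_block_mat (1\<^sub>m d) (0\<^sub>m d n) (0\<^sub>m n d) U)"
proof -
 assume U: "uni n U"
 note C = uniD(1)[OF U]
 let ?V = "four_block_mat (1\<^sub>m d) (0\<^sub>m d n) (0\<^sub>m n d) U"
 have ct: "ctr ?V = four_block_mat (1\<^sub>m d) (0\<^sub>m d n) (0\<^sub>m n d) (ctr U)"
  by (rule eq_matI) (use C in \<open>auto simp: ctr_def\<close>)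
 have "ctr ?V * ?V = four_block_mat (1\<^sub>m d * 1\<^sub>m d + 0\<^sub>m d n * 0\<^sub>m n d) (1\<^sub>m d * 0\<^sub>m d n + 0\<^sub>m d n * U)
   (0\<^sub>m n d * 1\<^sub>m d + ctr U * 0\<^sub>m n d) (0\<^sub>m n d * 0\<^sub>m d n + ctr U * U)"
  unfolding ct by (rule mult_four_block_mat) (use C in auto)
 also have "... = four_block_mat (1\<^sub>m d) (0\<^sub>m d n) (0\<^sub>m n d) (1\<^sub>m n)"
  using C uniD(2)[OF U] right_mult_zero_mat[OF ctr_carrier[OF C], of d] left_mult_zero_mat[OF C, of d]
  by (simp add: left_mult_zero_mat[of "1\<^sub>m d" d d n])
 finally show ?thesis using C unfolding uni_def by simp
qed

text \<open>Unitary matrices acting on the lower rows leave the zero rows alone; this transfers left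
  invariance from the tall matrix to its square part.\<close>

lemma lower_right_append_rows:
 assumes U: "U : \<M> n n" and G: "G : \<M> n c"
 shows "four_block_mat (1\<^sub>m d) (0\<^sub>m d n) (0\<^sub>m n d) U * (0\<^sub>m d c @\<^sub>r G) = 0\<^sub>m d c @\<^sub>r (U * G)"
proof -
 have "four_block_mat (1\<^sub>m d) (0\<^sub>m d n) (0\<^sub>m n d) U * four_block_mat (0\<^sub>m d c) (0\<^sub>m d 0) G (0\<^sub>m n 0) =
  four_block_mat (1\<^sub>m d * 0\<^sub>m d c + 0\<^sub>m d n * G) (1\<^sub>m d * 0\<^sub>m d 0 + 0\<^sub>m d n * 0\<^sub>m n 0)
   (0\<^sub>m n d * 0\<^sub>m d c + U * G) (0\<^sub>m n d * 0\<^sub>m d 0 + U * 0\<^sub>m n 0)"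
  by (rule mult_four_block_mat) (use U G in auto)
 also have "... = four_block_mat (0\<^sub>m d c) (0\<^sub>m d 0) (U * G) (0\<^sub>m n 0)"
  by (rule cong_four_block_mat; rule eq_matI) (use U G in \<open>auto simp: scalar_prod_def\<close>)
 finally show ?thesis using U G by (simp add: append_rows_def)
qed

text \<open>The QL formula peels the same data off a tall and off a square matrix. The powers of the
  corner differ by \<open>|z|^(2 d)\<close>, which is exactly the factor gained by
  \<open>|det G|^(2 d)\<close>. By left invariance the surplus rows end up as zero rows on
  top.\<close>

lemma rect_reduction:
 "\<exists>k. 0 < k & k < \<infinity> & (\<forall>Ps :: complex mat => ennreal. Ps : \<B> (lebm (d + n) n) -->
   (\<forall>U M :: complex mat. uni (d + n) U --> M : \<M> (d + n) n --> Ps (U * M) = Ps M) -->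
   (\<integral>X|d + n,n. Ps X) = k * (\<integral>G|n,n. ennreal (cmod (det G) ^ (2 * d)) * Ps (0\<^sub>m d n @\<^sub>r G)))"
proof (induction n)
 case 0
 show ?case
 proof (intro exI[of _ 1] conjI allI impI)
  fix Ps :: "complex mat => ennreal" assume m: "Ps : \<B> (lebm (d + 0) 0)"
  have e: "0\<^sub>m d 0 @\<^sub>r 0\<^sub>m 0 0 = 0\<^sub>m d 0" by (rule eq_matI) (auto simp: append_rows_def)
  have m2: "(%G. ennreal (cmod (det G) ^ (2 * d)) * Ps (0\<^sub>m d 0 @\<^sub>r G)) : \<B> (lebm 0 0)"
   by (intro measurable_times_ennreal measurable_norm_ennreal measurable_det[OF lebm_ident] measurable_compose[OF _ m]
     measurable_append_rows measurable_const_mat lebm_ident) auto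
  show "(\<integral>X|d + 0,0. Ps X) = 1 * (\<integral>G|0,0. ennreal (cmod (det G) ^ (2 * d)) * Ps (0\<^sub>m d 0 @\<^sub>r G))"
   using nn_integral_lebm_empty[OF m] nn_integral_lebm_empty[OF m2] by (simp add: e)
 qed auto
next
 case (Suc n)
 obtain k where k: "0 < k" "k < \<infinity>" and IH: "!!Ps :: complex mat => ennreal. Ps : \<B> (lebm (d + n) n) ==>
   (!!U M :: complex mat. uni (d + n) U ==> M : \<M> (d + n) n ==> Ps (U * M) = Ps M) ==>
   (\<integral>X|d + n,n. Ps X) = k * (\<integral>G|n,n. ennreal (cmod (det G) ^ (2 * d)) * Ps (0\<^sub>m d n @\<^sub>r G))"
  using Suc by blast
 let ?m = "d + n"
 show ?case
 \<comment> \<open>A QL step costs \<open>kap (d + n)\<close> on the tall side and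
   \<open>kap n\<close> on the square side; \<open>k\<close> comes from the smaller block.\<close>
 proof (intro exI[of _ "kap ?m * k / kap n"] conjI allI impI)
  show "0 < kap ?m * k / kap n"
   using k kap_finite_pos[of ?m] kap_finite_pos[of n]
   by (auto simp: ennreal_zero_less_mult_iff zero_less_iff_neq_zero less_top)
  have "kap ?m * k / kap n ~= \<infinity>"
   using k kap_finite_pos[of ?m] kap_finite_pos[of n]
   by (auto simp: ennreal_divide_eq_top_iff ennreal_mult_eq_top_iff)
  thus "kap ?m * k / kap n < \<infinity>" by (simp add: less_top)
  fix Ps :: "complex mat => ennreal" assume m0: "Ps : \<B> (lebm (d + Suc n) (Suc n))"
   and inv0: "\<forall>U M :: complex mat. uni (d + Suc n) U --> M : \<M> (d + Suc n) (Suc n) --> Ps (U * M) = Ps M"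
  have m: "Ps : \<B> (lebm (Suc ?m) (Suc n))" using m0 by simp
  have inv: "Ps (U * M) = Ps M" if "uni (Suc ?m) U" "M : \<M> (Suc ?m) (Suc n)" for U M :: "complex mat"
   using inv0 that by simp
  \<comment> \<open>Both sides are brought to this integrand, with the determinant power of the
    smaller block kept apart from the power of the corner.\<close>
  let ?Q = "%G b z. ennreal (cmod z ^ (2 * ?m)) * (ennreal (cmod (det G) ^ (2 * d)) * Ps (blk (0\<^sub>m d n @\<^sub>r G) (0\<^sub>m ?m 1) b z))"
  let ?T = "\<integral>\<^sup>+G. (\<integral>b|1,n. \<integral>z. ?Q G b z) \<partial>lebm n n"
  let ?F = "%C b z. ennreal (cmod z ^ (2 * ?m)) * Ps (blk C (0\<^sub>m ?m 1) b z)"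
  note mF = measurable_QL[OF m _ measurable_const_mat[OF zero_carrier_mat], where k = "2 * ?m"]
  have mQ: "(%x. ?Q (G x) (b x) (z x)) : \<B> N"
   if "G : measurable N (lebm n n)" "b : measurable N (lebm 1 n)" "z : \<B> N" for G b z and N :: "(complex mat \<times> complex mat \<times> complex) measure"
   by (intro measurable_times_ennreal measurable_norm_ennreal measurable_det[where n = n] measurable_compose[OF _ m]
     measurable_blk measurable_append_rows measurable_const_mat that) auto
  have mQ2: "(%x. ?Q (G x) (b x) (z x)) : \<B> N"
   if "G : measurable N (lebm n n)" "b : measurable N (lebm 1 n)" "z : \<B> N" for G b z and N :: "((complex mat \<times> complex) \<times> complex mat) measure"
   by (intro measurable_times_ennreal measurable_norm_ennreal measurable_det[where n = n] measurable_compose[OF _ m]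
     measurable_blk measurable_append_rows measurable_const_mat that) auto
  have sw4: "(\<integral>C|r,n. \<integral>b|1,n. \<integral>z. f C b z) = (\<integral>b|1,n. \<integral>z. \<integral>C|r,n. f C b z)"
   if f: "(%p. f (fst p) (fst (snd p)) (snd (snd p))) : \<B> (lebm r n \<Otimes> lebm 1 n \<Otimes> lborel)"
   for f :: "complex mat => complex mat => complex => ennreal" and r
  proof -
   have "(\<integral>C|r,n. \<integral>b|1,n. \<integral>z. f C b z) = (\<integral>b|1,n. \<integral>C|r,n. \<integral>z. f C b z)"
   proof (intro nn_integral_swap sigma_finite_lebm)
    have "(%p. (fst (fst p), snd (fst p), snd p)) : (lebm r n \<Otimes> lebm 1 n) \<Otimes> lborel \<rightarrow>\<^sub>M (lebm r n \<Otimes> lebm 1 n \<Otimes> \<L>)"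
     by measurable
    from measurable_compose[OF this f]
    have "(%(q, z). f (fst q) (snd q) z) : \<B> ((lebm r n \<Otimes> lebm 1 n) \<Otimes> lborel)" by (simp add: case_prod_beta')
    from measurable_nn_integral_lborel[OF this]
    show "(%(C, b). \<integral>z. f C b z) : \<B> (lebm r n \<Otimes> lebm 1 n)" by (simp add: case_prod_beta')
   qed
   also have "... = (\<integral>b|1,n. \<integral>z. \<integral>C|r,n. f C b z)"
   proof (intro nn_integral_cong nn_integral_swap sigma_finite_lebm sigma_finite_lborel)
    fix b assume b: "b : space (lebm 1 n)"
    have "(%p. (fst p, b, snd p)) : (lebm r n \<Otimes> lborel) \<rightarrow>\<^sub>M (lebm r n \<Otimes> lebm 1 n \<Otimes> \<L>)"
     using b by measurable
    from measurable_compose[OF this f]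
    show "(%(C, z). f C b z) : \<B> (lebm r n \<Otimes> lborel)" by (simp add: case_prod_beta')
   qed
   finally show ?thesis .
  qed
  have "(\<integral>X|Suc ?m,Suc n. Ps X) = kap ?m * (\<integral>C|?m,n. \<integral>b|1,n. \<integral>z. ?F C b z)"
   by (rule QL_integral[OF m inv])
  also have "(\<integral>C|?m,n. \<integral>b|1,n. \<integral>z. ?F C b z) = (\<integral>b|1,n. \<integral>z. \<integral>C|?m,n. ?F C b z)"
   by (rule sw4, rule mF) measurable
  also have "... = (\<integral>b|1,n. \<integral>z. k * (\<integral>G|n,n. ?Q G b z))"
  proof (rule nn_integral_cong, rule nn_integral_cong)
   fix b z assume "b : space (lebm 1 n)"
   hence b: "b : \<M> 1 n" by simp
   have mm: "(%C. ?F C b z) : \<B> (lebm ?m n)"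
    by (rule mF) (use b in auto)
   have "(\<integral>C|?m,n. ?F C b z) = k * (\<integral>G|n,n. ennreal (cmod (det G) ^ (2 * d)) * ?F (0\<^sub>m d n @\<^sub>r G) b z)"
   proof (rule IH[OF mm])
    fix U M :: "complex mat" assume U: "uni ?m U" and M: "M : \<M> ?m n"
    have "blk U (0\<^sub>m ?m 1) (0\<^sub>m 1 ?m) 1 * blk M (0\<^sub>m ?m 1) b z = blk (U * M) (0\<^sub>m ?m 1) (0\<^sub>m 1 ?m * M + 1 \<cdot> b) (1 * z)"
     by (rule QL_mult[OF uniD(1)[OF U] _ M b]) simp
    also have "0\<^sub>m 1 ?m * M + 1 \<cdot> b = b" using b M by (intro eq_matI) auto
    finally have "Ps (blk (U * M) (0\<^sub>m ?m 1) b z) = Ps (blk M (0\<^sub>m ?m 1) b z)"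
     using inv[OF uni_blk[OF U] blk_carrier[OF M, of "0\<^sub>m ?m 1" b z]] by simp
    thus "?F (U * M) b z = ?F M b z" by simp
   qed
   thus "(\<integral>C|?m,n. ?F C b z) = k * (\<integral>G|n,n. ?Q G b z)" by (simp add: mult_ac)
  qed
  also have "... = k * (\<integral>b|1,n. \<integral>z. \<integral>G|n,n. ?Q G b z)"
  proof -
   have a: "(%(q, G). ?Q G (fst q) (snd q)) : \<B> ((lebm 1 n \<Otimes> lborel) \<Otimes> lebm n n)"
    unfolding case_prod_beta' by (rule mQ2; measurable)
   from measurable_nn_integral_lebm[OF a]
   have a1: "(%(b, z). \<integral>G|n,n. ?Q G b z) : \<B> (lebm 1 n \<Otimes> lborel)" by (simp add: case_prod_beta')
   from measurable_nn_integral_lborel[OF this]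
   have a2: "(%b. \<integral>z. \<integral>G|n,n. ?Q G b z) : \<B> (lebm 1 n)" .
   have a3: "(%z. \<integral>G|n,n. ?Q G b z) : \<B> lborel" if "b : space (lebm 1 n)" for b
    using measurable_compose[OF measurable_Pair1'[OF that] a1] by simp
   show ?thesis
    by (subst nn_integral_cmult[OF a2, symmetric], rule nn_integral_cong, rule nn_integral_cmult[OF a3])
  qed
  also have "(\<integral>b|1,n. \<integral>z. \<integral>G|n,n. ?Q G b z) = ?T"
   by (rule sw4[symmetric], rule mQ) measurable
  finally have L: "(\<integral>X|Suc ?m,Suc n. Ps X) = kap ?m * (k * ?T)" .
  let ?Ph = "%G. ennreal (cmod (det G) ^ (2 * d)) * Ps (0\<^sub>m d (Suc n) @\<^sub>r G)"
  have mPh: "?Ph : \<B> (lebm (Suc n) (Suc n))"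
   by (intro measurable_times_ennreal measurable_norm_ennreal measurable_det[OF lebm_ident] measurable_compose[OF _ m0]
     measurable_append_rows measurable_const_mat lebm_ident) auto
  have "(\<integral>G|Suc n,Suc n. ?Ph G) =
    kap n * (\<integral>C|n,n. \<integral>b|1,n. \<integral>z. ennreal (cmod z ^ (2 * n)) * ?Ph (lblk n C b z))"
  proof (rule QL_integral[OF mPh])
   fix U M :: "complex mat" assume U: "uni (Suc n) U" and M: "M : \<M> (Suc n) (Suc n)"
   have "Ps (0\<^sub>m d (Suc n) @\<^sub>r (U * M)) = Ps (0\<^sub>m d (Suc n) @\<^sub>r M)"
    unfolding lower_right_append_rows[OF uniD(1)[OF U] M, symmetric]
    by (rule inv0[rule_format, OF uni_lower_right[OF U]])
       (use carrier_append_rows[OF zero_carrier_mat M, of d] in simp)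
   moreover have "cmod (det (U * M)) = cmod (det M)"
    using det_mult[OF uniD(1)[OF U] M] uni_det[OF U] by (simp add: norm_mult)
   ultimately show "?Ph (U * M) = ?Ph M" by simp
  qed
  also have "(\<integral>C|n,n. \<integral>b|1,n. \<integral>z. ennreal (cmod z ^ (2 * n)) * ?Ph (lblk n C b z)) = ?T"
  proof (rule nn_integral_cong, rule nn_integral_cong, rule nn_integral_cong)
   fix C b z assume "C : space (lebm n n)" "b : space (lebm 1 n)"
   hence C: "C : \<M> n n" and b: "b : \<M> 1 n" by auto
   have "0\<^sub>m d (Suc n) @\<^sub>r lblk n C b z = blk (0\<^sub>m d n @\<^sub>r C) (0\<^sub>m ?m 1) b z"
    by (rule eq_matI) (use C b in \<open>auto simp: append_rows_def blk_def\<close>)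
   thus "ennreal (cmod z ^ (2 * n)) * ?Ph (lblk n C b z) = ?Q C b z"
    by (simp add: det_blk_lower[OF C b] norm_mult power_mult_distrib ennreal_mult power_add distrib_left mult_ac)
  qed
  finally have R: "(\<integral>G|Suc n,Suc n. ?Ph G) = kap n * ?T" .
  have "kap ?m * k / kap n * (kap n * ?T) = kap ?m * k * ?T"
  proof -
   have "kap ?m * k / kap n * (kap n * ?T) = kap ?m * k * (kap n / kap n) * ?T"
    by (simp add: divide_ennreal_def mult_ac)
   also have "kap n / kap n = 1" using kap_finite_pos[of n] by (intro ennreal_divide_self) (auto simp: less_top)
   finally show ?thesis by simp
  qed
  thus "(\<integral>X|d + Suc n,Suc n. Ps X) = kap ?m * k / kap n * (\<integral>G|Suc n,Suc n. ?Ph G)"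
   using L unfolding R by (simp add: mult.assoc)
 qed
qed

section \<open>Products of square Gaussian matrices\<close>

text \<open>Generated by the coefficients. Eigenvalues have no canonical order, so their law is
  first expressed through functions of the characteristic polynomial.\<close>

definition polyM :: "complex poly measure" where
 "polyM = vimage_algebra UNIV coeff (PiM UNIV (%_. borel))"

lemma space_polyM [simp]: "space polyM = UNIV"
 by (simp add: polyM_def)

lemma measurable_polyMI:
 assumes "!!i. (%x. coeff (p x) i) : \<B> N"
 shows "p : measurable N polyM"
proof -
 have "(%x. coeff (p x)) : measurable N (PiM UNIV (%_. borel))"
  by (rule measurable_PiM_single') (use assms in \<open>auto simp: space_PiM\<close>)
 thus ?thesis unfolding polyM_def by (intro measurable_vimage_algebra2) auto
qed

lemma measurable_coeff:
 assumes "p : measurable N polyM"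
 shows "(%x. coeff (p x) i) : \<B> N"
proof -
 have "coeff : measurable polyM (PiM UNIV (%_. borel))"
  unfolding polyM_def by (rule measurable_vimage_algebra1) (auto simp: space_PiM)
 from measurable_compose[OF this measurable_component_singleton[of i]]
 have "(%p. coeff p i) : \<B> polyM" by simp
 from measurable_compose[OF assms this] show ?thesis .
qed

lemma measurable_poly_mult:
 assumes "p : measurable N polyM" "q : measurable N polyM"
 shows "(%x. p x * q x) : measurable N polyM"
 by (rule measurable_polyMI, unfold coeff_mult)
   (intro borel_measurable_sum borel_measurable_times measurable_coeff assms)

lemma measurable_poly_sum:
 assumes "!!i. i : I ==> p i : measurable N polyM"
 shows "(%x. \<Sum>i\<in>I. p i x) : measurable N polyM"
 by (rule measurable_polyMI, unfold coeff_sum) (intro borel_measurable_sum measurable_coeff assms)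

lemma measurable_poly_const: "(%x. p) : measurable N polyM"
 by simp

lemma measurable_poly_prod:
 assumes "finite I" "!!i. i : I ==> p i : measurable N polyM"
 shows "(%x. \<Prod>i\<in>I. p i x) : measurable N polyM"
 using assms by (induction I rule: finite_induct) (auto intro!: measurable_poly_mult)

lemma measurable_poly_linear:
 assumes "a : \<B> N" "b : \<B> N"
 shows "(%x. [:a x, b x:]) : measurable N polyM"
proof (rule measurable_polyMI)
 fix i
 show "(%x. coeff [:a x, b x:] i) : \<B> N"
  using assms by (cases i rule: nat.exhaust) (auto simp: coeff_pCons split: nat.split)
qed

text \<open>The degree may vary without bound, so evaluation is obtained as the pointwise limit of
  truncated sums, which are eventually constant at each point.\<close>

lemma measurable_poly_eval:
 assumes p: "p : measurable N polyM" and z: "z : \<B> N"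
 shows "(%x. poly (p x) (z x)) : \<B> N"
proof (rule borel_measurable_LIMSEQ_metric)
 show "(%x. \<Sum>i<k. coeff (p x) i * z x ^ i) : \<B> N" for k
  by (intro borel_measurable_sum borel_measurable_times borel_measurable_power measurable_coeff p z)
 fix x
 have "(\<Sum>i<k. coeff (p x) i * z x ^ i) = poly (p x) (z x)" if "k > degree (p x)" for k
 proof -
  have "poly (p x) (z x) = (\<Sum>i\<le>degree (p x). coeff (p x) i * z x ^ i)" by (rule poly_altdef)
  also have "... = (\<Sum>i<k. coeff (p x) i * z x ^ i)"
   by (rule sum.mono_neutral_left) (use that in \<open>auto simp: coeff_eq_0\<close>)
  finally show ?thesis by simp
 qed
 hence "eventually (%k. (\<Sum>i<k. coeff (p x) i * z x ^ i) = poly (p x) (z x)) sequentially"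
  by (intro eventually_mono[OF eventually_gt_at_top[of "degree (p x)"]])
 thus "(%k. \<Sum>i<k. coeff (p x) i * z x ^ i) \<longlonglongrightarrow> poly (p x) (z x)"
  by (rule tendsto_eventually)
qed

lemma measurable_char_poly:
 assumes A: "A : measurable N (lebm n n)"
 shows "(%x. char_poly (A x)) : measurable N polyM"
proof -
 have "(%x. \<Sum>p\<in>{p. p permutes {0..<n}}. signof p * (\<Prod>i = 0..<n. [:- (A x $$ (i, p i)), if i = p i then 1 else 0:])) : measurable N polyM"
 proof (intro measurable_poly_sum measurable_poly_mult measurable_poly_prod measurable_poly_linear borel_measurable_uminus
   measurable_index_mat'[OF A] borel_measurable_const measurable_poly_const)
  fix p i assume "p : {p. p permutes {0..<n}}" "i : {0..<n}"
  thus "i < n" "p i < n" using permutes_in_image[of p "{0..<n}" i] by auto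
 qed auto
 thus ?thesis
 proof (rule measurable_cong[THEN iffD1, rotated])
  fix x assume "x : space N"
  hence C: "A x : \<M> n n" by (rule measurable_carrier_mat[OF A])
  have e: "char_poly_matrix (A x) $$ (i, p i) = [:- (A x $$ (i, p i)), if i = p i then 1 else 0:]"
   if "p permutes {0..<n}" "i : {0..<n}" for p i
   using that C permutes_in_image[OF that(1), of i] by (auto simp: char_poly_matrix_def)
  show "(\<Sum>p\<in>{p. p permutes {0..<n}}. signof p * (\<Prod>i = 0..<n. [:- (A x $$ (i, p i)), if i = p i then 1 else 0:])) = char_poly (A x)"
   unfolding char_poly_def det_def'[OF char_poly_matrix_closed[OF C]]
   by (intro sum.cong prod.cong arg_cong2[of _ _ _ _ "(*)"] refl) (auto simp: e)
 qed
qed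

text \<open>The weight of a factor once it has been made square, \<open>m\<close> being its surplus
  of rows. For size one it reduces to \<open>gx\<close>.\<close>

definition gw :: "nat => complex mat => ennreal" where
 "gw m A = ennreal (cmod (det A) ^ (2 * m) * exp (- fro A))"

lemma measurable_gw:
 assumes A: "A : measurable N (lebm n n)"
 shows "(%x. gw m (A x)) : \<B> N"
 unfolding gw_def using measurable_det[OF A] measurable_fro[OF A] by measurable

lemma gw_uni_left: "uni n U ==> A : \<M> n n ==> gw m (U * A) = gw m A"
 using det_mult[of U n A] uni_det[of n U] uniD(1)[of n U] by (simp add: gw_def norm_mult fro_unitary_left)

lemma gw_uni_right: "uni n U ==> A : \<M> n n ==> gw m (A * U) = gw m A"
 using det_mult[of A n U] uni_det[of n U] uniD(1)[of n U] by (simp add: gw_def norm_mult fro_unitary_right)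

lemma fro_zero [simp]: "fro (0\<^sub>m r c) = 0"
 by (simp add: fro_def)

text \<open>The weight factorises over corner, block and row, so these three become independent for
  a triangular factor.\<close>

lemma gw_blk:
 assumes C: "C : \<M> n n" and b: "b : \<M> 1 n"
 shows "gw m (lblk n C b z) = gau b * (gx m z * gw m C)"
 unfolding gw_def gx_def det_blk_lower[OF C b] fro_blk[OF C zero_carrier_mat b]
 by (simp add: ennreal_mult[symmetric] norm_mult power_mult_distrib exp_add[symmetric] exp_diff exp_minus field_simps)

definition gn :: "nat => ennreal" where
 "gn n = (\<integral>b|1,n. gau b)"

text \<open>The head of the list belongs to the leftmost factor of the product.\<close>

primrec PI :: "nat list => nat => (complex mat => ennreal) => ennreal" where
 "PI [] n Ph = Ph (1\<^sub>m n)"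
| "PI (m # ms) n Ph = PI ms n (%B. \<integral>A|n,n. gw m A * Ph (A * B))"

text \<open>The same iteration for scalars. It describes the corner entries of the factors and turns
  out to be integration against the weight function.\<close>

primrec XI :: "nat list => (complex => ennreal) => ennreal" where
 "XI [] ph = ph 1"
| "XI (m # ms) ph = XI ms (%y. \<integral>x. gx m x * ph (x * y))"

lemma PI_step_measurable:
 assumes "(%(x, B). Ph x B) : \<B> (N \<Otimes> lebm n n)"
 shows "(%(x, B). \<integral>A|n,n. gw m A * Ph x (A * B)) : \<B> (N \<Otimes> lebm n n)"
proof -
 have mm: "(%p. snd p * snd (fst p)) : measurable ((N \<Otimes> lebm n n) \<Otimes> lebm n n) (lebm n n)"
  by (rule measurable_mat_mult[of _ _ n n]; measurable)
 have "(%p. (fst (fst p), snd p * snd (fst p))) : measurable ((N \<Otimes> lebm n n) \<Otimes> lebm n n) (N \<Otimes> lebm n n)"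
  using mm by measurable
 from measurable_compose[OF this assms]
 have "(%(q, A). gw m A * Ph (fst q) (A * snd q)) : \<B> ((N \<Otimes> lebm n n) \<Otimes> lebm n n)"
  using measurable_gw[OF measurable_snd, of m "N \<Otimes> lebm n n" n] by (simp add: case_prod_beta')
 from measurable_nn_integral_lebm[OF this] show ?thesis by (simp add: case_prod_beta')
qed

lemma PI_step_measurable1:
 assumes "Ph : \<B> (lebm n n)"
 shows "(%B. \<integral>A|n,n. gw m A * Ph (A * B)) : \<B> (lebm n n)"
proof -
 \<comment> \<open>The version with parameters is used with a parameter space of one point.\<close>
 have "(%(x, B). Ph B) : \<B> (count_space {()} \<Otimes> lebm n n)"
  unfolding case_prod_beta' by (rule measurable_compose[OF measurable_snd assms])
 from PI_step_measurable[OF this, of m]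
 have "(%p. \<integral>A|n,n. gw m A * Ph (A * snd p)) : \<B> (count_space {()} \<Otimes> lebm n n)"
  by (simp add: case_prod_beta')
 from measurable_compose[OF measurable_Pair1'[of "()" "count_space {()}" "lebm n n"] this] show ?thesis by simp
qed

lemma PI_step_inner_measurable:
 assumes "Ph : \<B> (lebm n n)" "B : \<M> n n"
 shows "(%A. gw m A * Ph (A * B)) : \<B> (lebm n n)"
 by (intro measurable_times_ennreal measurable_gw[OF lebm_ident] measurable_mult_const_right[OF assms(2,1)])

text \<open>Singular matrices form a null set in every factor, and the iteration ends at the
  identity. So integrands are compared at invertible matrices only, where division by determinants
  makes sense.\<close>

lemma PI_cong_nonsing:
 "(!!B. B : \<M> n n ==> det B ~= 0 ==> Ph B = Ph' B) ==> PI ms n Ph = PI ms n Ph'"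
proof (induction ms arbitrary: Ph Ph')
 case (Cons m ms)
 show ?case unfolding PI.simps
 proof (rule Cons.IH)
  fix B :: "complex mat" assume B: "B : \<M> n n" "det B ~= 0"
  show "(\<integral>A|n,n. gw m A * Ph (A * B)) = (\<integral>A|n,n. gw m A * Ph' (A * B))"
  proof (rule nn_integral_cong_AE, rule AE_mp[OF AE_det_neq_0 AE_I2], intro impI)
   fix A assume "A : space (lebm n n)" "det A ~= 0"
   thus "gw m A * Ph (A * B) = gw m A * Ph' (A * B)"
    using B det_mult[of A n B] Cons.prems[of "A * B"] by simp
  qed
 qed
qed simp

lemma PI_measurable:
 "(%(x, B). Ph x B) : \<B> (N \<Otimes> lebm n n) ==> (%x. PI ms n (Ph x)) : \<B> N"
proof (induction ms arbitrary: Ph)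
 case Nil
 have "(%x. (x, 1\<^sub>m n)) : measurable N (N \<Otimes> lebm n n)" by simp
 from measurable_compose[OF this Nil] show ?case by simp
next
 case (Cons m ms)
 show ?case unfolding PI.simps by (rule Cons.IH[OF PI_step_measurable[OF Cons.prems]])
qed

lemma PI_cmult:
 "Ph : \<B> (lebm n n) ==> PI ms n (%B. k * Ph B) = k * PI ms n Ph"
proof (induction ms arbitrary: Ph)
 case (Cons m ms)
 have "PI (m # ms) n (%B. k * Ph B) = PI ms n (%B. k * (\<integral>A|n,n. gw m A * Ph (A * B)))"
  unfolding PI.simps
 proof (rule PI_cong_nonsing)
  fix B :: "complex mat" assume B: "B : \<M> n n"
  show "(\<integral>A|n,n. gw m A * (k * Ph (A * B))) = k * (\<integral>A|n,n. gw m A * Ph (A * B))"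
   using nn_integral_cmult[OF PI_step_inner_measurable[OF Cons.prems B], of k m] by (simp add: mult_ac)
 qed
 also have "... = k * PI (m # ms) n Ph"
  unfolding PI.simps by (rule Cons.IH[OF PI_step_measurable1[OF Cons.prems]])
 finally show ?case .
qed simp

lemma PI_swap:
 "sigma_finite_measure M ==> (%(y, B). Ph y B) : \<B> (M \<Otimes> lebm n n) ==>
  PI ms n (%B. \<integral>\<^sup>+y. Ph y B \<partial>M) = (\<integral>\<^sup>+y. PI ms n (Ph y) \<partial>M)"
proof (induction ms arbitrary: Ph)
 case (Cons m ms)
 have "PI (m # ms) n (%B. \<integral>\<^sup>+y. Ph y B \<partial>M) = PI ms n (%B. \<integral>\<^sup>+y. (\<integral>A|n,n. gw m A * Ph y (A * B)) \<partial>M)"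
  unfolding PI.simps
 proof (rule PI_cong_nonsing)
  fix B :: "complex mat" assume B: "B : \<M> n n"
  have mp: "(%p. (fst p, snd p * B)) : measurable (M \<Otimes> lebm n n) (M \<Otimes> lebm n n)"
   by (intro measurable_Pair measurable_fst measurable_mat_mult[OF measurable_snd measurable_const_mat[OF B]])
  have m2: "(%(y, A). gw m A * Ph y (A * B)) : \<B> (M \<Otimes> lebm n n)"
   using measurable_compose[OF mp Cons.prems(2)] measurable_gw[OF measurable_snd, of m M n] by (simp add: case_prod_beta')
  have "(\<integral>A|n,n. gw m A * (\<integral>\<^sup>+y. Ph y (A * B) \<partial>M)) = (\<integral>A|n,n. \<integral>\<^sup>+y. gw m A * Ph y (A * B) \<partial>M)"
  proof (rule nn_integral_cong)
   fix A assume A: "A : space (lebm n n)"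
   have "(%y. (y, A * B)) : measurable M (M \<Otimes> lebm n n)" using A B by simp
   from measurable_compose[OF this Cons.prems(2)]
   show "gw m A * (\<integral>\<^sup>+y. Ph y (A * B) \<partial>M) = (\<integral>\<^sup>+y. gw m A * Ph y (A * B) \<partial>M)"
    by (subst nn_integral_cmult) auto
  qed
  also have "... = (\<integral>\<^sup>+y. (\<integral>A|n,n. gw m A * Ph y (A * B)) \<partial>M)"
   by (rule nn_integral_swap[symmetric, OF Cons.prems(1) sigma_finite_lebm m2])
  finally show "(\<integral>A|n,n. gw m A * (\<integral>\<^sup>+y. Ph y (A * B) \<partial>M)) = (\<integral>\<^sup>+y. (\<integral>A|n,n. gw m A * Ph y (A * B)) \<partial>M)" .
 qed
 also have "... = (\<integral>\<^sup>+y. PI (m # ms) n (Ph y) \<partial>M)"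
  unfolding PI.simps by (rule Cons.IH[OF Cons.prems(1) PI_step_measurable[OF Cons.prems(2)]])
 finally show ?case .
qed simp

lemma nn_integral_lebm_uni_right:
 assumes f: "f : \<B> (lebm r c)" and U: "uni c U"
 shows "(\<integral>A|r,c. f (A * U)) = (\<integral>A|r,c. f A)"
 using nn_integral_lebm_mult_right[OF f uniD(1)[OF U] uni_det_neq_0[OF U]] uni_det[OF U] by simp

text \<open>The factor \<open>U\<close> is moved into \<open>A\<close>, whose weight and measure are
  unitarily invariant. One integration thus makes any function left invariant.\<close>

lemma PI_step_left_inv:
 assumes m: "Ph : \<B> (lebm n n)" and U: "uni n U" and B: "B : \<M> n n"
 shows "(\<integral>A|n,n. gw m A * Ph (A * (U * B))) = (\<integral>A|n,n. gw m A * Ph (A * B))"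
proof -
 have "(\<integral>A|n,n. gw m A * Ph (A * (U * B))) = (\<integral>A|n,n. gw m (A * U) * Ph (A * U * B))"
  by (rule nn_integral_cong) (use U B uniD(1)[OF U] in \<open>simp add: gw_uni_right assoc_mult_mat[of _ n n _ n _ n]\<close>)
 also have "... = (\<integral>A|n,n. gw m A * Ph (A * B))"
  by (rule nn_integral_lebm_uni_right[OF PI_step_inner_measurable[OF m B] U])
 finally show ?thesis .
qed

text \<open>The accumulated product ends in the identity, which commutes with \<open>U\<close>; so a
  right factor becomes a left one and disappears by left invariance of the integrand.\<close>

lemma PI_right_inv:
 assumes "Ph : \<B> (lebm n n)" "uni n U"
  "!!U B. uni n U ==> B : \<M> n n ==> Ph (U * B) = Ph B"
 shows "PI ms n (%B. Ph (B * U)) = PI ms n Ph"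
 using assms(1,3)
proof (induction ms arbitrary: Ph)
 case Nil
 have "Ph (1\<^sub>m n * U) = Ph (U * 1\<^sub>m n)" using uniD(1)[OF assms(2)] by simp
 thus ?case using Nil(2)[OF assms(2), of "1\<^sub>m n"] by simp
next
 case (Cons m ms)
 let ?Ph = "%B. \<integral>A|n,n. gw m A * Ph (A * B)"
 have "PI (m # ms) n (%B. Ph (B * U)) = PI ms n (%B. ?Ph (B * U))"
  unfolding PI.simps
 proof (rule PI_cong_nonsing)
  fix B :: "complex mat" assume B: "B : \<M> n n"
  show "(\<integral>A|n,n. gw m A * Ph (A * B * U)) = ?Ph (B * U)"
   by (rule nn_integral_cong) (use B uniD(1)[OF assms(2)] in \<open>simp add: assoc_mult_mat[of _ n n _ n _ n]\<close>)
 qed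
 also have "... = PI ms n ?Ph"
  by (rule Cons.IH[OF PI_step_measurable1[OF Cons.prems(1)] PI_step_left_inv[OF Cons.prems(1)]])
 finally show ?case by simp
qed

lemma XI_cong: "(!!x. x ~= 0 ==> ph x = ph' x) ==> XI ms ph = XI ms ph'"
proof (induction ms arbitrary: ph ph')
 case (Cons m ms)
 show ?case unfolding XI.simps
 proof (rule Cons.IH)
  fix y :: complex assume y: "y ~= 0"
  show "(\<integral>x. gx m x * ph (x * y)) = (\<integral>x. gx m x * ph' (x * y))"
   by (rule nn_integral_cong_AE, rule AE_mp[OF AE_lborel_complex_neq_0 AE_I2]) (use y Cons.prems in auto)
 qed
qed simp

lemma XI_step_measurable:
 assumes "ph : \<B> borel"
 shows "(%y. \<integral>x. gx m x * ph (x * y)) : \<B> borel"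
proof -
 have "(%(y, x). gx m x * ph (x * y)) : \<B> (borel \<Otimes> lborel)"
  using assms by measurable
 from measurable_nn_integral_lborel[OF this] show ?thesis .
qed

lemma XI_cmult: "ph : \<B> borel ==> XI ms (%x. k * ph x) = k * XI ms ph"
proof (induction ms arbitrary: ph)
 case (Cons m ms)
 have "(\<integral>x. gx m x * (k * ph (x * y))) = k * (\<integral>x. gx m x * ph (x * y))" for y
 proof -
  have "(%x. gx m x * ph (x * y)) : \<B> lborel" using Cons.prems by measurable
  from nn_integral_cmult[OF this, of k] show ?thesis by (simp add: mult_ac)
 qed
 thus ?case using Cons.IH[OF XI_step_measurable[OF Cons.prems, of m]] by simp
qed simp

text \<open>One step of the iteration, carried out at the same time for the corner \<open>x\<close>
  and the block \<open>C\<close>.\<close>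

definition stepX :: "nat => nat => (complex => complex mat => ennreal) => complex => complex mat => ennreal" where
 "stepX n m xi x C = (\<integral>x'. gx m x' * (\<integral>C'|n,n. gw m C' * xi (x' * x) (C' * C)))"

lemma stepX_inner_measurable:
 fixes xi :: "complex => complex mat => ennreal"
 assumes xi: "(%(x, C). xi x C) : \<B> (lborel \<Otimes> lebm n n)"
 shows "(%(q, x'). \<integral>C'|n,n. gw m C' * xi (x' * fst q) (C' * snd q)) : \<B> ((lborel \<Otimes> lebm n n) \<Otimes> lborel)"
proof -
 let ?X = "((lborel \<Otimes> lebm n n) \<Otimes> \<L>) \<Otimes> lebm n n"
 have a: "(%p. snd (fst p)) : \<B> ?X"
  using measurable_compose[OF measurable_fst measurable_snd, of "(lborel \<Otimes> lebm n n)" lborel "lebm n n"] by simp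
 have b: "(%p. fst (fst (fst p))) : \<B> ?X"
  using measurable_compose[OF measurable_compose[OF measurable_fst measurable_fst] measurable_fst, of lborel "lebm n n" lborel "lebm n n"] by simp
 have c: "(%p. snd (fst (fst p))) : measurable ?X (lebm n n)"
  by (rule measurable_compose[OF measurable_compose[OF measurable_fst measurable_fst] measurable_snd])
 have mm: "(%p. snd p * snd (fst (fst p))) : measurable ?X (lebm n n)"
  by (rule measurable_mat_mult[OF measurable_snd c])
 have ab: "(%p. snd (fst p) * fst (fst (fst p))) : measurable ?X lborel"
  using borel_measurable_times[OF a b] by simp
 have x: "(%p. xi (snd (fst p) * fst (fst (fst p))) (snd p * snd (fst (fst p)))) : \<B> ?X"
  using measurable_compose[OF measurable_Pair[OF ab mm] xi] by (simp only: case_prod_conv)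
 have g: "(%p. gw m (snd p)) : \<B> ?X"
  by (rule measurable_gw[OF measurable_snd])
 have "(%(p, C'). gw m C' * xi (snd p * fst (fst p)) (C' * snd (fst p))) : \<B> ?X"
  unfolding case_prod_beta' by (rule measurable_times_ennreal[OF g x])
 from measurable_nn_integral_lebm[OF this] show ?thesis by (simp only: case_prod_beta')
qed

lemma stepX_measurable:
 fixes xi :: "complex => complex mat => ennreal"
 assumes xi: "(%(x, C). xi x C) : \<B> (lborel \<Otimes> lebm n n)"
 shows "(%(x, C). stepX n m xi x C) : \<B> (lborel \<Otimes> lebm n n)"
proof -
 have "(%(q, x'). gx m x' * (\<integral>C'|n,n. gw m C' * xi (x' * fst q) (C' * snd q))) : \<B> ((lborel \<Otimes> lebm n n) \<Otimes> lborel)"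
  using stepX_inner_measurable[OF xi, of m] by (simp add: case_prod_beta')
 from measurable_nn_integral_lborel[OF this]
 show ?thesis by (simp add: stepX_def case_prod_beta')
qed

text \<open>Fubini pulls the corner integral and its weight out of \<open>PI\<close>, which
  separates a joint step into one scalar and one matrix step.\<close>

lemma XI_PI_step:
 fixes xi :: "complex => complex mat => ennreal"
 assumes xi: "(%(x, C). xi x C) : \<B> (lborel \<Otimes> lebm n n)"
 shows "XI ms (%x. PI ms n (stepX n m xi x)) = XI (m # ms) (%x. PI (m # ms) n (xi x))"
proof -
 have "PI ms n (stepX n m xi x) = (\<integral>x'. gx m x' * PI (m # ms) n (xi (x' * x)))" for x
 proof -
  let ?G = "%x' C. \<integral>C'|n,n. gw m C' * xi (x' * x) (C' * C)"
  have "(%p. ((x, snd p), fst p)) : measurable (lborel \<Otimes> lebm n n) ((lborel \<Otimes> lebm n n) \<Otimes> lborel)"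
   by (intro measurable_Pair measurable_fst measurable_snd measurable_const) simp
  from measurable_compose[OF this stepX_inner_measurable[OF xi, of m]]
  have G: "(%(x', C). ?G x' C) : \<B> (lborel \<Otimes> lebm n n)" by (simp add: case_prod_beta')
  have G1: "?G x' : \<B> (lebm n n)" for x'
   using measurable_compose[OF measurable_Pair1'[of x' lborel "lebm n n"] G] by simp
  have "PI ms n (%C. \<integral>x'. gx m x' * ?G x' C) = (\<integral>x'. PI ms n (%C. gx m x' * ?G x' C))"
   by (rule PI_swap[OF sigma_finite_lborel]) (use G in \<open>simp add: case_prod_beta'\<close>)
  also have "... = (\<integral>x'. gx m x' * PI ms n (?G x'))"
   by (intro nn_integral_cong PI_cmult G1)
  also have "(%C. \<integral>x'. gx m x' * ?G x' C) = stepX n m xi x"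
   by (rule ext) (simp add: stepX_def)
  finally show ?thesis by simp
 qed
 thus ?thesis by simp
qed

lemma measurable_comp2:
 fixes h :: "complex => complex mat => ennreal"
 assumes h: "(%(x, C). h x C) : \<B> (lborel \<Otimes> lebm n n)"
  and z: "z : \<B> N" and C: "C : measurable N (lebm n n)"
 shows "(%p. h (z p) (C p)) : \<B> N"
proof -
 have "z : measurable N lborel" using z by simp
 from measurable_compose[OF measurable_Pair[OF this C] h] show ?thesis by simp
qed

lemma measurable_fro_ennreal: "b : measurable N (lebm r c) ==> (%x. gau (b x)) : \<B> N"
 using measurable_fro[of b N r c] by measurable

lemma measurable_gx': "z : \<B> N ==> (%x. gx m (z x)) : \<B> N"
 using measurable_gx by measurable

text \<open>The row \<open>b\<close> occurs only in its Gaussian weight and contributes the constant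
  \<open>gn n\<close>.\<close>

lemma gauss_blk_integral:
 fixes h :: "complex => complex mat => ennreal"
 assumes h: "(%(x, C). h x C) : \<B> (lborel \<Otimes> lebm n n)"
 shows "(\<integral>C|n,n. \<integral>b|1,n. \<integral>z. gau b * (gx m z * gw m C) * h z C) =
  gn n * (\<integral>z. gx m z * (\<integral>C|n,n. gw m C * h z C))"
proof -
 have m1: "(%z. gx m z * gw m C * h z C) : \<B> lborel" if "C : \<M> n n" for C
  by (intro measurable_times_ennreal measurable_comp2[OF h] measurable_gx' measurable_const_mat that borel_measurable_const measurable_ident_sets sets_lborel)
 have snd': "snd : \<B> (lebm n n \<Otimes> \<L>)"
  using measurable_snd[of "lebm n n" "lborel :: complex measure"] by simp
 have m2: "(%(C, z). gx m z * gw m C * h z C) : \<B> (lebm n n \<Otimes> lborel)"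
  unfolding case_prod_beta'
  by (intro measurable_times_ennreal measurable_comp2[OF h] measurable_gx' measurable_gw[OF measurable_fst] measurable_fst snd')
 have m3: "(%C. \<integral>z. gx m z * gw m C * h z C) : \<B> (lebm n n)"
  using measurable_nn_integral_lborel[OF m2] .
 have m4: "(%C. gw m C * h z C) : \<B> (lebm n n)" for z
  by (intro measurable_times_ennreal measurable_comp2[OF h] measurable_gw[OF lebm_ident] lebm_ident borel_measurable_const)
 have in_C: "(\<integral>C|n,n. gx m z * gw m C * h z C) = gx m z * (\<integral>C|n,n. gw m C * h z C)" for z
  using nn_integral_cmult[OF m4, of "gx m z" z] by (simp add: mult_ac)
 have "(\<integral>b|1,n. \<integral>z. gau b * (gx m z * gw m C) * h z C) =
   gn n * (\<integral>z. gx m z * gw m C * h z C)" if "C : \<M> n n" for C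
 proof -
  have "(\<integral>z. gau b * (gx m z * gw m C) * h z C) =
    (\<integral>z. gx m z * gw m C * h z C) * gau b" for b
   using nn_integral_cmult[OF m1[OF that], of "gau b"] by (simp add: mult_ac)
  thus ?thesis
   using nn_integral_cmult[OF measurable_fro_ennreal[OF lebm_ident[of 1 n]], of "\<integral>\<^sup>+z. gx m z * gw m C * h z C \<partial>lborel"]
   by (simp add: gn_def mult.commute)
 qed
 hence "(\<integral>C|n,n. \<integral>b|1,n. \<integral>z. gau b * (gx m z * gw m C) * h z C) =
   (\<integral>C|n,n. gn n * (\<integral>z. gx m z * gw m C * h z C))"
  by (intro nn_integral_cong) simp
 also have "... = gn n * (\<integral>C|n,n. \<integral>z. gx m z * gw m C * h z C)"
  by (rule nn_integral_cmult[OF m3])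
 also have "(\<integral>C|n,n. \<integral>z. gx m z * gw m C * h z C) = (\<integral>z. \<integral>C|n,n. gx m z * gw m C * h z C)"
  by (rule nn_integral_swap[OF sigma_finite_lebm sigma_finite_lborel m2])
 finally show ?thesis by (simp only: in_C)
qed

lemma stepX_measurable1:
 fixes xi :: "complex => complex mat => ennreal"
 assumes xi: "(%(x, C). xi x C) : \<B> (lborel \<Otimes> lebm n n)"
 shows "stepX n m xi x : \<B> (lebm n n)"
 by (intro measurable_comp2[OF stepX_measurable[OF xi]] borel_measurable_const lebm_ident)

text \<open>Each factor is brought to triangular form by the QL formula, and integrating it out
  leaves a left invariant function of the next. The hypothesis with \<open>|x|^(-2 n)\<close>
  reproduces itself, since QL supplies the \<open>|z|^(2 n)\<close> that turns
  \<open>|z x|^(-2 n)\<close> back into \<open>|x|^(-2 n)\<close>. Every factor costs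
  \<open>kap n\<close>, and \<open>gn n\<close> for its row.\<close>

lemma PI_blk:
 fixes xi :: "complex => complex mat => ennreal"
 assumes "Xi : \<B> (lebm (Suc n) (Suc n))"
  and "!!U B. uni (Suc n) U ==> B : \<M> (Suc n) (Suc n) ==> Xi (U * B) = Xi B"
  and "(%(x, C). xi x C) : \<B> (lborel \<Otimes> lebm n n)"
  and "!!x C b. x ~= 0 ==> C : \<M> n n ==> det C ~= 0 ==> b : \<M> 1 n ==>
   Xi (lblk n C b x) = ennreal (1 / cmod x ^ (2 * n)) * xi x C"
 shows "PI ms (Suc n) Xi = (kap n * gn n) ^ length ms * XI ms (%x. PI ms n (xi x))"
 using assms
proof (induction ms arbitrary: Xi xi)
 case Nil
 have "1\<^sub>m (Suc n) = lblk n (1\<^sub>m n) (0\<^sub>m 1 n) (1 :: complex)"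
  by (rule eq_matI) (auto simp: blk_def less_Suc_eq)
 thus ?case using Nil(4)[of 1 "1\<^sub>m n" "0\<^sub>m 1 n"] by simp
next
 case (Cons m ms)
 note Xi = Cons.prems(1) and inv = Cons.prems(2) and xi = Cons.prems(3) and eq = Cons.prems(4)
 let ?Xi = "%B. \<integral>A|Suc n,Suc n. gw m A * Xi (A * B)"
 let ?c = "kap n * gn n"
 let ?xi = "%x C. ?c * stepX n m xi x C"
 have mxi: "(%(x, C). ?xi x C) : \<B> (lborel \<Otimes> lebm n n)"
  using stepX_measurable[OF xi, of m] unfolding case_prod_beta' by (intro measurable_times_ennreal) auto
 have eq2: "?Xi (lblk n C0 b0 x) = ennreal (1 / cmod x ^ (2 * n)) * ?xi x C0"
  if x: "x ~= 0" and C0: "C0 : \<M> n n" "det C0 ~= 0" and b0: "b0 : \<M> 1 n" for x C0 b0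
 proof -
  let ?T = "lblk n C0 b0 x"
  let ?cx = "ennreal (1 / cmod x ^ (2 * n))"
  have T: "?T : \<M> (Suc n) (Suc n)" using C0 b0 by simp
  have mT: "(%A. gw m A * Xi (A * ?T)) : \<B> (lebm (Suc n) (Suc n))"
   by (rule PI_step_inner_measurable[OF Xi T])
  \<comment> \<open>The QL formula applies to the leftmost matrix \<open>A\<close> with
    \<open>?T\<close> fixed: both \<open>gw m A\<close> and \<open>Xi (A * ?T)\<close> are invariant
    under unitary left factors of \<open>A\<close>.\<close>
  have "?Xi ?T = kap n * (\<integral>C|n,n. \<integral>b|1,n. \<integral>z. ennreal (cmod z ^ (2 * n)) *
    (gw m (lblk n C b z) * Xi (lblk n C b z * ?T)))"
   by (rule QL_integral[OF mT])
     (use T in \<open>simp add: gw_uni_left inv uniD(1) assoc_mult_mat[of _ "Suc n" "Suc n" _ "Suc n" _ "Suc n"]\<close>)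
  also have "(\<integral>C|n,n. \<integral>b|1,n. \<integral>z. ennreal (cmod z ^ (2 * n)) *
    (gw m (lblk n C b z) * Xi (lblk n C b z * ?T))) =
    (\<integral>C|n,n. \<integral>b|1,n. \<integral>z. gau b * (gx m z * gw m C) * (?cx * xi (z * x) (C * C0)))"
  proof (rule nn_integral_cong_AE, rule AE_mp[OF AE_det_neq_0 AE_I2], rule impI, rule nn_integral_cong)
   fix C b assume C: "C : space (lebm n n)" "det C ~= 0" and b: "b : space (lebm 1 n)"
   show "(\<integral>z. ennreal (cmod z ^ (2 * n)) * (gw m (lblk n C b z) * Xi (lblk n C b z * ?T))) =
    (\<integral>z. gau b * (gx m z * gw m C) * (?cx * xi (z * x) (C * C0)))"
   proof (rule nn_integral_cong_AE, rule AE_mp[OF AE_lborel_complex_neq_0 AE_I2], intro impI)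
    fix z :: complex assume z: "z ~= 0"
    have "lblk n C b z * ?T = lblk n (C * C0) (b * C0 + z \<cdot> b0) (z * x)"
     by (rule QL_mult) (use C b C0 b0 in auto)
    also have "Xi ... = ennreal (1 / cmod (z * x) ^ (2 * n)) * xi (z * x) (C * C0)"
     by (rule eq) (use x z C b C0 b0 det_mult[of C n C0] in auto)
    finally have e: "Xi (lblk n C b z * ?T) = ennreal (1 / cmod (z * x) ^ (2 * n)) * xi (z * x) (C * C0)" .
    have "ennreal (cmod z ^ (2 * n)) * ennreal (1 / cmod (z * x) ^ (2 * n)) = ?cx"
     using z by (simp add: ennreal_mult[symmetric] norm_mult power_mult_distrib)
    thus "ennreal (cmod z ^ (2 * n)) * (gw m (lblk n C b z) * Xi (lblk n C b z * ?T)) =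
     gau b * (gx m z * gw m C) * (?cx * xi (z * x) (C * C0))"
     unfolding e using C b by (simp add: gw_blk) (simp add: mult_ac)
   qed
  qed
  also have "... = gn n * (\<integral>z. gx m z * (\<integral>C|n,n. gw m C * (?cx * xi (z * x) (C * C0))))"
  proof (rule gauss_blk_integral, unfold case_prod_beta', intro measurable_times_ennreal borel_measurable_const measurable_comp2[OF xi])
   show "(%p. fst p * x) : \<B> (lborel \<Otimes> lebm n n)"
    by (intro borel_measurable_times borel_measurable_const measurable_compose[OF measurable_fst]) simp
   show "(%p. snd p * C0) : measurable (lborel \<Otimes> lebm n n) (lebm n n)"
    by (intro measurable_mat_mult[OF measurable_snd measurable_const_mat[OF C0(1)]])
  qed
  also have "(\<integral>z. gx m z * (\<integral>C|n,n. gw m C * (?cx * xi (z * x) (C * C0)))) = ?cx * stepX n m xi x C0"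
  proof -
   have m1: "(%C. gw m C * xi (z * x) (C * C0)) : \<B> (lebm n n)" for z
    by (intro measurable_times_ennreal measurable_comp2[OF xi] measurable_gw[OF lebm_ident] lebm_ident borel_measurable_const
      measurable_mat_mult[OF lebm_ident measurable_const_mat[OF C0(1)]])
   have e: "(\<integral>C|n,n. gw m C * (?cx * xi (z * x) (C * C0))) = ?cx * (\<integral>C|n,n. gw m C * xi (z * x) (C * C0))" for z
    using nn_integral_cmult[OF m1, of ?cx z] by (simp add: mult_ac)
   have "(%z. ((x, C0), z)) : measurable lborel ((lborel \<Otimes> lebm n n) \<Otimes> lborel)"
    using C0(1) by (intro measurable_Pair measurable_const measurable_ident_sets) (auto simp: space_pair_measure)
   from measurable_compose[OF this stepX_inner_measurable[OF xi, of m]]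
   have m2: "(%z. gx m z * (\<integral>C|n,n. gw m C * xi (z * x) (C * C0))) : \<B> lborel"
    by (intro measurable_times_ennreal measurable_gx') simp_all
   have "(\<integral>z. gx m z * (?cx * (\<integral>C|n,n. gw m C * xi (z * x) (C * C0)))) =
     ?cx * (\<integral>z. gx m z * (\<integral>C|n,n. gw m C * xi (z * x) (C * C0)))"
    using nn_integral_cmult[OF m2, of ?cx] by (simp add: mult_ac)
   thus ?thesis unfolding e by (simp add: stepX_def)
  qed
  finally show ?thesis by (simp add: mult_ac)
 qed
 have "PI (m # ms) (Suc n) Xi = PI ms (Suc n) ?Xi" by simp
 also have "... = ?c ^ length ms * XI ms (%x. PI ms n (?xi x))"
  by (rule Cons.IH[OF PI_step_measurable1[OF Xi] PI_step_left_inv[OF Xi] mxi eq2]) (use inv in auto)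
 also have "XI ms (%x. PI ms n (?xi x)) = XI ms (%x. ?c * PI ms n (stepX n m xi x))"
  by (intro arg_cong[where f = "XI ms"] ext PI_cmult stepX_measurable1[OF xi])
 also have "... = ?c * XI ms (%x. PI ms n (stepX n m xi x))"
  by (rule XI_cmult) (use PI_measurable[OF stepX_measurable[OF xi]] in simp)
 also have "... = ?c * XI (m # ms) (%x. PI (m # ms) n (xi x))" unfolding XI_PI_step[OF xi] ..
 finally show ?case by (simp add: mult_ac)
qed

lemma minv_unique:
 assumes "A : \<M> n n" "X : \<M> n n" "det A ~= 0" "A * X = 1\<^sub>m n"
 shows "minv A = X"
proof -
 note i = minv[OF assms(1,3)]
 have "minv A = minv A * (A * X)" using i(1) assms(4) by simp
 also have "... = minv A * A * X" using assoc_mult_mat[OF i(1) assms(1,2)] by simp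
 finally show ?thesis using i(3) assms(2) by simp
qed

lemma minv_mult:
 assumes A: "A : \<M> n n" "det A ~= 0" and B: "B : \<M> n n" "det B ~= 0"
 shows "minv (A * B) = minv B * minv A"
proof (rule minv_unique)
 note a = minv[OF A] and b = minv[OF B]
 have "A * B * (minv B * minv A) = A * (B * minv B * minv A)"
  using A B a(1) b(1) by (simp add: assoc_mult_mat[of _ n n _ n _ n])
 thus "A * B * (minv B * minv A) = 1\<^sub>m n" using a b by simp
 show "det (A * B) ~= 0" using det_mult[OF A(1) B(1)] A B by simp
 show "minv B * minv A : \<M> n n" using a(1) b(1) by simp
qed (use A B in simp)

lemma minv_uni: "uni n U ==> minv U = ctr U"
 using minv_unique[OF uniD(1) uni_ctr[THEN uniD(1)] uni_det_neq_0 uni_right] by blast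

text \<open>With \<open>P = A * B\<close>, the weight of the leftmost factor \<open>A\<close> becomes a density in \<open>P\<close> that is
 conjugation invariant once \<open>B\<close> is integrated out, so that \<open>schur_deflation\<close> applies to the whole product.\<close>

definition wg :: "nat => nat => complex mat => complex mat => ennreal" where
 "wg m k P B = ennreal (1 / cmod (det B) ^ (2 * k)) * gw m (P * minv B)"

lemma measurable_wg:
 assumes P: "P : measurable N (lebm k k)" and B: "B : measurable N (lebm k k)"
 shows "(%x. wg m k (P x) (B x)) : \<B> N"
proof -
 have "(%x. ennreal (1 / cmod (det (B x)) ^ (2 * k))) : \<B> N"
  using measurable_det[OF B] by measurable
 thus ?thesis unfolding wg_def
  by (intro measurable_times_ennreal measurable_gw[where n = k] measurable_mat_mult[OF P measurable_minv[OF B]])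
qed

lemma wg_left_inv:
 assumes P: "P : \<M> (Suc n) (Suc n)" and B: "B : \<M> (Suc n) (Suc n)" and U: "uni (Suc n) U"
 shows "wg m (Suc n) P (U * B) = wg m (Suc n) P B"
proof (cases "det B = 0")
 \<comment> \<open>Both sides vanish, since \<open>1 / 0 = 0\<close>.\<close>
 case True
 thus ?thesis using det_mult[OF uniD(1)[OF U] B] by (simp add: wg_def)
next
 case False
 have "P * minv (U * B) = P * minv B * ctr U"
  using P B minv_carrier[OF B] uni_ctr[OF U, THEN uniD(1)]
  by (simp add: minv_mult[OF uniD(1)[OF U] uni_det_neq_0[OF U] B False] minv_uni[OF U] assoc_mult_mat[of _ "Suc n" "Suc n" _ "Suc n" _ "Suc n"])
 moreover have "P * minv B : \<M> (Suc n) (Suc n)" using P minv_carrier[OF B] by simp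
 ultimately show ?thesis using gw_uni_right[OF uni_ctr[OF U]] det_mult[OF uniD(1)[OF U] B] uni_det[OF U]
  by (simp add: wg_def norm_mult)
qed

text \<open>Conjugating \<open>P\<close> amounts to multiplying \<open>B\<close> by \<open>U\<close>
  on the right: one unitary factor does not affect \<open>gw\<close>, the other joins the inverse of
  \<open>B\<close>.\<close>

lemma wg_conj:
 assumes P: "P : \<M> k k" and B: "B : \<M> k k" "det B ~= 0" and U: "uni k U"
 shows "wg m k (U * P * ctr U) B = wg m k P (B * U)"
proof -
 note c = uniD(1)[OF U] uni_ctr[OF U, THEN uniD(1)] minv_carrier[OF B(1)]
 have "U * P * ctr U * minv B = U * (P * minv (B * U))"
  using P B c by (simp add: minv_mult[OF B uniD(1)[OF U] uni_det_neq_0[OF U]] minv_uni[OF U] assoc_mult_mat[of _ k k _ k _ k])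
 moreover have "P * minv (B * U) : \<M> k k" using P B c minv_carrier[of "B * U" k] by simp
 ultimately show ?thesis using gw_uni_left[OF U] det_mult[OF B(1) c(1)] uni_det[OF U]
  by (simp add: wg_def norm_mult)
qed

text \<open>What the deflation leaves for the block \<open>C\<close>. As \<open>det (z - C)\<close>
  is the value at \<open>z\<close> of the characteristic polynomial of \<open>C\<close>, this is
  again a function of \<open>z\<close> and that polynomial, so the induction on the size
  closes.\<close>

definition stepf :: "nat => (complex poly => ennreal) => complex => complex mat => ennreal" where
 "stepf n F z C = ennreal ((cmod (det (zsub n z C)))\<^sup>2) * F ([:- z, 1:] * char_poly C)"

lemma measurable_stepf:
 assumes F: "F : \<B> polyM" and z: "z : \<B> N" and C: "C : measurable N (lebm n n)"
 shows "(%x. stepf n F (z x) (C x)) : \<B> N"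
 unfolding stepf_def
 by (intro measurable_times_ennreal measurable_norm_ennreal measurable_det[where n = n] measurable_zsub z C
   measurable_compose[OF _ F] measurable_poly_mult measurable_poly_linear measurable_char_poly[OF C] borel_measurable_uminus borel_measurable_const)

lemma measurable_stepf':
 assumes F: "F : \<B> polyM"
 shows "(%(z, C). stepf n F z C) : \<B> (lborel \<Otimes> lebm n n)"
proof -
 have "(%p. fst p) : \<B> (\<L> \<Otimes> lebm n n)"
  using measurable_fst[of "lborel :: complex measure" "lebm n n"] by simp
 from measurable_stepf[OF F this measurable_snd] show ?thesis by (simp add: case_prod_beta')
qed

lemma measurable_stepf_wg:
 assumes F: "F : \<B> polyM" and m: "C : measurable N (lebm n n)" "b : measurable N (lebm 1 n)"
  "z : \<B> N" "B : measurable N (lebm (Suc n) (Suc n))"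
 shows "(%p. stepf n F (z p) (C p) * wg m (Suc n) (lblk n (C p) (b p) (z p)) (B p)) : \<B> N"
 by (intro measurable_times_ennreal measurable_stepf[OF F] measurable_wg measurable_blk measurable_const_mat m zero_carrier_mat)

lemma measurable_comp_char_poly:
 assumes "F : \<B> polyM" "A : measurable N (lebm n n)"
 shows "(%x. F (char_poly (A x))) : \<B> N"
 by (rule measurable_compose[OF measurable_char_poly[OF assms(2)] assms(1)])

text \<open>Substituting \<open>C * C0\<close>, \<open>b * C0 + z b0\<close> and \<open>z x\<close>
  cancels the inverse of the triangular matrix inside \<open>wg\<close>. The Jacobians give
  \<open>|det C0|^(2 n + 2) |x|^2\<close>; against the power \<open>2 (n + 1)\<close> of
  \<open>|det C0| |x|\<close> in the denominator of \<open>wg\<close> there remains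
  \<open>|x|^(-2 n)\<close>, the form that \<open>PI_blk\<close> expects.\<close>

lemma stepf_blk:
 assumes F: "F : \<B> polyM" and x: "x ~= 0" and C0: "C0 : \<M> n n" "det C0 ~= 0" and b0: "b0 : \<M> 1 n"
 shows "(\<integral>C|n,n. \<integral>b|1,n. \<integral>z. stepf n F z C * wg m (Suc n) (lblk n C b z) (lblk n C0 b0 x)) =
  ennreal (1 / cmod x ^ (2 * n)) * (gn n * stepX n m (stepf n F) x C0)"
proof -
 let ?T = "lblk n C0 b0 x"
 define g where "g C b z = stepf n F z C * wg m (Suc n) (lblk n C b z) ?T" for C b z
 have T: "?T : \<M> (Suc n) (Suc n)" using C0 b0 by simp
 have dT: "det ?T ~= 0" using det_blk_lower[OF C0(1) b0, of x] C0 x by simp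
 note mg = measurable_stepf_wg[OF F _ _ _ measurable_const_mat[OF T], where m = m, folded g_def]
 have snd': "snd : \<B> (K \<Otimes> \<L>)" for K :: "complex mat measure"
  using measurable_snd[of K "lborel :: complex measure"] by simp
 have snd'': "snd : \<B> (K \<Otimes> \<L>)" for K :: "(complex mat \<times> complex mat) measure"
  using measurable_snd[of K "lborel :: complex measure"] by simp
 have sw: "(\<integral>b|1,n. \<integral>z. g C b z) = (\<integral>z. \<integral>b|1,n. g C b z)"
  if C: "C : \<M> n n" for C
  by (rule nn_integral_swap[OF sigma_finite_lebm sigma_finite_lborel], unfold case_prod_beta',
    rule mg[OF measurable_const_mat[OF C] measurable_fst snd'])
 define h where "h C b z = stepf n F (z * x) (C * C0) * (ennreal (1 / cmod (det ?T) ^ (2 * Suc n)) * gw m (lblk n C b z))" for C b z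
 \<comment> \<open>In the new variables the triangular argument of \<open>wg\<close> is
   \<open>lblk n C b z * ?T\<close>, so the inverse of \<open>?T\<close> cancels.\<close>
 have gh: "g (C * C0) (b * C0 + z \<cdot> b0) (z * x) = h C b z"
  if C: "C : \<M> n n" and b: "b : \<M> 1 n" for C b z
 proof -
  have e: "lblk n (C * C0) (b * C0 + z \<cdot> b0) (z * x) = lblk n C b z * ?T"
   by (rule QL_mult[symmetric]) (use C b C0 b0 in auto)
  have "lblk n C b z * ?T * minv ?T = lblk n C b z"
   using minv[OF T dT] C b T assoc_mult_mat[of "lblk n C b z" "Suc n" "Suc n" ?T "Suc n" "minv ?T" "Suc n"] by simp
  thus ?thesis unfolding g_def h_def wg_def e by simp
 qed
 have inner: "(\<integral>b|1,n. \<integral>z. g (C * C0) b z) =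
   ennreal ((cmod (det C0))\<^sup>2 * (cmod x)\<^sup>2) * (\<integral>b|1,n. \<integral>z. h C b z)" if C: "C : \<M> n n" for C
 proof -
  have CC: "C * C0 : \<M> n n" using C C0 by simp
  have mx: "(%p. snd (fst p)) : \<B> (((lebm n n) \<Otimes> \<L>) \<Otimes> lebm 1 n)"
   using measurable_compose[OF measurable_fst measurable_snd, of "lebm n n" "lborel :: complex measure" "lebm 1 n"] by simp
  have m1: "(%z. \<integral>b|1,n. g (C * C0) b z) : \<B> borel"
  proof -
   have "(%(q, b). g (C * C0) b (snd q)) : \<B> ((lebm n n \<Otimes> lborel) \<Otimes> lebm 1 n)"
    unfolding case_prod_beta' by (rule mg[OF measurable_const_mat[OF CC] measurable_snd mx])
   from measurable_nn_integral_lebm[OF this]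
   have "(%q. \<integral>b|1,n. g (C * C0) b (snd q)) : \<B> (lebm n n \<Otimes> lborel)" .
   from measurable_compose[OF measurable_Pair1'[OF lebm_ident[THEN measurable_space, of "0\<^sub>m n n" n n]] this]
   show ?thesis by simp
  qed
  have b1: "(\<integral>b|1,n. g (C * C0) b (z * x)) = ennreal ((cmod (det C0))\<^sup>2) * (\<integral>b|1,n. h C b z)" for z
  proof -
   have "(\<integral>b|1,n. g (C * C0) b (z * x)) =
    ennreal ((cmod (det C0))\<^sup>2 * ((cmod 1)\<^sup>2) ^ n) * (\<integral>b|1,n. g (C * C0) (1 \<cdot> (b * C0) + z \<cdot> b0) (z * x))"
    by (rule nn_integral_row_affine[OF _ C0 one_neq_zero])
      (use mg[OF measurable_const_mat[OF CC] lebm_ident borel_measurable_const] b0 in auto)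
   also have "(\<integral>b|1,n. g (C * C0) (1 \<cdot> (b * C0) + z \<cdot> b0) (z * x)) = (\<integral>b|1,n. h C b z)"
   proof (rule nn_integral_cong)
    fix b assume b: "b : space (lebm 1 n)"
    have "1 \<cdot> (b * C0) = b * C0" by (rule eq_matI) auto
    thus "g (C * C0) (1 \<cdot> (b * C0) + z \<cdot> b0) (z * x) = h C b z" using gh[OF C, of b z] b by simp
   qed
   finally show ?thesis by simp
  qed
  have mh: "(%(z, b). h C b z) : \<B> (lborel \<Otimes> lebm 1 n)"
   unfolding case_prod_beta' h_def
   by (intro measurable_times_ennreal measurable_stepf[OF F] measurable_gw[where n = "Suc n"] measurable_blk measurable_const_mat C CC zero_carrier_mat
     borel_measurable_const borel_measurable_times measurable_snd)
     (rule measurable_compose[OF measurable_fst], simp)+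
  have "(\<integral>b|1,n. \<integral>z. g (C * C0) b z) = (\<integral>z. \<integral>b|1,n. g (C * C0) b z)"
   by (rule sw[OF CC])
  also have "... = ennreal ((cmod x)\<^sup>2) * (\<integral>z. \<integral>b|1,n. g (C * C0) b (z * x))"
   using nn_integral_lborel_complex_scale[OF x m1] by (simp add: mult.commute)
  also have "(\<integral>z. \<integral>b|1,n. g (C * C0) b (z * x)) = ennreal ((cmod (det C0))\<^sup>2) * (\<integral>z. \<integral>b|1,n. h C b z)"
   unfolding b1 by (rule nn_integral_cmult) (rule measurable_nn_integral_lebm[OF mh])
  also have "(\<integral>z. \<integral>b|1,n. h C b z) = (\<integral>b|1,n. \<integral>z. h C b z)"
   by (rule nn_integral_swap[OF sigma_finite_lborel sigma_finite_lebm mh])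
  finally show ?thesis by (simp add: ennreal_mult mult_ac)
 qed
 let ?w = "ennreal (1 / cmod (det ?T) ^ (2 * Suc n))"
 have mpair: "(%(C, b). \<integral>z. g C b z) : \<B> (lebm n n \<Otimes> lebm 1 n)"
 proof -
  have "(%(q, z). g (fst q) (snd q) z) : \<B> ((lebm n n \<Otimes> lebm 1 n) \<Otimes> lborel)"
   unfolding case_prod_beta'
   by (rule mg[OF measurable_compose[OF measurable_fst measurable_fst] measurable_compose[OF measurable_fst measurable_snd] snd''])
  from measurable_nn_integral_lborel[OF this] show ?thesis by (simp add: case_prod_beta')
 qed
 have mC: "(%C. \<integral>b|1,n. \<integral>z. g C b z) : \<B> (lebm n n)"
  by (rule measurable_nn_integral_lebm[OF mpair])
 have "(\<integral>C|n,n. \<integral>b|1,n. \<integral>z. g C b z) =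
   ennreal ((cmod (det C0))\<^sup>2) ^ n * (\<integral>C|n,n. \<integral>b|1,n. \<integral>z. g (C * C0) b z)"
  by (rule nn_integral_lebm_mult_right[OF mC C0])
 also have "(\<integral>C|n,n. \<integral>b|1,n. \<integral>z. g (C * C0) b z) =
   (\<integral>C|n,n. \<integral>b|1,n. \<integral>z. gau b * (gx m z * gw m C) *
    (ennreal ((cmod (det C0))\<^sup>2 * (cmod x)\<^sup>2) * ?w * stepf n F (z * x) (C * C0)))"
 proof (rule nn_integral_cong)
  fix C assume "C : space (lebm n n)"
  hence C: "C : \<M> n n" by simp
  let ?c = "ennreal ((cmod (det C0))\<^sup>2 * (cmod x)\<^sup>2)"
  have CC: "C * C0 : \<M> n n" using C C0 by simp
  have mh: "(%(b, z). h C b z) : \<B> (lebm 1 n \<Otimes> lborel)"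
   unfolding case_prod_beta' h_def
   by (intro measurable_times_ennreal measurable_stepf[OF F] measurable_gw[where n = "Suc n"] measurable_blk measurable_const_mat C CC zero_carrier_mat
     borel_measurable_const borel_measurable_times measurable_fst snd')
  have mh1: "(%z. h C b z) : \<B> lborel" if "b : \<M> 1 n" for b
   using measurable_compose[OF measurable_Pair1'[of b "lebm 1 n" lborel] mh] that by simp
  have "(\<integral>b|1,n. \<integral>z. g (C * C0) b z) = (\<integral>b|1,n. ?c * (\<integral>z. h C b z))"
   unfolding inner[OF C]
   by (rule nn_integral_cmult[symmetric]) (rule measurable_nn_integral_lborel[OF mh])
  also have "... = (\<integral>b|1,n. \<integral>z. ?c * h C b z)"
   by (intro nn_integral_cong nn_integral_cmult[symmetric] mh1) simp
  also have "... = (\<integral>b|1,n. \<integral>z. gau b * (gx m z * gw m C) * (?c * ?w * stepf n F (z * x) (C * C0)))"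
   by (intro nn_integral_cong) (use C in \<open>simp add: h_def gw_blk mult_ac\<close>)
  finally show "(\<integral>b|1,n. \<integral>z. g (C * C0) b z) =
    (\<integral>b|1,n. \<integral>z. gau b * (gx m z * gw m C) * (?c * ?w * stepf n F (z * x) (C * C0)))" .
 qed
 also have "... = gn n * (\<integral>z. gx m z * (\<integral>C|n,n. gw m C * (ennreal ((cmod (det C0))\<^sup>2 * (cmod x)\<^sup>2) * ?w * stepf n F (z * x) (C * C0))))"
 proof (rule gauss_blk_integral, unfold case_prod_beta', intro measurable_times_ennreal borel_measurable_const measurable_stepf[OF F])
  show "(%p. fst p * x) : \<B> (lborel \<Otimes> lebm n n)"
   by (intro borel_measurable_times borel_measurable_const measurable_compose[OF measurable_fst]) simp
  show "(%p. snd p * C0) : measurable (lborel \<Otimes> lebm n n) (lebm n n)"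
   by (intro measurable_mat_mult[OF measurable_snd measurable_const_mat[OF C0(1)]])
 qed
 also have "(\<integral>z. gx m z * (\<integral>C|n,n. gw m C * (ennreal ((cmod (det C0))\<^sup>2 * (cmod x)\<^sup>2) * ?w * stepf n F (z * x) (C * C0)))) =
   ennreal ((cmod (det C0))\<^sup>2 * (cmod x)\<^sup>2) * ?w * stepX n m (stepf n F) x C0" (is "_ = ?k * _")
 proof -
  have m1: "(%C. gw m C * stepf n F (z * x) (C * C0)) : \<B> (lebm n n)" for z
   by (intro measurable_times_ennreal measurable_stepf[OF F] measurable_gw[OF lebm_ident] lebm_ident borel_measurable_const
     measurable_mat_mult[OF lebm_ident measurable_const_mat[OF C0(1)]])
  have e: "(\<integral>C|n,n. gw m C * (?k * stepf n F (z * x) (C * C0))) = ?k * (\<integral>C|n,n. gw m C * stepf n F (z * x) (C * C0))" for z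
   using nn_integral_cmult[OF m1, of ?k z] by (simp add: mult_ac)
  have "(%(z, C). gw m C * stepf n F (z * x) (C * C0)) : \<B> (lborel \<Otimes> lebm n n)"
   unfolding case_prod_beta'
   by (intro measurable_times_ennreal measurable_stepf[OF F] measurable_gw[OF measurable_snd] measurable_snd borel_measurable_const borel_measurable_times
     measurable_mat_mult[OF measurable_snd measurable_const_mat[OF C0(1)]]) (rule measurable_compose[OF measurable_fst], simp)
  from measurable_nn_integral_lebm[OF this]
  have m2: "(%z. gx m z * (\<integral>C|n,n. gw m C * stepf n F (z * x) (C * C0))) : \<B> lborel"
   by (intro measurable_times_ennreal measurable_gx') simp_all
  have "(\<integral>z. gx m z * (?k * (\<integral>C|n,n. gw m C * stepf n F (z * x) (C * C0)))) =
    ?k * (\<integral>z. gx m z * (\<integral>C|n,n. gw m C * stepf n F (z * x) (C * C0)))"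
   using nn_integral_cmult[OF m2, of ?k] by (simp add: mult_ac)
  thus ?thesis unfolding e by (simp add: stepX_def)
 qed
 finally have r: "(\<integral>C|n,n. \<integral>b|1,n. \<integral>z. g C b z) =
   (ennreal ((cmod (det C0))\<^sup>2) ^ n * ?k) * (gn n * stepX n m (stepf n F) x C0)" by (simp add: mult_ac)
 have gen: "ennreal c ^ n * (ennreal (c * y) * ennreal d) = ennreal (c ^ n * ((c * y) * d))"
  if "0 <= c" "0 <= y" "0 <= d" for c y d
  using that by (simp add: ennreal_mult ennreal_power[symmetric])
 have "ennreal ((cmod (det C0))\<^sup>2) ^ n * ?k =
   ennreal (((cmod (det C0))\<^sup>2) ^ n * (((cmod (det C0))\<^sup>2 * (cmod x)\<^sup>2) * (1 / cmod (det ?T) ^ (2 * Suc n))))"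
  by (rule gen) auto
 also have "((cmod (det C0))\<^sup>2) ^ n * (((cmod (det C0))\<^sup>2 * (cmod x)\<^sup>2) * (1 / cmod (det ?T) ^ (2 * Suc n))) = 1 / cmod x ^ (2 * n)"
  unfolding det_blk_lower[OF C0(1) b0] using C0 x by (simp add: norm_mult power_mult_distrib power_mult field_simps power2_eq_square)
 finally show ?thesis using r unfolding g_def by simp
qed

text \<open>After the deflation of the product, the integrals over \<open>C\<close>,
  \<open>b\<close> and \<open>z\<close> are pulled inside \<open>PI ms\<close>, where they form the
  left invariant function \<open>Xi\<close>; \<open>PI_blk\<close> then makes the remaining factors
  triangular. The leftmost factor contributes \<open>kap n\<close> through the deflation and
  \<open>gn n\<close> through \<open>stepf_blk\<close>.\<close>

lemma PI_char_poly_step: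
 assumes F: "F : \<B> polyM"
 shows "of_nat (Suc n) * PI (m # ms) (Suc n) (%A. F (char_poly A)) =
  kap n * (gn n * (kap n * gn n) ^ length ms) * XI (m # ms) (%z. PI (m # ms) n (stepf n F z))"
proof -
 let ?k = "Suc n"
 note mFc = measurable_comp_char_poly[OF F, where n = "Suc n"]
 define Ps where "Ps P = PI ms ?k (wg m ?k P)" for P
 have mPs: "Ps : \<B> (lebm ?k ?k)"
 proof -
  have "(%(P, B). wg m ?k P B) : \<B> (lebm ?k ?k \<Otimes> lebm ?k ?k)"
   unfolding case_prod_beta' by (rule measurable_wg[OF measurable_fst measurable_snd])
  from PI_measurable[OF this] show ?thesis unfolding Ps_def .
 qed
 have mw1: "wg m ?k P : \<B> (lebm ?k ?k)" if "P : \<M> ?k ?k" for P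
  by (rule measurable_wg[OF measurable_const_mat[OF that] lebm_ident])
 \<comment> \<open>Right multiplication by the inverse of \<open>B\<close> makes the product itself
   the integration variable; the Jacobian is the determinant power in \<open>wg\<close>.\<close>
 have "PI (m # ms) ?k (%A. F (char_poly A)) = PI ms ?k (%B. \<integral>P|?k,?k. F (char_poly P) * wg m ?k P B)"
  unfolding PI.simps
 proof (rule PI_cong_nonsing)
  fix B :: "complex mat" assume B: "B : \<M> ?k ?k" "det B ~= 0"
  note i = minv[OF B]
  have i0: "det (minv B) ~= 0" using i(4) B by simp
  have mm: "(%A. gw m A * F (char_poly (A * B))) : \<B> (lebm ?k ?k)"
   by (intro measurable_times_ennreal measurable_gw[OF lebm_ident] mFc measurable_mat_mult[OF lebm_ident measurable_const_mat[OF B(1)]])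
  have w: "ennreal ((cmod (det (minv B)))\<^sup>2) ^ ?k = ennreal (1 / cmod (det B) ^ (2 * ?k))"
   unfolding i(4) norm_divide norm_one power_one_over power_mult
   by (subst ennreal_power) (simp_all add: power_one_over del: power_Suc)
  have m2: "(%A. gw m (A * minv B) * F (char_poly (A * minv B * B))) : \<B> (lebm ?k ?k)"
   using measurable_mult_const_right[OF i(1) mm] .
  have "(\<integral>A|?k,?k. gw m A * F (char_poly (A * B))) =
   ennreal (1 / cmod (det B) ^ (2 * ?k)) * (\<integral>A|?k,?k. gw m (A * minv B) * F (char_poly (A * minv B * B)))"
   unfolding w[symmetric] by (rule nn_integral_lebm_mult_right[OF mm i(1) i0])
  also have "... = (\<integral>A|?k,?k. ennreal (1 / cmod (det B) ^ (2 * ?k)) * (gw m (A * minv B) * F (char_poly (A * minv B * B))))"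
   by (rule nn_integral_cmult[OF m2, symmetric])
  also have "... = (\<integral>P|?k,?k. F (char_poly P) * wg m ?k P B)"
  proof (rule nn_integral_cong)
   fix A assume A: "A : space (lebm ?k ?k)"
   have "A * minv B * B = A"
    using A i B assoc_mult_mat[of A ?k ?k "minv B" ?k B ?k] by simp
   thus "ennreal (1 / cmod (det B) ^ (2 * ?k)) * (gw m (A * minv B) * F (char_poly (A * minv B * B))) = F (char_poly A) * wg m ?k A B"
    by (simp add: wg_def mult_ac del: mult_Suc_right power_Suc)
  qed
  finally show "(\<integral>A|?k,?k. gw m A * F (char_poly (A * B))) = (\<integral>P|?k,?k. F (char_poly P) * wg m ?k P B)" .
 qed
 also have "... = (\<integral>P|?k,?k. PI ms ?k (%B. F (char_poly P) * wg m ?k P B))"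
  by (rule PI_swap[OF sigma_finite_lebm], unfold case_prod_beta',
    intro measurable_times_ennreal mFc[OF measurable_fst] measurable_wg[OF measurable_fst measurable_snd])
 also have "... = (\<integral>P|?k,?k. F (char_poly P) * Ps P)"
  unfolding Ps_def by (intro nn_integral_cong PI_cmult mw1) simp
 finally have e1: "PI (m # ms) ?k (%A. F (char_poly A)) = (\<integral>P|?k,?k. F (char_poly P) * Ps P)" .
 \<comment> \<open>By \<open>wg_conj\<close> the conjugation becomes a right factor of the remaining
   product, where \<open>PI_right_inv\<close> removes it.\<close>
 have conj: "F (char_poly (U * P * ctr U)) * Ps (U * P * ctr U) = F (char_poly P) * Ps P"
  if U: "uni ?k U" and P: "P : \<M> ?k ?k" for U P
 proof -
  have "Ps (U * P * ctr U) = PI ms ?k (%B. wg m ?k P (B * U))"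
   unfolding Ps_def by (rule PI_cong_nonsing) (rule wg_conj[OF P _ _ U])
  also have "... = Ps P"
   unfolding Ps_def by (rule PI_right_inv[OF mw1[OF P] U wg_left_inv[OF P]])
  finally show ?thesis using uni_conj_char_poly[OF U P] by simp
 qed
 have mFPs: "(%P. F (char_poly P) * Ps P) : \<B> (lebm ?k ?k)"
  by (intro measurable_times_ennreal mFc[OF lebm_ident] mPs)
 define g where "g C b z B = stepf n F z C * wg m ?k (lblk n C b z) B" for C b z B
 note mg = measurable_stepf_wg[OF F, where n = n and m = m, folded g_def]
 have sl: "(%p. snd p) : \<B> (K \<Otimes> \<L>)" for K :: "(complex mat \<times> complex mat) measure"
  using measurable_snd[of K "lborel :: complex measure"] by simp
 have sl3: "(%p. snd p) : \<B> (K \<Otimes> \<L>)" for K :: "((complex mat \<times> complex mat) \<times> complex mat) measure"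
  using measurable_snd[of K "lborel :: complex measure"] by simp
 have fl: "(%p. fst p) : \<B> (\<L> \<Otimes> K)" for K :: "complex mat measure"
  using measurable_fst[of "lborel :: complex measure" K] by simp
 define gz where "gz C b B = (\<integral>z. g C b z B)" for C b B
 define gb where "gb C B = (\<integral>b|1,n. gz C b B)" for C B
 have gz3: "(%(q, b). gz (fst q) b (snd q)) : \<B> ((lebm n n \<Otimes> lebm ?k ?k) \<Otimes> lebm 1 n)"
 proof -
  have "(%(q, z). g (fst (fst q)) (snd q) z (snd (fst q))) : \<B> (((lebm n n \<Otimes> lebm ?k ?k) \<Otimes> lebm 1 n) \<Otimes> lborel)"
   unfolding case_prod_beta'
   by (rule mg[OF measurable_compose[OF measurable_compose[OF measurable_fst measurable_fst] measurable_fst]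
      measurable_compose[OF measurable_fst measurable_snd] sl3
      measurable_compose[OF measurable_compose[OF measurable_fst measurable_fst] measurable_snd]])
  from measurable_nn_integral_lborel[OF this]
  show ?thesis by (simp add: case_prod_beta' gz_def)
 qed
 have gb2: "(%(C, B). gb C B) : \<B> (lebm n n \<Otimes> lebm ?k ?k)"
  using measurable_nn_integral_lebm[OF gz3] by (simp add: case_prod_beta' gb_def)
 have gz2: "(%(b, B). gz C b B) : \<B> (lebm 1 n \<Otimes> lebm ?k ?k)" if C: "C : \<M> n n" for C
 proof -
  have "(%p. ((C, snd p), fst p)) : measurable (lebm 1 n \<Otimes> lebm ?k ?k) ((lebm n n \<Otimes> lebm ?k ?k) \<Otimes> lebm 1 n)"
   by (intro measurable_Pair measurable_const_mat[OF C] measurable_fst measurable_snd)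
  from measurable_compose[OF this gz3] show ?thesis by (simp add: case_prod_beta')
 qed
 \<comment> \<open>A function of the remaining product alone, which inherits left invariance from
   \<open>wg\<close>.\<close>
 define Xi where "Xi B = (\<integral>C|n,n. gb C B)" for B
 have mXi: "Xi : \<B> (lebm ?k ?k)"
 proof -
  have "(%p. (snd p, fst p)) : measurable (lebm ?k ?k \<Otimes> lebm n n) (lebm n n \<Otimes> lebm ?k ?k)"
   by (intro measurable_Pair measurable_fst measurable_snd)
  from measurable_compose[OF this gb2]
  have "(%(B, C). gb C B) : \<B> (lebm ?k ?k \<Otimes> lebm n n)" by (simp add: case_prod_beta')
  from measurable_nn_integral_lebm[OF this] show ?thesis unfolding Xi_def .
 qed
 \<comment> \<open>From here on the integrals over \<open>z\<close>, \<open>b\<close> and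
   \<open>C\<close> change places with \<open>PI ms\<close>, one at a time from the inside.\<close>
 have "(\<integral>C|n,n. \<integral>b|1,n. \<integral>z. ennreal ((cmod (det (zsub n z C)))\<^sup>2) * (F (char_poly (lblk n C b z)) * Ps (lblk n C b z))) =
   (\<integral>C|n,n. \<integral>b|1,n. \<integral>z. PI ms ?k (g C b z))"
 proof (intro nn_integral_cong)
  fix C b z assume Cb: "C : space (lebm n n)" "b : space (lebm 1 n)"
  hence "PI ms ?k (g C b z) = stepf n F z C * PI ms ?k (wg m ?k (lblk n C b z))"
   unfolding g_def by (intro PI_cmult mw1) simp
  thus "ennreal ((cmod (det (zsub n z C)))\<^sup>2) * (F (char_poly (lblk n C b z)) * Ps (lblk n C b z)) = PI ms ?k (g C b z)"
   using Cb char_poly_blk_lower[of C n b z] by (simp add: stepf_def Ps_def mult.assoc)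
 qed
 also have "... = (\<integral>C|n,n. \<integral>b|1,n. PI ms ?k (gz C b))"
 proof (intro nn_integral_cong)
  fix C b assume "C : space (lebm n n)" "b : space (lebm 1 n)"
  hence Cb: "C : \<M> n n" "b : \<M> 1 n" by simp_all
  have "(%(z, B). g C b z B) : \<B> (lborel \<Otimes> lebm ?k ?k)"
   unfolding case_prod_beta'
   by (rule mg[OF measurable_const_mat[OF Cb(1)] measurable_const_mat[OF Cb(2)] fl measurable_snd])
  from PI_swap[OF sigma_finite_lborel this]
  show "(\<integral>z. PI ms ?k (g C b z)) = PI ms ?k (gz C b)" unfolding gz_def by simp
 qed
 also have "... = (\<integral>C|n,n. PI ms ?k (gb C))"
 proof (rule nn_integral_cong)
  fix C assume "C : space (lebm n n)"
  hence C: "C : \<M> n n" by simp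
  have "gb C = (%B. \<integral>b|1,n. gz C b B)" by (rule ext) (rule gb_def)
  thus "(\<integral>b|1,n. PI ms ?k (gz C b)) = PI ms ?k (gb C)"
   using PI_swap[OF sigma_finite_lebm gz2[OF C], of ms] by simp
 qed
 also have "... = PI ms ?k Xi"
  unfolding Xi_def by (rule PI_swap[OF sigma_finite_lebm gb2, symmetric])
 also have "PI ms ?k Xi = (kap n * gn n) ^ length ms * XI ms (%x. PI ms n (%C. gn n * stepX n m (stepf n F) x C))"
 proof (rule PI_blk[OF mXi])
  show "Xi (U * B) = Xi B" if "uni ?k U" "B : \<M> ?k ?k" for U B
   unfolding Xi_def gb_def gz_def g_def
   by (intro nn_integral_cong arg_cong2[where f = "(*)"] refl wg_left_inv that) simp
  show "(%(x, C). gn n * stepX n m (stepf n F) x C) : \<B> (lborel \<Otimes> lebm n n)"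
   using stepX_measurable[OF measurable_stepf'[OF F, of n], of m] unfolding case_prod_beta' by (intro measurable_times_ennreal) auto
  show "Xi (lblk n C b x) = ennreal (1 / cmod x ^ (2 * n)) * (gn n * stepX n m (stepf n F) x C)"
   if "x ~= 0" "C : \<M> n n" "det C ~= 0" "b : \<M> 1 n" for x C b
   unfolding Xi_def gb_def gz_def g_def by (rule stepf_blk[OF F that])
 qed
 also have "XI ms (%x. PI ms n (%C. gn n * stepX n m (stepf n F) x C)) = XI ms (%x. gn n * PI ms n (stepX n m (stepf n F) x))"
  by (intro arg_cong[where f = "XI ms"] ext PI_cmult stepX_measurable1[OF measurable_stepf'[OF F]])
 also have "... = gn n * XI ms (%x. PI ms n (stepX n m (stepf n F) x))"
  by (rule XI_cmult) (use PI_measurable[OF stepX_measurable[OF measurable_stepf'[OF F]]] in simp)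
 also have "... = gn n * XI (m # ms) (%x. PI (m # ms) n (stepf n F x))" unfolding XI_PI_step[OF measurable_stepf'[OF F]] ..
 finally have e2: "(\<integral>C|n,n. \<integral>b|1,n. \<integral>z. ennreal ((cmod (det (zsub n z C)))\<^sup>2) * (F (char_poly (lblk n C b z)) * Ps (lblk n C b z))) =
   (kap n * gn n) ^ length ms * (gn n * XI (m # ms) (%x. PI (m # ms) n (stepf n F x)))" .
 have "of_nat ?k * (\<integral>P|?k,?k. F (char_poly P) * Ps P) =
  kap n * (\<integral>C|n,n. \<integral>b|1,n. \<integral>z. ennreal ((cmod (det (zsub n z C)))\<^sup>2) * (F (char_poly (lblk n C b z)) * Ps (lblk n C b z)))"
  by (rule schur_deflation[OF mFPs conj])
 thus ?thesis unfolding e1 e2 by (simp only: mult_ac)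
qed

section \<open>Induction on the size: the joint law of the roots\<close>

definition vdm :: "nat => (nat => complex) => real" where
 "vdm n x = (\<Prod>j<n. \<Prod>i<j. (cmod (x i - x j))\<^sup>2)"

lemma vdm_nonneg: "0 <= vdm n x"
 by (auto simp: vdm_def intro!: prod_nonneg)

lemma measurable_vdm:
 assumes "!!i. i < n ==> (%p. x p i) : \<B> N"
 shows "(%p. vdm n (x p)) : \<B> N"
 unfolding vdm_def
 by (intro borel_measurable_prod borel_measurable_power borel_measurable_norm[THEN measurable_compose[rotated]] borel_measurable_diff assms) auto

definition rootpoly :: "nat => (nat => complex) => complex poly" where
 "rootpoly n x = (\<Prod>l<n. [:- x l, 1:])"

lemma measurable_rootpoly:
 assumes "!!i. i < n ==> (%p. x p i) : \<B> N"
 shows "(%p. rootpoly n (x p)) : measurable N polyM"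
 unfolding rootpoly_def
 by (intro measurable_poly_prod measurable_poly_linear borel_measurable_uminus borel_measurable_const assms) auto

text \<open>The new factors are the squared distances from \<open>z\<close> to the old points, whose
  product is the squared modulus at \<open>z\<close> of the monic polynomial with these
  roots.\<close>

lemma vdm_Suc: "vdm (Suc n) (x(n := z)) = vdm n x * (cmod (poly (rootpoly n x) z))\<^sup>2"
proof -
 have "vdm (Suc n) (x(n := z)) = (\<Prod>j<n. \<Prod>i<j. (cmod (x i - x j))\<^sup>2) * (\<Prod>i<n. (cmod (x i - z))\<^sup>2)"
  unfolding vdm_def prod.lessThan_Suc by (intro arg_cong2[where f = "(*)"] prod.cong refl) auto
 also have "(\<Prod>i<n. (cmod (x i - z))\<^sup>2) = (cmod (poly (rootpoly n x) z))\<^sup>2"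
  by (simp add: rootpoly_def poly_prod prod_norm[symmetric] prod_power_distrib norm_minus_commute)
 finally show ?thesis by (simp add: vdm_def)
qed

lemma rootpoly_Suc: "rootpoly (Suc n) (x(n := z)) = [:- z, 1:] * rootpoly n x"
proof -
 have "(\<Prod>l<n. [:- (x(n := z)) l, 1:]) = (\<Prod>l<n. [:- x l, 1:])" by (rule prod.cong) auto
 thus ?thesis by (simp add: rootpoly_def prod.lessThan_Suc mult.commute del: mult_pCons_left mult_pCons_right)
qed

lemma gn_finite_pos: "gn n < \<infinity>" "gn n ~= 0"
 unfolding gn_def by (rule nn_integral_lebm_gaussian_finite_pos)+

lemma finite_pos_mult: "a < \<infinity> ==> a ~= 0 ==> b < \<infinity> ==> b ~= 0 ==> a * b < (\<infinity>::ennreal) & a * b ~= 0"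
 by (simp add: ennreal_mult_less_top)

text \<open>Deflation exposes one root \<open>z\<close> with the factor \<open>|p(z)|^2\<close>,
  where \<open>p\<close> is the characteristic polynomial of the complementary block; this is the
  step from \<open>vdm n\<close> to \<open>vdm (Suc n)\<close>. The constant is chosen before
  \<open>F\<close>, so that the test function 1 can later determine it.\<close>

theorem PI_char_poly:
 fixes W :: "complex => ennreal"
 assumes W: "W : \<B> borel"
  and XI: "!!ph. ph : \<B> borel ==> XI (m # ms) ph = (\<integral>z. ph z * W z)"
 shows "\<exists>c. 0 < c & c < \<infinity> & (\<forall>F\<in>\<B> polyM. PI (m # ms) n (%A. F (char_poly A)) =
   c * (\<integral>\<^sup>+x. (\<Prod>l<n. W (x l)) * ennreal (vdm n x) * F (rootpoly n x) \<partial>\<P> {..<n}))"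
proof (induction n)
 case 0
 \<comment> \<open>There is only one matrix of size zero, so the integrand is constant and every
   factor contributes 1.\<close>
 have p0: "PI ms 0 Ph = PI ms 0 (%_. Ph (1\<^sub>m 0))" for ms and Ph :: "complex mat => ennreal"
  by (rule PI_cong_nonsing) (rule arg_cong[where f = Ph], rule eq_matI, auto)
 have c0: "PI ms 0 (%_. k) = (\<Prod>m\<leftarrow>ms. \<integral>A|0,0. gw m A) * k" for ms and k :: ennreal
 proof (induction ms arbitrary: k)
  case (Cons m ms)
  have "(\<integral>A|0,0. gw m A * k) = (\<integral>A|0,0. gw m A) * k"
   by (rule nn_integral_multc[OF measurable_gw[OF lebm_ident]])
  thus ?case using Cons.IH by (simp add: mult_ac)
 qed simp
 have g1: "(\<integral>A|0,0. gw m A) = 1" for m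
 proof -
  have "(\<integral>A|0,0. gw m A) = gw m (0\<^sub>m 0 0)"
   using nn_integral_lebm_empty[OF measurable_gw[OF lebm_ident, of m 0]] by simp
  also have "... = 1" by (simp add: gw_def)
  finally show ?thesis .
 qed
 have "PI (m # ms) 0 (%A. F (char_poly A)) = F 1" for F
 proof -
  have "PI (m # ms) 0 (%A. F (char_poly A)) = PI (m # ms) 0 (%_. F (char_poly (1\<^sub>m 0)))"
   by (rule p0)
  also have "... = F (char_poly (1\<^sub>m 0))" unfolding c0 g1 by (simp add: map_replicate_const)
  also have "char_poly (1\<^sub>m 0 :: complex mat) = 1"
   by (simp add: char_poly_def char_poly_matrix_def)
  finally show ?thesis .
 qed
 thus ?case
  by (intro exI[of _ 1]) (simp add: rootpoly_def vdm_def PiM_empty nn_integral_count_space_finite del: PI.simps)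
next
 case (Suc n)
 then obtain c where c: "0 < c" "c < \<infinity>" and IH: "!!F. F : \<B> polyM ==> PI (m # ms) n (%A. F (char_poly A)) =
   c * (\<integral>\<^sup>+x. (\<Prod>l<n. W (x l)) * ennreal (vdm n x) * F (rootpoly n x) \<partial>\<P> {..<n})" by blast
 let ?P = "%n. PiM {..<n} (%_. \<L>)"
 let ?K = "kap n * (gn n * (kap n * gn n) ^ length ms)"
 have K: "?K < \<infinity>" "?K ~= 0"
  using kap_finite_pos[of n] gn_finite_pos[of n] finite_pos_mult ennreal_power_finite_pos by metis+
 \<comment> \<open>\<open>Suc n\<close> is the number of eigenvalues that could have been marked;
   \<open>?K\<close> collects the costs of one deflation in all factors, and \<open>c\<close> comes
   from the smaller size.\<close>
 let ?c = "ennreal (1 / real (Suc n)) * (?K * c)"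
 have c': "0 < ?c" "?c < \<infinity>"
  using finite_pos_mult[of ?K c] K c by (auto simp: ennreal_mult_less_top zero_less_iff_neq_zero)
 have "PI (m # ms) (Suc n) (%A. F (char_poly A)) =
   ?c * (\<integral>\<^sup>+x. (\<Prod>l<Suc n. W (x l)) * ennreal (vdm (Suc n) x) * F (rootpoly (Suc n) x) \<partial>?P (Suc n))"
  if F: "F : \<B> polyM" for F
 proof -
  \<comment> \<open>The test function for the smaller size, with the root \<open>z\<close> just
    split off as a parameter.\<close>
  let ?F = "%z p. ennreal ((cmod (poly p z))\<^sup>2) * F ([:- z, 1:] * p)"
  have mF: "?F z : \<B> polyM" for z
   by (intro measurable_times_ennreal measurable_norm_ennreal measurable_poly_eval measurable_compose[OF _ F]
     measurable_poly_mult measurable_poly_const borel_measurable_const measurable_ident_sets refl)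
  have "PI (m # ms) n (stepf n F z) = PI (m # ms) n (%A. ?F z (char_poly A))" for z
   by (rule PI_cong_nonsing) (simp add: stepf_def poly_char_poly)
  hence st: "PI (m # ms) n (stepf n F z) =
   c * (\<integral>\<^sup>+x. (\<Prod>l<n. W (x l)) * ennreal (vdm n x) * ?F z (rootpoly n x) \<partial>?P n)" for z
   using IH[OF mF[of z]] by simp
  let ?G = "%z x. (\<Prod>l<n. W (x l)) * ennreal (vdm n x) * ?F z (rootpoly n x)"
  have comp: "(%p. snd p i) : \<B> (lborel \<Otimes> ?P n)" if "i < n" for i
   using measurable_compose[OF measurable_snd measurable_component_singleton[of i "{..<n}" "%_. lborel"], of "lborel :: complex measure"] that by simp
  have fs: "(%p. fst p) : \<B> (\<L> \<Otimes> ?P n)"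
   using measurable_fst[of "lborel :: complex measure" "?P n"] by simp
  have mG: "(%(z, x). ?G z x) : \<B> (lborel \<Otimes> ?P n)"
   unfolding case_prod_beta'
   by (intro measurable_times_ennreal borel_measurable_prod_ennreal measurable_compose[OF comp W]
     measurable_compose[OF measurable_vdm measurable_ennreal] measurable_norm_ennreal measurable_poly_eval measurable_compose[OF _ F]
     measurable_poly_mult measurable_rootpoly measurable_poly_linear borel_measurable_uminus borel_measurable_const fs comp) auto
  have sfP: "sigma_finite_measure (?P n)"
   by (rule product_sigma_finite.sigma_finite[OF product_lborel]) simp
  have mI: "(%z. \<integral>\<^sup>+x. ?G z x \<partial>?P n) : \<B> borel"
   using sigma_finite_measure.borel_measurable_nn_integral[OF sfP mG] by simp
  have ins: "{..<Suc n} = insert n {..<n}" by auto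
  have mS: "(%x. (\<Prod>l<Suc n. W (x l)) * ennreal (vdm (Suc n) x) * F (rootpoly (Suc n) x)) : \<B> (?P (Suc n))"
   by (intro measurable_times_ennreal borel_measurable_prod_ennreal measurable_compose[OF _ W]
     measurable_compose[OF measurable_vdm measurable_ennreal] measurable_compose[OF measurable_rootpoly F])
     (use measurable_component_singleton[of _ "{..<Suc n}" "%_. \<L>"] in simp_all)
  have "of_nat (Suc n) * PI (m # ms) (Suc n) (%A. F (char_poly A)) = ?K * XI (m # ms) (%z. c * (\<integral>\<^sup>+x. ?G z x \<partial>?P n))"
   unfolding PI_char_poly_step[OF F] st ..
  also have "XI (m # ms) (%z. c * (\<integral>\<^sup>+x. ?G z x \<partial>?P n)) = c * XI (m # ms) (%z. \<integral>\<^sup>+x. ?G z x \<partial>?P n)"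
   by (rule XI_cmult[OF mI])
  also have "XI (m # ms) (%z. \<integral>\<^sup>+x. ?G z x \<partial>?P n) = (\<integral>z. (\<integral>\<^sup>+x. ?G z x \<partial>?P n) * W z)"
   by (rule XI[OF mI])
  also have "... = (\<integral>z. \<integral>\<^sup>+x. ?G z x * W z \<partial>?P n)"
  proof (rule nn_integral_cong)
   fix z :: complex
   have "?G z : \<B> (?P n)"
    using measurable_compose[OF measurable_Pair1'[of z lborel "?P n"] mG] by simp
   from nn_integral_multc[OF this, of "W z"]
   show "(\<integral>\<^sup>+x. ?G z x \<partial>?P n) * W z = (\<integral>\<^sup>+x. ?G z x * W z \<partial>?P n)" by simp
  qed
  also have "... = (\<integral>z. \<integral>\<^sup>+x. (\<Prod>l<Suc n. W ((x(n := z)) l)) * ennreal (vdm (Suc n) (x(n := z))) * F (rootpoly (Suc n) (x(n := z))) \<partial>?P n)"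
  proof (intro nn_integral_cong)
   fix z and x :: "nat => complex"
   have "(\<Prod>l<Suc n. W ((x(n := z)) l)) = (\<Prod>l<n. W (x l)) * W z"
    unfolding prod.lessThan_Suc by (intro arg_cong2[where f = "(*)"] prod.cong) auto
   thus "?G z x * W z = (\<Prod>l<Suc n. W ((x(n := z)) l)) * ennreal (vdm (Suc n) (x(n := z))) * F (rootpoly (Suc n) (x(n := z)))"
    unfolding vdm_Suc rootpoly_Suc ennreal_mult[OF vdm_nonneg zero_le_power2] by (simp only: mult_ac)
  qed
  also have "... = (\<integral>\<^sup>+x. (\<Prod>l<Suc n. W (x l)) * ennreal (vdm (Suc n) x) * F (rootpoly (Suc n) x) \<partial>?P (Suc n))"
   using product_sigma_finite.product_nn_integral_insert_rev[OF product_lborel _ _ mS[unfolded ins]]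
   by (simp add: ins)
  finally have e: "?K * (c * (\<integral>\<^sup>+x. (\<Prod>l<Suc n. W (x l)) * ennreal (vdm (Suc n) x) * F (rootpoly (Suc n) x) \<partial>?P (Suc n))) =
    ennreal (real (Suc n)) * PI (m # ms) (Suc n) (%A. F (char_poly A))" by (simp only: ennreal_of_nat_eq_real_of_nat)
  show ?thesis using ennreal_solve[OF _ e] by (simp only: of_nat_0_less_iff zero_less_Suc mult.assoc)
 qed
 thus ?case using c' by (intro exI[of _ ?c] conjI ballI) simp_all
qed

section \<open>Rectangular factors\<close>

lemma sum_lessThan_add: "sum f {..<a + b :: nat} = sum f {..<a} + (\<Sum>j<b. f (a + j) :: 'b::comm_monoid_add)"
 by (induction b) (simp_all add: add.assoc)

lemma fro_hcat:
 assumes "A : \<M> r c1" "B : \<M> r c2"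
 shows "fro (hcat A B) = fro A + fro B"
 unfolding fro_carrier[OF hcat_carrier[OF assms]] fro_carrier[OF assms(1)] fro_carrier[OF assms(2)] sum_lessThan_add sum.distrib
 by (intro arg_cong2[where f = "(+)"] sum.cong refl) (auto simp: index_hcat[OF assms])

lemma hcat_mult_append_zero:
 assumes A: "A : \<M> r d" and B: "B : \<M> r n" and G: "G : \<M> n n"
 shows "hcat A B * (0\<^sub>m d n @\<^sub>r G) = B * G"
proof (rule eq_matI)
 have Z: "0\<^sub>m d n @\<^sub>r G : \<M> (d + n) n" using G by simp
 note H = hcat_carrier[OF A B]
 fix i j assume "i < dim_row (B * G)" "j < dim_col (B * G)"
 hence ij: "i < r" "j < n" using B G by auto
 have v: "(0\<^sub>m d n @\<^sub>r G) $$ (k, j) = (if k < d then 0 else G $$ (k - d, j))" if "k < d + n" for k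
  using that ij G by (simp add: append_rows_def)
 have "(hcat A B * (0\<^sub>m d n @\<^sub>r G)) $$ (i, j) = (\<Sum>k<d + n. hcat A B $$ (i, k) * (0\<^sub>m d n @\<^sub>r G) $$ (k, j))"
  using ij H Z by (simp add: scalar_prod_def atLeast0LessThan)
 also have "... = (\<Sum>k<n. B $$ (i, k) * G $$ (k, j))"
  unfolding sum_lessThan_add using ij A B by (simp add: v index_hcat)
 also have "... = (B * G) $$ (i, j)" using ij B G by (simp add: scalar_prod_def atLeast0LessThan)
 finally show "(hcat A B * (0\<^sub>m d n @\<^sub>r G)) $$ (i, j) = (B * G) $$ (i, j)" .
qed (use assms hcat_carrier[OF A B] in \<open>auto simp: append_rows_def\<close>)

text \<open>The unnormalised expectation of \<open>Ph\<close> after \<open>B\<close> has been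
  multiplied from the left by a Gaussian matrix.\<close>

definition gauss_conv :: "nat => nat => (complex mat => ennreal) => complex mat => ennreal" where
 "gauss_conv r c Ph B = (\<integral>A|r,c. gau A * Ph (A * B))"

lemma gauss_conv_integrand_measurable:
 assumes "Ph : \<B> (lebm r n)" "B : \<M> c n"
 shows "(%A. gau A * Ph (A * B)) : \<B> (lebm r c)"
 by (intro measurable_times_ennreal measurable_fro_ennreal[OF lebm_ident]
   measurable_compose[OF measurable_mat_mult[OF lebm_ident measurable_const_mat[OF assms(2)]] assms(1)])

lemma measurable_gauss_conv:
 assumes Ph: "Ph : \<B> (lebm r n)"
 shows "gauss_conv r c Ph : \<B> (lebm c n)"
proof -
 have "(%(B, A). gau A * Ph (A * B)) : \<B> (lebm c n \<Otimes> lebm r c)"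
  unfolding case_prod_beta'
  by (intro measurable_times_ennreal measurable_fro_ennreal[OF measurable_snd]
   measurable_compose[OF measurable_mat_mult[OF measurable_snd measurable_fst] Ph])
 from measurable_nn_integral_lebm[OF this] show ?thesis unfolding gauss_conv_def .
qed

lemma gauss_conv_left_inv:
 assumes Ph: "Ph : \<B> (lebm r n)" and U: "uni c U" and B: "B : \<M> c n"
 shows "gauss_conv r c Ph (U * B) = gauss_conv r c Ph B"
proof -
 have "gauss_conv r c Ph (U * B) = (\<integral>A|r,c. gau (A * U) * Ph (A * U * B))"
  unfolding gauss_conv_def
  by (rule nn_integral_cong) (use U B uniD(1)[OF U] in \<open>simp add: fro_unitary_right assoc_mult_mat[of _ r c _ c _ n]\<close>)
 also have "... = gauss_conv r c Ph B"
  unfolding gauss_conv_def by (rule nn_integral_lebm_uni_right[OF gauss_conv_integrand_measurable[OF Ph B] U])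
 finally show ?thesis .
qed

text \<open>The first \<open>d\<close> columns of the Gaussian factor meet zero rows and contribute
  only their total mass.\<close>

lemma gauss_conv_append_zero:
 assumes Ph: "Ph : \<B> (lebm r n)" and G: "G : \<M> n n"
 shows "gauss_conv r (d + n) Ph (0\<^sub>m d n @\<^sub>r G) =
  (\<integral>A|r,d. gau A) * (\<integral>A|r,n. gau A * Ph (A * G))"
proof -
 have Z: "0\<^sub>m d n @\<^sub>r G : \<M> (d + n) n" using G by simp
 have "gauss_conv r (d + n) Ph (0\<^sub>m d n @\<^sub>r G) =
   (\<integral>A|r,d. \<integral>B|r,n. gau (hcat A B) * Ph (hcat A B * (0\<^sub>m d n @\<^sub>r G)))"
  unfolding gauss_conv_def by (rule nn_integral_lebm_hcat[OF gauss_conv_integrand_measurable[OF Ph Z]])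
 also have "... = (\<integral>A|r,d. \<integral>B|r,n. gau A * (gau B * Ph (B * G)))"
 proof (rule nn_integral_cong, rule nn_integral_cong)
  fix A B :: "complex mat" assume "A : space (lebm r d)" "B : space (lebm r n)"
  hence AB: "A : \<M> r d" "B : \<M> r n" by simp_all
  have "ennreal (exp (- (fro A + fro B))) = gau A * gau B"
   by (simp add: exp_diff exp_minus ennreal_mult[symmetric] divide_inverse)
  thus "gau (hcat A B) * Ph (hcat A B * (0\<^sub>m d n @\<^sub>r G)) =
    gau A * (gau B * Ph (B * G))"
   by (simp only: hcat_mult_append_zero[OF AB G] fro_hcat[OF AB] mult.assoc)
 qed
 also have "... = (\<integral>A|r,d. gau A * (\<integral>B|r,n. gau B * Ph (B * G)))"
  by (intro nn_integral_cong nn_integral_cmult gauss_conv_integrand_measurable[OF Ph G])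
 also have "... = (\<integral>A|r,d. gau A) * (\<integral>B|r,n. gau B * Ph (B * G))"
  by (rule nn_integral_multc[OF measurable_fro_ennreal[OF lebm_ident]])
 finally show ?thesis .
qed

text \<open>Surplus columns of a factor are spent on the zero rows of its successor, while surplus
  rows turn into a determinant power. So a factor receives the exponent of its own row surplus
  \<open>d'\<close>, although both its dimensions may exceed \<open>n\<close>.\<close>

lemma gauss_conv_reduction:
 "\<exists>k. 0 < k & k < \<infinity> & (\<forall>Ph :: complex mat => ennreal. Ph : \<B> (lebm (d' + n) n) -->
   (\<forall>U M :: complex mat. uni (d' + n) U --> M : \<M> (d' + n) n --> Ph (U * M) = Ph M) -->
   (\<forall>G\<in>\<M> n n. gauss_conv (d' + n) (d + n) Ph (0\<^sub>m d n @\<^sub>r G) =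
    k * (\<integral>A|n,n. gw d' A * Ph (0\<^sub>m d' n @\<^sub>r (A * G)))))"
proof -
 obtain k where k: "0 < k" "k < \<infinity>" and red: "!!Ps. Ps : \<B> (lebm (d' + n) n) ==>
   (!!U M. uni (d' + n) U ==> M : \<M> (d' + n) n ==> Ps (U * M) = Ps M) ==>
   (\<integral>X|d' + n,n. Ps X) = k * (\<integral>G|n,n. ennreal (cmod (det G) ^ (2 * d')) * Ps (0\<^sub>m d' n @\<^sub>r G))"
  using rect_reduction[of d' n] by blast
 let ?g = "\<integral>\<^sup>+A. gau A \<partial>lebm (d' + n) d"
 show ?thesis
 proof (intro exI[of _ "?g * k"] conjI allI impI ballI)
  show "0 < ?g * k" "?g * k < \<infinity>"
   using finite_pos_mult[OF nn_integral_lebm_gaussian_finite_pos[of "d' + n" d], of k] k by (auto simp: zero_less_iff_neq_zero)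
  fix Ph :: "complex mat => ennreal" and G :: "complex mat"
  assume Ph: "Ph : \<B> (lebm (d' + n) n)"
   and "\<forall>U M. uni (d' + n) U --> M : \<M> (d' + n) n --> Ph (U * M) = Ph M" and G: "G : \<M> n n"
  hence inv: "!!U M. uni (d' + n) U ==> M : \<M> (d' + n) n ==> Ph (U * M) = Ph M" by blast
  have "(\<integral>A|d' + n,n. gau A * Ph (A * G)) =
    k * (\<integral>A|n,n. ennreal (cmod (det A) ^ (2 * d')) * (gau (0\<^sub>m d' n @\<^sub>r A) * Ph ((0\<^sub>m d' n @\<^sub>r A) * G)))"
  proof (rule red[OF gauss_conv_integrand_measurable[OF Ph G]])
   fix U A :: "complex mat" assume U: "uni (d' + n) U" and A: "A : \<M> (d' + n) n"
   have "U * A * G = U * (A * G)" using A G uniD(1)[OF U] by simp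
   moreover have "Ph (U * (A * G)) = Ph (A * G)" by (rule inv[OF U]) (use A G in simp)
   ultimately show "gau (U * A) * Ph (U * A * G) = gau A * Ph (A * G)"
    using fro_unitary_left[OF U A] by simp
  qed
  also have "(\<integral>A|n,n. ennreal (cmod (det A) ^ (2 * d')) * (gau (0\<^sub>m d' n @\<^sub>r A) * Ph ((0\<^sub>m d' n @\<^sub>r A) * G))) =
    (\<integral>A|n,n. gw d' A * Ph (0\<^sub>m d' n @\<^sub>r (A * G)))"
  proof (rule nn_integral_cong)
   fix A assume "A : space (lebm n n)"
   hence A: "A : \<M> n n" by simp
   have "(0\<^sub>m d' n @\<^sub>r A) * G = 0\<^sub>m d' n @\<^sub>r (A * G)"
   proof (rule eq_matI)
    fix i j assume "i < dim_row (0\<^sub>m d' n @\<^sub>r (A * G))" "j < dim_col (0\<^sub>m d' n @\<^sub>r (A * G))"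
    hence ij: "i < d' + n" "j < n" using A G by (auto simp: append_rows_def)
    thus "((0\<^sub>m d' n @\<^sub>r A) * G) $$ (i, j) = (0\<^sub>m d' n @\<^sub>r (A * G)) $$ (i, j)"
     using A G by (auto simp: append_rows_def scalar_prod_def)
   qed (use A G in \<open>auto simp: append_rows_def\<close>)
   moreover have "fro (0\<^sub>m d' n @\<^sub>r A) = fro A"
   proof -
    have "fro (0\<^sub>m d' n @\<^sub>r A) = (\<Sum>i<d' + n. \<Sum>j<n. (cmod ((0\<^sub>m d' n @\<^sub>r A) $$ (i, j)))\<^sup>2)"
     by (rule fro_carrier) (use A in simp)
    also have "... = fro A" unfolding sum_lessThan_add fro_carrier[OF A] using A by (simp add: append_rows_def)
    finally show ?thesis .
   qed
   ultimately show "ennreal (cmod (det A) ^ (2 * d')) * (gau (0\<^sub>m d' n @\<^sub>r A) * Ph ((0\<^sub>m d' n @\<^sub>r A) * G)) =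
     gw d' A * Ph (0\<^sub>m d' n @\<^sub>r (A * G))"
    by (simp add: gw_def ennreal_mult mult.assoc)
  qed
  finally show "gauss_conv (d' + n) (d + n) Ph (0\<^sub>m d n @\<^sub>r G) =
    ?g * k * (\<integral>A|n,n. gw d' A * Ph (0\<^sub>m d' n @\<^sub>r (A * G)))"
   unfolding gauss_conv_append_zero[OF Ph G] by (simp add: mult.assoc)
 qed
qed

lemma measurable_append_zero: "Ph : \<B> (lebm (d + n) n) ==> (%G. Ph (0\<^sub>m d n @\<^sub>r G)) : \<B> (lebm n n)"
 by (rule measurable_compose[OF measurable_append_rows[OF measurable_const_mat[OF zero_carrier_mat] lebm_ident]])

text \<open>\<open>T i\<close> stands for the product of the factors from \<open>i\<close> on and
  \<open>D i\<close> for the row surplus of factor \<open>i\<close>. The left invariance that the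
  reduction requires is passed on, because \<open>gauss_conv\<close> makes every function left
  invariant.\<close>

lemma expectation_product_left_inv:
 fixes T :: "nat => 'a => complex mat" and D :: "nat => nat"
 assumes M: "prob_space M" and D: "D (Suc k) = 0"
  and last: "!!s. s : space M ==> T (Suc k) s = 1\<^sub>m n"
  and peel: "!!i. 1 <= i ==> i <= k ==> \<exists>g. 0 < g & g < \<infinity> & (\<forall>Ph\<in>\<B> (lebm (D i + n) n).
   (\<integral>\<^sup>+s. Ph (T i s) \<partial>M) = g * (\<integral>\<^sup>+s. gauss_conv (D i + n) (D (Suc i) + n) Ph (T (Suc i) s) \<partial>M))"
  and i: "1 <= i" "i + c = Suc k"
 shows "\<exists>g. 0 < g & g < \<infinity> & (\<forall>Ph :: complex mat => ennreal. Ph : \<B> (lebm (D i + n) n) -->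
   (\<forall>U M :: complex mat. uni (D i + n) U --> M : \<M> (D i + n) n --> Ph (U * M) = Ph M) -->
   (\<integral>\<^sup>+s. Ph (T i s) \<partial>M) = g * PI (map D [i..<Suc k]) n (%G. Ph (0\<^sub>m (D i) n @\<^sub>r G)))"
 using i
proof (induction c arbitrary: i)
 case 0
 hence i: "i = Suc k" by simp
 have "0\<^sub>m 0 n @\<^sub>r 1\<^sub>m n = (1\<^sub>m n :: complex mat)"
  by (rule eq_matI) (auto simp: append_rows_def)
 moreover have "(\<integral>\<^sup>+s. Ph (T (Suc k) s) \<partial>M) = Ph (1\<^sub>m n)" for Ph :: "complex mat => ennreal"
 proof -
  have "(\<integral>\<^sup>+s. Ph (T (Suc k) s) \<partial>M) = (\<integral>\<^sup>+s. Ph (1\<^sub>m n) \<partial>M)"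
   by (rule nn_integral_cong) (simp add: last)
  thus ?thesis using prob_space.emeasure_space_1[OF M] by simp
 qed
 ultimately show ?case unfolding i D by (intro exI[of _ 1]) simp
next
 case (Suc c)
 hence i: "1 <= Suc i" "Suc i + c = Suc k" "i <= k" by auto
 from Suc.IH[OF i(1,2)] obtain g1 where g1: "0 < g1" "g1 < \<infinity>" and IH: "!!Ph. Ph : \<B> (lebm (D (Suc i) + n) n) ==>
   (!!U M. uni (D (Suc i) + n) U ==> M : \<M> (D (Suc i) + n) n ==> Ph (U * M) = Ph M) ==>
   (\<integral>\<^sup>+s. Ph (T (Suc i) s) \<partial>M) = g1 * PI (map D [Suc i..<Suc k]) n (%G. Ph (0\<^sub>m (D (Suc i)) n @\<^sub>r G))" by blast
 from peel[OF Suc.prems(1) i(3)] obtain g2 where g2: "0 < g2" "g2 < \<infinity>" and peel': "!!Ph. Ph : \<B> (lebm (D i + n) n) ==>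
   (\<integral>\<^sup>+s. Ph (T i s) \<partial>M) = g2 * (\<integral>\<^sup>+s. gauss_conv (D i + n) (D (Suc i) + n) Ph (T (Suc i) s) \<partial>M)" by blast
 from gauss_conv_reduction[of "D i" n "D (Suc i)"] obtain g3 where g3: "0 < g3" "g3 < \<infinity>" and red: "!!Ph G. Ph : \<B> (lebm (D i + n) n) ==>
   (!!U M. uni (D i + n) U ==> M : \<M> (D i + n) n ==> Ph (U * M) = Ph M) ==> G : \<M> n n ==>
   gauss_conv (D i + n) (D (Suc i) + n) Ph (0\<^sub>m (D (Suc i)) n @\<^sub>r G) =
    g3 * (\<integral>A|n,n. gw (D i) A * Ph (0\<^sub>m (D i) n @\<^sub>r (A * G)))" by blast
 have l: "map D [i..<Suc k] = D i # map D [Suc i..<Suc k]" using i by (subst upt_conv_Cons) auto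
 show ?case
 proof (intro exI[of _ "g2 * (g1 * g3)"] conjI allI impI)
  show "0 < g2 * (g1 * g3)" "g2 * (g1 * g3) < \<infinity>"
   using g1 g2 g3 by (auto simp: ennreal_mult_less_top ennreal_zero_less_mult_iff)
  fix Ph :: "complex mat => ennreal"
  assume Ph: "Ph : \<B> (lebm (D i + n) n)"
   and "\<forall>U M. uni (D i + n) U --> M : \<M> (D i + n) n --> Ph (U * M) = Ph M"
  hence inv: "!!U M. uni (D i + n) U ==> M : \<M> (D i + n) n ==> Ph (U * M) = Ph M" by blast
  let ?Ph = "%G. Ph (0\<^sub>m (D i) n @\<^sub>r G)"
  have "(\<integral>\<^sup>+s. gauss_conv (D i + n) (D (Suc i) + n) Ph (T (Suc i) s) \<partial>M) =
    g1 * PI (map D [Suc i..<Suc k]) n (%G. gauss_conv (D i + n) (D (Suc i) + n) Ph (0\<^sub>m (D (Suc i)) n @\<^sub>r G))"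
   by (rule IH[OF measurable_gauss_conv[OF Ph] gauss_conv_left_inv[OF Ph]])
  also have "PI (map D [Suc i..<Suc k]) n (%G. gauss_conv (D i + n) (D (Suc i) + n) Ph (0\<^sub>m (D (Suc i)) n @\<^sub>r G)) =
    PI (map D [Suc i..<Suc k]) n (%G. g3 * (\<integral>A|n,n. gw (D i) A * ?Ph (A * G)))"
   by (rule PI_cong_nonsing) (rule red[OF Ph inv])
  also have "... = g3 * PI (map D [i..<Suc k]) n ?Ph"
   unfolding l PI.simps by (rule PI_cmult[OF PI_step_measurable1[OF measurable_append_zero[OF Ph]]])
  finally show "(\<integral>\<^sup>+s. Ph (T i s) \<partial>M) = g2 * (g1 * g3) * PI (map D [i..<Suc k]) n ?Ph"
   unfolding peel'[OF Ph] by (simp only: mult.assoc)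
 qed
qed

text \<open>The first factor has no surplus rows, so its rows are not reduced and \<open>Ph\<close>
  may be arbitrary. This matters because functions of the characteristic polynomial are not left
  invariant.\<close>

lemma expectation_product:
 fixes T :: "nat => 'a => complex mat" and D :: "nat => nat"
 assumes M: "prob_space M" and D: "D (Suc k) = 0" "D 1 = 0" and k: "1 <= k"
  and last: "!!s. s : space M ==> T (Suc k) s = 1\<^sub>m n"
  and peel: "!!i. 1 <= i ==> i <= k ==> \<exists>g. 0 < g & g < \<infinity> & (\<forall>Ph\<in>\<B> (lebm (D i + n) n).
   (\<integral>\<^sup>+s. Ph (T i s) \<partial>M) = g * (\<integral>\<^sup>+s. gauss_conv (D i + n) (D (Suc i) + n) Ph (T (Suc i) s) \<partial>M))"
 shows "\<exists>g. 0 < g & g < \<infinity> & (\<forall>Ph\<in>\<B> (lebm n n).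
   (\<integral>\<^sup>+s. Ph (T 1 s) \<partial>M) = g * PI (map D [1..<Suc k]) n Ph)"
proof -
 from expectation_product_left_inv[OF M D(1) last peel, of "Suc 1" "k - 1"] k
 obtain g1 where g1: "0 < g1" "g1 < \<infinity>" and IH: "!!Ph. Ph : \<B> (lebm (D (Suc 1) + n) n) ==>
   (!!U M. uni (D (Suc 1) + n) U ==> M : \<M> (D (Suc 1) + n) n ==> Ph (U * M) = Ph M) ==>
   (\<integral>\<^sup>+s. Ph (T (Suc 1) s) \<partial>M) = g1 * PI (map D [Suc 1..<Suc k]) n (%G. Ph (0\<^sub>m (D (Suc 1)) n @\<^sub>r G))" by fastforce
 from peel[OF order_refl k] obtain g2 where g2: "0 < g2" "g2 < \<infinity>" and peel': "!!Ph. Ph : \<B> (lebm n n) ==>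
   (\<integral>\<^sup>+s. Ph (T 1 s) \<partial>M) = g2 * (\<integral>\<^sup>+s. gauss_conv n (D (Suc 1) + n) Ph (T (Suc 1) s) \<partial>M)" using D(2) by auto
 let ?g3 = "\<integral>\<^sup>+A. gau A \<partial>lebm n (D (Suc 1))"
 have g3: "0 < ?g3" "?g3 < \<infinity>" using nn_integral_lebm_gaussian_finite_pos[of n "D (Suc 1)"] by (auto simp: zero_less_iff_neq_zero)
 have l: "map D [1..<Suc k] = 0 # map D [Suc 1..<Suc k]" using k D(2) by (subst upt_conv_Cons) auto
 show ?thesis
 proof (intro exI[of _ "g2 * (g1 * ?g3)"] conjI ballI)
  show "0 < g2 * (g1 * ?g3)" "g2 * (g1 * ?g3) < \<infinity>"
   using g1 g2 g3 by (auto simp: ennreal_mult_less_top ennreal_zero_less_mult_iff)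
  fix Ph :: "complex mat => ennreal" assume Ph: "Ph : \<B> (lebm n n)"
  have "(\<integral>\<^sup>+s. gauss_conv n (D (Suc 1) + n) Ph (T (Suc 1) s) \<partial>M) =
    g1 * PI (map D [Suc 1..<Suc k]) n (%G. gauss_conv n (D (Suc 1) + n) Ph (0\<^sub>m (D (Suc 1)) n @\<^sub>r G))"
   by (rule IH[OF measurable_gauss_conv[OF Ph] gauss_conv_left_inv[OF Ph]])
  also have "PI (map D [Suc 1..<Suc k]) n (%G. gauss_conv n (D (Suc 1) + n) Ph (0\<^sub>m (D (Suc 1)) n @\<^sub>r G)) =
    PI (map D [Suc 1..<Suc k]) n (%G. ?g3 * (\<integral>A|n,n. gw 0 A * Ph (A * G)))"
   by (rule PI_cong_nonsing) (simp add: gauss_conv_append_zero[OF Ph] gw_def)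
  also have "... = ?g3 * PI (map D [1..<Suc k]) n Ph"
   unfolding l PI.simps by (rule PI_cmult[OF PI_step_measurable1[OF Ph]])
  finally show "(\<integral>\<^sup>+s. Ph (T 1 s) \<partial>M) = g2 * (g1 * ?g3) * PI (map D [1..<Suc k]) n Ph"
   unfolding peel'[OF Ph] by (simp only: mult.assoc)
 qed
qed

section \<open>From independent entries to matrix integrals\<close>

lemma PiM_density:
 assumes N: "sigma_finite_measure N" and g: "g : \<B> N"
  and Ng: "sigma_finite_measure (density N g)" and K: "finite K"
 shows "PiM K (%_. density N g) = density (PiM K (%_. N)) (%x. \<Prod>i\<in>K. g (x i))"
proof (rule product_sigma_finite.PiM_eqI[OF product_sigma_finite_const[OF Ng] K, symmetric])
 show "sets (density (PiM K (%_. N)) (%x. \<Prod>i\<in>K. g (x i))) = sets (PiM K (%_. density N g))"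
  by (simp, intro sets_PiM_cong) simp_all
 fix A assume "!!i. i : K ==> A i : sets (density N g)"
 hence A: "!!i. i : K ==> A i : sets N" by simp
 have m: "(%x. \<Prod>i\<in>K. g (x i)) : \<B> (PiM K (%_. N))"
  by (intro borel_measurable_prod_ennreal measurable_compose[OF _ g] measurable_component_singleton)
 have "emeasure (density (PiM K (%_. N)) (%x. \<Prod>i\<in>K. g (x i))) (Pi\<^sub>E K A) =
   (\<integral>\<^sup>+x. (\<Prod>i\<in>K. g (x i)) * indicator (Pi\<^sub>E K A) x \<partial>PiM K (%_. N))"
  by (rule emeasure_density[OF m]) (intro sets_PiM_I_finite K A)
 also have "... = (\<integral>\<^sup>+x. (\<Prod>i\<in>K. g (x i) * indicator (A i) (x i)) \<partial>PiM K (%_. N))"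
 proof (rule nn_integral_cong)
  fix x assume x: "x : space (PiM K (%_. N))"
  have "(indicator (Pi\<^sub>E K A) x :: ennreal) = (\<Prod>i\<in>K. indicator (A i) (x i))"
  proof (cases "x : Pi\<^sub>E K A")
   case False
   then obtain i where "i : K" "x i \<notin> A i" using x by (auto simp: space_PiM PiE_iff)
   hence "(\<Prod>i\<in>K. indicator (A i) (x i)) = (0 :: ennreal)"
    by (intro prod_zero[OF K] bexI[of _ i]) auto
   thus ?thesis using False by simp
  qed (auto simp: PiE_iff)
  thus "(\<Prod>i\<in>K. g (x i)) * indicator (Pi\<^sub>E K A) x = (\<Prod>i\<in>K. g (x i) * indicator (A i) (x i))"
   by (simp add: prod.distrib)
 qed
 also have "... = (\<Prod>i\<in>K. \<integral>\<^sup>+x. g x * indicator (A i) x \<partial>N)"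
  by (rule product_sigma_finite.product_nn_integral_prod[OF product_sigma_finite_const[OF N] K])
    (intro measurable_times_ennreal g borel_measurable_indicator A)
 also have "... = (\<Prod>i\<in>K. emeasure (density N g) (A i))"
  by (intro prod.cong refl emeasure_density[OF g, symmetric] A)
 finally show "emeasure (density (PiM K (%_. N)) (%x. \<Prod>i\<in>K. g (x i))) (Pi\<^sub>E K A) = (\<Prod>i\<in>K. emeasure (density N g) (A i))" .
qed

text \<open>By independence the entries have a product density, which is \<open>gau\<close> up to a
  power of \<open>pi\<close>. The injection \<open>h\<close> places the indices of one matrix into
  the index set of all entries.\<close>

lemma (in prob_space) nn_integral_gaussian_matrix:
 fixes X :: "'i => 'a => complex"
 assumes h: "inj_on h ({..<r} \<times> {..<c})" and rc: "0 < r" "0 < c"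
  and ind: "indep_vars (%_. borel) X (h ` ({..<r} \<times> {..<c}))"
  and d: "!!p. p : h ` ({..<r} \<times> {..<c}) ==> distributed M lborel (X p) (%x. ennreal (std_complex_gaussian_density x))"
  and f: "f : \<B> (lebm r c)"
 shows "(\<integral>\<^sup>+s. f (mat r c (%ab. X (h ab) s)) \<partial>M) =
  ennreal (1 / pi ^ (r * c)) * (\<integral>A|r,c. gau A * f A)"
proof -
 let ?R = "{..<r} \<times> {..<c}"
 let ?K = "h ` ?R"
 let ?g = "%x. ennreal (std_complex_gaussian_density x)"
 have fin: "finite ?K" and ne: "?K ~= {}" using rc by auto
 have mg: "?g : \<B> lborel" unfolding std_complex_gaussian_density_def by measurable
 have rv: "X p : \<B> M" if "p : ?K" for p
  using distributed_measurable[OF d[OF that]] by simp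
 have dd: "distr M borel (X p) = density lborel ?g" if "p : ?K" for p
 proof -
  have "distr M borel (X p) = distr M lborel (X p)" by (rule distr_cong) auto
  thus ?thesis using distributed_distr_eq_density[OF d[OF that]] by simp
 qed
 have sfd: "sigma_finite_measure (density lborel ?g)"
 proof -
  obtain p where p: "p : ?K" using ne by blast
  interpret P: prob_space "distr M borel (X p)" by (rule prob_space_distr[OF rv[OF p]])
  show ?thesis using dd[OF p] P.sigma_finite_measure_axioms by simp
 qed
 have pm: "distr M (PiM ?K (%_. borel)) (%s. \<lambda>p\<in>?K. X p s) = density (\<P> ?K) (%x. \<Prod>i\<in>?K. ?g (x i))"
 proof -
  have "distr M (PiM ?K (%_. borel)) (%s. \<lambda>p\<in>?K. X p s) = PiM ?K (%p. distr M borel (X p))"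
   using indep_vars_iff_distr_eq_PiM'[OF ne, where M' = "%_. borel" and X = X] rv ind by blast
  also have "... = PiM ?K (%_. density lborel ?g)" by (rule PiM_cong) (auto simp: dd)
  also have "... = density (\<P> ?K) (%x. \<Prod>i\<in>?K. ?g (x i))"
   by (rule PiM_density[OF sigma_finite_lborel mg sfd fin])
  finally show ?thesis .
 qed
 let ?F = "%x. f (mat r c (%ab. x (h ab)))"
 have mm: "(%x. mat r c (%ab. x (h ab))) : measurable (\<P> ?K) (lebm r c)"
 proof (rule measurable_lebmI)
  fix i j assume ij: "i < r" "j < c"
  have "(%x. x (h (i, j))) : measurable (\<P> ?K) \<L>"
   by (rule measurable_component_singleton) (use ij in auto)
  thus "(%x. mat r c (%ab. x (h ab)) $$ (i, j)) : \<B> (PiM ?K (%_. \<L>))"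
   using ij by simp
 qed simp
 have mF: "?F : \<B> (\<P> ?K)" by (rule measurable_compose[OF mm f])
 have sb: "sets (PiM ?K (%_. borel :: complex measure)) = sets (PiM ?K (%_. \<L>))"
  by (rule sets_PiM_cong) auto
 have mF': "?F : \<B> (PiM ?K (%_. borel))"
  using mF measurable_cong_sets[OF sb refl, of borel] by blast
 have mX: "(%s. \<lambda>p\<in>?K. X p s) : measurable M (PiM ?K (%_. borel))" by (intro measurable_restrict rv)
 have mp: "(%x. \<Prod>i\<in>?K. ?g (x i)) : \<B> (\<P> ?K)"
  by (intro borel_measurable_prod_ennreal measurable_compose[OF _ mg] measurable_component_singleton)
 have "(\<integral>\<^sup>+s. f (mat r c (%ab. X (h ab) s)) \<partial>M) = (\<integral>\<^sup>+s. ?F (\<lambda>p\<in>?K. X p s) \<partial>M)"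
  by (intro nn_integral_cong arg_cong[where f = f] eq_matI) auto
 also have "... = (\<integral>\<^sup>+x. ?F x \<partial>distr M (PiM ?K (%_. borel)) (%s. \<lambda>p\<in>?K. X p s))"
  by (rule nn_integral_distr[OF mX, symmetric]) (use mF' in simp)
 also have "... = (\<integral>\<^sup>+x. (\<Prod>i\<in>?K. ?g (x i)) * ?F x \<partial>\<P> ?K)"
  unfolding pm by (rule nn_integral_density[OF mp mF])
 also have "... = (\<integral>\<^sup>+x. (\<Prod>i\<in>?K. ?g ((\<lambda>i\<in>?K. x (inv_into ?R h i)) i)) * ?F (\<lambda>i\<in>?K. x (inv_into ?R h i)) \<partial>\<P> ?R)"
  by (rule nn_integral_PiM_reindex[OF sigma_finite_lborel _ h]) (use mp mF in auto)
 also have "... = (\<integral>\<^sup>+x. ennreal (1 / pi ^ (r * c)) * (gau (mat r c x) * f (mat r c x)) \<partial>\<P> ?R)"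
 proof (rule nn_integral_cong)
  fix x :: "nat \<times> nat => complex"
  have e1: "mat r c (%ab. (\<lambda>i\<in>?K. x (inv_into ?R h i)) (h ab)) = mat r c x"
   by (rule eq_matI) (auto simp: inv_into_f_f[OF h])
  have "(\<Prod>i\<in>?K. ?g ((\<lambda>i\<in>?K. x (inv_into ?R h i)) i)) = (\<Prod>ab\<in>?R. ?g (x ab))"
   unfolding prod.reindex[OF h] comp_def
   by (rule prod.cong[OF refl]) (simp add: inv_into_f_f[OF h])
  also have "... = ennreal (\<Prod>ab\<in>?R. std_complex_gaussian_density (x ab))"
   by (rule prod_ennreal) (simp add: std_complex_gaussian_density_def)
  also have "(\<Prod>ab\<in>?R. std_complex_gaussian_density (x ab)) = (1 / pi ^ (r * c)) * exp (- fro (mat r c x))"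
  proof -
   have "fro (mat r c x) = (\<Sum>ij\<in>?R. (cmod (x ij))\<^sup>2)"
    unfolding fro_carrier[OF mat_carrier] by (simp add: sum.cartesian_product)
   hence "exp (- fro (mat r c x)) = (\<Prod>ij\<in>?R. exp (- (cmod (x ij))\<^sup>2))"
    by (simp add: sum_negf[symmetric] exp_sum)
   thus ?thesis by (simp add: std_complex_gaussian_density_def prod_dividef)
  qed
  finally have e2: "(\<Prod>i\<in>?K. ?g ((\<lambda>i\<in>?K. x (inv_into ?R h i)) i)) = ennreal (1 / pi ^ (r * c)) * gau (mat r c x)"
   by (simp add: ennreal_mult[symmetric])
  show "(\<Prod>i\<in>?K. ?g ((\<lambda>i\<in>?K. x (inv_into ?R h i)) i)) * ?F (\<lambda>i\<in>?K. x (inv_into ?R h i)) =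
    ennreal (1 / pi ^ (r * c)) * (gau (mat r c x) * f (mat r c x))"
   unfolding e1 e2 by (rule mult.assoc)
 qed
 also have "... = ennreal (1 / pi ^ (r * c)) * (\<integral>\<^sup>+x. gau (mat r c x) * f (mat r c x) \<partial>\<P> ?R)"
  by (intro nn_integral_cmult measurable_times_ennreal measurable_fro_ennreal[OF measurable_mat_PiM] measurable_compose[OF measurable_mat_PiM f])
 also have "(\<integral>\<^sup>+x. gau (mat r c x) * f (mat r c x) \<partial>\<P> ?R) = (\<integral>A|r,c. gau A * f A)"
  by (rule nn_integral_lebm[symmetric]) (intro measurable_times_ennreal measurable_fro_ennreal[OF lebm_ident] f)
 finally show ?thesis .
qed

text \<open>Independence makes the joint law a product measure, and Fubini integrates the left
  factor first.\<close>

lemma (in prob_space) nn_integral_peel: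
 assumes ind: "indep_var (lebm r c) A (lebm c n) T"
  and law: "!!f. f : \<B> (lebm r c) ==> (\<integral>\<^sup>+s. f (A s) \<partial>M) = g * (\<integral>A|r,c. gau A * f A)"
  and Ph: "Ph : \<B> (lebm r n)"
 shows "(\<integral>\<^sup>+s. Ph (A s * T s) \<partial>M) = g * (\<integral>\<^sup>+s. gauss_conv r c Ph (T s) \<partial>M)"
proof -
 have A: "A : measurable M (lebm r c)" and T: "T : measurable M (lebm c n)"
  and eq: "distr M (lebm r c) A \<Otimes> distr M (lebm c n) T = distr M (lebm r c \<Otimes> lebm c n) (%s. (A s, T s))"
  using ind unfolding indep_var_distribution_eq by auto
 interpret PA: prob_space "distr M (lebm r c) A" by (rule prob_space_distr[OF A])
 interpret PT: prob_space "distr M (lebm c n) T" by (rule prob_space_distr[OF T])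
 interpret P: pair_sigma_finite "distr M (lebm r c) A" "distr M (lebm c n) T" ..
 have m: "(%p. Ph (fst p * snd p)) : \<B> (lebm r c \<Otimes> lebm c n)"
  by (rule measurable_compose[OF measurable_mat_mult[OF measurable_fst measurable_snd] Ph])
 have m': "(%p. Ph (fst p * snd p)) : \<B> (distr M (lebm r c) A \<Otimes> distr M (lebm c n) T)"
  using m unfolding eq by simp
 have "(\<integral>\<^sup>+s. Ph (A s * T s) \<partial>M) = (\<integral>\<^sup>+p. Ph (fst p * snd p) \<partial>distr M (lebm r c \<Otimes> lebm c n) (%s. (A s, T s)))"
  by (subst nn_integral_distr[OF measurable_Pair[OF A T]]) (use m in simp_all)
 also have "... = (\<integral>\<^sup>+B. \<integral>\<^sup>+A. Ph (A * B) \<partial>distr M (lebm r c) A \<partial>distr M (lebm c n) T)"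
  unfolding eq[symmetric] using P.nn_integral_snd[OF m'] by simp
 also have "... = (\<integral>\<^sup>+B. g * gauss_conv r c Ph B \<partial>distr M (lebm c n) T)"
 proof (rule nn_integral_cong)
  fix B assume "B : space (distr M (lebm c n) T)"
  hence B: "B : \<M> c n" by simp
  have mB: "(%A. Ph (A * B)) : \<B> (lebm r c)"
   by (rule measurable_compose[OF measurable_mat_mult[OF lebm_ident measurable_const_mat[OF B]] Ph])
  have "(\<integral>\<^sup>+A. Ph (A * B) \<partial>distr M (lebm r c) A) = (\<integral>\<^sup>+s. Ph (A s * B) \<partial>M)"
   by (rule nn_integral_distr[OF A]) (use mB in simp)
  thus "(\<integral>\<^sup>+A. Ph (A * B) \<partial>distr M (lebm r c) A) = g * gauss_conv r c Ph B"
   unfolding gauss_conv_def law[OF mB] .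
 qed
 also have "... = g * (\<integral>\<^sup>+B. gauss_conv r c Ph B \<partial>distr M (lebm c n) T)"
  by (rule nn_integral_cmult) (use measurable_gauss_conv[OF Ph] in simp)
 also have "(\<integral>\<^sup>+B. gauss_conv r c Ph B \<partial>distr M (lebm c n) T) = (\<integral>\<^sup>+s. gauss_conv r c Ph (T s) \<partial>M)"
  by (rule nn_integral_distr[OF T]) (use measurable_gauss_conv[OF Ph] in simp)
 finally show ?thesis .
qed

text \<open>Factors are peeled off from the left. The product \<open>T (Suc i)\<close> of the later
  ones is a measurable function \<open>Y (Suc i)\<close> of the entries indexed by
  \<open>L (Suc i)\<close>; these indices are disjoint from those of factor \<open>i\<close>, whence
  the independence.\<close>

lemma (in prob_space) gaussian_product_law:
 fixes A :: "nat => 'a => complex mat" and n :: "nat => nat"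
 assumes k: "k \<ge> 1"
  and pos: "!!i. i : {1..k} ==> n i \<ge> 1"
  and last: "n (k + 1) = n 1"
  and min: "n 1 = Min (n ` {1..k})"
  and dims: "!!i s. i : {1..k} ==> s : space M ==> A i s : \<M> (n i) (n (i + 1))"
  and indep: "indep_vars (%_. borel) (%(i, a, b) s. A i s $$ (a, b))
         (SIGMA i:{1..k}. {..<n i} \<times> {..<n (i + 1)})"
  and gauss: "!!i a b. i : {1..k} ==> a < n i ==> b < n (i + 1) ==>
         distributed M lborel (%s. A i s $$ (a, b)) (%x. ennreal (std_complex_gaussian_density x))"
 shows "(%s. matrix_product (n 1) (map (%i. A i s) [1..<k + 1])) : measurable M (lebm (n 1) (n 1))"
  and "\<exists>g. 0 < g & g < \<infinity> & (\<forall>Ph\<in>\<B> (lebm (n 1) (n 1)).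
   (\<integral>\<^sup>+s. Ph (matrix_product (n 1) (map (%i. A i s) [1..<k + 1])) \<partial>M) = g * PI (map (%j. n j - n 1) [1..<Suc k]) (n 1) Ph)"
proof -
 let ?n = "n 1"
 define X where "X = (%(i, a, b) s. A i s $$ (a, b))"
 define J where "J = (SIGMA i:{1..k}. {..<n i} \<times> {..<n (i + 1)})"
 define T where "T i s = foldr (*) (map (%j. A j s) [i..<Suc k]) (1\<^sub>m ?n)" for i s
 define Y where "Y i y = foldr (*) (map (%j. mat (n j) (n (j + 1)) (%ab. y (j, ab))) [i..<Suc k]) (1\<^sub>m ?n)" for i and y :: "nat \<times> nat \<times> nat => complex"
 define L where "L i = (SIGMA j:{i..k}. {..<n j} \<times> {..<n (j + 1)})" for i
 note indep' = indep[folded X_def J_def]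
 have dist: "distributed M lborel (X p) (%x. ennreal (std_complex_gaussian_density x))" if "p : J" for p
  using that gauss by (auto simp: X_def J_def)
 have rvX: "X p : \<B> M" if "p : J" for p
  using distributed_measurable[OF dist[OF that]] by simp
 have Am: "A i s = mat (n i) (n (i + 1)) (%ab. X (i, ab) s)" if "i : {1..k}" "s : space M" for i s
  by (rule eq_matI) (use dims[OF that] in \<open>auto simp: X_def\<close>)
 have le: "?n <= n i" if "i : {1..k}" for i using min that by simp
 \<comment> \<open>The index \<open>Suc k\<close>, which gives the column number of the last factor,
   is covered by \<open>n (k + 1) = n 1\<close>.\<close>
 have le': "?n <= n i" if "1 <= i" "i <= Suc k" for i
  using le[of i] that last by (cases "i = Suc k") auto
 have Yi: "Y i y = mat (n i) (n (i + 1)) (%ab. y (i, ab)) * Y (Suc i) y" if "i <= k" for i y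
  using that unfolding Y_def by (subst upt_conv_Cons) auto
 have Yk: "Y (Suc k) y = 1\<^sub>m ?n" for y unfolding Y_def by simp
 have mY: "Y i : measurable (PiM (L i) (%_. borel)) (lebm (n i) ?n)" if "1 <= i" "i + c = Suc k" for i c
  using that
 proof (induction c arbitrary: i)
  case 0
  hence i: "i = Suc k" by simp
  show ?case using last unfolding i Yk[abs_def] by (intro measurable_const_mat) simp
 next
  case (Suc c)
  have sub: "L (Suc i) \<subseteq> L i" by (auto simp: L_def)
  have "Y (Suc i) : measurable (PiM (L (Suc i)) (%_. borel)) (lebm (n (Suc i)) ?n)"
   by (rule Suc.IH) (use Suc.prems in auto)
  from measurable_compose[OF measurable_restrict_subset[OF sub] this]
  have m1: "(%y. Y (Suc i) (restrict y (L (Suc i)))) : measurable (PiM (L i) (%_. borel)) (lebm (n (Suc i)) ?n)" .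
  have "Y (Suc i) (restrict y (L (Suc i))) = Y (Suc i) y" for y
   unfolding Y_def
   by (intro arg_cong2[where f = "foldr (*)"] map_cong refl eq_matI) (auto simp: L_def)
  hence m2: "Y (Suc i) : measurable (PiM (L i) (%_. borel)) (lebm (n (Suc i)) ?n)" using m1 by simp
  have m3: "(%y. mat (n i) (n (i + 1)) (%ab. y (i, ab))) : measurable (PiM (L i) (%_. borel)) (lebm (n i) (n (Suc i)))"
  proof (rule measurable_lebmI)
   fix a b assume ab: "a < n i" "b < n (Suc i)"
   have "(%y. y (i, a, b)) : \<B> (PiM (L i) (%_. borel :: complex measure))"
    by (rule measurable_component_singleton) (use ab Suc.prems in \<open>auto simp: L_def\<close>)
   thus "(%y. mat (n i) (n (i + 1)) (%ab. y (i, ab)) $$ (a, b)) : \<B> (PiM (L i) (%_. borel :: complex measure))"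
    using ab by simp
  qed simp
  have "Y i = (%y. mat (n i) (n (i + 1)) (%ab. y (i, ab)) * Y (Suc i) y)"
   by (rule ext) (use Yi Suc.prems in simp)
  thus ?case using measurable_mat_mult[OF m3 m2] by simp
 qed
 have LJ: "L i \<subseteq> J" if "1 <= i" for i using that by (auto simp: L_def J_def)
 have TY: "T i s = Y i (restrict (%p. X p s) (L i))" if "1 <= i" "s : space M" for i s
  unfolding T_def Y_def
 proof (intro arg_cong2[where f = "foldr (*)"] map_cong refl)
  fix j assume j: "j : set [i..<Suc k]"
  hence j1: "j : {1..k}" using that by auto
  show "A j s = mat (n j) (n (j + 1)) (%ab. restrict (%p. X p s) (L i) (j, ab))"
   unfolding Am[OF j1 that(2)] by (rule eq_matI) (use j in \<open>auto simp: L_def\<close>)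
 qed
 have T1: "matrix_product ?n (map (%i. A i s) [1..<k + 1]) = T 1 s" for s
  by (simp add: T_def matrix_product_def)
 have mXL: "(%s. restrict (%p. X p s) (L i)) : measurable M (PiM (L i) (%_. borel))" if "1 <= i" for i
  by (intro measurable_restrict rvX) (use LJ[OF that] in auto)
 have "(%s. Y 1 (restrict (%p. X p s) (L 1))) : measurable M (lebm ?n ?n)"
  using measurable_compose[OF mXL mY[of 1 k]] by simp
 thus "(%s. matrix_product ?n (map (%i. A i s) [1..<k + 1])) : measurable M (lebm ?n ?n)"
  unfolding T1 by (rule measurable_cong[THEN iffD2, rotated]) (simp add: TY)
 have peel: "\<exists>g. 0 < g & g < \<infinity> & (\<forall>Ph\<in>\<B> (lebm (n i - ?n + ?n) ?n).
   (\<integral>\<^sup>+s. Ph (T i s) \<partial>M) = g * (\<integral>\<^sup>+s. gauss_conv (n i - ?n + ?n) (n (Suc i) - ?n + ?n) Ph (T (Suc i) s) \<partial>M))"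
  if i: "1 <= i" "i <= k" for i
 proof -
  have ii: "i : {1..k}" using i by simp
  have e: "n i - ?n + ?n = n i" "n (Suc i) - ?n + ?n = n (Suc i)" using le'[of i] le'[of "Suc i"] i by auto
  let ?R = "{..<n i} \<times> {..<n (Suc i)}"
  let ?h = "%ab :: nat \<times> nat. (i, ab)"
  have h: "inj_on ?h ?R" by (auto simp: inj_on_def)
  have hJ: "?h ` ?R \<subseteq> J" using ii by (auto simp: J_def)
  \<comment> \<open>All dimensions are at least \<open>n 1\<close>, hence positive; the index set of
    the entries is thus nonempty, as the product form of independence requires.\<close>
  have p: "0 < n i" "0 < n (Suc i)" using pos[OF ii] le'[of "Suc i"] pos[of 1] k i by auto
  have law: "(\<integral>\<^sup>+s. f (mat (n i) (n (Suc i)) (%ab. X (?h ab) s)) \<partial>M) =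
   ennreal (1 / pi ^ (n i * n (Suc i))) * (\<integral>A|n i,n (Suc i). gau A * f A)"
   if "f : \<B> (lebm (n i) (n (Suc i)))" for f
   by (rule nn_integral_gaussian_matrix[OF h p indep_vars_subset[OF indep' hJ] dist that]) (use hJ in auto)
  have disj: "?h ` ?R \<inter> L (Suc i) = {}" by (auto simp: L_def)
  have sub: "L (Suc i) \<subseteq> J" using LJ[of "Suc i"] by simp
  have iv: "indep_var (PiM (?h ` ?R) (%_. borel)) (%s. restrict (%p. X p s) (?h ` ?R)) (PiM (L (Suc i)) (%_. borel)) (%s. restrict (%p. X p s) (L (Suc i)))"
   by (rule indep_var_restrict[OF indep' disj hJ sub])
  have mY1: "(%y. mat (n i) (n (Suc i)) (%ab. y (?h ab))) : measurable (PiM (?h ` ?R) (%_. borel)) (lebm (n i) (n (Suc i)))"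
  proof (rule measurable_lebmI)
   fix a b assume ab: "a < n i" "b < n (Suc i)"
   have "(%y. y (i, a, b)) : \<B> (PiM (?h ` ?R) (%_. borel :: complex measure))"
    by (rule measurable_component_singleton) (use ab in auto)
   thus "(%y. mat (n i) (n (Suc i)) (%ab. y (?h ab)) $$ (a, b)) : \<B> (PiM (?h ` ?R) (%_. borel :: complex measure))"
    using ab by simp
  qed simp
  have mY2: "Y (Suc i) : measurable (PiM (L (Suc i)) (%_. borel)) (lebm (n (Suc i)) ?n)"
   by (rule mY[of "Suc i" "k - i"]) (use i in auto)
  have "(%y. mat (n i) (n (Suc i)) (%ab. y (?h ab))) \<circ> (%s. restrict (%p. X p s) (?h ` ?R)) = (%s. mat (n i) (n (Suc i)) (%ab. X (?h ab) s))"
   by (rule ext, rule eq_matI) auto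
  with indep_var_compose[OF iv mY1 mY2]
  have iv2: "indep_var (lebm (n i) (n (Suc i))) (%s. mat (n i) (n (Suc i)) (%ab. X (?h ab) s))
    (lebm (n (Suc i)) ?n) (Y (Suc i) \<circ> (%s. restrict (%p. X p s) (L (Suc i))))" by (simp only:)
  show ?thesis unfolding e
  proof (intro exI[of _ "ennreal (1 / pi ^ (n i * n (Suc i)))"] conjI ballI)
   fix Ph :: "complex mat => ennreal" assume Ph: "Ph : \<B> (lebm (n i) ?n)"
   have Ts: "T i s = A i s * T (Suc i) s" for s unfolding T_def using i by (subst upt_conv_Cons) auto
   have "(\<integral>\<^sup>+s. Ph (T i s) \<partial>M) = (\<integral>\<^sup>+s. Ph (mat (n i) (n (Suc i)) (%ab. X (?h ab) s) * (Y (Suc i) \<circ> (%s. restrict (%p. X p s) (L (Suc i)))) s) \<partial>M)"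
    by (rule nn_integral_cong) (use Am[OF ii] TY[of "Suc i"] in \<open>simp add: Ts\<close>)
   also have "... = ennreal (1 / pi ^ (n i * n (Suc i))) * (\<integral>\<^sup>+s. gauss_conv (n i) (n (Suc i)) Ph ((Y (Suc i) \<circ> (%s. restrict (%p. X p s) (L (Suc i)))) s) \<partial>M)"
    by (rule nn_integral_peel[OF iv2 law Ph])
   also have "(\<integral>\<^sup>+s. gauss_conv (n i) (n (Suc i)) Ph ((Y (Suc i) \<circ> (%s. restrict (%p. X p s) (L (Suc i)))) s) \<partial>M) =
     (\<integral>\<^sup>+s. gauss_conv (n i) (n (Suc i)) Ph (T (Suc i) s) \<partial>M)"
    by (rule nn_integral_cong) (simp add: TY)
   finally show "(\<integral>\<^sup>+s. Ph (T i s) \<partial>M) = ennreal (1 / pi ^ (n i * n (Suc i))) * (\<integral>\<^sup>+s. gauss_conv (n i) (n (Suc i)) Ph (T (Suc i) s) \<partial>M)" .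
  qed auto
 qed
 show "\<exists>g. 0 < g & g < \<infinity> & (\<forall>Ph\<in>\<B> (lebm ?n ?n).
   (\<integral>\<^sup>+s. Ph (matrix_product ?n (map (%i. A i s) [1..<k + 1])) \<partial>M) = g * PI (map (%j. n j - ?n) [1..<Suc k]) ?n Ph)"
  unfolding T1
  by (rule expectation_product[OF prob_space_axioms, of "%j. n j - ?n" k T ?n]) (use last k peel in \<open>auto simp: T_def\<close>)
qed

section \<open>The weight function\<close>

lemma XI_PiM:
 "ph : \<B> borel ==> XI (map D [i..<i + c]) ph =
  (\<integral>\<^sup>+x. (\<Prod>j\<in>{i..<i + c}. gx (D j) (x j)) * ph (\<Prod>j\<in>{i..<i + c}. x j) \<partial>\<P> {i..<i + c})"
proof (induction c arbitrary: i ph)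
 case 0
 thus ?case by (simp add: PiM_empty nn_integral_count_space_finite)
next
 case (Suc c)
 let ?I = "{Suc i..<Suc i + c}"
 have I: "{i..<i + Suc c} = insert i ?I" by auto
 have l: "map D [i..<i + Suc c] = D i # map D [Suc i..<Suc i + c]" by (subst upt_conv_Cons) auto
 let ?f = "%x. (\<Prod>j\<in>insert i ?I. gx (D j) (x j)) * ph (\<Prod>j\<in>insert i ?I. x j)"
 have comp: "(%x. x j) : \<B> (PiM (insert i ?I) (%_. \<L>))" if "j : insert i ?I" for j
  using measurable_component_singleton[OF that, of "%_. \<L>"] by simp
 have mf: "?f : \<B> (\<P> (insert i ?I))"
  by (intro measurable_times_ennreal borel_measurable_prod_ennreal measurable_gx' measurable_compose[OF _ Suc.prems] borel_measurable_prod comp)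
 have "XI (map D [i..<i + Suc c]) ph = XI (map D [Suc i..<Suc i + c]) (%y. \<integral>x. gx (D i) x * ph (x * y))"
  unfolding l by simp
 also have "... = (\<integral>\<^sup>+x. (\<Prod>j\<in>?I. gx (D j) (x j)) * (\<integral>y. gx (D i) y * ph (y * (\<Prod>j\<in>?I. x j))) \<partial>\<P> ?I)"
  by (rule Suc.IH[OF XI_step_measurable[OF Suc.prems]])
 also have "... = (\<integral>\<^sup>+x. (\<integral>y. ?f (x(i := y))) \<partial>\<P> ?I)"
 proof (rule nn_integral_cong)
  fix x :: "nat => complex"
  have e: "?f (x(i := y)) = (\<Prod>j\<in>?I. gx (D j) (x j)) * (gx (D i) y * ph (y * (\<Prod>j\<in>?I. x j)))" for y
  proof -
   have "(\<Prod>j\<in>?I. gx (D j) ((x(i := y)) j)) = (\<Prod>j\<in>?I. gx (D j) (x j))" "(\<Prod>j\<in>?I. (x(i := y)) j) = (\<Prod>j\<in>?I. x j)"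
    by (rule prod.cong; auto)+
   thus ?thesis by (simp add: mult_ac)
  qed
  have "(%y. gx (D i) y * ph (y * (\<Prod>j\<in>?I. x j))) : \<B> lborel"
   using Suc.prems by measurable
  thus "(\<Prod>j\<in>?I. gx (D j) (x j)) * (\<integral>y. gx (D i) y * ph (y * (\<Prod>j\<in>?I. x j))) = (\<integral>y. ?f (x(i := y)))"
   unfolding e by (rule nn_integral_cmult[symmetric])
 qed
 also have "... = (\<integral>\<^sup>+x. ?f x \<partial>\<P> (insert i ?I))"
  by (rule product_sigma_finite.product_nn_integral_insert[OF product_lborel _ _ mf, symmetric]) auto
 finally show ?case unfolding I .
qed

lemma pw_weight_eq:
 fixes k :: nat and n :: "nat => nat"
 shows
 "ennreal (exp (- (\<Sum>j\<in>{1..k}. (cmod (x j))\<^sup>2)) * (\<Prod>j\<in>{1..k}. cmod (x j) ^ (2 * (n j - n 1)))) =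
  (\<Prod>j\<in>{1..k}. gx (n j - n 1) (x j))"
proof -
 have "exp (- (\<Sum>j\<in>{1..k}. (cmod (x j))\<^sup>2)) * (\<Prod>j\<in>{1..k}. cmod (x j) ^ (2 * (n j - n 1))) =
   (\<Prod>j\<in>{1..k}. cmod (x j) ^ (2 * (n j - n 1)) * exp (- (cmod (x j))\<^sup>2))"
  by (simp add: sum_negf[symmetric] exp_sum prod.distrib)
 thus ?thesis by (simp add: gx_def prod_ennreal)
qed

lemma nn_integral_pushforward:
 assumes ph: "ph : \<B> borel"
 shows "(\<integral>\<^sup>+z. ph z \<partial>distr (density (\<P> {1..k}) (%x. ennreal (exp (- (\<Sum>j\<in>{1..k}. (cmod (x j))\<^sup>2)) * (\<Prod>j\<in>{1..k}. cmod (x j) ^ (2 * (n j - n 1))))))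
   borel (%x. \<Prod>j\<in>{1..k}. x j)) = XI (map (%j. n j - n 1) [1..<Suc k]) ph"
proof -
 let ?P = "PiM {1..k} (%_. \<L>)"
 have comp: "(%x. x j) : \<B> ?P" if "j : {1..k}" for j
  using measurable_component_singleton[OF that, of "%_. \<L>"] by simp
 have mp: "(%x. \<Prod>j\<in>{1..k}. x j) : \<B> ?P" by (intro borel_measurable_prod comp)
 have mg: "(%x. \<Prod>j\<in>{1..k}. gx (n j - n 1) (x j)) : \<B> ?P"
  by (intro borel_measurable_prod_ennreal measurable_gx' comp)
 have I: "{1..<Suc k} = {1..k}" and k': "1 + k = Suc k" by auto
 have "XI (map (%j. n j - n 1) [1..<Suc k]) ph = (\<integral>\<^sup>+x. (\<Prod>j\<in>{1..k}. gx (n j - n 1) (x j)) * ph (\<Prod>j\<in>{1..k}. x j) \<partial>?P)"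
  using XI_PiM[OF ph, of "%j. n j - n 1" 1 k] unfolding k' I .
 also have "... = (\<integral>\<^sup>+x. ph (\<Prod>j\<in>{1..k}. x j) \<partial>density ?P (%x. \<Prod>j\<in>{1..k}. gx (n j - n 1) (x j)))"
  by (rule nn_integral_density[OF mg measurable_compose[OF mp ph], symmetric])
 also have "... = (\<integral>\<^sup>+z. ph z \<partial>distr (density ?P (%x. \<Prod>j\<in>{1..k}. gx (n j - n 1) (x j))) borel (%x. \<Prod>j\<in>{1..k}. x j))"
  by (rule nn_integral_distr[symmetric]) (use mp ph in simp_all)
 finally show ?thesis unfolding pw_weight_eq by simp
qed

text \<open>The scalar iteration is the integral over all \<open>x\<close> written out one variable
  at a time. This supplies the hypothesis of \<open>PI_char_poly\<close> for every version of the
  weight.\<close>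

lemma XI_weight:
 assumes w: "product_weight k n \<omega>" and ph: "ph : \<B> borel"
 shows "XI (map (%j. n j - n 1) [1..<Suc k]) ph = (\<integral>z. ph z * ennreal (\<omega> z))"
proof -
 have "\<omega> : \<B> borel" using w by (simp add: product_weight_def pushforward_weight_def)
 hence m: "(%z. ennreal (\<omega> z)) : \<B> lborel" by measurable
 have "(\<integral>z. ennreal (\<omega> z) * ph z) = (\<integral>\<^sup>+z. ph z \<partial>density lborel (%z. ennreal (\<omega> z)))"
  by (rule nn_integral_density[OF m, symmetric]) (use ph in simp)
 thus ?thesis using w unfolding nn_integral_pushforward[OF ph, symmetric]
  by (simp add: product_weight_def pushforward_weight_def mult.commute)
qed

text \<open>The modulus is multiplicative, so the even moments of the weight are products of
  one-dimensional moments.\<close>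

lemma XI_norm_power: "XI ms (%x. ennreal (cmod x ^ (2 * j))) = (\<Prod>m\<leftarrow>ms. \<integral>x. gx (m + j) x)"
proof (induction ms)
 case (Cons m ms)
 have "(\<integral>x. gx m x * ennreal (cmod (x * y) ^ (2 * j))) = (\<integral>x. gx (m + j) x) * ennreal (cmod y ^ (2 * j))" for y
 proof -
  have "(\<integral>x. gx m x * ennreal (cmod (x * y) ^ (2 * j))) = (\<integral>x. gx (m + j) x * ennreal (cmod y ^ (2 * j)))"
   by (intro nn_integral_cong) (simp add: gx_def ennreal_mult[symmetric] norm_mult power_mult_distrib power_add distrib_left mult_ac)
  also have "... = (\<integral>x. gx (m + j) x) * ennreal (cmod y ^ (2 * j))"
   by (rule nn_integral_multc) simp
  finally show ?thesis .
 qed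
 hence "XI (m # ms) (%x. ennreal (cmod x ^ (2 * j))) = XI ms (%y. (\<integral>x. gx (m + j) x) * ennreal (cmod y ^ (2 * j)))"
  by simp
 also have "... = (\<integral>x. gx (m + j) x) * XI ms (%y. ennreal (cmod y ^ (2 * j)))"
  by (rule XI_cmult) measurable
 finally show ?case using Cons by simp
qed simp

lemma XI_norm_power_finite_pos: "XI ms (%x. ennreal (cmod x ^ (2 * j))) < \<infinity> & XI ms (%x. ennreal (cmod x ^ (2 * j))) ~= 0"
 unfolding XI_norm_power by (induction ms) (use nn_integral_gx in \<open>auto simp: ennreal_mult_less_top\<close>)

text \<open>Multiplication by \<open>y ~= 0\<close> preserves null sets, so the first integration
  already gives 0 at every nonzero argument, and \<open>XI_cong\<close> ignores the argument
  0.\<close>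

lemma XI_null:
 assumes Z: "Z : null_sets \<L>"
 shows "XI (m # ms) (indicator Z) = 0"
proof -
 have Zb: "Z : sets borel" using Z by auto
 have "(\<integral>x. gx m x * indicator Z (x * y)) = 0" if y: "y ~= 0" for y :: complex
 proof -
  have mi: "indicator Z : \<B> (borel :: complex measure)" using Zb by measurable
  have mi': "(%x. indicator Z (x * y) :: ennreal) : \<B> lborel" using Zb by measurable
  have "(\<integral>z. indicator Z z) = ennreal ((cmod y)\<^sup>2) * (\<integral>z. indicator Z (y * z))"
   by (rule nn_integral_lborel_complex_scale[OF y mi])
  moreover have "(\<integral>\<^sup>+z. indicator Z z \<partial>\<L>) = 0" using Z Zb by (simp add: null_sets_def)
  ultimately have "(\<integral>x. indicator Z (x * y)) = 0" using y by (simp add: mult.commute)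
  hence "AE x in lborel. (indicator Z (x * y) :: ennreal) = 0" using nn_integral_0_iff_AE[OF mi'] by simp
  hence "(\<integral>x. gx m x * indicator Z (x * y)) = (\<integral>\<^sup>+x. 0 \<partial>\<L>)"
   by (intro nn_integral_cong_AE) (auto elim!: eventually_mono)
  thus ?thesis by simp
 qed
 hence "XI (m # ms) (indicator Z) = XI ms (%_. 0 * 0)" unfolding XI.simps by (intro XI_cong) simp
 also have "... = 0 * XI ms (%_. 0)" by (rule XI_cmult) simp
 finally show ?thesis by simp
qed

text \<open>The push-forward is absolutely continuous and so has a Radon-Nikodym density. Its total
  mass is the moment of order zero and finite, so the density is finite almost everywhere and can be
  replaced by a real one.\<close>

lemma product_weight_exists:
 assumes k: "k \<ge> 1"
 shows "\<exists>\<omega>. product_weight k n \<omega>"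
proof -
 let ?ms = "map (%j. n j - n 1) [1..<Suc k]"
 define N where "N = distr (density (\<P> {1..k}) (%x. ennreal (exp (- (\<Sum>j\<in>{1..k}. (cmod (x j))\<^sup>2)) * (\<Prod>j\<in>{1..k}. cmod (x j) ^ (2 * (n j - n 1))))))
   borel (%x. \<Prod>j\<in>{1..k}. x j)"
 have sN: "sets N = sets borel" by (simp add: N_def)
 have emN: "emeasure N Z = XI ?ms (indicator Z)" if "Z : sets borel" for Z
 proof -
  have "emeasure N Z = (\<integral>\<^sup>+z. indicator Z z \<partial>N)" using that sN by simp
  also have "... = XI ?ms (indicator Z)"
   unfolding N_def by (rule nn_integral_pushforward) (use that in measurable)
  finally show ?thesis .
 qed
 have l: "?ms = (n 1 - n 1) # map (%j. n j - n 1) [Suc 1..<Suc k]" using k by (subst upt_conv_Cons) auto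
 have "absolutely_continuous lborel N"
  unfolding absolutely_continuous_def
 proof
  fix Z :: "complex set" assume Z: "Z : null_sets lborel"
  have Zb: "Z : sets borel" using null_setsD2[OF Z] by simp
  hence "emeasure N Z = 0" using emN[OF Zb] XI_null[OF Z] unfolding l by simp
  thus "Z : null_sets N" by (rule null_setsI) (use Zb sN in simp)
 qed
 moreover have "sets N = sets lborel" using sN by simp
 ultimately obtain f where f: "f : \<B> lborel" "density lborel f = N"
  using sigma_finite_measure.Radon_Nikodym[OF sigma_finite_lborel, of N] by blast
 have ind: "(indicator UNIV :: complex => ennreal) = (%x. ennreal (cmod x ^ (2 * 0)))" by (rule ext) simp
 have "(\<integral>z. f z) = emeasure N UNIV"
  unfolding f(2)[symmetric] using f(1) by (subst emeasure_density) auto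
 also have "... = XI ?ms (%x. ennreal (cmod x ^ (2 * 0)))" using emN[of UNIV] ind by simp
 finally have "(\<integral>z. f z) ~= \<infinity>" using XI_norm_power_finite_pos[of ?ms 0] by auto
 hence fin: "AE z in lborel. f z ~= \<infinity>" by (rule nn_integral_PInf_AE[OF f(1)])
 have "density lborel (%z. ennreal (enn2real (f z))) = density lborel f"
  using f(1) fin by (intro density_cong) (auto elim!: eventually_mono simp: less_top)
 hence "product_weight k n (%z. enn2real (f z))"
  unfolding product_weight_def pushforward_weight_def N_def[symmetric] using f by simp
 thus ?thesis by (intro exI[where x = "%z. enn2real (f z)"])
qed

text \<open>Rotating the first scalar factor alone rotates the product, and the weight of that
  factor depends only on the modulus.\<close>

lemma weight_rotation:
 assumes w: "product_weight k n \<omega>" and k: "k \<ge> 1" and u: "cmod u = 1" and ph: "ph : \<B> borel"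
 shows "(\<integral>z. ph (u * z) * ennreal (\<omega> z)) = (\<integral>z. ph z * ennreal (\<omega> z))"
proof -
 let ?ms = "map (%j. n j - n 1) [Suc 1..<Suc k]"
 let ?m = "n 1 - n 1"
 have l: "map (%j. n j - n 1) [1..<Suc k] = ?m # ?ms" using k by (subst upt_conv_Cons) auto
 have phu: "(%z. ph (u * z)) : \<B> borel" using ph by measurable
 have u0: "u ~= 0" using u by auto
 have "XI (?m # ?ms) (%z. ph (u * z)) = XI (?m # ?ms) ph"
  unfolding XI.simps
 proof (rule XI_cong)
  fix y :: complex
  have m: "(%x. gx ?m x * ph (x * y)) : \<B> borel" using ph by measurable
  have "(\<integral>x. gx ?m x * ph (x * y)) = (\<integral>x. gx ?m (u * x) * ph (u * x * y))"
   using nn_integral_lborel_complex_scale[OF u0 m] u by simp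
  also have "... = (\<integral>x. gx ?m x * ph (u * (x * y)))"
   by (intro nn_integral_cong) (simp add: gx_def norm_mult u mult.assoc)
  finally show "(\<integral>x. gx ?m x * ph (u * (x * y))) = (\<integral>x. gx ?m x * ph (x * y))" by simp
 qed
 thus ?thesis
  using XI_weight[OF w phu] XI_weight[OF w ph] unfolding l by (simp only:)
qed

section \<open>Measurable enumeration of roots\<close>

text \<open>Monic of degree \<open>n\<close>, expressed by coefficients so that the set of these
  polynomials is visibly measurable.\<close>

definition monicn :: "nat => complex poly => bool" where
 "monicn n p \<longleftrightarrow> coeff p n = 1 & (\<forall>i>n. coeff p i = 0)"

lemma monicn_degree: "monicn n p ==> degree p = n & p ~= 0"
 unfolding monicn_def by (metis coeff_0 degree_le le_antisym le_degree zero_neq_one)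

lemma monicn_char_poly: "A : \<M> n n ==> monicn n (char_poly A)"
 using degree_monic_char_poly[of A n] by (simp add: monicn_def coeff_eq_0)

text \<open>The lexicographically least root is measurable because \<open>measurable_common_root\<close> makes
 \<open>{p. lroot_re p <= t}\<close> measurable for all \<open>t\<close>, and likewise for the imaginary part after a shift.\<close>

definition lroot_re :: "complex poly => real" where
 "lroot_re p = Min (Re ` {z. poly p z = 0})"

definition lroot_im :: "complex poly => real" where
 "lroot_im p = Min (Im ` {z. poly p z = 0 & Re z = lroot_re p})"

definition lroot :: "complex poly => complex" where
 "lroot p = Complex (lroot_re p) (lroot_im p)"

lemma roots_finite_nonempty:
 assumes "monicn (Suc n) p"
 shows "finite {z. poly p z = 0}" "{z. poly p z = 0} ~= {}"
 using monicn_degree[OF assms] poly_roots_finite[of p] fundamental_theorem_of_algebra[of p] constant_degree[of p] by auto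

lemma lroot_re_roots:
 assumes "monicn (Suc n) p"
 shows "finite {z. poly p z = 0 & Re z = lroot_re p}" "{z. poly p z = 0 & Re z = lroot_re p} ~= {}"
proof -
 have "lroot_re p : Re ` {z. poly p z = 0}"
  unfolding lroot_re_def by (rule Min_in) (use roots_finite_nonempty[OF assms] in auto)
 thus "{z. poly p z = 0 & Re z = lroot_re p} ~= {}" by auto
 show "finite {z. poly p z = 0 & Re z = lroot_re p}"
  by (rule finite_subset[OF _ roots_finite_nonempty(1)[OF assms]]) auto
qed

lemma poly_lroot:
 assumes "monicn (Suc n) p"
 shows "poly p (lroot p) = 0"
proof -
 have "lroot_im p : Im ` {z. poly p z = 0 & Re z = lroot_re p}"
  unfolding lroot_im_def by (rule Min_in) (use lroot_re_roots[OF assms] in auto)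
 then obtain z where "poly p z = 0" "Re z = lroot_re p" "Im z = lroot_im p" by auto
 thus ?thesis by (metis complex_surj lroot_def)
qed

lemma closed_Re_le: "closed {z. Re z <= t}"
 by (intro closed_Collect_le continuous_intros)

lemma measurable_lroot_re:
 assumes p: "p : measurable N polyM" and mon: "!!x. x : space N ==> monicn (Suc n) (p x)"
 shows "(%x. lroot_re (p x)) : \<B> N"
proof (rule borel_measurableI_le)
 fix t
 have "{x : space N. \<exists>z\<in>{z. Re z <= t}. poly (p x) z = 0 & poly (p x) z = 0} : sets N"
  by (rule measurable_common_root[OF closed_Re_le])
    (use mon monicn_degree measurable_poly_eval[OF p borel_measurable_const] in auto)
 also have "{x : space N. \<exists>z\<in>{z. Re z <= t}. poly (p x) z = 0 & poly (p x) z = 0} = {x : space N. lroot_re (p x) <= t}"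
 proof (rule Collect_cong, rule conj_cong[OF refl])
  fix x assume "x : space N"
  note f = roots_finite_nonempty[OF mon[OF this]]
  have "lroot_re (p x) <= t \<longleftrightarrow> (\<exists>a\<in>Re ` {z. poly (p x) z = 0}. a <= t)"
   unfolding lroot_re_def by (rule Min_le_iff) (use f in auto)
  thus "(\<exists>z\<in>{z. Re z <= t}. poly (p x) z = 0 & poly (p x) z = 0) = (lroot_re (p x) <= t)" by auto
 qed
 finally show "{x : space N. lroot_re (p x) <= t} : sets N" .
qed

lemma measurable_lroot_im:
 assumes p: "p : measurable N polyM" and mon: "!!x. x : space N ==> monicn (Suc n) (p x)"
 shows "(%x. lroot_im (p x)) : \<B> N"
proof (rule borel_measurableI_le)
 fix t
 \<comment> \<open>The vertical line through the leftmost roots varies with \<open>x\<close>;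
   translating the polynomial moves it into the fixed closed set \<open>?K\<close>.\<close>
 let ?s = "%x. pcompose (p x) [:of_real (lroot_re (p x)), 1:]"
 let ?K = "{z. Re z = 0} \<inter> {z. Im z <= t}"
 have K: "closed ?K" by (intro closed_Int closed_Collect_le closed_Collect_eq continuous_intros)
 have ev: "(%x. poly (?s x) z) : \<B> N" for z
 proof -
  have "(%x. complex_of_real (lroot_re (p x)) + z) : \<B> N"
   using measurable_lroot_re[OF assms] by measurable
  from measurable_poly_eval[OF p this] show ?thesis by (simp add: poly_pcompose)
 qed
 have "{x : space N. \<exists>z\<in>?K. poly (?s x) z = 0 & poly (?s x) z = 0} : sets N"
  by (rule measurable_common_root[OF K _ ev ev]) (use mon monicn_degree in \<open>auto simp: pcompose_eq_0_iff\<close>)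
 also have "{x : space N. \<exists>z\<in>?K. poly (?s x) z = 0 & poly (?s x) z = 0} = {x : space N. lroot_im (p x) <= t}"
 proof (rule Collect_cong, rule conj_cong[OF refl])
  fix x assume x: "x : space N"
  note f = lroot_re_roots[OF mon[OF this]]
  let ?a = "of_real (lroot_re (p x)) :: complex"
  have "lroot_im (p x) <= t \<longleftrightarrow> (\<exists>a\<in>Im ` {z. poly (p x) z = 0 & Re z = lroot_re (p x)}. a <= t)"
   unfolding lroot_im_def by (rule Min_le_iff) (use f in auto)
  also have "... \<longleftrightarrow> (\<exists>z. poly (p x) z = 0 & Re z = lroot_re (p x) & Im z <= t)" by auto
  also have "... \<longleftrightarrow> (\<exists>w. poly (p x) (?a + w) = 0 & Re w = 0 & Im w <= t)"
  proof
   assume "\<exists>z. poly (p x) z = 0 & Re z = lroot_re (p x) & Im z <= t"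
   then obtain z where "poly (p x) z = 0 & Re z = lroot_re (p x) & Im z <= t" by blast
   thus "\<exists>w. poly (p x) (?a + w) = 0 & Re w = 0 & Im w <= t"
    by (intro exI[of _ "z - ?a"]) simp
  next
   assume "\<exists>w. poly (p x) (?a + w) = 0 & Re w = 0 & Im w <= t"
   then obtain w where "poly (p x) (?a + w) = 0 & Re w = 0 & Im w <= t" by blast
   thus "\<exists>z. poly (p x) z = 0 & Re z = lroot_re (p x) & Im z <= t"
    by (intro exI[of _ "?a + w"]) simp
  qed
  finally show "(\<exists>z\<in>?K. poly (?s x) z = 0 & poly (?s x) z = 0) = (lroot_im (p x) <= t)"
   by (auto simp: poly_pcompose)
 qed
 finally show "{x : space N. lroot_im (p x) <= t} : sets N" .
qed

lemma measurable_lroot: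
 assumes p: "p : measurable N polyM" and mon: "!!x. x : space N ==> monicn (Suc n) (p x)"
 shows "(%x. lroot (p x)) : \<B> N"
 using measurable_lroot_re[OF assms] measurable_lroot_im[OF assms] by (simp add: borel_measurable_complex_iff lroot_def)

text \<open>The Horner quotient of \<open>p\<close> by \<open>X - c\<close>. Its coefficients are
  polynomials in \<open>c\<close> and the coefficients of \<open>p\<close>, which gives
  measurability; at a root the division is exact.\<close>

definition sdiv :: "nat => complex poly => complex => complex poly" where
 "sdiv n p c = (\<Sum>i\<le>n. monom (\<Sum>j\<in>{i<..Suc n}. coeff p j * c ^ (j - Suc i)) i)"

lemma coeff_sdiv: "coeff (sdiv n p c) i = (\<Sum>j\<in>{i<..Suc n}. coeff p j * c ^ (j - Suc i))"
proof (cases "i <= n")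
 case False
 hence "{i<..Suc n} = {}" by auto
 thus ?thesis using False by (simp add: sdiv_def coeff_sum)
qed (simp add: sdiv_def coeff_sum)

text \<open>The coefficient sums telescope; only the constant term uses
  \<open>poly p c = 0\<close>.\<close>

lemma sdiv_correct:
 assumes mon: "monicn (Suc n) p" and root: "poly p c = 0"
 shows "[:- c, 1:] * sdiv n p c = p"
proof (rule poly_eqI)
 fix i
 have z: "coeff p j = 0" if "j > Suc n" for j using mon that by (simp add: monicn_def)
 have shift: "(\<Sum>j\<in>{i<..Suc n}. coeff p j * c ^ (j - i)) = c * coeff (sdiv n p c) i" for i
  unfolding coeff_sdiv sum_distrib_left
 proof (rule sum.cong[OF refl])
  fix j assume "j : {i<..Suc n}"
  hence "j - i = Suc (j - Suc i)" by auto
  thus "coeff p j * c ^ (j - i) = c * (coeff p j * c ^ (j - Suc i))" by simp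
 qed
 show "coeff ([:- c, 1:] * sdiv n p c) i = coeff p i"
 proof (cases i rule: nat.exhaust)
  case zero
  have "0 = (\<Sum>j\<le>Suc n. coeff p j * c ^ j)"
   using root monicn_degree[OF mon] by (simp add: poly_altdef)
  also have "{..Suc n} = insert 0 {0<..Suc n}" by auto
  finally have "0 = coeff p 0 + c * coeff (sdiv n p c) 0" using shift[of 0] by simp
  thus ?thesis using zero by (simp add: algebra_simps add_eq_0_iff)
 next
  case (Suc i')
  have "coeff (sdiv n p c) i' = coeff p (Suc i') + (\<Sum>j\<in>{Suc i'<..Suc n}. coeff p j * c ^ (j - Suc i'))"
  proof (cases "i' <= n")
   case True
   hence "{i'<..Suc n} = insert (Suc i') {Suc i'<..Suc n}" by auto
   thus ?thesis unfolding coeff_sdiv by simp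
  next
   case False
   hence "{i'<..Suc n} = {}" "{Suc i'<..Suc n} = {}" by auto
   thus ?thesis using False z[of "Suc i'"] by (simp add: coeff_sdiv)
  qed
  thus ?thesis using Suc shift[of "Suc i'"] by (simp add: algebra_simps)
 qed
qed

lemma monicn_sdiv:
 assumes mon: "monicn (Suc n) p"
 shows "monicn n (sdiv n p c)"
proof -
 have "{n<..Suc n} = {Suc n}" by auto
 moreover have "{i<..Suc n} = {}" if "i > n" for i using that by auto
 ultimately show ?thesis using mon by (simp add: monicn_def coeff_sdiv)
qed

lemma measurable_sdiv:
 assumes p: "p : measurable N polyM" and c: "c : \<B> N"
 shows "(%x. sdiv n (p x) (c x)) : measurable N polyM"
 by (rule measurable_polyMI, unfold coeff_sdiv)
   (intro borel_measurable_sum borel_measurable_times borel_measurable_power measurable_coeff[OF p] c)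

text \<open>The least root receives the highest index, and the others are enumerated from the
  quotient. Outside \<open>{..<n}\<close> the value is \<open>undefined\<close>, so the enumeration
  is extensional.\<close>

primrec rts :: "nat => complex poly => nat => complex" where
 "rts 0 p = (%_. undefined)"
| "rts (Suc n) p = (rts n (sdiv n p (lroot p)))(n := lroot p)"

lemma rootpoly_rts: "monicn n p ==> rootpoly n (rts n p) = p"
proof (induction n arbitrary: p)
 case 0
 hence "degree p = 0" "coeff p 0 = 1" using monicn_degree[OF 0] by (auto simp: monicn_def)
 hence "p = 1" by (metis degree_0_id one_pCons)
 thus ?case by (simp add: rootpoly_def)
next
 case (Suc n)
 show ?case unfolding rts.simps rootpoly_Suc Suc.IH[OF monicn_sdiv[OF Suc.prems]]
  by (rule sdiv_correct[OF Suc.prems poly_lroot[OF Suc.prems]])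
qed

lemma measurable_rts:
 "p : measurable N polyM ==> (!!x. x : space N ==> monicn n (p x)) ==> i < n ==> (%x. rts n (p x) i) : \<B> N"
proof (induction n arbitrary: p)
 case (Suc n)
 note l = measurable_lroot[OF Suc.prems(1,2)]
 show ?case
 proof (cases "i = n")
  case True
  thus ?thesis using l by simp
 next
  case False
  hence "(%x. rts n (sdiv n (p x) (lroot (p x))) i) : \<B> N"
   by (intro Suc.IH measurable_sdiv Suc.prems l monicn_sdiv) (use Suc.prems in auto)
  thus ?thesis using False by simp
 qed
qed simp

lemma monicn_rootpoly: "monicn n (rootpoly n x)"
proof -
 have "degree (rootpoly n x) = n"
  unfolding rootpoly_def by (subst degree_prod_eq_sum_degree) auto
 moreover have "lead_coeff (rootpoly n x) = 1" by (simp add: rootpoly_def lead_coeff_prod)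
 ultimately show ?thesis by (auto simp: monicn_def coeff_eq_0)
qed

lemma proots_rootpoly: "proots (rootpoly n x) = image_mset x (mset_set {..<n})"
proof -
 have "proots (rootpoly n x) = (\<Sum>l<n. {#x l#})"
  unfolding rootpoly_def by (subst proots_prod) auto
 also have "... = image_mset x (mset_set {..<n})"
  by (induction n) (simp_all add: lessThan_Suc)
 finally show ?thesis .
qed

lemma monicn_sets: "{p. monicn n p} : sets polyM"
proof -
 have "(%p. coeff p i) : \<B> polyM" for i
  by (rule measurable_coeff) simp
 hence "{p : space polyM. coeff p n = 1 & (\<forall>i\<in>{n<..}. coeff p i = 0)} : sets polyM"
  by measurable
 thus ?thesis by (simp add: monicn_def greaterThan_def)
qed

text \<open>\<open>rts\<close> is under control only on monic polynomials of degree
  \<open>n\<close>; elsewhere the test function is set to 0.\<close>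

lemma measurable_rts_comp:
 assumes G: "G : \<B> (PiM {..<n} (%_. borel))"
 shows "(%p. if monicn n p then G (\<lambda>l\<in>{..<n}. rts n p l) else (0 :: ennreal)) : \<B> polyM"
proof -
 let ?N = "restrict_space polyM {p. monicn n p}"
 have id: "(%p. p) : measurable ?N polyM" by (rule measurable_restrict_space1) simp
 have "(%p. \<lambda>l\<in>{..<n}. rts n p l) : measurable ?N (PiM {..<n} (%_. borel))"
  by (intro measurable_restrict measurable_rts[OF id]) (auto simp: space_restrict_space)
 from measurable_compose[OF this G] show ?thesis
  by (subst measurable_If_restrict_space_iff) (use monicn_sets in auto)
qed

section \<open>Correlation kernel\<close>

lemma blk_index_cases:
 assumes "C : \<M> r c" "v : \<M> r 1" "b : \<M> 1 c" "i < Suc r" "j < Suc c"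
 shows "blk C v b z $$ (i, j) = (if i < r then if j < c then C $$ (i, j) else v $$ (i, 0) else if j < c then b $$ (0, j) else z)"
 using assms by (auto simp: blk_def less_Suc_eq)

text \<open>A column operation replaces the last column by the values of the monic polynomial that
  vanishes at the first \<open>n\<close> points, so only the value at the last point survives. The
  scales \<open>s j\<close> will normalise the monomials.\<close>

lemma det_scaled_vandermonde:
 fixes x :: "nat => complex" and s :: "nat => complex"
 assumes s: "!!j. s j ~= 0"
 shows "(cmod (det (mat n n (%(i, j). x i ^ j / s j))))\<^sup>2 = vdm n x * (\<Prod>j<n. 1 / (cmod (s j))\<^sup>2)"
proof (induction n)
 case (Suc n)
 let ?V = "%n. mat n n (%(i, j). x i ^ j / s j)"
 let ?p = "rootpoly n x"
 let ?q = "mat n 1 (%(j, _). coeff ?p j * s j / s n)"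
 let ?v = "mat n 1 (%(i, _). x i ^ n / s n)" and ?b = "mat 1 n (%(_, j). x n ^ j / s j)"
 have P: "(\<Sum>j<n. z ^ j / s j * (coeff ?p j * s j / s n)) + z ^ n / s n = poly ?p z / s n" for z
 proof -
  have d: "degree ?p = n" and l: "coeff ?p n = 1"
   using monicn_degree[OF monicn_rootpoly] monicn_rootpoly[of n x] by (auto simp: monicn_def)
  have "poly ?p z = (\<Sum>j<n. coeff ?p j * z ^ j) + z ^ n"
   unfolding poly_altdef d using l by (simp add: lessThan_Suc_atMost[symmetric])
  thus ?thesis using s by (simp add: add_divide_distrib sum_divide_distrib mult.commute)
 qed
 have r0: "poly ?p (x i) = 0" if "i < n" for i
  using that by (auto simp: rootpoly_def poly_prod)
 have e: "?V (Suc n) = blk (?V n) ?v ?b (x n ^ n / s n)"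
 proof (rule eq_matI)
  fix i j assume "i < dim_row (blk (?V n) ?v ?b (x n ^ n / s n))" "j < dim_col (blk (?V n) ?v ?b (x n ^ n / s n))"
  hence ij: "i < Suc n" "j < Suc n" by (auto simp: blk_def)
  thus "?V (Suc n) $$ (i, j) = blk (?V n) ?v ?b (x n ^ n / s n) $$ (i, j)"
   by (subst blk_index_cases[of _ n n]) (auto simp: less_Suc_eq)
 qed (auto simp: blk_def)
 have "?V (Suc n) * blk (1\<^sub>m n) ?q (0\<^sub>m 1 n) 1 =
   blk (?V n * 1\<^sub>m n + ?v * 0\<^sub>m 1 n) (?V n * ?q + 1 \<cdot> ?v) (?b * 1\<^sub>m n + (x n ^ n / s n) \<cdot> 0\<^sub>m 1 n) ((?b * ?q) $$ (0, 0) + x n ^ n / s n * 1)"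
  unfolding e by (rule mult_blk) auto
 also have "?V n * 1\<^sub>m n + ?v * 0\<^sub>m 1 n = ?V n"
  using right_mult_zero_mat[of ?v n 1 n] by simp
 also have "?V n * ?q + 1 \<cdot> ?v = 0\<^sub>m n 1"
 proof (rule eq_matI)
  fix i j assume "i < dim_row (0\<^sub>m n 1 :: complex mat)" "j < dim_col (0\<^sub>m n 1 :: complex mat)"
  hence ij: "i < n" "j = 0" by auto
  thus "(?V n * ?q + 1 \<cdot> ?v) $$ (i, j) = 0\<^sub>m n 1 $$ (i, j)"
   using P[of "x i"] r0[of i] by (simp add: scalar_prod_def atLeast0LessThan)
 qed auto
 also have "?b * 1\<^sub>m n + (x n ^ n / s n) \<cdot> 0\<^sub>m 1 n = ?b" by simp
 also have "(?b * ?q) $$ (0, 0) + x n ^ n / s n * 1 = poly ?p (x n) / s n"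
  using P[of "x n"] by (simp add: scalar_prod_def atLeast0LessThan)
 finally have f: "?V (Suc n) * blk (1\<^sub>m n) ?q (0\<^sub>m 1 n) 1 = lblk n (?V n) ?b (poly ?p (x n) / s n)" .
 have "det (blk (1\<^sub>m n) ?q (0\<^sub>m 1 n) 1) = 1"
  using det_blk_upper[of "1\<^sub>m n" n ?q "1 :: complex"] by simp
 hence "det (?V (Suc n)) = det (?V n) * (poly ?p (x n) / s n)"
  using arg_cong[OF f, of det] det_mult[of "?V (Suc n)" "Suc n" "blk (1\<^sub>m n) ?q (0\<^sub>m 1 n) 1"]
   det_blk_lower[of "?V n" n ?b "poly ?p (x n) / s n"] by simp
 moreover have "vdm (Suc n) x = vdm n x * (cmod (poly ?p (x n)))\<^sup>2"
  using vdm_Suc[of n x "x n"] by simp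
 ultimately show ?case
  using Suc.IH by (simp add: norm_mult norm_divide power_mult_distrib power_divide)
qed (simp add: vdm_def)

text \<open>Beyond measurability and sign, the construction of the kernel relies on two properties
  of the weight: rotation invariance and finite nonzero even moments.\<close>

locale radial_weight =
 fixes \<omega> :: "complex => real" and n :: nat
 assumes measurable_weight: "\<omega> : \<B> borel" and weight_nonneg: "!!z. 0 <= \<omega> z"
  and moment: "!!j. (\<integral>z. ennreal (cmod z ^ (2 * j)) * ennreal (\<omega> z)) < \<infinity>"
   "!!j. (\<integral>z. ennreal (cmod z ^ (2 * j)) * ennreal (\<omega> z)) ~= 0"
  and rotation: "!!u ph. cmod u = 1 ==> ph : \<B> borel ==>
   (\<integral>z. ph (u * z) * ennreal (\<omega> z)) = (\<integral>z. ph z * ennreal (\<omega> z))"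
begin

abbreviation Wt :: "nat => (nat => complex) => ennreal" where
 "Wt r x \<equiv> (\<Prod>l<r. ennreal (\<omega> (x l)))"

definition mu :: "complex measure" where
 "mu = density lborel (%z. ennreal (\<omega> z))"

lemma sets_mu [simp, measurable_cong]: "sets mu = sets borel"
 by (simp add: mu_def)

lemma space_mu [simp]: "space mu = UNIV"
 by (simp add: mu_def)

lemma measurable_mu [simp]: "measurable mu N = measurable borel N"
 by (rule measurable_cong_sets) auto

lemma nn_integral_mu:
 "ph : \<B> borel ==> (\<integral>\<^sup>+z. ph z \<partial>mu) = (\<integral>z. ph z * ennreal (\<omega> z))"
 unfolding mu_def by (subst nn_integral_density) (use measurable_weight in \<open>auto simp: mult.commute\<close>)

text \<open>The squared norm of the monomial of degree \<open>j\<close>.\<close>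

definition hm :: "nat => real" where
 "hm j = (\<integral>z. cmod z ^ (2 * j) \<partial>mu)"

lemma integrable_norm_power: "integrable mu (%z. cmod z ^ (2 * j))"
proof (rule integrableI_nonneg)
 have "(\<integral>\<^sup>+z. ennreal (cmod z ^ (2 * j)) \<partial>mu) = (\<integral>z. ennreal (cmod z ^ (2 * j)) * ennreal (\<omega> z))"
  by (rule nn_integral_mu) measurable
 thus "(\<integral>\<^sup>+z. ennreal (cmod z ^ (2 * j)) \<partial>mu) < \<infinity>" using moment(1)[of j] by simp
qed auto

lemma hm_pos: "0 < hm j"
proof -
 have "ennreal (hm j) = (\<integral>\<^sup>+z. ennreal (cmod z ^ (2 * j)) \<partial>mu)"
  unfolding hm_def by (rule nn_integral_eq_integral[OF integrable_norm_power, symmetric]) auto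
 also have "... = (\<integral>z. ennreal (cmod z ^ (2 * j)) * ennreal (\<omega> z))"
  by (rule nn_integral_mu) measurable
 finally have "ennreal (hm j) ~= 0" using moment(2)[of j] by simp
 thus ?thesis by (metis ennreal_neg not_le)
qed

text \<open>The product \<open>|z|^a |z|^b\<close> is at most the sum of the two squares, so the
  even moments suffice.\<close>

lemma integrable_monomial: "integrable mu (%z. z ^ a * cnj z ^ b)"
proof (rule Bochner_Integration.integrable_bound)
 show "integrable mu (%z. cmod z ^ (2 * a) + cmod z ^ (2 * b))"
  by (intro Bochner_Integration.integrable_add integrable_norm_power)
 show "AE z in mu. norm (z ^ a * cnj z ^ b) <= norm (cmod z ^ (2 * a) + cmod z ^ (2 * b))"
 proof (rule AE_I2)
  fix z :: complex
  have "2 * (cmod z ^ a * cmod z ^ b) <= (cmod z ^ a)\<^sup>2 + (cmod z ^ b)\<^sup>2"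
   using sum_squares_bound[of "cmod z ^ a" "cmod z ^ b"] by simp
  moreover have "0 <= cmod z ^ a * cmod z ^ b" by simp
  ultimately have "cmod z ^ a * cmod z ^ b <= (cmod z ^ a)\<^sup>2 + (cmod z ^ b)\<^sup>2" by linarith
  thus "norm (z ^ a * cnj z ^ b) <= norm (cmod z ^ (2 * a) + cmod z ^ (2 * b))"
   by (simp add: norm_mult norm_power power_mult[symmetric] mult.commute)
 qed
 have "continuous_on UNIV (%z :: complex. z ^ a * cnj z ^ b)" by (intro continuous_intros)
 thus "(%z. z ^ a * cnj z ^ b) : \<B> mu" by (simp add: borel_measurable_continuous_onI)
qed

lemma distr_rotation: "cmod u = 1 ==> distr mu borel (%z. u * z) = mu"
proof (rule measure_eqI)
 fix X assume u: "cmod u = 1" and "X : sets (distr mu borel (%z. u * z))"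
 hence X: "X : sets borel" by simp
 have mu: "(%z. u * z) : \<B> mu" by simp
 have m1: "indicator X : \<B> (borel :: complex measure)" and
  m2: "(%z. indicator X (u * z) :: ennreal) : \<B> borel" using X by measurable
 have "emeasure (distr mu borel (%z. u * z)) X = (\<integral>\<^sup>+z. indicator X z \<partial>distr mu borel (%z. u * z))" using X by simp
 also have "... = (\<integral>\<^sup>+z. indicator X (u * z) \<partial>mu)" by (rule nn_integral_distr[OF mu]) (use m1 in simp)
 also have "... = (\<integral>\<^sup>+z. indicator X z \<partial>mu)" unfolding nn_integral_mu[OF m2] nn_integral_mu[OF m1] by (rule rotation[OF u m1])
 also have "... = emeasure mu X" using X by simp
 finally show "emeasure (distr mu borel (%z. u * z)) X = emeasure mu X" .
qed simp

lemma integral_monomial: "(\<integral>z. z ^ a * cnj z ^ b \<partial>mu) = (if a = b then of_real (hm a) else 0)"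
proof (cases "a = b")
 case True
 have "(\<integral>z. z ^ a * cnj z ^ a \<partial>mu) = (\<integral>z. complex_of_real (cmod z ^ (2 * a)) \<partial>mu)"
  by (intro Bochner_Integration.integral_cong refl) (simp add: power_mult_distrib[symmetric] complex_norm_square[symmetric] power_mult)
 thus ?thesis using True unfolding integral_complex_of_real hm_def by simp
next
 case False
 \<comment> \<open>Rotation by this angle multiplies the integrand by \<open>cis pi\<close>, which
   is \<open>-1\<close>; the integral therefore equals its own negative.\<close>
 define t where "t = pi / (real a - real b)"
 have "cis t ^ a * cnj (cis t) ^ b = cis (real a * t - real b * t)"
  by (simp add: Complex.DeMoivre cis_cnj cis_mult)
 also have "real a * t - real b * t = (real a - real b) * t" by (simp add: left_diff_distrib)
 also have "... = pi" using False by (simp add: t_def)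
 finally have c: "cis t ^ a * cnj (cis t) ^ b = - 1" by simp
 have mm: "(%z :: complex. z ^ a * cnj z ^ b) : \<B> borel"
  by (intro borel_measurable_continuous_onI continuous_intros)
 have "(\<integral>z. z ^ a * cnj z ^ b \<partial>mu) = (\<integral>z. z ^ a * cnj z ^ b \<partial>distr mu borel (%z. cis t * z))"
  by (simp add: distr_rotation)
 also have "... = (\<integral>z. (cis t * z) ^ a * cnj (cis t * z) ^ b \<partial>mu)"
  by (rule integral_distr[OF _ mm]) simp
 also have "... = (\<integral>z. - (z ^ a * cnj z ^ b) \<partial>mu)"
 proof (intro Bochner_Integration.integral_cong refl)
  fix z :: complex
  have "(cis t * z) ^ a * cnj (cis t * z) ^ b = (cis t ^ a * cnj (cis t) ^ b) * (z ^ a * cnj z ^ b)"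
   by (simp only: power_mult_distrib complex_cnj_mult mult_ac)
  thus "(cis t * z) ^ a * cnj (cis t * z) ^ b = - (z ^ a * cnj z ^ b)" unfolding c by simp
 qed
 also have "... = - (\<integral>z. z ^ a * cnj z ^ b \<partial>mu)" by simp
 finally show ?thesis using False by simp
qed

text \<open>The reproducing kernel of the polynomials of degree below \<open>n\<close> with respect
  to \<open>mu\<close>; the square roots of the weight join it in \<open>kern\<close>.\<close>

definition S :: "complex => complex => complex" where
 "S x y = (\<Sum>j<n. x ^ j * cnj y ^ j / of_real (hm j))"

text \<open>Orthogonality of the monomials reduces the double sum to its diagonal, where one factor
  \<open>hm i\<close> cancels.\<close>

lemma integrable_S_S: "integrable mu (%y. S x y * S y w)"
 and integral_S_S: "(\<integral>y. S x y * S y w \<partial>mu) = S x w"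
proof -
 have e: "S x y * S y w = (\<Sum>i<n. \<Sum>j<n. (x ^ i * cnj w ^ j / (of_real (hm i) * of_real (hm j))) * (y ^ j * cnj y ^ i))" for y
  by (simp add: S_def sum_product field_simps)
 show "integrable mu (%y. S x y * S y w)"
  unfolding e by (intro Bochner_Integration.integrable_sum integrable_mult_right integrable_monomial)
 have "(\<integral>y. S x y * S y w \<partial>mu) = (\<Sum>i<n. \<Sum>j<n. (x ^ i * cnj w ^ j / (of_real (hm i) * of_real (hm j))) * (\<integral>y. y ^ j * cnj y ^ i \<partial>mu))"
  unfolding e by (subst Bochner_Integration.integral_sum; (intro Bochner_Integration.integrable_sum integrable_mult_right integrable_monomial)?)
   (intro sum.cong refl, subst Bochner_Integration.integral_sum; (intro integrable_mult_right integrable_monomial)?; simp)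
 also have "... = (\<Sum>i<n. \<Sum>j<n. if j = i then x ^ i * cnj w ^ i / of_real (hm i) else 0)"
  using hm_pos by (intro sum.cong refl) (auto simp: integral_monomial less_imp_neq[THEN not_sym])
 also have "... = S x w" by (simp add: S_def)
 finally show "(\<integral>y. S x y * S y w \<partial>mu) = S x w" .
qed

lemma integrable_S_diag: "integrable mu (%y. S y y)"
 and integral_S_diag: "(\<integral>y. S y y \<partial>mu) = of_nat n"
proof -
 have e: "S y y = (\<Sum>j<n. (1 / of_real (hm j)) * (y ^ j * cnj y ^ j))" for y by (simp add: S_def)
 show "integrable mu (%y. S y y)"
  unfolding e by (intro Bochner_Integration.integrable_sum integrable_mult_right integrable_monomial)
 have "(\<integral>y. S y y \<partial>mu) = (\<Sum>j<n. (1 / of_real (hm j)) * (\<integral>y. y ^ j * cnj y ^ j \<partial>mu))"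
  unfolding e by (subst Bochner_Integration.integral_sum; (intro integrable_mult_right integrable_monomial)?; simp)
 also have "... = of_nat n" using hm_pos by (simp add: integral_monomial less_imp_neq[THEN not_sym])
 finally show "(\<integral>y. S y y \<partial>mu) = of_nat n" .
qed

definition Dmat :: "nat => (nat => complex) => complex mat" where
 "Dmat r x = mat r r (%(i, j). S (x i) (x j))"

definition D :: "nat => (nat => complex) => complex" where
 "D r x = det (Dmat r x)"

text \<open>Expansion of the bordered determinant by \<open>det_blk\<close>. The new point
  \<open>y\<close> is confined to \<open>S y y\<close> and the products
  \<open>S (x j) y * S y (x i)\<close>, whose integrals are known.\<close>

lemma D_Suc:
 "D (Suc r) (x(r := y)) = S y y * D r x - (\<Sum>i<r. \<Sum>j<r. adj_mat (Dmat r x) $$ (i, j) * (S (x j) y * S y (x i)))"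
proof -
 let ?c = "mat r 1 (%(i, _). S (x i) y)" and ?b = "mat 1 r (%(_, j). S y (x j))"
 have M: "Dmat r x : \<M> r r" by (simp add: Dmat_def)
 have "Dmat (Suc r) (x(r := y)) = blk (Dmat r x) ?c ?b (S y y)"
 proof (rule eq_matI)
  fix i j assume "i < dim_row (blk (Dmat r x) ?c ?b (S y y))" "j < dim_col (blk (Dmat r x) ?c ?b (S y y))"
  hence "i < Suc r" "j < Suc r" by (auto simp: blk_def Dmat_def)
  thus "Dmat (Suc r) (x(r := y)) $$ (i, j) = blk (Dmat r x) ?c ?b (S y y) $$ (i, j)"
   by (subst blk_index_cases[of _ r r]) (auto simp: Dmat_def)
 qed (auto simp: blk_def Dmat_def)
 hence "D (Suc r) (x(r := y)) = S y y * D r x - (?b * adj_mat (Dmat r x) * ?c) $$ (0, 0)"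
  unfolding D_def using det_blk[OF M, of ?c ?b] by simp
 also have "(?b * adj_mat (Dmat r x) * ?c) $$ (0, 0) = (\<Sum>i<r. \<Sum>j<r. adj_mat (Dmat r x) $$ (i, j) * (S (x j) y * S y (x i)))"
  by (subst bilinear_form_index[of _ r]) (use adj_mat(1)[OF M] in \<open>auto simp: sum_distrib_left mult_ac\<close>)
 finally show ?thesis .
qed

text \<open>In Gaudin's step the diagonal term integrates to \<open>n\<close>, and the double sum
  becomes the trace of the adjugate times the matrix, which is \<open>r\<close> times the
  determinant.\<close>

lemma integrable_D_Suc: "integrable mu (%y. D (Suc r) (x(r := y)))"
 and integral_D_Suc: "(\<integral>y. D (Suc r) (x(r := y)) \<partial>mu) = (of_nat n - of_nat r) * D r x"
proof -
 have M: "Dmat r x : \<M> r r" by (simp add: Dmat_def)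
 let ?a = "%i j. adj_mat (Dmat r x) $$ (i, j)"
 have i1: "integrable mu (%y. S y y * D r x)" by (intro integrable_mult_left integrable_S_diag)
 have i2: "integrable mu (%y. \<Sum>i<r. \<Sum>j<r. ?a i j * (S (x j) y * S y (x i)))"
  by (intro Bochner_Integration.integrable_sum integrable_mult_right integrable_S_S)
 show "integrable mu (%y. D (Suc r) (x(r := y)))"
  unfolding D_Suc by (intro Bochner_Integration.integrable_diff i1 i2)
 have "(\<integral>y. (\<Sum>i<r. \<Sum>j<r. ?a i j * (S (x j) y * S y (x i))) \<partial>mu) = (\<Sum>i<r. \<Sum>j<r. ?a i j * S (x j) (x i))"
  by (subst Bochner_Integration.integral_sum; (intro Bochner_Integration.integrable_sum integrable_mult_right integrable_S_S)?)
    (intro sum.cong refl, subst Bochner_Integration.integral_sum; (intro integrable_mult_right integrable_S_S)?; simp add: integral_S_S)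
 also have "... = (\<Sum>i<r. (adj_mat (Dmat r x) * Dmat r x) $$ (i, i))"
  using adj_mat(1)[OF M] by (intro sum.cong refl) (auto simp: scalar_prod_def atLeast0LessThan Dmat_def)
 also have "... = of_nat r * D r x" unfolding adj_mat(3)[OF M] by (simp add: D_def)
 finally have "(\<integral>y. (\<Sum>i<r. \<Sum>j<r. ?a i j * (S (x j) y * S y (x i))) \<partial>mu) = of_nat r * D r x" .
 thus "(\<integral>y. D (Suc r) (x(r := y)) \<partial>mu) = (of_nat n - of_nat r) * D r x"
  unfolding D_Suc using i1 i2 by (simp add: Bochner_Integration.integral_diff integrable_S_diag integral_S_diag algebra_simps)
qed

text \<open>A Gram factorisation by normalised monomials. Zero columns keep \<open>V\<close> square,
  so that determinants multiply also for \<open>r > n\<close>.\<close>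

lemma Dmat_factor:
 fixes r :: nat and x :: "nat => complex"
 assumes "n <= r"
 defines "V \<equiv> mat r r (%(i, j). if j < n then x i ^ j / of_real (sqrt (hm j)) else 0)"
 shows "Dmat r x = V * ctr V"
proof (rule eq_matI)
 have V: "V : \<M> r r" by (simp add: V_def)
 fix i j assume "i < dim_row (V * ctr V)" "j < dim_col (V * ctr V)"
 hence ij: "i < r" "j < r" using V ctr_carrier[OF V] by auto
 have "(V * ctr V) $$ (i, j) = (\<Sum>l<r. V $$ (i, l) * cnj (V $$ (j, l)))"
  using ij carrier_matD[OF V] carrier_matD[OF ctr_carrier[OF V]]
  by (simp add: scalar_prod_def atLeast0LessThan index_ctr[OF V])
 also have "... = (\<Sum>l<n. V $$ (i, l) * cnj (V $$ (j, l)))"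
  by (rule sum.mono_neutral_right) (use assms(1) ij in \<open>auto simp: V_def\<close>)
 also have "... = S (x i) (x j)"
 proof (unfold S_def, rule sum.cong[OF refl])
  fix l assume l: "l : {..<n}"
  have "complex_of_real (sqrt (hm l)) * complex_of_real (sqrt (hm l)) = of_real (hm l)"
   using hm_pos[of l] by (simp add: of_real_mult[symmetric] del: of_real_mult)
  thus "V $$ (i, l) * cnj (V $$ (j, l)) = x i ^ l * cnj (x j) ^ l / of_real (hm l)"
   using l ij assms(1) by (simp add: V_def)
 qed
 finally show "Dmat r x $$ (i, j) = (V * ctr V) $$ (i, j)" using ij by (simp add: Dmat_def)
qed (auto simp: V_def Dmat_def ctr_def)

lemma D_top: "D n x = of_real (vdm n x / (\<Prod>j<n. hm j))"
proof -
 let ?V = "mat n n (%(i, j). x i ^ j / complex_of_real (sqrt (hm j)))"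
 have e: "mat n n (%(i, j). if j < n then x i ^ j / of_real (sqrt (hm j)) else 0) = ?V" by (rule eq_matI) auto
 have "D n x = det (?V * ctr ?V)" unfolding D_def Dmat_factor[OF order_refl] e ..
 also have "... = of_real ((cmod (det ?V))\<^sup>2)"
  using det_mult[of ?V n "ctr ?V"] det_ctr[of ?V n] complex_norm_square[of "det ?V"] by simp
 also have "(cmod (det ?V))\<^sup>2 = vdm n x * (\<Prod>j<n. 1 / (cmod (complex_of_real (sqrt (hm j))))\<^sup>2)"
  by (rule det_scaled_vandermonde) (use hm_pos in \<open>simp add: less_imp_neq[THEN not_sym]\<close>)
 also have "(\<Prod>j<n. 1 / (cmod (complex_of_real (sqrt (hm j))))\<^sup>2) = 1 / (\<Prod>j<n. hm j)"
  using hm_pos by (simp add: prod_dividef less_imp_le)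
 finally show ?thesis by simp
qed

text \<open>Column \<open>n\<close> of the factor is zero, reflecting that more than
  \<open>n\<close> points cannot be correlated.\<close>

lemma D_above:
 assumes "n < r"
 shows "D r x = 0"
proof -
 let ?V = "mat r r (%(i, j). if j < n then x i ^ j / complex_of_real (sqrt (hm j)) else 0)"
 have V: "?V : \<M> r r" by simp
 have "?V *\<^sub>v unit_vec r n = 0\<^sub>v r"
  by (rule eq_vecI) (use assms in auto)
 moreover have "unit_vec r n ~= (0\<^sub>v r :: complex vec)" using assms by (simp add: unit_vec_nonzero)
 ultimately have "det ?V = 0"
  using det_0_iff_vec_prod_zero[OF V] unit_vec_carrier[of r n] by blast
 hence "det (?V * ctr ?V) = 0" using det_mult[OF V ctr_carrier[OF V]] by simp
 thus ?thesis unfolding D_def using Dmat_factor[of r x] assms by simp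
qed

text \<open>Descending induction from the explicit value at \<open>r = n\<close>: for smaller
  \<open>r\<close>, \<open>D r\<close> is a positive multiple of an integral of
  \<open>D (Suc r)\<close>.\<close>

lemma D_real_nonneg:
 "r <= n ==> D r x = of_real (Re (D r x)) & 0 <= Re (D r x)"
proof (induction "n - r" arbitrary: r x)
 case 0
 hence "r = n" by simp
 have "0 <= vdm n x / (\<Prod>j<n. hm j)" by (intro divide_nonneg_nonneg vdm_nonneg prod_nonneg) (use hm_pos in \<open>simp add: less_imp_le\<close>)
 thus ?case unfolding \<open>r = n\<close> D_top Re_complex_of_real by blast
next
 case (Suc k)
 hence r: "r < n" by simp
 have IH: "D (Suc r) y = of_real (Re (D (Suc r) y))" "0 <= Re (D (Suc r) y)" for y
  using Suc.hyps(1)[of "Suc r" y] Suc.hyps(2) r by auto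
 have "(\<integral>y. D (Suc r) (x(r := y)) \<partial>mu) = (\<integral>y. complex_of_real (Re (D (Suc r) (x(r := y)))) \<partial>mu)"
  by (intro Bochner_Integration.integral_cong refl IH(1))
 also have "... = of_real (\<integral>y. Re (D (Suc r) (x(r := y))) \<partial>mu)" by simp
 finally have e: "of_real (real n - real r) * D r x = of_real (\<integral>y. Re (D (Suc r) (x(r := y))) \<partial>mu)"
  unfolding integral_D_Suc by simp
 let ?I = "\<integral>y. Re (D (Suc r) (x(r := y))) \<partial>mu"
 have "0 <= ?I" by (rule Bochner_Integration.integral_nonneg) (rule IH(2))
 moreover have "D r x = of_real (?I / (real n - real r))"
  using e r by (simp add: field_simps)
 ultimately show ?case using r by simp
qed

lemma measurable_S: "a : \<B> N ==> b : \<B> N ==> (%p. S (a p) (b p)) : \<B> N"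
proof -
 assume a: "a : \<B> N" and b: "b : \<B> N"
 have "cnj : \<B> borel" by (intro borel_measurable_continuous_onI continuous_intros)
 from measurable_compose[OF b this] have "(%p. cnj (b p)) : \<B> N" .
 thus ?thesis unfolding S_def
  by (intro borel_measurable_sum borel_measurable_divide borel_measurable_times borel_measurable_power a borel_measurable_const)
qed

lemma measurable_D:
 assumes "!!i. i < r ==> (%p. x p i) : \<B> N"
 shows "(%p. D r (x p)) : \<B> N"
proof -
 have "(%p. Dmat r (x p)) : measurable N (lebm r r)"
 proof (rule measurable_lebmI)
  fix i j assume "i < r" "j < r"
  thus "(%p. Dmat r (x p) $$ (i, j)) : \<B> N"
   using measurable_S[OF assms[of i] assms[of j]] by (simp add: Dmat_def)
 qed (simp add: Dmat_def)
 from measurable_det[OF this] show ?thesis unfolding D_def .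
qed

text \<open>The Bochner integral passes to \<open>ennreal\<close> because \<open>D\<close> is real
  and nonnegative for up to \<open>n\<close> points.\<close>

lemma nn_integral_D_Suc:
 assumes "r < n"
 shows "(\<integral>y. ennreal (Re (D (Suc r) (x(r := y)))) * ennreal (\<omega> y)) = of_nat (n - r) * ennreal (Re (D r x))"
proof -
 have nn: "0 <= Re (D (Suc r) y)" for y using D_real_nonneg[of "Suc r" y] assms by simp
 have m: "(%y. ennreal (Re (D (Suc r) (x(r := y))))) : \<B> borel"
  using measurable_D[of "Suc r" "%y. x(r := y)" borel] by (simp add: fun_upd_def)
 have "(\<integral>y. ennreal (Re (D (Suc r) (x(r := y)))) * ennreal (\<omega> y)) = (\<integral>\<^sup>+y. ennreal (Re (D (Suc r) (x(r := y)))) \<partial>mu)"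
  by (rule nn_integral_mu[OF m, symmetric])
 also have "... = ennreal (\<integral>y. Re (D (Suc r) (x(r := y))) \<partial>mu)"
  by (rule nn_integral_eq_integral[OF integrable_Re[OF integrable_D_Suc]]) (use nn in auto)
 also have "(\<integral>y. Re (D (Suc r) (x(r := y))) \<partial>mu) = Re (\<integral>y. D (Suc r) (x(r := y)) \<partial>mu)"
  by (rule integral_Re[OF integrable_D_Suc])
 also have "... = real (n - r) * Re (D r x)"
 proof -
  have "(of_nat n - of_nat r :: complex) = of_real (real (n - r))" using assms by (simp add: of_nat_diff)
  thus ?thesis unfolding integral_D_Suc by simp
 qed
 finally have e: "(\<integral>y. ennreal (Re (D (Suc r) (x(r := y)))) * ennreal (\<omega> y)) = ennreal (real (n - r) * Re (D r x))" .
 have "0 <= Re (D r x)" using D_real_nonneg[of r x] assms by simp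
 thus ?thesis unfolding e by (simp add: ennreal_mult'' ennreal_of_nat_eq_real_of_nat)
qed

text \<open>The points beyond the first \<open>r\<close> are integrated out one at a time, starting
  with the last; the point with index \<open>r + j\<close> leaves the factor
  \<open>n - (r + j)\<close>.\<close>

lemma nn_integral_marginal:
 assumes f: "f : \<B> (\<P> {..<r})" and m: "m = r + d" "m <= n"
 shows "(\<integral>\<^sup>+x. (Wt m x) * ennreal (Re (D m x)) * f (restrict x {..<r}) \<partial>\<P> {..<m}) =
  (\<Prod>j<d. of_nat (n - (r + j))) * (\<integral>\<^sup>+x. (Wt r x) * ennreal (Re (D r x)) * f x \<partial>\<P> {..<r})"
 using m
proof (induction d arbitrary: m)
 case 0
 hence m: "m = r" by simp
 have "restrict x {..<r} = x" if "x : space (PiM {..<r} (%_. \<L>))" for x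
  using that by (intro PiE_restrict) (simp add: space_PiM)
 thus ?case unfolding m by (simp cong: nn_integral_cong)
next
 case (Suc d)
 let ?m = "r + d"
 have m: "m = Suc ?m" "?m < n" using Suc.prems by auto
 let ?g = "%m x. (Wt m x) * ennreal (Re (D m x)) * f (restrict x {..<r})"
 have mw: "(%z. ennreal (\<omega> z)) : \<B> borel" using measurable_weight by measurable
 have mg: "?g m : \<B> (\<P> {..<m})"
 proof (intro measurable_times_ennreal borel_measurable_prod_ennreal measurable_compose[OF _ f] measurable_compose[OF _ mw])
  show "(%x. x l) : \<B> (PiM {..<m} (%_. \<L>))" if "l : {..<m}" for l
   using measurable_component_singleton[OF that, of "%_. \<L>"] by simp
  hence "(%x. D m x) : \<B> (PiM {..<m} (%_. \<L>))"
   by (intro measurable_D) simp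
  thus "(%x. ennreal (Re (D m x))) : \<B> (PiM {..<m} (%_. \<L>))" by measurable
  show "(%x. restrict x {..<r}) : measurable (\<P> {..<m}) (PiM {..<r} (%_. \<L>))"
   by (rule measurable_restrict_subset) (use m in auto)
 qed
 have ins: "{..<m} = insert ?m {..<?m}" using m by auto
 have "(\<integral>\<^sup>+x. ?g m x \<partial>\<P> {..<m}) = (\<integral>\<^sup>+x. (\<integral>y. ?g m (x(?m := y))) \<partial>\<P> {..<?m})"
  unfolding ins
  by (rule product_sigma_finite.product_nn_integral_insert[OF product_lborel])
    (use mg[unfolded ins] in auto)
 also have "... = (\<integral>\<^sup>+x. of_nat (n - ?m) * ?g ?m x \<partial>\<P> {..<?m})"
 proof (rule nn_integral_cong)
  fix x :: "nat => complex"
  have e: "?g m (x(?m := y)) = (Wt ?m x) * f (restrict x {..<r}) * (ennreal (Re (D (Suc ?m) (x(?m := y)))) * ennreal (\<omega> y))" for y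
  proof -
   have "(\<Prod>l<m. ennreal (\<omega> ((x(?m := y)) l))) = (Wt ?m x) * ennreal (\<omega> y)"
    unfolding m(1) prod.lessThan_Suc by (intro arg_cong2[where f = "(*)"] prod.cong refl) auto
   moreover have "restrict (x(?m := y)) {..<r} = restrict x {..<r}" by (rule ext) simp
   ultimately show ?thesis using m(1) by (simp only: mult_ac)
  qed
  have "(%y. D (Suc ?m) (x(?m := y))) : \<B> borel"
   by (rule measurable_D) (simp add: fun_upd_def)
  hence "(%y. ennreal (Re (D (Suc ?m) (x(?m := y)))) * ennreal (\<omega> y)) : \<B> lborel"
   using measurable_weight by measurable
  hence "(\<integral>y. ?g m (x(?m := y))) = (Wt ?m x) * f (restrict x {..<r}) * (of_nat (n - ?m) * ennreal (Re (D ?m x)))"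
   unfolding e nn_integral_D_Suc[OF m(2), symmetric] by (rule nn_integral_cmult)
  thus "(\<integral>y. ?g m (x(?m := y))) = of_nat (n - ?m) * ?g ?m x" by (simp only: mult_ac)
 qed
 also have "... = of_nat (n - ?m) * (\<integral>\<^sup>+x. ?g ?m x \<partial>\<P> {..<?m})"
 proof (rule nn_integral_cmult, intro measurable_times_ennreal borel_measurable_prod_ennreal measurable_compose[OF _ f] measurable_compose[OF _ mw])
  show "(%x. x l) : \<B> (PiM {..<?m} (%_. \<L>))" if "l : {..<?m}" for l
   using measurable_component_singleton[OF that, of "%_. \<L>"] by simp
  hence "(%x. D ?m x) : \<B> (PiM {..<?m} (%_. \<L>))"
   by (intro measurable_D) simp
  thus "(%x. ennreal (Re (D ?m x))) : \<B> (PiM {..<?m} (%_. \<L>))" by measurable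
  show "(%x. restrict x {..<r}) : measurable (\<P> {..<?m}) (PiM {..<r} (%_. \<L>))"
   by (rule measurable_restrict_subset) auto
 qed
 finally have e: "(\<integral>\<^sup>+x. ?g m x \<partial>\<P> {..<m}) = of_nat (n - ?m) * (\<integral>\<^sup>+x. ?g ?m x \<partial>\<P> {..<?m})" .
 have IH: "(\<integral>\<^sup>+x. ?g ?m x \<partial>\<P> {..<?m}) = (\<Prod>j<d. of_nat (n - (r + j))) *
  (\<integral>\<^sup>+x. (Wt r x) * ennreal (Re (D r x)) * f x \<partial>\<P> {..<r})"
  by (rule Suc.IH) (use m in auto)
 show ?case unfolding e IH prod.lessThan_Suc by (simp only: mult_ac)
qed

end

section \<open>Symmetry under permutations of the points\<close>

definition pairprod :: "nat set => (nat => complex) => real" where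
 "pairprod A x = (\<Prod>i\<in>A. \<Prod>j\<in>A - {i}. cmod (x i - x j))"

lemma pairprod_reindex:
 assumes "bij_betw g B A"
 shows "pairprod A x = pairprod B (%i. x (g i))"
 unfolding pairprod_def
proof (rule prod.reindex_bij_betw[OF assms, symmetric, THEN trans], rule prod.cong[OF refl])
 fix i assume i: "i : B"
 have "bij_betw g (B - {i}) (A - {g i})"
  using bij_betw_DiffI[OF assms, of "{i}" "{g i}"] i assms by (auto simp: bij_betw_def)
 from prod.reindex_bij_betw[OF this]
 show "(\<Prod>j\<in>A - {g i}. cmod (x (g i) - x j)) = (\<Prod>j\<in>B - {i}. cmod (x (g i) - x (g j)))" by (rule sym)
qed

text \<open>Ordered pairs take the place of squares over \<open>i < j\<close>; in this form
  permutation invariance is a mere reindexing.\<close>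

lemma vdm_eq_pairprod: "vdm n x = pairprod {..<n} x"
proof (induction n)
 case (Suc n)
 have "pairprod {..<Suc n} x = (\<Prod>i<n. \<Prod>j\<in>{..<Suc n} - {i}. cmod (x i - x j)) * (\<Prod>j\<in>{..<Suc n} - {n}. cmod (x n - x j))"
  by (simp add: pairprod_def)
 also have "{..<Suc n} - {n} = {..<n}" by auto
 also have "(\<Prod>i<n. \<Prod>j\<in>{..<Suc n} - {i}. cmod (x i - x j)) = (\<Prod>i<n. cmod (x i - x n) * (\<Prod>j\<in>{..<n} - {i}. cmod (x i - x j)))"
 proof (rule prod.cong[OF refl])
  fix i assume "i : {..<n}"
  hence "{..<Suc n} - {i} = insert n ({..<n} - {i})" by auto
  thus "(\<Prod>j\<in>{..<Suc n} - {i}. cmod (x i - x j)) = cmod (x i - x n) * (\<Prod>j\<in>{..<n} - {i}. cmod (x i - x j))" by simp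
 qed
 also have "... * (\<Prod>j<n. cmod (x n - x j)) = (\<Prod>i<n. (cmod (x i - x n))\<^sup>2) * pairprod {..<n} x"
  by (simp add: pairprod_def prod.distrib power2_eq_square norm_minus_commute mult_ac)
 finally show ?case using Suc.IH by (simp add: vdm_def mult.commute)
qed (simp add: vdm_def pairprod_def)

lemma ivl_Suc: "{1..n} = Suc ` {..<n}"
 by (auto simp: image_iff) (metis Suc_le_eq diff_Suc_1 lessThan_iff not0_implies_Suc not_one_le_zero)

lemma prod_Suc_ivl: "(\<Prod>j\<in>{1..n}. h j) = (\<Prod>j<n. h (Suc j) :: 'b::comm_monoid_mult)"
proof -
 show ?thesis unfolding ivl_Suc by (simp add: prod.reindex)
qed

lemma statement_vdm:
 "(\<Prod>j\<in>{1..n}. \<Prod>i\<in>{1..<j}. (cmod (x i - x j))\<^sup>2) = vdm n (%l. x (Suc l))"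
proof -
 have "{1..<Suc j} = {1..j}" for j by auto
 thus ?thesis unfolding prod_Suc_ivl vdm_def by (simp add: prod_Suc_ivl del: prod.lessThan_Suc)
qed

lemma sum_inj_reindex:
 assumes g: "bij_betw g B A" and A: "finite A"
 shows "(\<Sum>ph | ph\<in>I \<rightarrow>\<^sub>E A & inj_on ph I. f (\<lambda>i\<in>I. y (ph i))) =
  (\<Sum>ph | ph\<in>I \<rightarrow>\<^sub>E B & inj_on ph I. f (\<lambda>i\<in>I. y (g (ph i))))"
proof (rule sum.reindex_bij_witness[where i = "%ph. \<lambda>i\<in>I. g (ph i)" and j = "%ph. \<lambda>i\<in>I. inv_into B g (ph i)"])
 fix ph assume ph: "ph : {ph. ph : I \<rightarrow>\<^sub>E A & inj_on ph I}"
 hence v: "ph i : A" if "i : I" for i using that by auto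
 show "(\<lambda>i\<in>I. g ((\<lambda>i\<in>I. inv_into B g (ph i)) i)) = ph"
 proof
  fix i show "(\<lambda>i\<in>I. g ((\<lambda>i\<in>I. inv_into B g (ph i)) i)) i = ph i"
   using ph bij_betw_inv_into_right[OF g v[of i]] by (auto simp: PiE_iff extensional_def)
 qed
 have "inj_on (inv_into B g) A" using bij_betw_inv_into[OF g] by (simp add: bij_betw_def)
 hence "inj_on (%i. inv_into B g (ph i)) I" using ph v by (auto simp: inj_on_def)
 moreover have "inv_into B g (ph i) : B" if "i : I" for i
  using v[OF that] bij_betw_inv_into[OF g] by (auto simp: bij_betw_def)
 ultimately show "(\<lambda>i\<in>I. inv_into B g (ph i)) : {ph. ph : I \<rightarrow>\<^sub>E B & inj_on ph I}"
  by (auto simp: inj_on_def)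
 show "f (\<lambda>i\<in>I. y (g ((\<lambda>i\<in>I. inv_into B g (ph i)) i))) = f (\<lambda>i\<in>I. y (ph i))"
  by (intro arg_cong[where f = f] ext) (simp add: bij_betw_inv_into_right[OF g v])
next
 fix ph assume ph: "ph : {ph. ph : I \<rightarrow>\<^sub>E B & inj_on ph I}"
 hence v: "ph i : B" if "i : I" for i using that by auto
 show "(\<lambda>i\<in>I. inv_into B g ((\<lambda>i\<in>I. g (ph i)) i)) = ph"
 proof
  fix i show "(\<lambda>i\<in>I. inv_into B g ((\<lambda>i\<in>I. g (ph i)) i)) i = ph i"
   using ph bij_betw_inv_into_left[OF g v[of i]] by (auto simp: PiE_iff extensional_def)
 qed
 have "inj_on (%i. g (ph i)) I" using ph v g by (auto simp: inj_on_def bij_betw_def)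
 thus "(\<lambda>i\<in>I. g (ph i)) : {ph. ph : I \<rightarrow>\<^sub>E A & inj_on ph I}"
  using v g by (auto simp: inj_on_def bij_betw_def)
qed

text \<open>The complements of \<open>{..<r}\<close> and of the image of \<open>ph\<close> have the
  same cardinality, and any bijection between them completes \<open>ph\<close>.\<close>

lemma inj_extends_to_perm:
 fixes r n :: nat
 assumes ph: "ph : {..<r} \<rightarrow>\<^sub>E {..<n}" "inj_on ph {..<r}"
 obtains \<pi> where "bij_betw \<pi> {..<n} {..<n}" "!!i. i < r ==> \<pi> i = ph i"
proof -
 have "ph ` {..<r} \<subseteq> {..<n}" using ph(1) by auto
 from card_inj_on_le[OF ph(2) this] have rn: "r <= n" by simp
 have c: "card (ph ` {..<r}) = r" by (simp add: card_image[OF ph(2)])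
 have sub: "ph ` {..<r} \<subseteq> {..<n}" using ph(1) by auto
 have "card ({..<n} - {..<r}) = card ({..<n} - ph ` {..<r})"
  using rn c sub by (simp add: card_Diff_subset)
 then obtain h where h: "bij_betw h ({..<n} - {..<r}) ({..<n} - ph ` {..<r})"
  using finite_same_card_bij[of "{..<n} - {..<r}" "{..<n} - ph ` {..<r}"] by auto
 have b1: "bij_betw ph {..<r} (ph ` {..<r})" using ph(2) by (simp add: bij_betw_def)
 let ?\<pi> = "%i. if i : {..<r} then ph i else h i"
 have "bij_betw ?\<pi> ({..<r} \<union> ({..<n} - {..<r})) (ph ` {..<r} \<union> ({..<n} - ph ` {..<r}))"
  by (rule bij_betw_disjoint_Un[OF b1 h]) auto
 moreover have "{..<r} \<union> ({..<n} - {..<r}) = {..<n}" "ph ` {..<r} \<union> ({..<n} - ph ` {..<r}) = {..<n}"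
  using rn sub by auto
 ultimately have "bij_betw ?\<pi> {..<n} {..<n}" by simp
 thus ?thesis by (rule that) simp
qed

lemma nn_integral_PiM_permute:
 fixes f :: "(nat => complex) => ennreal"
 assumes \<pi>: "bij_betw \<pi> {..<n} {..<n}" and f: "f : \<B> (\<P> {..<n})"
 shows "(\<integral>\<^sup>+x. f x \<partial>\<P> {..<n}) = (\<integral>\<^sup>+x. f (\<lambda>i\<in>{..<n}. x (\<pi> i)) \<partial>\<P> {..<n})"
proof -
 let ?rh = "inv_into {..<n} \<pi>"
 have rh: "bij_betw ?rh {..<n} {..<n}" by (rule bij_betw_inv_into[OF \<pi>])
 have inj: "inj_on ?rh {..<n}" and im: "?rh ` {..<n} = {..<n}" using rh by (auto simp: bij_betw_def)
 have "inv_into {..<n} ?rh i = \<pi> i" if "i : {..<n}" for i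
 proof (rule inv_into_f_eq[OF inj])
  show "\<pi> i : {..<n}" using \<pi> that by (auto simp: bij_betw_def)
  show "?rh (\<pi> i) = i" by (rule bij_betw_inv_into_left[OF \<pi> that])
 qed
 hence e: "(\<lambda>i\<in>{..<n}. x (inv_into {..<n} ?rh i)) = (\<lambda>i\<in>{..<n}. x (\<pi> i))" for x :: "nat => complex"
  by (intro restrict_ext) simp
 show ?thesis using nn_integral_PiM_reindex[OF sigma_finite_lborel _ inj, unfolded im, OF _ f] unfolding e by simp
qed

text \<open>In the Leibniz sum a permutation meets every row and every column once, so each scale
  comes out squared. This takes the square roots of the weight out of the kernel
  determinant.\<close>

lemma det_scale_both:
 fixes a :: "nat => complex"
 shows "det (mat r r (%(i, j). a i * a j * M i j)) = (\<Prod>i<r. (a i)\<^sup>2) * det (mat r r (%(i, j). M i j))"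
proof -
 have e: "(\<Prod>i = 0..<r. mat r r (%(i, j). a i * a j * M i j) $$ (i, p i)) =
   (\<Prod>i<r. (a i)\<^sup>2) * (\<Prod>i = 0..<r. mat r r (%(i, j). M i j) $$ (i, p i))" if p: "p permutes {0..<r}" for p
 proof -
  have "(\<Prod>i = 0..<r. mat r r (%(i, j). a i * a j * M i j) $$ (i, p i)) = (\<Prod>i = 0..<r. a i * a (p i) * mat r r (%(i, j). M i j) $$ (i, p i))"
   by (rule prod.cong[OF refl]) (use permutes_in_image[OF p] in auto)
  also have "... = (\<Prod>i = 0..<r. a i) * (\<Prod>i = 0..<r. a (p i)) * (\<Prod>i = 0..<r. mat r r (%(i, j). M i j) $$ (i, p i))"
   by (simp add: prod.distrib)
  also have "(\<Prod>i = 0..<r. a (p i)) = (\<Prod>i = 0..<r. a i)" by (rule prod.permute[OF p, unfolded comp_def, symmetric])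
  also have "(\<Prod>i = 0..<r. a i) * (\<Prod>i = 0..<r. a i) = (\<Prod>i<r. (a i)\<^sup>2)"
   by (simp add: prod.distrib[symmetric] power2_eq_square atLeast0LessThan)
  finally show ?thesis .
 qed
 show ?thesis
  unfolding det_def'[OF mat_carrier]
 proof (unfold sum_distrib_left, rule sum.cong[OF refl])
  fix p assume "p : {p. p permutes {0..<r}}"
  hence p: "p permutes {0..<r}" by simp
  show "signof p * (\<Prod>i = 0..<r. mat r r (%(i, j). a i * a j * M i j) $$ (i, p i)) =
   (\<Prod>i<r. (a i)\<^sup>2) * (signof p * (\<Prod>i = 0..<r. mat r r (%(i, j). M i j) $$ (i, p i)))"
   unfolding e[OF p] by (rule mult.left_commute)
 qed
qed

text \<open>On the product space the coordinates outside \<open>I\<close> are constantly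
  \<open>undefined\<close>, so the inclusion into all functions with their Borel sets is measurable
  coordinate by coordinate.\<close>

lemma measurable_of_continuous_PiE:
 fixes f :: "(nat => complex) => complex"
 assumes f: "continuous_on (I \<rightarrow>\<^sub>E UNIV) f"
 shows "f : \<B> (\<P> I)"
proof -
 have "(%x. x) : \<B> (PiM I (%_. \<L>))"
 proof (rule measurable_coordinatewise_then_product)
  fix i
  show "(%x. x i) : \<B> (PiM I (%_. \<L>))"
  proof (cases "i : I")
   case True
   thus ?thesis using measurable_component_singleton[OF True, of "%_. \<L>"] by simp
  next
   case False
   have "(%x. undefined) : \<B> (PiM I (%_. \<L>))" by simp
   thus ?thesis
    by (rule measurable_cong[THEN iffD1, rotated]) (use False in \<open>auto simp: space_PiM PiE_iff extensional_def\<close>)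
  qed
 qed
 hence "(%x. x) : measurable (\<P> I) (restrict_space borel (I \<rightarrow>\<^sub>E UNIV :: (nat => complex) set))"
  by (intro measurable_restrict_space2) (auto simp: space_PiM)
 from measurable_compose[OF this borel_measurable_continuous_on_restrict[OF f]] show ?thesis .
qed

lemma prod_lessThan_add: "prod f {..<a + b :: nat} = prod f {..<a} * (\<Prod>j<b. f (a + j) :: 'b::comm_monoid_mult)"
 by (induction b) (simp_all add: mult.assoc)

section \<open>Random roots and their correlation functions\<close>

lemma proots_permute:
 assumes y: "image_mset y (mset_set {1..n}) = proots q" and q: "monicn n q"
 obtains sg where "sg permutes {1..n}" "!!i. i : {1..n} ==> y i = rts n q (sg i - 1)"
proof -
 have "image_mset y (mset_set {1..n}) = image_mset (rts n q) (mset_set {..<n})"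
  using y proots_rootpoly[of n "rts n q"] rootpoly_rts[OF q] by simp
 also have "... = image_mset (%i. rts n q (i - 1)) (mset_set {1..n})"
  unfolding ivl_Suc by (subst image_mset_mset_set[symmetric]) (auto simp: image_mset.compositionality comp_def)
 finally obtain sg where "sg permutes {1..n}" "\<forall>i\<in>{1..n}. y i = rts n q (sg i - 1)"
  by (rule image_mset_eq_implies_permutes[OF finite_atLeastAtMost])
 thus ?thesis by (intro that[of sg]) simp_all
qed

text \<open>What remains of the matrix model is the law of the characteristic polynomial
  \<open>cp\<close> up to a constant \<open>c0\<close>. The enumeration \<open>z\<close> is tied to
  \<open>cp\<close> through the multiset of roots alone.\<close>

locale root_law = prob_space M + radial_weight \<omega> n
 for M :: "'a measure" and \<omega> n +
 fixes cp :: "'a => complex poly" and z :: "'a => nat => complex" and c0 :: ennreal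
 assumes measurable_cp: "cp : measurable M polyM" and monic_cp: "!!s. s : space M ==> monicn n (cp s)"
  and roots: "!!s. s : space M ==> image_mset (z s) (mset_set {1..n}) = proots (cp s)"
  and c0: "0 < c0" "c0 < \<infinity>"
  and law: "!!F. F : \<B> polyM ==> (\<integral>\<^sup>+s. F (cp s) \<partial>M) =
   c0 * (\<integral>\<^sup>+x. (\<Prod>l<n. ennreal (\<omega> (x l))) * ennreal (vdm n x) * F (rootpoly n x) \<partial>\<P> {..<n})"
begin

lemma measurable_comp_lborel: "i : I ==> (%x. x i) : \<B> (PiM I (%_. \<L>))"
 using measurable_component_singleton[of i I "%_. \<L>"] by simp

lemma sets_PiM_lborel: "sets (PiM I (%_. borel :: complex measure)) = sets (PiM I (%_. \<L>))"
 by (rule sets_PiM_cong) auto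

lemma law_roots:
 assumes G: "G : \<B> (\<P> {..<n})"
 shows "(\<integral>\<^sup>+s. G (\<lambda>l\<in>{..<n}. rts n (cp s) l) \<partial>M) =
  c0 * (\<integral>\<^sup>+x. (Wt n x) * ennreal (vdm n x) * G (\<lambda>l\<in>{..<n}. rts n (rootpoly n x) l) \<partial>\<P> {..<n})"
proof -
 have G': "G : \<B> (PiM {..<n} (%_. borel))"
  using G measurable_cong_sets[OF sets_PiM_lborel refl, of "{..<n}" borel] by blast
 have "(\<integral>\<^sup>+s. G (\<lambda>l\<in>{..<n}. rts n (cp s) l) \<partial>M) = (\<integral>\<^sup>+s. (if monicn n (cp s) then G (\<lambda>l\<in>{..<n}. rts n (cp s) l) else 0) \<partial>M)"
  by (rule nn_integral_cong) (simp add: monic_cp)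
 thus ?thesis unfolding law[OF measurable_rts_comp[OF G']] by (simp add: monicn_rootpoly)
qed

lemma measurable_roots:
 "(%s. \<lambda>l\<in>{..<n}. rts n (cp s) l) : measurable M (\<P> {..<n})"
proof (rule measurable_restrict)
 fix l assume "l : {..<n}"
 thus "(%s. rts n (cp s) l) : measurable M lborel"
  using measurable_rts[OF measurable_cp monic_cp, of l] by simp
qed

lemma rootpoly_permute:
 obtains sg where "sg permutes {..<n}" "!!i. i < n ==> x i = rts n (rootpoly n x) (sg i)"
proof -
 have "image_mset x (mset_set {..<n}) = image_mset (rts n (rootpoly n x)) (mset_set {..<n})"
  using proots_rootpoly[of n x] proots_rootpoly[of n "rts n (rootpoly n x)"] rootpoly_rts[OF monicn_rootpoly[of n x]] by simp
 then obtain sg where "sg permutes {..<n}" "\<forall>i\<in>{..<n}. x i = rts n (rootpoly n x) (sg i)"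
  by (rule image_mset_eq_implies_permutes[OF finite_lessThan])
 thus ?thesis by (intro that[of sg]) simp_all
qed

text \<open>The constant that belongs to \<open>D n\<close> in place of the Vandermonde factor; the
  two differ by the product of the \<open>hm j\<close>.\<close>

definition c1 :: ennreal where
 "c1 = c0 * ennreal (\<Prod>j<n. hm j)"

lemma vdm_eq_D: "c0 * (a * ennreal (vdm n x) * b) = c1 * (a * ennreal (Re (D n x)) * b)"
proof -
 have H: "0 < (\<Prod>j<n. hm j)" using hm_pos by (simp add: prod_pos)
 have "vdm n x = (\<Prod>j<n. hm j) * Re (D n x)" unfolding D_top Re_complex_of_real times_divide_eq_right
  by (rule nonzero_mult_div_cancel_left[symmetric]) (use H in linarith)
 moreover have "0 <= Re (D n x)" using D_real_nonneg[OF order_refl] by blast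
 ultimately have "ennreal (vdm n x) = ennreal (\<Prod>j<n. hm j) * ennreal (Re (D n x))" using H by (simp add: ennreal_mult)
 thus ?thesis by (simp add: c1_def mult_ac)
qed

lemma measurable_weight_prod:
 assumes "J \<subseteq> I"
 shows "(%x. \<Prod>l\<in>J. ennreal (\<omega> (x l))) : \<B> (\<P> I)"
proof -
 have "(%z. ennreal (\<omega> z)) : \<B> borel" using measurable_weight by measurable
 thus ?thesis
  using assms by (intro borel_measurable_prod_ennreal measurable_compose[OF measurable_comp_lborel[OF subsetD]])
qed

lemma measurable_ReD: "(%x. ennreal (Re (D r x))) : \<B> (\<P> {..<r})"
 using measurable_D[of r "%x. x" "\<P> {..<r}"] measurable_comp_lborel[of _ "{..<r}"] by measurable

lemma law_D:
 assumes G: "G : \<B> (\<P> {..<n})"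
 shows "c0 * (\<integral>\<^sup>+x. (Wt n x) * ennreal (vdm n x) * G x \<partial>\<P> {..<n}) =
  c1 * (\<integral>\<^sup>+x. (Wt n x) * ennreal (Re (D n x)) * G x \<partial>\<P> {..<n})"
proof -
 have mv: "(%x. ennreal (vdm n x)) : \<B> (\<P> {..<n})"
  using measurable_vdm[of n "%x. x" "\<P> {..<n}"] measurable_comp_lborel[of _ "{..<n}"] by measurable
 have "c0 * (\<integral>\<^sup>+x. (Wt n x) * ennreal (vdm n x) * G x \<partial>\<P> {..<n}) =
  (\<integral>\<^sup>+x. c0 * ((Wt n x) * ennreal (vdm n x) * G x) \<partial>\<P> {..<n})"
  by (rule nn_integral_cmult[symmetric]) (intro measurable_times_ennreal measurable_weight_prod order_refl mv G)
 also have "... = c1 * (\<integral>\<^sup>+x. (Wt n x) * ennreal (Re (D n x)) * G x \<partial>\<P> {..<n})"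
  unfolding vdm_eq_D by (rule nn_integral_cmult) (intro measurable_times_ennreal measurable_weight_prod order_refl measurable_ReD G)
 finally show ?thesis .
qed

text \<open>Integrating all \<open>n\<close> points out of \<open>D n\<close> gives
  \<open>n!\<close>, and the total probability is 1.\<close>

lemma c1_normalization: "c1 * (\<Prod>j<n. of_nat (n - j)) = 1"
proof -
 have "1 = (\<integral>\<^sup>+s. 1 \<partial>M)" using emeasure_space_1 by simp
 also have "... = c0 * (\<integral>\<^sup>+x. (Wt n x) * ennreal (vdm n x) * 1 \<partial>\<P> {..<n})"
  using law[of "%_. 1"] by simp
 also have "... = c1 * (\<integral>\<^sup>+x. (Wt n x) * ennreal (Re (D n x)) * 1 \<partial>\<P> {..<n})"
  by (rule law_D) simp
 also have "(\<integral>\<^sup>+x. (Wt n x) * ennreal (Re (D n x)) * 1 \<partial>\<P> {..<n}) = (\<Prod>j<n. of_nat (n - j))"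
  using nn_integral_marginal[of "%_. 1" 0 n n] by (simp add: PiM_empty nn_integral_count_space_finite D_def Dmat_def)
 finally show ?thesis by simp
qed

text \<open>The statistic that defines correlation functions, with indices from 0.\<close>

definition inj_sum :: "nat => ((nat => complex) => ennreal) => (nat => complex) => ennreal" where
 "inj_sum r f x = (\<Sum>ph | ph\<in>{..<r} \<rightarrow>\<^sub>E {..<n} & inj_on ph {..<r}. f (\<lambda>i\<in>{..<r}. x (ph i)))"

lemma inj_sum_cong: "(!!i. i < n ==> x i = y i) ==> inj_sum r f x = inj_sum r f y"
 unfolding inj_sum_def by (intro sum.cong refl arg_cong[where f = f] restrict_ext) auto

lemma inj_sum_permute: "sg permutes {..<n} ==> inj_sum r f (%i. x (sg i)) = inj_sum r f x"
 unfolding inj_sum_def by (rule sum_inj_reindex[OF permutes_imp_bij, symmetric]) auto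

lemma measurable_pick:
 assumes f: "f : \<B> (\<P> {..<r})" and ph: "ph : {..<r} \<rightarrow>\<^sub>E {..<n}"
 shows "(%x. f (\<lambda>i\<in>{..<r}. x (ph i))) : \<B> (\<P> {..<n})"
 by (rule measurable_compose[OF measurable_restrict f], rule measurable_component_singleton) (use ph in auto)

lemma measurable_inj_sum:
 "f : \<B> (\<P> {..<r}) ==> inj_sum r f : \<B> (\<P> {..<n})"
 unfolding inj_sum_def[abs_def] by (intro borel_measurable_sum measurable_pick) auto

text \<open>The given eigenvalues and the enumerated roots differ by a permutation depending on
  \<open>s\<close>, and the sum over injections does not notice it. Measurability is thereby
  inherited from the enumeration.\<close>

lemma statement_sum:
 assumes s: "s : space M"
 shows "(\<Sum>ph | ph\<in>{..<r} \<rightarrow>\<^sub>E {1..n} & inj_on ph {..<r}. f (\<lambda>i\<in>{..<r}. z s (ph i))) = inj_sum r f (\<lambda>l\<in>{..<n}. rts n (cp s) l)"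
proof -
 obtain sg where sg: "sg permutes {1..n}" "!!i. i : {1..n} ==> z s i = rts n (cp s) (sg i - 1)"
  using proots_permute[OF roots[OF s] monic_cp[OF s]] by metis
 note I = ivl_Suc[of n]
 have b: "bij_betw Suc {..<n} {1..n}" unfolding I by (simp add: bij_betw_def)
 have b2: "bij_betw sg {1..n} {1..n}" by (rule permutes_imp_bij[OF sg(1)])
 let ?y = "%i. rts n (cp s) (i - 1)"
 have "(\<Sum>ph | ph\<in>{..<r} \<rightarrow>\<^sub>E {1..n} & inj_on ph {..<r}. f (\<lambda>i\<in>{..<r}. z s (ph i))) =
  (\<Sum>ph | ph\<in>{..<r} \<rightarrow>\<^sub>E {1..n} & inj_on ph {..<r}. f (\<lambda>i\<in>{..<r}. ?y (sg (ph i))))"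
 proof (rule sum.cong[OF refl])
  fix ph assume ph: "ph : {ph. ph : {..<r} \<rightarrow>\<^sub>E {1..n} & inj_on ph {..<r}}"
  have "(\<lambda>i\<in>{..<r}. z s (ph i)) = (\<lambda>i\<in>{..<r}. ?y (sg (ph i)))"
  proof (rule restrict_ext)
   fix i assume "i : {..<r}"
   hence "ph i : {1..n}" using ph by (simp add: PiE_iff)
   thus "z s (ph i) = ?y (sg (ph i))" by (rule sg(2))
  qed
  thus "f (\<lambda>i\<in>{..<r}. z s (ph i)) = f (\<lambda>i\<in>{..<r}. ?y (sg (ph i)))" by (rule arg_cong)
 qed
 also have "... = (\<Sum>ph | ph\<in>{..<r} \<rightarrow>\<^sub>E {1..n} & inj_on ph {..<r}. f (\<lambda>i\<in>{..<r}. ?y (ph i)))"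
  by (rule sum_inj_reindex[OF b2, symmetric]) simp
 also have "... = (\<Sum>ph | ph\<in>{..<r} \<rightarrow>\<^sub>E {..<n} & inj_on ph {..<r}. f (\<lambda>i\<in>{..<r}. ?y (Suc (ph i))))"
  by (rule sum_inj_reindex[OF b]) simp
 also have "... = inj_sum r f (rts n (cp s))" unfolding inj_sum_def by simp
 also have "... = inj_sum r f (\<lambda>l\<in>{..<n}. rts n (cp s) l)" by (rule inj_sum_cong) simp
 finally show ?thesis .
qed

lemma inj_sum_rts: "inj_sum r f (\<lambda>l\<in>{..<n}. rts n (rootpoly n x) l) = inj_sum r f x"
proof -
 obtain sg where sg: "sg permutes {..<n}" "!!i. i < n ==> x i = rts n (rootpoly n x) (sg i)" using rootpoly_permute by metis
 have "inj_sum r f x = inj_sum r f (%i. rts n (rootpoly n x) (sg i))" by (rule inj_sum_cong) (rule sg(2))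
 also have "... = inj_sum r f (rts n (rootpoly n x))" by (rule inj_sum_permute[OF sg(1)])
 also have "... = inj_sum r f (\<lambda>l\<in>{..<n}. rts n (rootpoly n x) l)" by (rule inj_sum_cong) simp
 finally show ?thesis by simp
qed

text \<open>Seen through the Vandermonde form of \<open>D n\<close>, where the invariance is
  apparent.\<close>

lemma D_permute:
 assumes "bij_betw \<pi> {..<n} {..<n}"
 shows "D n (\<lambda>i\<in>{..<n}. x (\<pi> i)) = D n x"
proof -
 have "vdm n (\<lambda>i\<in>{..<n}. x (\<pi> i)) = vdm n (%i. x (\<pi> i))"
  unfolding vdm_def
 proof (intro prod.cong refl)
  fix j i assume "j : {..<n}" "i : {..<j}"
  hence "i < n" "j < n" by auto
  thus "(cmod ((\<lambda>i\<in>{..<n}. x (\<pi> i)) i - (\<lambda>i\<in>{..<n}. x (\<pi> i)) j))\<^sup>2 = (cmod (x (\<pi> i) - x (\<pi> j)))\<^sup>2" by simp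
 qed
 also have "... = vdm n x" unfolding vdm_eq_pairprod by (rule pairprod_reindex[OF assms, symmetric])
 finally show ?thesis by (simp add: D_top)
qed

text \<open>An injection extends to a permutation, so all \<open>n! / (n - r)!\<close> terms have
  the integral of the term for the first \<open>r\<close> points. Marginalisation gives
  \<open>(n - r)!\<close>, and the resulting \<open>n!\<close> cancels against \<open>c1\<close>.
  For \<open>r > n\<close> there are no injections and \<open>D r\<close> vanishes.\<close>

lemma nn_integral_inj_sum:
 assumes f: "f : \<B> (\<P> {..<r})"
 shows "(\<integral>\<^sup>+s. inj_sum r f (\<lambda>l\<in>{..<n}. rts n (cp s) l) \<partial>M) =
  (\<integral>\<^sup>+x. (Wt r x) * ennreal (Re (D r x)) * f x \<partial>\<P> {..<r})"
proof -
 let ?I = "{ph. ph : {..<r} \<rightarrow>\<^sub>E {..<n} & inj_on ph {..<r}}"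
 let ?w = "%x. (Wt n x) * ennreal (Re (D n x))"
 let ?T = "\<integral>\<^sup>+x. ?w x * f (restrict x {..<r}) \<partial>\<P> {..<n}"
 have mw: "?w : \<B> (\<P> {..<n})"
  by (intro measurable_times_ennreal measurable_weight_prod order_refl measurable_ReD)
 have perm: "(\<integral>\<^sup>+x. ?w x * f (\<lambda>i\<in>{..<r}. x (ph i)) \<partial>\<P> {..<n}) = ?T" if ph: "ph : ?I" for ph
 proof -
  have ph1: "ph : {..<r} \<rightarrow>\<^sub>E {..<n}" "inj_on ph {..<r}" using ph by auto
  have rn: "r <= n" using card_inj_on_le[OF ph1(2), of "{..<n}"] ph1(1) by fastforce
  obtain \<pi> where \<pi>: "bij_betw \<pi> {..<n} {..<n}" "!!i. i < r ==> \<pi> i = ph i" using inj_extends_to_perm[OF ph1] by metis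
  have mg: "(%x. ?w x * f (restrict x {..<r})) : \<B> (\<P> {..<n})"
   by (intro measurable_times_ennreal mw measurable_compose[OF measurable_restrict_subset f]) (use rn in auto)
  have "?T = (\<integral>\<^sup>+x. ?w (\<lambda>i\<in>{..<n}. x (\<pi> i)) * f (restrict (\<lambda>i\<in>{..<n}. x (\<pi> i)) {..<r}) \<partial>\<P> {..<n})"
   by (rule nn_integral_PiM_permute[OF \<pi>(1) mg])
  also have "... = (\<integral>\<^sup>+x. ?w x * f (\<lambda>i\<in>{..<r}. x (ph i)) \<partial>\<P> {..<n})"
  proof (rule nn_integral_cong)
   fix x :: "nat => complex"
   have "(\<Prod>l<n. ennreal (\<omega> ((\<lambda>i\<in>{..<n}. x (\<pi> i)) l))) = (\<Prod>l<n. ennreal (\<omega> (x (\<pi> l))))" by (rule prod.cong) auto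
   also have "... = (Wt n x)" by (rule prod.reindex_bij_betw[OF \<pi>(1)])
   finally have e: "(\<Prod>l<n. ennreal (\<omega> ((\<lambda>i\<in>{..<n}. x (\<pi> i)) l))) = (Wt n x)" .
   have e2: "restrict (\<lambda>i\<in>{..<n}. x (\<pi> i)) {..<r} = (\<lambda>i\<in>{..<r}. x (ph i))"
    by (rule ext) (use rn \<pi>(2) in auto)
   show "?w (\<lambda>i\<in>{..<n}. x (\<pi> i)) * f (restrict (\<lambda>i\<in>{..<n}. x (\<pi> i)) {..<r}) = ?w x * f (\<lambda>i\<in>{..<r}. x (ph i))"
    unfolding e e2 D_permute[OF \<pi>(1)] ..
  qed
  finally show ?thesis by simp
 qed
 have fin: "finite ?I" by (rule finite_subset[of _ "{..<r} \<rightarrow>\<^sub>E {..<n}"]) (auto intro: finite_PiE)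
 have "(\<integral>\<^sup>+s. inj_sum r f (\<lambda>l\<in>{..<n}. rts n (cp s) l) \<partial>M) =
  c1 * (\<integral>\<^sup>+x. ?w x * inj_sum r f x \<partial>\<P> {..<n})"
  unfolding law_roots[OF measurable_inj_sum[OF f]] inj_sum_rts by (rule law_D[OF measurable_inj_sum[OF f]])
 also have "(\<integral>\<^sup>+x. ?w x * inj_sum r f x \<partial>\<P> {..<n}) =
   (\<Sum>ph\<in>?I. \<integral>\<^sup>+x. ?w x * f (\<lambda>i\<in>{..<r}. x (ph i)) \<partial>\<P> {..<n})"
  unfolding inj_sum_def sum_distrib_left
  by (rule nn_integral_sum) (intro measurable_times_ennreal mw measurable_pick[OF f], simp)
 also have "... = of_nat (card ?I) * ?T" by (simp add: perm del: mem_Collect_eq)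
 finally have e: "(\<integral>\<^sup>+s. inj_sum r f (\<lambda>l\<in>{..<n}. rts n (cp s) l) \<partial>M) = c1 * (of_nat (card ?I) * ?T)" .
 have card: "card ?I = (\<Prod>j<r. n - j)"
  using card_inj_on_subset_funcset[of "{..<r}" "{..<n}" "{..<r}"] by (simp add: atLeast0LessThan)
 show ?thesis
 proof (cases "r <= n")
  case True
  then obtain d where d: "n = r + d" using le_Suc_ex by blast
  have "?T = (\<Prod>j<d. of_nat (n - (r + j))) * (\<integral>\<^sup>+x. (Wt r x) * ennreal (Re (D r x)) * f x \<partial>\<P> {..<r})"
   by (rule nn_integral_marginal[OF f d order_refl])
  moreover have "(\<Prod>j<r. of_nat (n - j)) * (\<Prod>j<d. of_nat (n - (r + j))) = (\<Prod>j<n. of_nat (n - j) :: ennreal)"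
   using prod_lessThan_add[of "%j. of_nat (n - j) :: ennreal" r d] d by simp
  ultimately have "c1 * (of_nat (card ?I) * ?T) = c1 * (\<Prod>j<n. of_nat (n - j)) *
    (\<integral>\<^sup>+x. (Wt r x) * ennreal (Re (D r x)) * f x \<partial>\<P> {..<r})"
   unfolding card of_nat_prod by (metis (no_types, lifting) mult.assoc)
  thus ?thesis unfolding e c1_normalization by simp
 next
  case False
  hence "card ?I = 0" unfolding card by (intro prod_zero) (auto intro: bexI[of _ n])
  thus ?thesis unfolding e using False by (simp add: D_above)
 qed
qed

text \<open>The weight is divided symmetrically between both arguments, so that the determinant is
  \<open>D r\<close> times the product of the weights.\<close>

definition kern :: "complex => complex => complex" where
 "kern x y = of_real (sqrt (\<omega> x)) * of_real (sqrt (\<omega> y)) * S x y"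

lemma determinantal: "determinantal_process M n z"
 unfolding determinantal_process_def
proof (intro exI[of _ kern] conjI allI)
 have w: "(%p. complex_of_real (sqrt (\<omega> (g p)))) : \<B> N"
  if "g : \<B> N" for N :: "(complex \<times> complex) measure" and g
  using measurable_compose[OF that measurable_weight] by measurable
 show "case_prod kern : \<B> (borel \<Otimes> borel)"
  unfolding kern_def case_prod_beta' by (intro borel_measurable_times w measurable_S measurable_fst measurable_snd)
 fix r
 let ?rh = "%x. (\<Prod>l<r. \<omega> (x l)) * Re (D r x)"
 have ReD: "D r x = of_real (Re (D r x)) & 0 <= Re (D r x)" for x
 proof (cases "r <= n")
  case True
  thus ?thesis by (rule D_real_nonneg)
 next
  case False
  thus ?thesis by (simp add: D_above)
 qed
 have nn: "0 <= ?rh x" for x using ReD weight_nonneg by (simp add: prod_nonneg)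
 have erh: "ennreal (?rh x) = (Wt r x) * ennreal (Re (D r x))" for x
  using ReD weight_nonneg by (simp add: ennreal_mult prod_nonneg prod_ennreal)
 have "correlation_function M n z r ?rh"
  unfolding correlation_function_def Let_def
 proof (intro conjI allI impI nn)
  have "(%x. \<omega> (x l)) : \<B> (\<P> {..<r})" if "l : {..<r}" for l
   by (rule measurable_compose[OF measurable_comp_lborel[OF that] measurable_weight])
  moreover have "(%x. D r x) : \<B> (\<P> {..<r})"
   by (rule measurable_D) (simp add: measurable_comp_lborel)
  ultimately show "?rh : \<B> (\<P> {..<r})"
   by (intro borel_measurable_times borel_measurable_prod) auto
  fix f :: "(nat => complex) => ennreal" assume f: "f : \<B> (\<P> {..<r})"
  let ?S = "%s. \<Sum>ph | ph\<in>{..<r} \<rightarrow>\<^sub>E {1..n} & inj_on ph {..<r}. f (\<lambda>i\<in>{..<r}. z s (ph i))"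
  have "(%s. inj_sum r f (\<lambda>l\<in>{..<n}. rts n (cp s) l)) : \<B> M"
   by (rule measurable_compose[OF measurable_roots measurable_inj_sum[OF f]])
  thus "?S : \<B> M"
   by (rule measurable_cong[THEN iffD1, rotated]) (rule statement_sum[symmetric])
  have "(\<integral>\<^sup>+s. ?S s \<partial>M) = (\<integral>\<^sup>+s. inj_sum r f (\<lambda>l\<in>{..<n}. rts n (cp s) l) \<partial>M)"
   by (rule nn_integral_cong) (rule statement_sum)
  also have "... = (\<integral>\<^sup>+x. f x * ennreal (?rh x) \<partial>\<P> {..<r})"
   unfolding nn_integral_inj_sum[OF f] erh by (simp only: mult_ac)
  finally show "(\<integral>\<^sup>+s. ?S s \<partial>M) = (\<integral>\<^sup>+x. f x * ennreal (?rh x) \<partial>\<P> {..<r})" .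
 qed
 moreover have "complex_of_real (?rh x) = det (mat r r (%(i, j). kern (x i) (x j)))" for x
 proof -
  have "det (mat r r (%(i, j). kern (x i) (x j))) = (\<Prod>i<r. (complex_of_real (sqrt (\<omega> (x i))))\<^sup>2) * D r x"
   unfolding kern_def D_def Dmat_def by (rule det_scale_both)
  also have "(\<Prod>i<r. (complex_of_real (sqrt (\<omega> (x i))))\<^sup>2) = of_real (\<Prod>i<r. \<omega> (x i))"
   unfolding of_real_prod of_real_power[symmetric] using weight_nonneg by simp
  also have "D r x = of_real (Re (D r x))" using ReD by blast
  finally show ?thesis by simp
 qed
 ultimately show "\<exists>rh. correlation_function M n z r rh &
      (AE x in \<P> {..<r}. complex_of_real (rh x) = det (mat r r (%(i, j). kern (x i) (x j))))"
  by (intro exI[of _ ?rh]) simp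
qed

end

lemma symmetric_fun_roots:
 assumes f: "symmetric_fun n f" and y: "image_mset y (mset_set {1..n}) = proots q" and q: "monicn n q"
 shows "f (restrict y {1..n}) = f (\<lambda>i\<in>{1..n}. rts n q (i - 1))"
proof -
 obtain sg where sg: "sg permutes {1..n}" "!!i. i : {1..n} ==> y i = rts n q (sg i - 1)"
  using proots_permute[OF y q] by metis
 let ?X = "\<lambda>i\<in>{1..n}. rts n q (i - 1)"
 have "restrict y {1..n} = ?X \<circ> sg"
 proof
  fix i
  show "restrict y {1..n} i = (?X \<circ> sg) i"
  proof (cases "i : {1..n}")
   case True
   hence "sg i : {1..n}" using permutes_in_image[OF sg(1)] by blast
   thus ?thesis using True sg(2) by simp
  next
   \<comment> \<open>Outside the index range the permutation is the identity and both functions are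
     \<open>undefined\<close>.\<close>
   case False
   hence "sg i = i" using permutes_not_in[OF sg(1)] by blast
   thus ?thesis using False by (simp only: comp_def restrict_def if_False)
  qed
 qed
 moreover have "?X : {1..n} \<rightarrow>\<^sub>E UNIV" by simp
 ultimately show ?thesis using f sg(1) unfolding symmetric_fun_def by metis
qed

section \<open>The symmetric joint density\<close>

context root_law
begin

text \<open>The constant is \<open>c0\<close> itself, which is finite and therefore faithfully
  represented by \<open>enn2real\<close>.\<close>

definition pdens :: "(nat => complex) => real" where
 "pdens x = enn2real c0 * ((\<Prod>l\<in>{1..n}. \<omega> (x l)) * (\<Prod>j\<in>{1..n}. \<Prod>i\<in>{1..<j}. (cmod (x i - x j))\<^sup>2))"

lemma pdens_nonneg: "0 <= pdens x"
 using weight_nonneg unfolding pdens_def by (intro mult_nonneg_nonneg prod_nonneg) auto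

lemma pdens_eq: "pdens x = enn2real c0 * ((\<Prod>l<n. \<omega> (x (Suc l))) * vdm n (%l. x (Suc l)))"
 unfolding pdens_def statement_vdm prod_Suc_ivl ..

lemma ennreal_pdens: "ennreal (pdens x) = c0 * ((\<Prod>l<n. ennreal (\<omega> (x (Suc l)))) * ennreal (vdm n (%l. x (Suc l))))"
proof -
 have "ennreal (enn2real c0) = c0" using c0 by simp
 moreover have "0 <= (\<Prod>l<n. \<omega> (x (Suc l)))" using weight_nonneg by (simp add: prod_nonneg)
 ultimately show ?thesis unfolding pdens_eq
  using vdm_nonneg[of n "%l. x (Suc l)"] weight_nonneg by (simp add: ennreal_mult prod_ennreal)
qed

lemma measurable_pdens: "pdens : \<B> (\<P> {1..n})"
proof -
 have c: "(%x. x (Suc l)) : \<B> (PiM {1..n} (%_. \<L>))" if "l < n" for l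
  by (rule measurable_comp_lborel) (use that in auto)
 have v: "(%x. vdm n (%l. x (Suc l))) : \<B> (\<P> {1..n})"
  by (rule measurable_vdm) (rule c)
 have w: "(%x. \<omega> (x (Suc l))) : \<B> (\<P> {1..n})" if "l : {..<n}" for l
  by (rule measurable_compose[OF c measurable_weight]) (use that in simp)
 show ?thesis unfolding pdens_eq[abs_def]
  by (intro borel_measurable_times borel_measurable_const borel_measurable_prod v w)
qed

lemma pdens_symmetric: "symmetric_fun n pdens"
 unfolding symmetric_fun_def
proof (intro allI impI ballI)
 fix sg and x :: "nat => complex" assume sg: "sg permutes {1..n}"
 have b: "bij_betw Suc {..<n} {1..n}" unfolding ivl_Suc by (simp add: bij_betw_def)
 have v: "vdm n (%l. x (Suc l)) = pairprod {1..n} x" for x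
  unfolding vdm_eq_pairprod by (rule pairprod_reindex[OF b, symmetric])
 have "pairprod {1..n} (x \<circ> sg) = pairprod {1..n} x"
  using pairprod_reindex[OF permutes_imp_bij[OF sg], of x] by (simp add: comp_def)
 moreover have "(\<Prod>l\<in>{1..n}. \<omega> ((x \<circ> sg) l)) = (\<Prod>l\<in>{1..n}. \<omega> (x l))"
  unfolding comp_def by (rule prod.reindex_bij_betw[OF permutes_imp_bij[OF sg]])
 ultimately show "pdens (x \<circ> sg) = pdens x" unfolding pdens_def statement_vdm v by simp
qed

text \<open>Arranges a vector in the order chosen by \<open>rts\<close>. The law is known for
  functions of the polynomial, so eigenvalues and density are compared after both have been put into
  this order.\<close>

definition rsort :: "(nat => complex) => nat => complex" where
 "rsort x = (\<lambda>i\<in>{1..n}. rts n (rootpoly n (%l. x (Suc l))) (i - 1))"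

lemma measurable_rsort: "rsort : measurable (\<P> {1..n}) (\<P> {1..n})"
 unfolding rsort_def
proof (rule measurable_restrict)
 fix i assume "i : {1..n}"
 hence i: "i - 1 < n" by auto
 have "(%x. rootpoly n (%l. x (Suc l))) : measurable (\<P> {1..n}) polyM"
  by (rule measurable_rootpoly, rule measurable_comp_lborel) auto
 from measurable_rts[OF this monicn_rootpoly i]
 show "(%x. rts n (rootpoly n (%l. x (Suc l))) (i - 1)) : measurable (\<P> {1..n}) lborel" by simp
qed

lemma measurable_shift:
 "(%y. \<lambda>i\<in>{1..n}. y (i - 1)) : measurable (\<P> {..<n}) (PiM {1..n} (%_. \<L>))"
proof (rule measurable_restrict)
 fix i assume "i : {1..n}"
 thus "(%y. y (i - 1)) : measurable (\<P> {..<n}) \<L>"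
  by (intro measurable_component_singleton) auto
qed

lemma law_pdens:
 assumes g: "g : \<B> (\<P> {1..n})"
 shows "(\<integral>\<^sup>+s. g (\<lambda>i\<in>{1..n}. rts n (cp s) (i - 1)) \<partial>M) =
  (\<integral>\<^sup>+x. ennreal (pdens x) * g (rsort x) \<partial>\<P> {1..n})"
proof -
 let ?G = "%y. g (\<lambda>i\<in>{1..n}. y (i - 1))"
 have G: "?G : \<B> (\<P> {..<n})" by (rule measurable_compose[OF measurable_shift g])
 have sh: "(\<lambda>i\<in>{1..n}. (\<lambda>l\<in>{..<n}. y l) (i - 1)) = (\<lambda>i\<in>{1..n}. y (i - 1))" for y :: "nat => complex"
  by (rule restrict_ext) auto
 have mK: "(%x. ennreal (pdens x) * g (rsort x)) : \<B> (\<P> {1..n})"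
  using measurable_pdens measurable_compose[OF measurable_rsort g] by measurable
 have inv: "inv_into {..<n} Suc i = i - 1" if "i : {1..n}" for i
  by (rule inv_into_f_eq) (use that in auto)
 have mR: "(%x. (Wt n x) * ennreal (vdm n x) * ?G (\<lambda>l\<in>{..<n}. rts n (rootpoly n x) l)) : \<B> (\<P> {..<n})"
 proof (intro measurable_times_ennreal measurable_weight_prod order_refl)
  show "(%x. ennreal (vdm n x)) : \<B> (\<P> {..<n})"
   using measurable_vdm[of n "%x. x" "\<P> {..<n}"] measurable_comp_lborel[of _ "{..<n}"] by measurable
  have "(%x. \<lambda>l\<in>{..<n}. rts n (rootpoly n x) l) : measurable (\<P> {..<n}) (\<P> {..<n})"
  proof (rule measurable_restrict)
   fix l assume "l : {..<n}"
   hence l: "l < n" by simp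
   have "(%x. rootpoly n x) : measurable (\<P> {..<n}) polyM"
    by (rule measurable_rootpoly, rule measurable_comp_lborel) auto
   from measurable_rts[OF this monicn_rootpoly l]
   show "(%x. rts n (rootpoly n x) l) : measurable (\<P> {..<n}) lborel" by simp
  qed
  from measurable_compose[OF this G]
  show "(%x. ?G (\<lambda>l\<in>{..<n}. rts n (rootpoly n x) l)) : \<B> (\<P> {..<n})" .
 qed
 have "(\<integral>\<^sup>+s. g (\<lambda>i\<in>{1..n}. rts n (cp s) (i - 1)) \<partial>M) = (\<integral>\<^sup>+s. ?G (\<lambda>l\<in>{..<n}. rts n (cp s) l) \<partial>M)"
  unfolding sh ..
 also have "... = (\<integral>\<^sup>+x. c0 * ((Wt n x) * ennreal (vdm n x) * ?G (\<lambda>l\<in>{..<n}. rts n (rootpoly n x) l)) \<partial>\<P> {..<n})"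
  unfolding law_roots[OF G] by (rule nn_integral_cmult[symmetric, OF mR])
 also have "... = (\<integral>\<^sup>+x. ennreal (pdens (\<lambda>i\<in>{1..n}. x (inv_into {..<n} Suc i))) * g (rsort (\<lambda>i\<in>{1..n}. x (inv_into {..<n} Suc i))) \<partial>\<P> {..<n})"
 proof (rule nn_integral_cong)
  fix x :: "nat => complex"
  let ?x = "\<lambda>i\<in>{1..n}. x (inv_into {..<n} Suc i)"
  have x: "?x (Suc l) = x l" if "l < n" for l using that inv[of "Suc l"] by simp
  have "vdm n (%l. ?x (Suc l)) = vdm n x"
   unfolding vdm_def
  proof (intro prod.cong refl)
   fix j i assume "j : {..<n}" "i : {..<j}"
   hence "i < n" "j < n" by auto
   thus "(cmod (?x (Suc i) - ?x (Suc j)))\<^sup>2 = (cmod (x i - x j))\<^sup>2" by (simp only: x)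
  qed
  moreover have "(\<Prod>l<n. ennreal (\<omega> (?x (Suc l)))) = (Wt n x)"
   by (rule prod.cong[OF refl]) (simp only: x lessThan_iff)
  ultimately have "ennreal (pdens ?x) = c0 * ((Wt n x) * ennreal (vdm n x))"
   unfolding ennreal_pdens by simp
  moreover have "rootpoly n (%l. ?x (Suc l)) = rootpoly n x"
   unfolding rootpoly_def by (rule prod.cong[OF refl]) (simp only: x lessThan_iff)
  hence "rsort ?x = (\<lambda>i\<in>{1..n}. rts n (rootpoly n x) (i - 1))" unfolding rsort_def by (simp only:)
  ultimately show "c0 * ((Wt n x) * ennreal (vdm n x) * ?G (\<lambda>l\<in>{..<n}. rts n (rootpoly n x) l)) =
   ennreal (pdens ?x) * g (rsort ?x)" unfolding sh by (simp only: mult.assoc)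
 qed
 also have "... = (\<integral>\<^sup>+x. ennreal (pdens x) * g (rsort x) \<partial>\<P> {1..n})"
  unfolding ivl_Suc
  by (rule nn_integral_PiM_reindex[OF sigma_finite_lborel, symmetric]) (use mK in \<open>auto simp: ivl_Suc\<close>)
 finally show ?thesis .
qed

lemma rsort_symmetric:
 assumes f: "symmetric_fun n f" and x: "x : {1..n} \<rightarrow>\<^sub>E UNIV"
 shows "f (rsort x) = f x"
proof -
 have "image_mset x (mset_set {1..n}) = proots (rootpoly n (%l. x (Suc l)))"
  unfolding proots_rootpoly ivl_Suc by (subst image_mset_mset_set[symmetric]) (auto simp: image_mset.compositionality comp_def)
 from symmetric_fun_roots[OF f this monicn_rootpoly] show ?thesis
  using PiE_restrict[OF x] by (simp add: rsort_def)
qed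

text \<open>The ordered eigenvalues and the ordered vector under the density have the same
  distribution, and a symmetric test function does not see the ordering on either side.\<close>

lemma has_symmetric_density_pdens: "has_symmetric_density M n z pdens"
 unfolding has_symmetric_density_def
proof (intro conjI allI impI pdens_nonneg pdens_symmetric)
 let ?P = "PiM {1..n} (%_. \<L>)"
 let ?R = "%s. \<lambda>i\<in>{1..n}. rts n (cp s) (i - 1)"
 let ?Q = "density ?P (%x. ennreal (pdens x))"
 have mR: "?R : measurable M ?P"
 proof (rule measurable_restrict)
  fix i assume "i : {1..n}"
  hence "i - 1 < n" by auto
  from measurable_rts[OF measurable_cp monic_cp this]
  show "(%s. rts n (cp s) (i - 1)) : measurable M lborel" by simp
 qed
 have mp: "(%x. ennreal (pdens x)) : \<B> ?P" using measurable_pdens by measurable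
 have mQ: "rsort : measurable ?Q ?P" using measurable_rsort by simp
 \<comment> \<open>Equality of measures, obtained from indicator functions, carries the law over to
   Bochner integrals of complex functions.\<close>
 have eq: "distr M ?P ?R = distr ?Q ?P rsort"
 proof (rule measure_eqI)
  fix X assume "X : sets (distr M ?P ?R)"
  hence X: "X : sets ?P" by simp
  have mi: "indicator X : \<B> ?P" using X by simp
  have "emeasure (distr M ?P ?R) X = (\<integral>\<^sup>+x. indicator X x \<partial>distr M ?P ?R)" using X by simp
  also have "... = (\<integral>\<^sup>+s. indicator X (?R s) \<partial>M)" by (rule nn_integral_distr[OF mR]) (use mi in simp)
  also have "... = (\<integral>\<^sup>+x. ennreal (pdens x) * indicator X (rsort x) \<partial>?P)" by (rule law_pdens[OF mi])
  also have "... = (\<integral>\<^sup>+x. indicator X (rsort x) \<partial>?Q)"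
   by (rule nn_integral_density[OF mp measurable_compose[OF measurable_rsort mi], symmetric])
  also have "... = (\<integral>\<^sup>+x. indicator X x \<partial>distr ?Q ?P rsort)" by (rule nn_integral_distr[OF mQ, symmetric]) (use mi in simp)
  also have "... = emeasure (distr ?Q ?P rsort) X" using X by simp
  finally show "emeasure (distr M ?P ?R) X = emeasure (distr ?Q ?P rsort) X" .
 qed simp
 show "integrable ?P pdens"
 proof (rule integrableI_nonneg[OF measurable_pdens])
  have "(\<integral>\<^sup>+x. ennreal (pdens x) \<partial>?P) = (\<integral>\<^sup>+s. 1 \<partial>M)" using law_pdens[of "%_. 1"] by simp
  thus "(\<integral>\<^sup>+x. ennreal (pdens x) \<partial>?P) < \<infinity>" using emeasure_space_1 by simp
 qed (simp add: pdens_nonneg)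
 fix f :: "(nat => complex) => complex"
 assume "continuous_on ({1..n} \<rightarrow>\<^sub>E UNIV) f & bounded (f ` ({1..n} \<rightarrow>\<^sub>E UNIV)) & symmetric_fun n f"
 hence cont: "continuous_on ({1..n} \<rightarrow>\<^sub>E UNIV) f" and bdd: "bounded (f ` ({1..n} \<rightarrow>\<^sub>E UNIV))" and sym: "symmetric_fun n f" by auto
 have mf: "f : \<B> ?P" by (rule measurable_of_continuous_PiE[OF cont])
 obtain B where B: "!!x. x : {1..n} \<rightarrow>\<^sub>E UNIV ==> norm (f x) <= B" using bdd unfolding bounded_iff by auto
 have fz: "f (restrict (z s) {1..n}) = f (?R s)" if "s : space M" for s
  by (rule symmetric_fun_roots[OF sym roots[OF that] monic_cp[OF that]])
 have "integrable M (%s. f (?R s))"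
  by (rule integrable_const_bound[where B = B]) (use B measurable_compose[OF mR mf] in auto)
 hence "integrable M (%s. f (restrict (z s) {1..n}))"
  by (rule Bochner_Integration.integrable_cong[THEN iffD2, OF refl, rotated]) (rule fz)
 moreover have "(\<integral>s. f (restrict (z s) {1..n}) \<partial>M) = (\<integral>x. f x * complex_of_real (pdens x) \<partial>?P)"
 proof -
  have "(\<integral>s. f (restrict (z s) {1..n}) \<partial>M) = (\<integral>s. f (?R s) \<partial>M)"
   by (rule Bochner_Integration.integral_cong[OF refl]) (rule fz)
  also have "... = (\<integral>x. f x \<partial>distr M ?P ?R)" by (rule integral_distr[OF mR mf, symmetric])
  also have "... = (\<integral>x. f (rsort x) \<partial>?Q)" unfolding eq by (rule integral_distr[OF mQ mf])
  also have "... = (\<integral>x. pdens x *\<^sub>R f (rsort x) \<partial>?P)"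
   by (rule integral_density[OF measurable_compose[OF measurable_rsort mf] measurable_pdens]) (simp add: pdens_nonneg)
  also have "... = (\<integral>x. f x * complex_of_real (pdens x) \<partial>?P)"
  proof (rule Bochner_Integration.integral_cong[OF refl])
   fix x assume "x : space ?P"
   hence "x : {1..n} \<rightarrow>\<^sub>E UNIV" by (simp add: space_PiM)
   from rsort_symmetric[OF sym this] show "pdens x *\<^sub>R f (rsort x) = f x * complex_of_real (pdens x)"
    by (simp add: scaleR_conv_of_real mult.commute)
  qed
  finally show ?thesis .
 qed
 ultimately show "has_bochner_integral M (%s. f (restrict (z s) {1..n})) (\<integral>x. f x * complex_of_real (pdens x) \<partial>?P)"
  by (simp add: has_bochner_integral_iff)
qed

end

theorem theorem2:
  fixes M :: "'a measure"
    and k :: nat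
    and n :: "nat \<Rightarrow> nat"
    and A :: "nat \<Rightarrow> 'a \<Rightarrow> complex mat"
    and z :: "'a \<Rightarrow> nat \<Rightarrow> complex"
  assumes "prob_space M"
    and "k \<ge> 1"
    and "\<And>i. i \<in> {1..k} \<Longrightarrow> n i \<ge> 1"
    and "n (k + 1) = n 1"
    and "n 1 = Min (n ` {1..k})"
    and dims: "\<And>i s. i \<in> {1..k} \<Longrightarrow> s \<in> space M \<Longrightarrow> A i s \<in> carrier_mat (n i) (n (i + 1))"
    and indep: "prob_space.indep_vars M (\<lambda>_. borel) (\<lambda>(i, a, b) s. A i s $$ (a, b))
                  (SIGMA i:{1..k}. {..<n i} \<times> {..<n (i + 1)})"
    and gauss: "\<And>i a b. i \<in> {1..k} \<Longrightarrow> a < n i \<Longrightarrow> b < n (i + 1) \<Longrightarrow>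
                  distributed M lborel (\<lambda>s. A i s $$ (a, b))
                    (\<lambda>x. ennreal (std_complex_gaussian_density x))"
    and eigenvalues: "\<And>s. s \<in> space M \<Longrightarrow>
                  image_mset (z s) (mset_set {1..n 1}) =
                  proots (char_poly (matrix_product (n 1) (map (\<lambda>i. A i s) [1..<k + 1])))"
  shows "determinantal_process M (n 1) z \<and>
         (\<exists>\<omega>. product_weight k n \<omega>) \<and>
         (\<forall>\<omega>. product_weight k n \<omega> \<longrightarrow>
            (\<exists>c>0. has_symmetric_density M (n 1) z
               (\<lambda>x. c * ((\<Prod>l\<in>{1..n 1}. \<omega> (x l)) *
                         (\<Prod>j\<in>{1..n 1}. \<Prod>i\<in>{1..<j}. (cmod (x i - x j))\<^sup>2)))))"
proof -
 interpret prob_space M by fact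
 let ?A = "%s. matrix_product (n 1) (map (%i. A i s) [1..<k + 1])"
 let ?ms = "map (%j. n j - n 1) [Suc 1..<Suc k]"
 have l: "map (%j. n j - n 1) [1..<Suc k] = (n 1 - n 1) # ?ms"
  using \<open>k \<ge> 1\<close> by (subst upt_conv_Cons) auto
 note glaw = gaussian_product_law[OF assms(2-5) dims indep gauss]
 have mA: "?A : measurable M (lebm (n 1) (n 1))" by (rule glaw(1))
 obtain g where g: "0 < g" "g < \<infinity>" and Eg: "!!Ph. Ph : \<B> (lebm (n 1) (n 1)) ==>
   (\<integral>\<^sup>+s. Ph (?A s) \<partial>M) = g * PI ((n 1 - n 1) # ?ms) (n 1) Ph"
  using glaw(2) unfolding l by blast
 have cA: "?A s : \<M> (n 1) (n 1)" if "s : space M" for s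
  using measurable_carrier_mat[OF mA that] .
 \<comment> \<open>The constant is the product of \<open>g\<close>, from reducing the random
   matrices to \<open>PI\<close>, and of \<open>c\<close>, from passing to the roots.\<close>
 have main: "\<exists>c0. root_law M \<omega> (n 1) (%s. char_poly (?A s)) z c0" if w: "product_weight k n \<omega>" for \<omega>
 proof -
  have m\<omega>: "\<omega> : \<B> borel" and nn: "!!z. 0 <= \<omega> z"
   using w by (auto simp: product_weight_def pushforward_weight_def)
  have "(%z. ennreal (\<omega> z)) : \<B> borel" using m\<omega> by measurable
  moreover have "XI ((n 1 - n 1) # ?ms) ph = (\<integral>z. ph z * ennreal (\<omega> z))" if "ph : \<B> borel" for ph
   using XI_weight[OF w that] unfolding l .
  ultimately obtain c where c: "0 < c" "c < \<infinity>" and Pc: "!!F. F : \<B> polyM ==>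
   PI ((n 1 - n 1) # ?ms) (n 1) (%A. F (char_poly A)) =
   c * (\<integral>\<^sup>+x. (\<Prod>l<n 1. ennreal (\<omega> (x l))) * ennreal (vdm (n 1) x) * F (rootpoly (n 1) x) \<partial>\<P> {..<n 1})"
   using PI_char_poly[of "%z. ennreal (\<omega> z)" "n 1 - n 1" ?ms "n 1"] by blast
  have mom: "(\<integral>z. ennreal (cmod z ^ (2 * j)) * ennreal (\<omega> z)) = XI (map (%j. n j - n 1) [1..<Suc k]) (%x. ennreal (cmod x ^ (2 * j)))" for j
   by (rule XI_weight[OF w, symmetric]) measurable
  have "root_law M \<omega> (n 1) (%s. char_poly (?A s)) z (g * c)"
  proof unfold_locales
   show "\<omega> : \<B> borel" "!!z. 0 <= \<omega> z" by fact+
   show "(\<integral>z. ennreal (cmod z ^ (2 * j)) * ennreal (\<omega> z)) < \<infinity>"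
    "(\<integral>z. ennreal (cmod z ^ (2 * j)) * ennreal (\<omega> z)) ~= 0" for j
    unfolding mom using XI_norm_power_finite_pos by auto
   show "(\<integral>z. ph (u * z) * ennreal (\<omega> z)) = (\<integral>z. ph z * ennreal (\<omega> z))"
    if "cmod u = 1" "ph : \<B> borel" for u ph
    by (rule weight_rotation[OF w \<open>k \<ge> 1\<close> that])
   show "(%s. char_poly (?A s)) : measurable M polyM" by (rule measurable_char_poly[OF mA])
   show "monicn (n 1) (char_poly (?A s))" if "s : space M" for s by (rule monicn_char_poly[OF cA[OF that]])
   show "image_mset (z s) (mset_set {1..n 1}) = proots (char_poly (?A s))" if "s : space M" for s
    by (rule eigenvalues[OF that])
   show "0 < g * c" "g * c < \<infinity>" using g c by (auto simp: ennreal_mult_less_top ennreal_zero_less_mult_iff)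
   fix F :: "complex poly => ennreal" assume F: "F : \<B> polyM"
   have "(%B. F (char_poly B)) : \<B> (lebm (n 1) (n 1))"
    by (rule measurable_compose[OF measurable_char_poly[OF lebm_ident] F])
   from Eg[OF this] show "(\<integral>\<^sup>+s. F (char_poly (?A s)) \<partial>M) =
    g * c * (\<integral>\<^sup>+x. (\<Prod>l<n 1. ennreal (\<omega> (x l))) * ennreal (vdm (n 1) x) * F (rootpoly (n 1) x) \<partial>\<P> {..<n 1})"
    unfolding Pc[OF F] by (simp only: mult.assoc)
  qed
  thus ?thesis by (rule exI)
 qed
 \<comment> \<open>The determinantal property does not mention a weight, so one version is produced
   for the construction of the kernel.\<close>
 obtain \<omega>0 where w0: "product_weight k n \<omega>0" using product_weight_exists[OF \<open>k \<ge> 1\<close>] by blast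
 show ?thesis
 proof (intro conjI allI impI)
  show "\<exists>\<omega>. product_weight k n \<omega>" using w0 by blast
  obtain c0 where "root_law M \<omega>0 (n 1) (%s. char_poly (?A s)) z c0" using main[OF w0] by blast
  thus "determinantal_process M (n 1) z" by (rule root_law.determinantal)
  fix \<omega> assume "product_weight k n \<omega>"
  from main[OF this] obtain c0 where r: "root_law M \<omega> (n 1) (%s. char_poly (?A s)) z c0" by blast
  have "0 < enn2real c0" using root_law.c0[OF r] by (simp add: enn2real_positive_iff)
  thus "\<exists>c>0. has_symmetric_density M (n 1) z
        (%x. c * ((\<Prod>l\<in>{1..n 1}. \<omega> (x l)) *
             (\<Prod>j\<in>{1..n 1}. \<Prod>i\<in>{1..<j}. (cmod (x i - x j))\<^sup>2)))"
   using root_law.has_symmetric_density_pdens[OF r] unfolding root_law.pdens_def[OF r, abs_def] by blast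
 qed
qed

end
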